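(* Let $\Lambda=[\lambda^{xy}]_{x,y\in S}$ satisfy the canonical conditions relative to the pair $(S,\mathbb F)$, and let $\xi$ be an $S$-valued random variable such that for every $x\in S$, $\mathbb Q(\xi=x\mid\mathcal F_T)=\mu_x$ for some $\mathcal F_0$-measurable random variable $\mu_x$ with values in $[0,1]$. Suppose that the intensities $a^{xy}$ of the Poisson processes $N^{xy}$ are strictly positive for all $x,y\in S$, $x\ne y$. Let $X$ be the unique solution of the SDE $$dX_t=\sum_{x,y\in S,\ x\neq y}(y-x)\,\mathbf 1_{\{x\}}(X_{t-})\,dN^{xy}_t,\quad t\in[0,T],\qquad X_0=\xi .$$ For each pair $x,y\in S$, $x\ne y$, define $$\kappa^{xy}_t=\frac{\lambda^{xy}_{t-}}{a^{xy}}-1,\qquad t\in[0,T],$$ and assume that the random variable $$\vartheta=\prod_{x,y\in S:\,x\ne y}\exp\Big(-\int_0^T H^x_{u-}a^{xy}\kappa^{xy}_u\,du\Big)\prod_{0<u\le T}\big(1+\kappa^{xy}_u\,\Delta H^{xy}_u\big)$$ satisfies $\mathbb E_{\mathbb Q}\vartheta=1$. Define on $(\Omega,\widehat{\mathcal G}_T)$ the probability $\mathbb P$ by $\frac{d\mathbb P}{d\mathbb Q}\big|_{\widehat{\mathcal G}_T}=\vartheta$. Then: (i) $\mathbb P|_{\mathcal F_T}=\mathbb Q|_{\mathcal F_T}$; (ii) $X$ is an $(\mathbb F,\mathbb G)$-CMC under $\mathbb P$ with the $\mathbb F$-intensity matrix process $\Lambda$, and with initial distribution satisfying $$\mathbb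 P(X_0=x\mid\mathcal F_T)=\mathbb P(X_0=x\mid\mathcal F_0)=\mathbb Q(X_0=x\mid\mathcal F_T),\qquad x\in S.$$
   Context: $T>0$ is fixed, $S=\{1,\dots,d\}$, $(\Omega,\mathcal A,\mathbb Q)$ is a complete probability space. All filtrations are indexed by $[0,T]$ and completed. On this space are given: - a (reference) filtration $\mathbb F=(\mathcal F_t)$ satisfying the usual conditions; - the $S$-valued random variable $\xi$; - a family $(N^{xy})_{x,y\in S,\,x\ne y}$ of mutually independent Poisson processes with (constant) intensities $a^{xy}$, independent of $\mathcal F_T\vee\sigma(\xi)$. Put $\mathcal G_t=\big(\bigvee_{x\neq y}\mathcal F^{N^{xy}}_t\big)\vee\sigma(\xi)$, where $\mathbb F^{U}$ denotes the completed right-continuous filtration generated by a process $U$; $\mathbb G=(\mathcal G_t)$, $\widehat{\mathcal G}_t=\mathcal F_T\vee\mathcal G_t$, $\mathbb F\vee\mathbb G=(\mathcal F_t\vee\mathcal G_t)$. For an $S$-valued càdlàg process $X$: $H^x_t=\mathbf 1_{\{X_t=x\}}$, $H_t=(H^x_t)_{x\in S}^\top$, and for $x\ne y$, $H^{xy}_t=\int_{]0,t]}H^x_{u-}\,dH^y_u$ (number of jumps from $x$ to $y$ up to time $t$). Convention: $U_{0-}:=0$ for any real valued process $U$. Canonical conditions relative to $(S,\mathbb F)$: a matrix-valued process $\Lambda=[\lambda^{xy}]_{x,y\in S}$ satisfies them if (C1) $\Lambda$ is $\mathbb F$-progressively measurable, $\lambda^{xy}_t\ge 0$ for $x\ne y$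 and $\sum_{y\in S}\lambda^{xy}_t=0$ for all $x\in S$; (C2) the processes $\lambda^{xy}$, $x\neq y$, have countably many jumps $\mathbb Q$-a.s., and their trajectories admit left limits. $(\mathbb F,\mathbb G)$-CMC (conditional Markov chain) under $\mathbb P$: an $S$-valued, $\mathbb G$-adapted càdlàg process $X$ such that for all $x_1,\dots,x_k\in S$ and $0\le t\le t_1\le\dots\le t_k\le T$, $$\mathbb P(X_{t_1}=x_1,\dots,X_{t_k}=x_k\mid\mathcal F_t\vee\mathcal G_t)=\mathbb P(X_{t_1}=x_1,\dots,X_{t_k}=x_k\mid\mathcal F_t\vee\sigma(X_t)).$$ $\mathbb F$-intensity of $X$ under $\mathbb P$: an $\mathbb F$-adapted matrix-valued process $\Lambda=[\lambda^{xy}]_{x,y\in S}$ with $\lambda^{xy}_t\ge0$ for $x\ne y$, $\sum_y\lambda^{xy}_t=0$ for all $x$, such that $M_t=H_t-\int_0^t\Lambda_u^\top H_u\,du$, $t\in[0,T]$, is an $\mathbb R^d$-valued $\mathbb F\vee\mathbb G$-local martingale under $\mathbb P$. *)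

theory Defs
  imports "HOL-Probability.Probability"
begin

text \<open>A filtration on the time interval \<open>{0..T}\<close> is a function \<open>real \<Rightarrow> 'a measure\<close> of which only the
  \<open>space\<close> and \<open>sets\<close> components at times in \<open>{0..T}\<close> matter.  A process is a function
  \<open>real \<Rightarrow> 'a \<Rightarrow> 'b\<close> of which only the values at times in \<open>{0..T}\<close> matter.\<close>

section \<open>Sigma-algebras and filtrations\<close>

definition join_alg :: "'a measure \<Rightarrow> 'a measure \<Rightarrow> 'a measure" where
  "join_alg A B = sigma (space A) (sets A \<union> sets B)"

definition sigma_rv :: "'a measure \<Rightarrow> ('a \<Rightarrow> nat) \<Rightarrow> 'a measure" where
  "sigma_rv M Z = vimage_algebra (space M) Z (count_space UNIV)"

definition usual_conditions :: "'a measure \<Rightarrow> real \<Rightarrow> (real \<Rightarrow> 'a measure) \<Rightarrow> bool" where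
  "usual_conditions Q T F \<longleftrightarrow>
     (\<forall>t\<in>{0..T}. subalgebra Q (F t) \<and> null_sets Q \<subseteq> sets (F t)) \<and>
     (\<forall>s t. 0 \<le> s \<and> s \<le> t \<and> t \<le> T \<longrightarrow> sets (F s) \<subseteq> sets (F t)) \<and>
     (\<forall>t\<in>{0..<T}. sets (F t) = (\<Inter>u\<in>{t<..T}. sets (F u)))"

definition completed_history :: "'a measure \<Rightarrow> (real \<Rightarrow> 'a \<Rightarrow> nat) \<Rightarrow> real \<Rightarrow> 'a measure" where
  "completed_history Q U t =
     sigma (space Q) ((\<Union>s\<in>{0..t}. sets (sigma_rv Q (U s))) \<union> null_sets Q)"

text \<open>The completed right-continuous filtration generated by \<open>U\<close>.  Adding the index \<open>T\<close> is redundant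
  for \<open>t < T\<close>; for \<open>t = T\<close> it makes the intersection the completed history at the horizon.\<close>

definition natural_filtration ::
  "'a measure \<Rightarrow> real \<Rightarrow> (real \<Rightarrow> 'a \<Rightarrow> nat) \<Rightarrow> real \<Rightarrow> 'a measure" where
  "natural_filtration Q T U t =
     sigma (space Q) (\<Inter>u\<in>insert T {t<..T}. sets (completed_history Q U u))"

definition off_diagonal :: "nat set \<Rightarrow> (nat \<times> nat) set" where
  "off_diagonal S = {(x, y). x \<in> S \<and> y \<in> S \<and> x \<noteq> y}"

text \<open>The null sets are added explicitly only because of the one-point state space, for which
  there is no driving process: every filtration is meant to be completed.\<close>

definition driver_filtration ::
  "'a measure \<Rightarrow> real \<Rightarrow> nat set \<Rightarrow> (nat \<Rightarrow> nat \<Rightarrow> real \<Rightarrow> 'a \<Rightarrow> nat) \<Rightarrow> ('a \<Rightarrow> nat) \<Rightarrow> real \<Rightarrow> 'a measure"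
where
  "driver_filtration Q T S N \<xi> t =
     sigma (space Q)
       ((\<Union>(x, y)\<in>off_diagonal S. sets (natural_filtration Q T (N x y) t)) \<union>
        sets (sigma_rv Q \<xi>) \<union> null_sets Q)"

definition adapted ::
  "real \<Rightarrow> (real \<Rightarrow> 'a measure) \<Rightarrow> 'b measure \<Rightarrow> (real \<Rightarrow> 'a \<Rightarrow> 'b) \<Rightarrow> bool" where
  "adapted T F E U \<longleftrightarrow> (\<forall>t\<in>{0..T}. U t \<in> measurable (F t) E)"

definition progressively_measurable ::
  "real \<Rightarrow> (real \<Rightarrow> 'a measure) \<Rightarrow> (real \<Rightarrow> 'a \<Rightarrow> real) \<Rightarrow> bool" where
  "progressively_measurable T F U \<longleftrightarrow>
     (\<forall>t\<in>{0..T}. (\<lambda>(u, \<omega>). U u \<omega>) \<in> borel_measurable (restrict_space borel {0..t} \<Otimes>\<^sub>M F t))"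

definition cond_prob_alg :: "'a measure \<Rightarrow> 'a measure \<Rightarrow> ('a \<Rightarrow> bool) \<Rightarrow> 'a \<Rightarrow> real" where
  "cond_prob_alg M A E = real_cond_exp M A (indicator {\<omega> \<in> space M. E \<omega>})"

section \<open>Paths\<close>

definition cadlag :: "real \<Rightarrow> (real \<Rightarrow> 'b::topological_space) \<Rightarrow> bool" where
  "cadlag T f \<longleftrightarrow>
     (\<forall>t\<in>{0..<T}. (f \<longlongrightarrow> f t) (at_right t)) \<and>
     (\<forall>t\<in>{0<..T}. \<exists>l. (f \<longlongrightarrow> l) (at_left t))"

text \<open>Convention: the left limit at time \<open>0\<close> is \<open>0\<close>.\<close>

definition left_lim :: "(real \<Rightarrow> 'b::{t2_space, zero}) \<Rightarrow> real \<Rightarrow> 'b" where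
  "left_lim f t = (if t \<le> 0 then 0 else Lim (at_left t) f)"

definition jump :: "(real \<Rightarrow> real) \<Rightarrow> real \<Rightarrow> real" where
  "jump g t = g t - left_lim g t"

definition jump_times :: "(real \<Rightarrow> real) \<Rightarrow> real \<Rightarrow> real set" where
  "jump_times g t = {u. 0 < u \<and> u \<le> t \<and> jump g u \<noteq> 0}"

text \<open>The Lebesgue-Stieltjes integral of \<open>f\<close> with respect to \<open>g\<close> over the half-open interval from \<open>0\<close>
  (excluded) to \<open>t\<close> (included).  All integrators below are piecewise constant, right-continuous
  and have finitely many jumps, so that the integral is this finite sum.\<close>

definition jump_integral :: "(real \<Rightarrow> real) \<Rightarrow> (real \<Rightarrow> real) \<Rightarrow> real \<Rightarrow> real" where
  "jump_integral f g t = (\<Sum>u\<in>jump_times g t. f u * jump g u)"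

definition state_ind :: "(real \<Rightarrow> 'a \<Rightarrow> nat) \<Rightarrow> nat \<Rightarrow> 'a \<Rightarrow> real \<Rightarrow> real" where
  "state_ind X x \<omega> t = of_bool (X t \<omega> = x)"

definition transition_count :: "(real \<Rightarrow> 'a \<Rightarrow> nat) \<Rightarrow> nat \<Rightarrow> nat \<Rightarrow> 'a \<Rightarrow> real \<Rightarrow> real" where
  "transition_count X x y \<omega> t = jump_integral (left_lim (state_ind X x \<omega>)) (state_ind X y \<omega>) t"

section \<open>Poisson processes and the driving equation\<close>

definition poisson_process :: "'a measure \<Rightarrow> real \<Rightarrow> real \<Rightarrow> (real \<Rightarrow> 'a \<Rightarrow> nat) \<Rightarrow> bool" where
  "poisson_process Q T c N \<longleftrightarrow>
     (\<forall>t\<in>{0..T}. N t \<in> measurable Q (count_space UNIV)) \<and>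
     (AE \<omega> in Q. N 0 \<omega> = 0 \<and> cadlag T (\<lambda>t. N t \<omega>)) \<and>
     (\<forall>s t k. 0 \<le> s \<and> s \<le> t \<and> t \<le> T \<longrightarrow>
        measure Q {\<omega> \<in> space Q. N t \<omega> = N s \<omega> + k} = exp (- c * (t - s)) * (c * (t - s)) ^ k / fact k) \<and>
     (\<forall>n (r :: nat \<Rightarrow> real). 0 \<le> r 0 \<and> (\<forall>i<n. r i \<le> r (Suc i)) \<and> r n \<le> T \<longrightarrow>
        prob_space.indep_vars Q (\<lambda>_. count_space UNIV)
          (\<lambda>i \<omega>. int (N (r (Suc i)) \<omega>) - int (N (r i) \<omega>)) {..<n})"

text \<open>Mutual independence of the processes, and independence of the whole family from \<open>A\<close>.\<close>

definition independent_drivers ::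
  "'a measure \<Rightarrow> real \<Rightarrow> nat set \<Rightarrow> (nat \<Rightarrow> nat \<Rightarrow> real \<Rightarrow> 'a \<Rightarrow> nat) \<Rightarrow> 'a measure \<Rightarrow> bool" where
  "independent_drivers Q T S N A \<longleftrightarrow>
     (let \<H> = (\<lambda>(x, y). sigma_sets (space Q) (\<Union>s\<in>{0..T}. sets (sigma_rv Q (N x y s)))) in
      prob_space.indep_sets Q \<H> (off_diagonal S) \<and>
      prob_space.indep_set Q (sets A) (sigma_sets (space Q) (\<Union>p\<in>off_diagonal S. \<H> p)))"

definition solves_SDE ::
  "'a measure \<Rightarrow> real \<Rightarrow> nat set \<Rightarrow> (nat \<Rightarrow> nat \<Rightarrow> real \<Rightarrow> 'a \<Rightarrow> nat) \<Rightarrow> ('a \<Rightarrow> nat) \<Rightarrow> (real \<Rightarrow> 'a \<Rightarrow> nat) \<Rightarrow> bool"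
where
  "solves_SDE Q T S N \<xi> X \<longleftrightarrow>
     (AE \<omega> in Q. cadlag T (\<lambda>t. X t \<omega>) \<and> X 0 \<omega> = \<xi> \<omega> \<and>
        (\<forall>t\<in>{0..T}. real (X t \<omega>) = real (\<xi> \<omega>) +
           (\<Sum>(x, y)\<in>off_diagonal S.
              jump_integral (\<lambda>u. (real y - real x) * of_bool (left_lim (\<lambda>s. X s \<omega>) u = x))
                (\<lambda>s. real (N x y s \<omega>)) t)))"

section \<open>Intensity matrices and the density\<close>

definition canonical_conditions ::
  "'a measure \<Rightarrow> real \<Rightarrow> nat set \<Rightarrow> (real \<Rightarrow> 'a measure) \<Rightarrow> (nat \<Rightarrow> nat \<Rightarrow> real \<Rightarrow> 'a \<Rightarrow> real) \<Rightarrow> bool"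
where
  "canonical_conditions Q T S F \<Lambda> \<longleftrightarrow>
     (\<forall>x\<in>S. \<forall>y\<in>S. progressively_measurable T F (\<Lambda> x y)) \<and>
     (\<forall>(x, y)\<in>off_diagonal S. \<forall>t\<in>{0..T}. \<forall>\<omega>\<in>space Q. 0 \<le> \<Lambda> x y t \<omega>) \<and>
     (\<forall>x\<in>S. \<forall>t\<in>{0..T}. \<forall>\<omega>\<in>space Q. (\<Sum>y\<in>S. \<Lambda> x y t \<omega>) = 0) \<and>
     (\<forall>(x, y)\<in>off_diagonal S. AE \<omega> in Q. countable (jump_times (\<lambda>t. \<Lambda> x y t \<omega>) T)) \<and>
     (\<forall>(x, y)\<in>off_diagonal S. \<forall>\<omega>\<in>space Q. \<forall>t\<in>{0<..T}. \<exists>l. ((\<lambda>u. \<Lambda> x y u \<omega>) \<longlongrightarrow> l) (at_left t))"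

definition kappa ::
  "(nat \<Rightarrow> nat \<Rightarrow> real \<Rightarrow> 'a \<Rightarrow> real) \<Rightarrow> (nat \<Rightarrow> nat \<Rightarrow> real) \<Rightarrow> nat \<Rightarrow> nat \<Rightarrow> 'a \<Rightarrow> real \<Rightarrow> real" where
  "kappa \<Lambda> a x y \<omega> t = left_lim (\<lambda>u. \<Lambda> x y u \<omega>) t / a x y - 1"

text \<open>\<open>exp_neg_integral T f\<close> is \<open>exp (- \<integral>\<^sub>0\<^sup>T f u du)\<close> for measurable \<open>f\<close> bounded below.  If such an \<open>f\<close> is
  not integrable, its integral is \<open>+\<infinity>\<close> (the library's integral would be the default value \<open>0\<close>), and
  the exponential is \<open>0\<close>.  In \<open>doleans_density\<close> the integrand is bounded below by \<open>- a x y\<close>, but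
  the intensities may fail to be integrable, as they are not required to have right limits.\<close>

definition exp_neg_integral :: "real \<Rightarrow> (real \<Rightarrow> real) \<Rightarrow> real" where
  "exp_neg_integral T f =
     (if set_integrable lborel {0..T} f then exp (- set_lebesgue_integral lborel {0..T} f) else 0)"

text \<open>The product over all \<open>u\<close> in \<open>{0<..T}\<close> is taken over the finitely many jump times only, all other
  factors being \<open>1\<close>.\<close>

definition doleans_density ::
  "real \<Rightarrow> nat set \<Rightarrow> (nat \<Rightarrow> nat \<Rightarrow> real \<Rightarrow> 'a \<Rightarrow> real) \<Rightarrow> (nat \<Rightarrow> nat \<Rightarrow> real) \<Rightarrow> (real \<Rightarrow> 'a \<Rightarrow> nat) \<Rightarrow> 'a \<Rightarrow> real"
where
  "doleans_density T S \<Lambda> a X \<omega> =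
     (\<Prod>(x, y)\<in>off_diagonal S.
        exp_neg_integral T (\<lambda>u. left_lim (state_ind X x \<omega>) u * a x y * kappa \<Lambda> a x y \<omega> u) *
        (\<Prod>u\<in>jump_times (transition_count X x y \<omega>) T.
           1 + kappa \<Lambda> a x y \<omega> u * jump (transition_count X x y \<omega>) u))"

section \<open>Conditional Markov chains and intensities\<close>

definition is_CMC ::
  "'a measure \<Rightarrow> real \<Rightarrow> nat set \<Rightarrow> (real \<Rightarrow> 'a measure) \<Rightarrow> (real \<Rightarrow> 'a measure) \<Rightarrow> (real \<Rightarrow> 'a \<Rightarrow> nat) \<Rightarrow> bool"
where
  "is_CMC P T S F G X \<longleftrightarrow>
     (AE \<omega> in P. cadlag T (\<lambda>t. X t \<omega>) \<and> (\<forall>t\<in>{0..T}. X t \<omega> \<in> S)) \<and>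
     adapted T G (count_space UNIV) X \<and>
     (\<forall>t ts xs. 0 \<le> t \<and> sorted (t # ts) \<and> set ts \<subseteq> {..T} \<and> t \<le> T \<and> length xs = length ts \<and> set xs \<subseteq> S \<longrightarrow>
        (AE \<omega> in P.
           cond_prob_alg P (join_alg (F t) (G t)) (\<lambda>\<omega>. \<forall>i<length ts. X (ts ! i) \<omega> = xs ! i) \<omega> =
           cond_prob_alg P (join_alg (F t) (sigma_rv P (X t))) (\<lambda>\<omega>. \<forall>i<length ts. X (ts ! i) \<omega> = xs ! i) \<omega>))"

definition martingale :: "'a measure \<Rightarrow> real \<Rightarrow> (real \<Rightarrow> 'a measure) \<Rightarrow> (real \<Rightarrow> 'a \<Rightarrow> real) \<Rightarrow> bool" where
  "martingale P T K M \<longleftrightarrow>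
     adapted T K borel M \<and>
     (\<forall>t\<in>{0..T}. integrable P (M t)) \<and>
     (\<forall>s t. 0 \<le> s \<and> s \<le> t \<and> t \<le> T \<longrightarrow> (AE \<omega> in P. real_cond_exp P (K s) (M t) \<omega> = M s \<omega>))"

text \<open>On a finite horizon a localizing sequence consists of stopping times with values in \<open>{0..T}\<close>
  that increase and almost surely reach \<open>T\<close> after finitely many steps.\<close>

definition local_martingale ::
  "'a measure \<Rightarrow> real \<Rightarrow> (real \<Rightarrow> 'a measure) \<Rightarrow> (real \<Rightarrow> 'a \<Rightarrow> real) \<Rightarrow> bool" where
  "local_martingale P T K M \<longleftrightarrow>
     adapted T K borel M \<and>
     (AE \<omega> in P. cadlag T (\<lambda>t. M t \<omega>)) \<and>
     (\<exists>\<tau> :: nat \<Rightarrow> 'a \<Rightarrow> real.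
        (\<forall>n. \<forall>\<omega>\<in>space P. \<tau> n \<omega> \<in> {0..T}) \<and>
        (\<forall>n. \<forall>t\<in>{0..T}. Measurable.pred (K t) (\<lambda>\<omega>. \<tau> n \<omega> \<le> t)) \<and>
        (AE \<omega> in P. (\<forall>n. \<tau> n \<omega> \<le> \<tau> (Suc n) \<omega>) \<and> (\<exists>n. \<tau> n \<omega> = T)) \<and>
        (\<forall>n. martingale P T K (\<lambda>t \<omega>. M (min t (\<tau> n \<omega>)) \<omega>)))"

text \<open>The vector-valued local martingale property is stated componentwise.  The integrability
  clause says that the integral process exists.\<close>

definition is_intensity ::
  "'a measure \<Rightarrow> real \<Rightarrow> nat set \<Rightarrow> (real \<Rightarrow> 'a measure) \<Rightarrow> (real \<Rightarrow> 'a measure) \<Rightarrow> (real \<Rightarrow> 'a \<Rightarrow> nat) \<Rightarrow>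
    (nat \<Rightarrow> nat \<Rightarrow> real \<Rightarrow> 'a \<Rightarrow> real) \<Rightarrow> bool"
where
  "is_intensity P T S F G X \<Lambda> \<longleftrightarrow>
     (\<forall>x\<in>S. \<forall>y\<in>S. adapted T F borel (\<Lambda> x y)) \<and>
     (\<forall>(x, y)\<in>off_diagonal S. \<forall>t\<in>{0..T}. \<forall>\<omega>\<in>space P. 0 \<le> \<Lambda> x y t \<omega>) \<and>
     (\<forall>x\<in>S. \<forall>t\<in>{0..T}. \<forall>\<omega>\<in>space P. (\<Sum>y\<in>S. \<Lambda> x y t \<omega>) = 0) \<and>
     (\<forall>y\<in>S. AE \<omega> in P. set_integrable lborel {0..T} (\<lambda>u. \<Sum>x\<in>S. \<Lambda> x y u \<omega> * state_ind X x \<omega> u)) \<and>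
     (\<forall>y\<in>S. local_martingale P T (\<lambda>t. join_alg (F t) (G t))
        (\<lambda>t \<omega>. state_ind X y \<omega> t -
           set_lebesgue_integral lborel {0..t} (\<lambda>u. \<Sum>x\<in>S. \<Lambda> x y u \<omega> * state_ind X x \<omega> u)))"

end

theory Submission
  imports Defs
begin

text \<open>Conditionally on \<open>F T\<close> and the past of the noise, the Poisson increments over the cells of a time
  grid have an explicit generating function.  Sampling the intensities at the left end points of the cells
  turns the density into a product of cell densities of conditional mean one, and Fatou's lemma makes
  the density process a supermartingale for \<open>(F T \<or> G t)\<close>.  As \<open>\<theta>\<close> has mean one, it is a martingale;
  at time \<open>0\<close> this gives that \<open>P\<close> and \<open>Q\<close> agree on \<open>F T\<close>, and the initial law.

  On \<open>X t = x\<close> both the future of \<open>X\<close> and the density over \<open>{t<..T}\<close> are functionals of \<open>F T\<close> and of the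
  increments of the noise after \<open>t\<close>.  Under \<open>Q\<close> these increments are independent of \<open>F T \<or> G t\<close>, and \<open>F T\<close> is
  conditionally independent of \<open>F t \<or> G t\<close> given \<open>F t\<close>, hence the conditional Markov property.

  For the intensity, one component of the density is multiplied by \<open>1 + \<epsilon>\<close> on a window ending at a
  localizing time.  The supermartingale inequality for the perturbed density, compared to first order
  for \<open>\<epsilon>\<close> of both signs, identifies the compensator of every transition count.\<close>

text \<open>Two features of the hypotheses shape the proof. The intensities have left limits but
  need be neither bounded nor integrable. So densities are truncated at a level \<open>m\<close>
  before the mesh is refined, an infinite integral gives density 0, and only inequalities survive
  the limits; but \<open>\<theta>\<close> is positive almost surely under \<open>P\<close>, and this
  makes the integrals along the path finite there. Also, \<open>J\<close> contains the null sets but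
  need not be right-continuous, so a hitting time is made a stopping time by having its level
  attained. Measurability of quantities read off a path is reduced to limits of expressions on
  grids, which involve finitely many times each and agree with the path quantity off a null set. The
  perturbation works because an intensity multiplied by \<open>1 + \<epsilon>\<close> on an adapted
  set is again nonnegative and adapted. The supermartingale inequality holds for every such
  intensity with no condition on the mean, so both signs of \<open>\<epsilon>\<close> are available,
  and no stochastic integral has to be constructed.\<close>

lemma left_lim_eq: "0 < u \<Longrightarrow> (f \<longlongrightarrow> l) (at_left u) \<Longrightarrow> left_lim f u = l"
  unfolding left_lim_def by (simp add: tendsto_Lim trivial_limit_at_left_real)

lemma tendsto_left_lim:
  "0 < u \<Longrightarrow> \<exists>l. (f \<longlongrightarrow> l) (at_left u) \<Longrightarrow> (f \<longlongrightarrow> left_lim f u) (at_left u)"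
  using left_lim_eq by blast

section \<open>Paths with values in the natural numbers\<close>

definition jump_set :: "real \<Rightarrow> (real \<Rightarrow> nat) \<Rightarrow> real set" where
  "jump_set T f = {u. 0 < u \<and> u \<le> T \<and> f u \<noteq> left_lim f u}"

lemma cadlag_tendsto_left_lim:
  fixes f :: "real \<Rightarrow> 'b::{t2_space, zero}"
  shows "cadlag T f \<Longrightarrow> 0 < u \<Longrightarrow> u \<le> T \<Longrightarrow> (f \<longlongrightarrow> left_lim f u) (at_left u)"
  unfolding cadlag_def by (auto intro: tendsto_left_lim)

text \<open>Convergence in the discrete space of naturals is eventual equality, so one-sided limits
  give one-sided constancy. At the end points the side outside the interval is vacuous, so the
  convention for the left limit at 0 does no harm.\<close>

lemma cadlag_local:
  fixes f :: "real \<Rightarrow> nat"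
  assumes f: "cadlag T f" and x: "0 \<le> x" "x \<le> T"
  obtains d where "d > 0" "\<And>s. 0 \<le> s \<Longrightarrow> x - d < s \<Longrightarrow> s < x \<Longrightarrow> f s = left_lim f x"
    "\<And>s. s \<le> T \<Longrightarrow> x \<le> s \<Longrightarrow> s < x + d \<Longrightarrow> f s = f x"
proof -
  have "\<exists>d>0. \<forall>s. 0 \<le> s \<longrightarrow> x - d < s \<longrightarrow> s < x \<longrightarrow> f s = left_lim f x"
  proof (cases "x = 0")
    case False
    then have "eventually (\<lambda>s. f s = left_lim f x) (at_left x)"
      using cadlag_tendsto_left_lim[OF f, of x] x by (simp add: tendsto_discrete)
    then obtain b where "b < x" "\<And>s. b < s \<Longrightarrow> s < x \<Longrightarrow> f s = left_lim f x"
      unfolding eventually_at_left_field by auto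
    then show ?thesis by (intro exI[of _ "x - b"]) auto
  qed (auto intro: exI[of _ 1])
  then obtain d1 where d1: "d1 > 0" "\<And>s. 0 \<le> s \<Longrightarrow> x - d1 < s \<Longrightarrow> s < x \<Longrightarrow> f s = left_lim f x" by blast
  have "\<exists>d>0. \<forall>s. s \<le> T \<longrightarrow> x \<le> s \<longrightarrow> s < x + d \<longrightarrow> f s = f x"
  proof (cases "x = T")
    case False
    then have "(f \<longlongrightarrow> f x) (at_right x)"
      using f x unfolding cadlag_def by auto
    then have "eventually (\<lambda>s. f s = f x) (at_right x)"
      by (simp add: tendsto_discrete)
    then obtain b where b: "b > x" "\<And>s. x < s \<Longrightarrow> s < b \<Longrightarrow> f s = f x"
      unfolding eventually_at_right_field by auto
    then show ?thesis by (intro exI[of _ "b - x"]) (auto simp: le_less)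
  qed (auto intro: exI[of _ 1])
  then obtain d2 where d2: "d2 > 0" "\<And>s. s \<le> T \<Longrightarrow> x \<le> s \<Longrightarrow> s < x + d2 \<Longrightarrow> f s = f x" by blast
  show ?thesis by (rule that[of "min d1 d2"]) (use d1(1) d2(1) in \<open>auto intro!: d1(2) d2(2)\<close>)
qed

lemma cadlag_right_const:
  fixes f :: "real \<Rightarrow> nat"
  assumes "cadlag T f" "0 \<le> x" "x \<le> T"
  shows "\<exists>d>0. \<forall>s. s \<le> T \<longrightarrow> x \<le> s \<longrightarrow> s < x + d \<longrightarrow> f s = f x"
  by (rule cadlag_local[OF assms]) blast

lemma cadlag_left_const:
  fixes f :: "real \<Rightarrow> nat"
  assumes "cadlag T f" "0 \<le> x" "x \<le> T"
  shows "\<exists>d>0. \<forall>s. 0 \<le> s \<longrightarrow> x - d < s \<longrightarrow> s < x \<longrightarrow> f s = left_lim f x"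
  by (rule cadlag_local[OF assms]) blast

text \<open>Compactness as an induction rule: local constancy leaves at most one jump near each
  point, so a relation stable under concatenation is checked only on intervals with no jump or a
  single one. Finiteness of the jump set is itself derived from this rule.\<close>

lemma cadlag_Bolzano [consumes 4, case_names trans empty single]:
  fixes f :: "real \<Rightarrow> nat" and P :: "real \<Rightarrow> real \<Rightarrow> bool"
  assumes f: "cadlag T f" and ab: "0 \<le> a" "a \<le> b" "b \<le> T"
    and trans: "\<And>a b c. P a b \<Longrightarrow> P b c \<Longrightarrow> 0 \<le> a \<Longrightarrow> a \<le> b \<Longrightarrow> b \<le> c \<Longrightarrow> c \<le> T \<Longrightarrow> P a c"
    and empty: "\<And>a b. 0 \<le> a \<Longrightarrow> a \<le> b \<Longrightarrow> b \<le> T \<Longrightarrow> f b = f a \<Longrightarrow> jump_set T f \<inter> {a<..b} = {} \<Longrightarrow> P a b"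
    and single: "\<And>a x b. 0 \<le> a \<Longrightarrow> a < x \<Longrightarrow> x \<le> b \<Longrightarrow> b \<le> T \<Longrightarrow> f a = left_lim f x \<Longrightarrow> f b = f x \<Longrightarrow>
        jump_set T f \<inter> {a<..b} = {x} \<Longrightarrow> P a b"
  shows "P a b"
proof -
  have "0 \<le> a \<longrightarrow> b \<le> T \<longrightarrow> P a b" using ab(2)
  proof (induction rule: Bolzano)
    case (trans a b c) then show ?case using assms(5) by auto
  next
    case (local x)
    then have x: "0 \<le> x" "x \<le> T" using ab by auto
    obtain d where d: "d > 0" "\<And>s. 0 \<le> s \<Longrightarrow> x - d < s \<Longrightarrow> s < x \<Longrightarrow> f s = left_lim f x"
      "\<And>s. s \<le> T \<Longrightarrow> x \<le> s \<Longrightarrow> s < x + d \<Longrightarrow> f s = f x"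
      using cadlag_local[OF f x] by metis
    show ?case
    proof (intro exI[of _ d] conjI allI impI d(1))
      fix a b assume h: "a \<le> x \<and> x \<le> b \<and> b - a < d" "0 \<le> a" "b \<le> T"
      \<comment> \<open>The path is constant on either side of \<open>x\<close> in this short
        interval, so no other point can be a jump.\<close>
      have nj: "left_lim f u = f u" if u: "a < u" "u \<le> b" "u \<noteq> x" for u
      proof (rule left_lim_eq)
        show "0 < u" using h u by auto
        show "(f \<longlongrightarrow> f u) (at_left u)"
        proof (cases "u < x")
          case True
          have "eventually (\<lambda>s. f s = f u) (at_left u)"
            unfolding eventually_at_left_field using True d(2) h u
            by (intro exI[of _ a]) auto
          then show ?thesis by (simp add: tendsto_discrete)
        next
          case False
          have fx: "f s = f x" if "x \<le> s" "s \<le> u" for s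
            by (rule d(3)) (use h u that in auto)
          have "f s = f u" if "x < s" "s < u" for s
            using fx[of s] fx[of u] that by simp
          moreover have "x < u" using False u by simp
          ultimately have "eventually (\<lambda>s. f s = f u) (at_left u)"
            unfolding eventually_at_left_field by blast
          then show ?thesis by (simp add: tendsto_discrete)
        qed
      qed
      have fb: "f b = f x" by (rule d(3)) (use h in auto)
      show "P a b"
      \<comment> \<open>A jump at \<open>a = x\<close> does not count, because the intervals are
        open on the left.\<close>
      proof (cases "a = x \<or> f x = left_lim f x")
        case True
        have "f a = left_lim f x" if "a \<noteq> x" by (rule d(2)) (use h that in auto)
        then have "f a = f x" using True by (cases "a = x") auto
        moreover have "jump_set T f \<inter> {a<..b} = {}" using nj True by (force simp: jump_set_def)
        ultimately show ?thesis using empty h fb by auto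
      next
        case False
        then have ax: "a < x" using h by auto
        have "jump_set T f \<inter> {a<..b} = {x}" using nj False ax h by (force simp: jump_set_def)
        moreover have "f a = left_lim f x" by (rule d(2)) (use h ax in auto)
        ultimately show ?thesis using single[of a x b] h ax fb by auto
      qed
    qed
  qed
  then show ?thesis using ab by auto
qed

lemma finite_jump_set_Ioc:
  fixes f :: "real \<Rightarrow> nat"
  assumes "cadlag T f" "0 \<le> a" "a \<le> b" "b \<le> T"
  shows "finite (jump_set T f \<inter> {a<..b})"
  using assms
proof (induction rule: cadlag_Bolzano[where P = "\<lambda>a b. finite (jump_set T f \<inter> {a<..b})"])
  case (trans a b c)
  then have "jump_set T f \<inter> {a<..c} = jump_set T f \<inter> {a<..b} \<union> jump_set T f \<inter> {b<..c}"
    by auto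
  then show ?case using trans by simp
qed auto

lemma finite_jump_set: "cadlag T f \<Longrightarrow> finite (jump_set T f)"
proof (cases "0 \<le> T")
  case True
  assume "cadlag T f"
  then have "finite (jump_set T f \<inter> {0<..T})" using True by (intro finite_jump_set_Ioc) auto
  moreover have "jump_set T f \<inter> {0<..T} = jump_set T f" by (auto simp: jump_set_def)
  ultimately show ?thesis by simp
next
  case False
  then have "jump_set T f = {}" by (auto simp: jump_set_def)
  then show ?thesis by simp
qed

lemma cadlag_telescope:
  fixes f :: "real \<Rightarrow> nat" and h :: "nat \<Rightarrow> 'b::ab_group_add"
  assumes "cadlag T f" "0 \<le> a" "a \<le> b" "b \<le> T"
  shows "h (f b) - h (f a) = (\<Sum>u\<in>jump_set T f \<inter> {a<..b}. h (f u) - h (left_lim f u))"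
  using assms
proof (induction rule: cadlag_Bolzano[where
      P = "\<lambda>a b. h (f b) - h (f a) = (\<Sum>u\<in>jump_set T f \<inter> {a<..b}. h (f u) - h (left_lim f u))"])
  case (trans a b c)
  then have eq: "jump_set T f \<inter> {a<..c} = jump_set T f \<inter> {a<..b} \<union> jump_set T f \<inter> {b<..c}"
    by auto
  show ?case unfolding eq
    using trans finite_jump_set[OF assms(1)]
    by (subst sum.union_disjoint) (auto simp flip: trans(1,2))
qed auto

lemma cadlag_const:
  fixes f :: "real \<Rightarrow> nat"
  assumes "cadlag T f" "0 \<le> a" "a \<le> b" "b \<le> T" "jump_set T f \<inter> {a<..b} = {}"
  shows "f b = f a"
  using cadlag_telescope[OF assms(1-4), of int] assms(5) by simp

lemma left_lim_const:
  fixes f :: "real \<Rightarrow> nat"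
  assumes f: "cadlag T f" and ab: "0 \<le> a" "a < b" "b \<le> T" and nj: "jump_set T f \<inter> {a<..<b} = {}"
  shows "left_lim f b = f a"
proof (rule left_lim_eq)
  show "0 < b" using ab by auto
  have "f s = f a" if "a < s" "s < b" for s
    using nj that ab by (intro cadlag_const[OF f]) auto
  then have "eventually (\<lambda>s. f s = f a) (at_left b)"
    unfolding eventually_at_left_field using ab by (intro exI[of _ a]) auto
  then show "(f \<longlongrightarrow> f a) (at_left b)" by (simp add: tendsto_discrete)
qed

lemma left_lim_comp:
  fixes f :: "real \<Rightarrow> nat" and h :: "nat \<Rightarrow> 'b::{t2_space, zero}"
  assumes "cadlag T f" "0 < u" "u \<le> T"
  shows "left_lim (\<lambda>s. h (f s)) u = h (left_lim f u)"
proof (rule left_lim_eq)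
  have "eventually (\<lambda>s. f s = left_lim f u) (at_left u)"
    using cadlag_tendsto_left_lim[OF assms] by (simp add: tendsto_discrete)
  then have "eventually (\<lambda>s. h (f s) = h (left_lim f u)) (at_left u)"
    by eventually_elim simp
  then show "((\<lambda>s. h (f s)) \<longlongrightarrow> h (left_lim f u)) (at_left u)" by (rule tendsto_eventually)
qed (fact assms)

lemma tendsto_left_lim_comp:
  fixes f :: "real \<Rightarrow> nat" and h :: "nat \<Rightarrow> 'b::topological_space"
  assumes "cadlag T f" "0 < u" "u \<le> T"
  shows "((\<lambda>s. h (f s)) \<longlongrightarrow> h (left_lim f u)) (at_left u)"
proof -
  have "eventually (\<lambda>s. f s = left_lim f u) (at_left u)"
    using cadlag_tendsto_left_lim[OF assms] by (simp add: tendsto_discrete)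
  then have "eventually (\<lambda>s. h (f s) = h (left_lim f u)) (at_left u)"
    by eventually_elim simp
  then show ?thesis by (rule tendsto_eventually)
qed

section \<open>Riemann sums along grids\<close>

definition grid :: "real \<Rightarrow> real \<Rightarrow> nat \<Rightarrow> nat \<Rightarrow> real" where
  "grid s t n i = s + (t - s) * real i / real n"

lemma grid_0 [simp]: "grid s t n 0 = s" by (simp add: grid_def)
lemma grid_n [simp]: "0 < n \<Longrightarrow> grid s t n n = t" by (simp add: grid_def)
lemma grid_Suc: "grid s t n (Suc i) - grid s t n i = (t - s) / real n"
  by (simp add: grid_def field_simps flip: add_divide_distrib)
lemma grid_mono: "s \<le> t \<Longrightarrow> i \<le> j \<Longrightarrow> grid s t n i \<le> grid s t n j"
  by (auto simp: grid_def intro!: divide_right_mono mult_left_mono)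
lemma grid_bounds: assumes "s \<le> t" "i \<le> n" "0 < n" shows "s \<le> grid s t n i" "grid s t n i \<le> t"
  using grid_mono[of s t 0 i n] grid_mono[of s t i n n] assms by auto
lemma grid_same [simp]: "grid s s n i = s" by (simp add: grid_def)

text \<open>Cells are open on the left and closed on the right; the ceiling minus one is the index
  of the cell containing \<open>w\<close>. Its left end point lies strictly before \<open>w\<close>,
  so sampling there does not anticipate.\<close>

definition below :: "real \<Rightarrow> real \<Rightarrow> nat \<Rightarrow> real \<Rightarrow> nat" where
  "below s t n w = nat (\<lceil>(w - s) * real n / (t - s)\<rceil> - 1)"

lemma below_grid:
  assumes "s < w" "w \<le> t" "0 < n"
  shows "below s t n w < n" "grid s t n (below s t n w) < w" "w \<le> grid s t n (Suc (below s t n w))"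
proof -
  define r where "r = (w - s) * real n / (t - s)"
  have r: "0 < r" "r \<le> real n" using assms by (auto simp: r_def field_simps)
  have i: "real (below s t n w) = of_int \<lceil>r\<rceil> - 1"
    using r unfolding below_def r_def[symmetric] by simp
  have w: "w = s + (t - s) * r / real n" using assms by (simp add: r_def)
  show "below s t n w < n" using i r(2) by linarith
  have "real (below s t n w) < r" using i r by linarith
  then show "grid s t n (below s t n w) < w"
    unfolding grid_def using assms by (subst w) (auto intro!: divide_strict_right_mono)
  have "r \<le> real (Suc (below s t n w))" using i by simp
  then show "w \<le> grid s t n (Suc (below s t n w))"
    unfolding grid_def using assms by (subst w) (auto intro!: divide_right_mono mult_left_mono)
qed

lemma below_unique:
  assumes "s \<le> t" "grid s t n i < w" "w \<le> grid s t n (Suc i)" "s < w" "w \<le> t" "0 < n"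
  shows "i = below s t n w"
proof (rule ccontr)
  note b = below_grid[OF assms(4-6)]
  assume "i \<noteq> below s t n w"
  then consider "Suc i \<le> below s t n w" | "Suc (below s t n w) \<le> i" by linarith
  then show False
  proof cases
    case 1 then show False using grid_mono[OF assms(1) 1, of n] assms b by linarith
  next
    case 2 then show False using grid_mono[OF assms(1) 2, of n] assms b by linarith
  qed
qed

lemma below_fibre:
  assumes "s \<le> t" "0 < n" "J \<subseteq> {s<..t}"
  shows "{w\<in>J. below s t n w = i} = J \<inter> {grid s t n i<..grid s t n (Suc i)}"
proof (intro set_eqI iffI)
  fix w assume "w \<in> {w\<in>J. below s t n w = i}"
  then have "w \<in> J" "below s t n w = i" "s < w" "w \<le> t" using assms by auto
  then show "w \<in> J \<inter> {grid s t n i<..grid s t n (Suc i)}"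
    using below_grid[of s w t n] assms(2) by auto
next
  fix w assume w: "w \<in> J \<inter> {grid s t n i<..grid s t n (Suc i)}"
  then have "s < w" "w \<le> t" using assms by auto
  then show "w \<in> {w\<in>J. below s t n w = i}" using below_unique[of s t n i w] assms w by auto
qed

text \<open>The left end points approach \<open>w\<close> strictly from below, within one mesh size.
  Composition with this filter therefore sees the left limit at \<open>w\<close> and never the value
  at \<open>w\<close>.\<close>

lemma filterlim_below:
  assumes "s < w" "w \<le> t"
  shows "filterlim (\<lambda>n. grid s t (Suc n) (below s t (Suc n) w)) (at_left w) sequentially"
proof -
  let ?g = "\<lambda>n. grid s t (Suc n) (below s t (Suc n) w)"
  have "(\<lambda>n. w - (t - s) / real (Suc n)) \<longlonglongrightarrow> w - 0"
    by (intro tendsto_diff tendsto_const lim_const_over_n[THEN LIMSEQ_Suc])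
  moreover have "w - (t - s) / real (Suc n) \<le> ?g n" for n
    using below_grid(3)[OF assms, of "Suc n"] grid_Suc[of s t "Suc n" "below s t (Suc n) w"] by simp
  moreover have lt: "?g n < w" for n using below_grid(2)[OF assms, of "Suc n"] by simp
  ultimately have "?g \<longlonglongrightarrow> w"
    by (intro tendsto_sandwich[of "\<lambda>n. w - (t - s) / real (Suc n)" ?g _ "\<lambda>_. w"])
      (auto intro!: always_eventually less_imp_le)
  then show ?thesis using lt by (auto simp: filterlim_at intro!: always_eventually less_imp_neq)
qed

lemma sum_grid_indicator:
  fixes f :: "real \<Rightarrow> real"
  assumes "s < t" "0 < n"
  shows "indicator {s<..t} u * f (grid s t n (below s t n u)) =
    (\<Sum>i<n. f (grid s t n i) * indicator {grid s t n i<..grid s t n (Suc i)} u)"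
proof (cases "u \<in> {s<..t}")
  case True
  then have b: "below s t n u < n" "u \<in> {grid s t n (below s t n u)<..grid s t n (Suc (below s t n u))}"
    using below_grid[of s u t n] assms by auto
  have "(\<Sum>i<n. f (grid s t n i) * indicator {grid s t n i<..grid s t n (Suc i)} u) =
    (\<Sum>i\<in>{below s t n u}. f (grid s t n i) * indicator {grid s t n i<..grid s t n (Suc i)} u)"
    using b True assms below_unique[of s t n _ u]
    by (intro sum.mono_neutral_right) (auto simp: indicator_def)
  also have "\<dots> = f (grid s t n (below s t n u))" using b by (simp add: indicator_def)
  finally show ?thesis using True by simp
next
  case False
  have "u \<notin> {grid s t n i<..grid s t n (Suc i)}" if "i < n" for i
    using False grid_bounds[of s t i n] grid_bounds[of s t "Suc i" n] that assms by auto
  then show ?thesis using False by simp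
qed

lemma prod_grid_cells:
  fixes c :: "real \<Rightarrow> 'b::comm_monoid_mult"
  assumes "s \<le> t" "0 < n" "finite J" "J \<subseteq> {s<..t}"
  shows "(\<Prod>i<n. c (grid s t n i) ^ card (J \<inter> {grid s t n i<..grid s t n (Suc i)})) =
    (\<Prod>w\<in>J. c (grid s t n (below s t n w)))"
proof -
  have "(\<Prod>w\<in>J. c (grid s t n (below s t n w))) =
      (\<Prod>i<n. \<Prod>w\<in>{w\<in>J. below s t n w = i}. c (grid s t n (below s t n w)))"
    using assms below_grid(1)[of s _ t n] by (intro prod.group[symmetric]) auto
  also have "\<dots> = (\<Prod>i<n. \<Prod>w\<in>J \<inter> {grid s t n i<..grid s t n (Suc i)}. c (grid s t n i))"
  proof (rule prod.cong[OF refl])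
    fix i
    have "{w\<in>J. below s t n w = i} = J \<inter> {grid s t n i<..grid s t n (Suc i)}"
      by (rule below_fibre) (use assms in auto)
    then show "(\<Prod>w\<in>{w\<in>J. below s t n w = i}. c (grid s t n (below s t n w))) =
      (\<Prod>w\<in>J \<inter> {grid s t n i<..grid s t n (Suc i)}. c (grid s t n i))"
      by (intro prod.cong) auto
  qed
  finally show ?thesis by simp
qed

lemma sum_grid_cells:
  fixes c :: "real \<Rightarrow> real"
  assumes "s \<le> t" "0 < n" "finite J" "J \<subseteq> {s<..t}"
  shows "(\<Sum>i<n. c (grid s t n i) * real (card (J \<inter> {grid s t n i<..grid s t n (Suc i)}))) =
    (\<Sum>w\<in>J. c (grid s t n (below s t n w)))"
proof -
  have "(\<Sum>w\<in>J. c (grid s t n (below s t n w))) =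
      (\<Sum>i<n. \<Sum>w\<in>{w\<in>J. below s t n w = i}. c (grid s t n (below s t n w)))"
    using assms below_grid(1)[of s _ t n] by (intro sum.group[symmetric]) auto
  also have "\<dots> = (\<Sum>i<n. \<Sum>w\<in>J \<inter> {grid s t n i<..grid s t n (Suc i)}. c (grid s t n i))"
  proof (rule sum.cong[OF refl])
    fix i
    have "{w\<in>J. below s t n w = i} = J \<inter> {grid s t n i<..grid s t n (Suc i)}"
      by (rule below_fibre) (use assms in auto)
    then show "(\<Sum>w\<in>{w\<in>J. below s t n w = i}. c (grid s t n (below s t n w))) =
      (\<Sum>w\<in>J \<inter> {grid s t n i<..grid s t n (Suc i)}. c (grid s t n i))"
      by (intro sum.cong) auto
  qed
  finally show ?thesis by (simp add: mult.commute)
qed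

text \<open>A function of left limits is the pointwise limit of step functions sampled at left end
  points, each of which is Borel whatever \<open>f\<close> is.\<close>

lemma left_limits_measurable:
  fixes f \<phi> :: "real \<Rightarrow> real"
  assumes "\<And>u. s < u \<Longrightarrow> u \<le> t \<Longrightarrow> (f \<longlongrightarrow> \<phi> u) (at_left u)"
  shows "(\<lambda>u. indicator {s<..t} u * \<phi> u) \<in> borel_measurable borel"
proof (cases "s < t")
  case True
  let ?f = "\<lambda>n u. \<Sum>i<Suc n. f (grid s t (Suc n) i) * indicator {grid s t (Suc n) i<..grid s t (Suc n) (Suc i)} u"
  have "(\<lambda>n. ?f n u) \<longlonglongrightarrow> indicator {s<..t} u * \<phi> u" for u
  proof -
    have "(\<lambda>n. indicator {s<..t} u * f (grid s t (Suc n) (below s t (Suc n) u))) \<longlonglongrightarrow> indicator {s<..t} u * \<phi> u"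
      using filterlim_compose[OF assms filterlim_below, of u] by (cases "u \<in> {s<..t}") auto
    then show ?thesis by (subst (asm) sum_grid_indicator) (use True in auto)
  qed
  moreover have "?f n \<in> borel_measurable borel" for n by measurable
  ultimately show ?thesis by (rule borel_measurable_LIMSEQ_real)
qed auto

text \<open>Dominated convergence for the sampled step functions: left limits and a bound replace
  Riemann integrability. The bound is what truncating the intensities provides later.\<close>

lemma Riemann_left_limits:
  fixes f \<phi> :: "real \<Rightarrow> real"
  assumes st: "s \<le> t" and lim: "\<And>u. s < u \<Longrightarrow> u \<le> t \<Longrightarrow> (f \<longlongrightarrow> \<phi> u) (at_left u)"
    and bnd: "\<And>u. s \<le> u \<Longrightarrow> u \<le> t \<Longrightarrow> \<bar>f u\<bar> \<le> m"
  shows "(\<lambda>n. \<Sum>i<Suc n. f (grid s t (Suc n) i) * ((t - s) / real (Suc n)))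
      \<longlonglongrightarrow> (\<integral>u. indicator {s<..t} u * \<phi> u \<partial>lborel)"
proof (cases "s = t")
  case False
  then have st: "s < t" using st by auto
  let ?f = "\<lambda>n u. indicator {s<..t} u * f (grid s t (Suc n) (below s t (Suc n) u))"
  have eq: "?f n u = (\<Sum>i<Suc n. f (grid s t (Suc n) i) * indicator {grid s t (Suc n) i<..grid s t (Suc n) (Suc i)} u)"
    for n u using sum_grid_indicator[OF st, of "Suc n" u f] by simp
  have meas: "?f n \<in> borel_measurable lborel" for n unfolding eq by measurable
  have int: "(\<integral>u. ?f n u \<partial>lborel) = (\<Sum>i<Suc n. f (grid s t (Suc n) i) * ((t - s) / real (Suc n)))" for n
    unfolding eq using st
    by (subst Bochner_Integration.integral_sum)
      (auto simp: grid_Suc grid_mono[of s t] simp del: sum.lessThan_Suc intro!: sum.cong)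
  have "(\<lambda>n. \<integral>u. ?f n u \<partial>lborel) \<longlonglongrightarrow> (\<integral>u. indicator {s<..t} u * \<phi> u \<partial>lborel)"
  proof (rule integral_dominated_convergence[where w = "\<lambda>u. m * indicator {s<..t} u"])
    show "(\<lambda>u. indicator {s<..t} u * \<phi> u) \<in> borel_measurable lborel"
      using left_limits_measurable[OF lim] by simp
    show "integrable lborel (\<lambda>u. m * indicator {s<..t} u)"
      by (intro integrable_mult_right integrable_real_indicator) (use st in auto)
    show "AE u in lborel. (\<lambda>n. ?f n u) \<longlonglongrightarrow> indicator {s<..t} u * \<phi> u"
    proof (intro always_eventually allI)
      fix u show "(\<lambda>n. ?f n u) \<longlonglongrightarrow> indicator {s<..t} u * \<phi> u"
        using filterlim_compose[OF lim filterlim_below, of u] by (cases "u \<in> {s<..t}") auto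
    qed
    show "AE u in lborel. norm (?f n u) \<le> m * indicator {s<..t} u" for n
      using bnd grid_bounds[of s t "below s t (Suc n) _" "Suc n"] st below_grid(1)[of s _ t "Suc n"]
      by (intro always_eventually) (auto simp: indicator_def less_imp_le)
  qed (rule meas)
  then show ?thesis unfolding int .
qed simp
section \<open>Exponential densities along a path\<close>

definition unit_jumps :: "real \<Rightarrow> (real \<Rightarrow> nat) \<Rightarrow> bool" where
  "unit_jumps T N \<longleftrightarrow> cadlag T N \<and> (\<forall>u\<in>jump_set T N. N u = Suc (left_lim N u))"

lemma unit_jumps_increment:
  assumes "unit_jumps T N" "0 \<le> a" "a \<le> b" "b \<le> T"
  shows "N b = N a + card (jump_set T N \<inter> {a<..b})"
proof -
  have "int (N b) - int (N a) = (\<Sum>u\<in>jump_set T N \<inter> {a<..b}. int (N u) - int (left_lim N u))"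
    using assms by (intro cadlag_telescope) (auto simp: unit_jumps_def)
  also have "\<dots> = (\<Sum>u\<in>jump_set T N \<inter> {a<..b}. 1)"
    using assms by (intro sum.cong) (auto simp: unit_jumps_def)
  finally show ?thesis by simp
qed

text \<open>Valued in \<open>ennreal\<close> because an intensity with left limits may have an
  infinite integral; splitting the interval is then additive without integrability.\<close>

definition path_int :: "(real \<Rightarrow> real) \<Rightarrow> real \<Rightarrow> real \<Rightarrow> ennreal" where
  "path_int \<phi> s t = (\<integral>\<^sup>+u. ennreal (indicator {s<..t} u * \<phi> u) \<partial>lborel)"

text \<open>The case distinction is the convention exp(-infinity) = 0, the same as in
  \<open>exp_neg_integral\<close>.\<close>

definition exp_neg :: "real \<Rightarrow> ennreal \<Rightarrow> real" where
  "exp_neg a I = (if I = \<infinity> then 0 else exp (- a * enn2real I))"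

text \<open>Likelihood ratio of a point process with intensity \<open>a \<phi>\<close> against a
  Poisson process of rate \<open>a\<close>. The finite part \<open>a (t - s)\<close> of the exponent
  is kept apart from the possibly infinite integral.\<close>

definition path_dens :: "real \<Rightarrow> (real \<Rightarrow> real) \<Rightarrow> real set \<Rightarrow> real \<Rightarrow> real \<Rightarrow> real" where
  "path_dens a \<phi> J s t = exp (a * (t - s)) * exp_neg a (path_int \<phi> s t) * (\<Prod>w\<in>J \<inter> {s<..t}. \<phi> w)"

text \<open>With mesh \<open>h\<close>, each factor is the ratio of the Poisson weights of means
  \<open>a f h\<close> and \<open>a h\<close> at the observed increment, \<open>f\<close> being
  truncated at \<open>m\<close>.\<close>

definition grid_dens :: "real \<Rightarrow> (real \<Rightarrow> real) \<Rightarrow> (real \<Rightarrow> nat) \<Rightarrow> real \<Rightarrow> real \<Rightarrow> real \<Rightarrow> nat \<Rightarrow> real" where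
  "grid_dens a f N s t m n = (\<Prod>i<n. exp (- a * (min (f (grid s t n i)) m - 1) * ((t - s) / real n)) *
      min (f (grid s t n i)) m ^ (N (grid s t n (Suc i)) - N (grid s t n i)))"

definition trunc_dens :: "real \<Rightarrow> (real \<Rightarrow> real) \<Rightarrow> real set \<Rightarrow> real \<Rightarrow> real \<Rightarrow> real \<Rightarrow> real" where
  "trunc_dens a \<phi> J s t m = exp (a * (t - s)) * exp (- a * (\<integral>u. indicator {s<..t} u * min (\<phi> u) m \<partial>lborel)) *
      (\<Prod>w\<in>J \<inter> {s<..t}. min (\<phi> w) m)"

lemma eventually_min_eq: "\<forall>\<^sub>F m in sequentially. min x (real m) = x"
  using eventually_ge_at_top[of "nat \<lceil>x\<rceil>"]
proof eventually_elim
  case (elim m)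
  then have "x \<le> real m" using real_nat_ceiling_ge[of x] by linarith
  then show ?case by simp
qed

lemma tendsto_min_const:
  fixes f :: "'c \<Rightarrow> real"
  shows "(f \<longlongrightarrow> l) F \<Longrightarrow> ((\<lambda>u. min (f u) m) \<longlongrightarrow> min l m) F"
  by (rule tendsto_min) auto

text \<open>The exponents add up to a Riemann sum. The powers regroup into one factor per jump,
  because a path with unit jumps grows over a cell by the number of its jumps there.\<close>

lemma grid_dens_tendsto:
  assumes N: "unit_jumps T N" and st: "0 \<le> s" "s \<le> t" "t \<le> T"
    and lim: "\<And>u. s < u \<Longrightarrow> u \<le> t \<Longrightarrow> (f \<longlongrightarrow> \<phi> u) (at_left u)"
    and f: "\<And>u. s \<le> u \<Longrightarrow> u \<le> t \<Longrightarrow> 0 \<le> f u" and m: "0 \<le> m"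
  shows "(\<lambda>n. grid_dens a f N s t m (Suc n)) \<longlonglongrightarrow> trunc_dens a \<phi> (jump_set T N) s t m"
proof -
  let ?J = "jump_set T N \<inter> {s<..t}" and ?f = "\<lambda>u. min (f u) m"
  have fin: "finite ?J" using N finite_jump_set by (auto simp: unit_jumps_def)
  have lim': "(?f \<longlongrightarrow> min (\<phi> u) m) (at_left u)" if "s < u" "u \<le> t" for u
    using lim[OF that] by (rule tendsto_min_const)
  have 1: "(\<lambda>n. \<Sum>i<Suc n. ?f (grid s t (Suc n) i) * ((t - s) / real (Suc n)))
      \<longlonglongrightarrow> (\<integral>u. indicator {s<..t} u * min (\<phi> u) m \<partial>lborel)"
    using f m by (intro Riemann_left_limits[where m = m] lim' st(2)) (auto simp: min_def)
  have 2: "(\<lambda>n. \<Prod>w\<in>?J. ?f (grid s t (Suc n) (below s t (Suc n) w))) \<longlonglongrightarrow> (\<Prod>w\<in>?J. min (\<phi> w) m)"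
    by (intro tendsto_prod filterlim_compose[OF lim' filterlim_below]) auto
  have eq: "grid_dens a f N s t m (Suc n) =
     exp (a * (t - s)) * exp (- a * (\<Sum>i<Suc n. ?f (grid s t (Suc n) i) * ((t - s) / real (Suc n)))) *
      (\<Prod>w\<in>?J. ?f (grid s t (Suc n) (below s t (Suc n) w)))" for n
  proof -
    let ?g = "grid s t (Suc n)" and ?h = "(t - s) / real (Suc n)"
    have "N (?g (Suc i)) - N (?g i) = card (?J \<inter> {?g i<..?g (Suc i)})" if "i < Suc n" for i
    proof -
      have "s \<le> ?g i" "?g i \<le> ?g (Suc i)" "?g (Suc i) \<le> t"
        using grid_bounds[of s t _ "Suc n"] grid_mono[of s t i "Suc i"] st that by auto
      then have "N (?g (Suc i)) = N (?g i) + card (jump_set T N \<inter> {?g i<..?g (Suc i)})"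
        using st by (intro unit_jumps_increment[OF N]) auto
      moreover have "jump_set T N \<inter> {?g i<..?g (Suc i)} = ?J \<inter> {?g i<..?g (Suc i)}"
        using \<open>s \<le> ?g i\<close> \<open>?g (Suc i) \<le> t\<close> by auto
      ultimately show ?thesis by simp
    qed
    then have "grid_dens a f N s t m (Suc n) = (\<Prod>i<Suc n. exp (- a * (?f (?g i) - 1) * ?h)) *
        (\<Prod>i<Suc n. ?f (?g i) ^ card (?J \<inter> {?g i<..?g (Suc i)}))"
      unfolding grid_dens_def prod.distrib by (simp del: prod.lessThan_Suc)
    also have "(\<Prod>i<Suc n. ?f (?g i) ^ card (?J \<inter> {?g i<..?g (Suc i)})) =
        (\<Prod>w\<in>?J. ?f (?g (below s t (Suc n) w)))"
      using st fin by (intro prod_grid_cells) auto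
    also have "(\<Prod>i<Suc n. exp (- a * (?f (?g i) - 1) * ?h)) = exp (\<Sum>i<Suc n. - a * (?f (?g i) - 1) * ?h)"
      by (simp only: exp_sum[OF finite_lessThan])
    also have "(\<Sum>i<Suc n. - a * (?f (?g i) - 1) * ?h) =
        a * (\<Sum>i<Suc n. ?h) - a * (\<Sum>i<Suc n. ?f (?g i) * ?h)"
      unfolding sum_distrib_left sum_subtractf[symmetric]
      by (intro sum.cong) (auto simp: algebra_simps simp flip: add_divide_distrib diff_divide_distrib)
    also have "(\<Sum>i<Suc n. ?h) = t - s" by (simp del: sum.lessThan_Suc)
    also have "exp (a * (t - s) - a * (\<Sum>i<Suc n. ?f (?g i) * ?h)) =
        exp (a * (t - s)) * exp (- a * (\<Sum>i<Suc n. ?f (?g i) * ?h))"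
      by (simp only: exp_add[symmetric] mult_minus_left) simp
    finally show ?thesis .
  qed
  show ?thesis unfolding eq trunc_dens_def by (intro tendsto_intros 1 2)
qed

lemma path_int_measurable:
  fixes f \<phi> :: "real \<Rightarrow> real"
  assumes "\<And>u. s < u \<Longrightarrow> u \<le> t \<Longrightarrow> (f \<longlongrightarrow> \<phi> u) (at_left u)"
  shows "(\<lambda>u. ennreal (indicator {s<..t} u * \<phi> u)) \<in> borel_measurable borel"
  using left_limits_measurable[OF assms] by simp

lemma trunc_int_tendsto:
  fixes f \<phi> :: "real \<Rightarrow> real"
  assumes lim: "\<And>u. s < u \<Longrightarrow> u \<le> t \<Longrightarrow> (f \<longlongrightarrow> \<phi> u) (at_left u)"
    and f: "\<And>u. s < u \<Longrightarrow> u \<le> t \<Longrightarrow> 0 \<le> \<phi> u"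
  shows "(\<lambda>m. ennreal (\<integral>u. indicator {s<..t} u * min (\<phi> u) (real m) \<partial>lborel)) \<longlonglongrightarrow> path_int \<phi> s t"
proof -
  have meas: "(\<lambda>u. indicator {s<..t} u * min (\<phi> u) (real m)) \<in> borel_measurable borel" for m
    by (rule left_limits_measurable[where f = "\<lambda>u. min (f u) (real m)"]) (intro tendsto_min_const lim)
  have le: "emeasure lborel {s<..t} < \<infinity>" by (cases "s \<le> t") auto
  have "ennreal (\<integral>u. indicator {s<..t} u * min (\<phi> u) (real m) \<partial>lborel) =
      (\<integral>\<^sup>+u. ennreal (indicator {s<..t} u * min (\<phi> u) (real m)) \<partial>lborel)" for m
  proof (rule nn_integral_eq_integral[symmetric])
    show "integrable lborel (\<lambda>u. indicator {s<..t} u * min (\<phi> u) (real m))"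
      by (rule integrableI_bounded_set[of "{s<..t}" _ _ "real m"])
        (use meas le f in \<open>auto intro!: always_eventually simp: indicator_def\<close>)
  qed (use f in \<open>auto intro!: always_eventually simp: indicator_def\<close>)
  moreover have "(\<lambda>m. \<integral>\<^sup>+u. ennreal (indicator {s<..t} u * min (\<phi> u) (real m)) \<partial>lborel)
      \<longlonglongrightarrow> (\<integral>\<^sup>+u. ennreal (indicator {s<..t} u * \<phi> u) \<partial>lborel)"
  proof (rule nn_integral_LIMSEQ)
    show "incseq (\<lambda>m u. ennreal (indicator {s<..t} u * min (\<phi> u) (real m)))"
      by (auto simp: incseq_def le_fun_def indicator_def intro!: ennreal_leI)
    show "(\<lambda>m. ennreal (indicator {s<..t} u * min (\<phi> u) (real m))) \<longlonglongrightarrow> ennreal (indicator {s<..t} u * \<phi> u)" for u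
      by (intro tendsto_ennrealI tendsto_mult_left tendsto_eventually eventually_min_eq)
  qed (use meas in measurable)
  ultimately show ?thesis unfolding path_int_def by simp
qed

text \<open>Monotone convergence for the integral; if it diverges, the exponential tends to 0 in
  agreement with \<open>exp_neg\<close>. Each factor of the jump product is eventually
  untruncated.\<close>

lemma trunc_dens_tendsto:
  fixes f \<phi> :: "real \<Rightarrow> real"
  assumes lim: "\<And>u. s < u \<Longrightarrow> u \<le> t \<Longrightarrow> (f \<longlongrightarrow> \<phi> u) (at_left u)"
    and f: "\<And>u. s < u \<Longrightarrow> u \<le> t \<Longrightarrow> 0 \<le> \<phi> u" and a: "0 < a"
  shows "(\<lambda>m. trunc_dens a \<phi> J s t (real m)) \<longlonglongrightarrow> path_dens a \<phi> J s t"
proof -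
  let ?I = "\<lambda>m. \<integral>u. indicator {s<..t} u * min (\<phi> u) (real m) \<partial>lborel"
  have I: "(\<lambda>m. ennreal (?I m)) \<longlonglongrightarrow> path_int \<phi> s t"
    using trunc_int_tendsto[OF lim f] by simp
  have I0: "0 \<le> ?I m" for m
    using f by (intro Bochner_Integration.integral_nonneg) (auto simp: indicator_def)
  have 1: "(\<lambda>m. exp (- a * ?I m)) \<longlonglongrightarrow> exp_neg a (path_int \<phi> s t)"
  proof (cases "path_int \<phi> s t = \<infinity>")
    case True
    then have "filterlim ?I at_top sequentially"
      using I by (simp add: ennreal_tendsto_top_eq_at_top)
    then have "filterlim (\<lambda>m. - a * ?I m) at_bot sequentially"
      using a by (intro filterlim_tendsto_neg_mult_at_bot[OF tendsto_const]) auto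
    then show ?thesis using True
      by (simp add: exp_neg_def filterlim_compose[OF exp_at_bot])
  next
    case False
    then have "(\<lambda>m. enn2real (ennreal (?I m))) \<longlonglongrightarrow> enn2real (path_int \<phi> s t)"
      using I by (intro tendsto_enn2real) (auto simp: less_top)
    then have "?I \<longlonglongrightarrow> enn2real (path_int \<phi> s t)" using I0 by simp
    then show ?thesis using False by (auto simp: exp_neg_def intro!: tendsto_intros)
  qed
  have 2: "(\<lambda>m. \<Prod>w\<in>J \<inter> {s<..t}. min (\<phi> w) (real m)) \<longlonglongrightarrow> (\<Prod>w\<in>J \<inter> {s<..t}. \<phi> w)"
    by (intro tendsto_prod tendsto_eventually eventually_min_eq)
  show ?thesis unfolding path_dens_def trunc_dens_def by (intro tendsto_mult tendsto_const 1 2)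
qed

lemma exp_neg_add: "exp_neg a (I1 + I2) = exp_neg a I1 * exp_neg a I2"
  by (auto simp: exp_neg_def enn2real_plus less_top algebra_simps exp_add[symmetric])

lemma path_int_split:
  fixes f \<phi> :: "real \<Rightarrow> real"
  assumes lim: "\<And>u. s < u \<Longrightarrow> u \<le> v \<Longrightarrow> (f \<longlongrightarrow> \<phi> u) (at_left u)" and st: "s \<le> t" "t \<le> v"
  shows "path_int \<phi> s v = path_int \<phi> s t + path_int \<phi> t v"
proof -
  have "path_int \<phi> s v = (\<integral>\<^sup>+u. ennreal (indicator {s<..t} u * \<phi> u) + ennreal (indicator {t<..v} u * \<phi> u) \<partial>lborel)"
    unfolding path_int_def using st by (intro nn_integral_cong) (auto simp: indicator_def)
  also have "\<dots> = path_int \<phi> s t + path_int \<phi> t v" unfolding path_int_def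
    using lim st by (intro nn_integral_add) (auto intro!: path_int_measurable[of _ _ f])
  finally show ?thesis .
qed

lemma path_dens_split:
  fixes f \<phi> :: "real \<Rightarrow> real"
  assumes "\<And>u. s < u \<Longrightarrow> u \<le> v \<Longrightarrow> (f \<longlongrightarrow> \<phi> u) (at_left u)" "s \<le> t" "t \<le> v" "finite J"
  shows "path_dens a \<phi> J s v = path_dens a \<phi> J s t * path_dens a \<phi> J t v"
proof -
  have "J \<inter> {s<..v} = J \<inter> {s<..t} \<union> J \<inter> {t<..v}" using assms by auto
  then have "(\<Prod>w\<in>J \<inter> {s<..v}. \<phi> w) = (\<Prod>w\<in>J \<inter> {s<..t}. \<phi> w) * (\<Prod>w\<in>J \<inter> {t<..v}. \<phi> w)"
    using assms by (simp, subst prod.union_disjoint) auto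
  moreover have "path_int \<phi> s v = path_int \<phi> s t + path_int \<phi> t v"
    by (rule path_int_split[OF assms(1-3)])
  moreover have "exp (a * (v - s)) = exp (a * (t - s)) * exp (a * (v - t))"
    by (simp add: exp_add[symmetric] algebra_simps)
  ultimately show ?thesis unfolding path_dens_def by (simp add: exp_neg_add)
qed

text \<open>Sums over jump times have a random index set; this exhibits them as limits of
  expressions in the values at fixed times, from which measurability will follow.\<close>

lemma count_sum_tendsto:
  fixes f \<phi> :: "real \<Rightarrow> real"
  assumes N: "unit_jumps T N" and st: "0 \<le> s" "s \<le> t" "t \<le> T"
    and lim: "\<And>u. s < u \<Longrightarrow> u \<le> t \<Longrightarrow> (f \<longlongrightarrow> \<phi> u) (at_left u)"
  shows "(\<lambda>n. \<Sum>i<Suc n. f (grid s t (Suc n) i) * (real (N (grid s t (Suc n) (Suc i))) - real (N (grid s t (Suc n) i))))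
    \<longlonglongrightarrow> (\<Sum>w\<in>jump_set T N \<inter> {s<..t}. \<phi> w)"
proof -
  let ?J = "jump_set T N \<inter> {s<..t}"
  have fin: "finite ?J" using N finite_jump_set by (auto simp: unit_jumps_def)
  have "(\<lambda>n. \<Sum>w\<in>?J. f (grid s t (Suc n) (below s t (Suc n) w))) \<longlonglongrightarrow> (\<Sum>w\<in>?J. \<phi> w)"
    by (intro tendsto_sum filterlim_compose[OF lim filterlim_below]) auto
  moreover have "(\<Sum>w\<in>?J. f (grid s t (Suc n) (below s t (Suc n) w))) =
    (\<Sum>i<Suc n. f (grid s t (Suc n) i) * (real (N (grid s t (Suc n) (Suc i))) - real (N (grid s t (Suc n) i))))" for n
  proof -
    let ?g = "grid s t (Suc n)"
    have "real (N (?g (Suc i))) - real (N (?g i)) = real (card (?J \<inter> {?g i<..?g (Suc i)}))" if "i < Suc n" for i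
    proof -
      have "s \<le> ?g i" "?g i \<le> ?g (Suc i)" "?g (Suc i) \<le> t"
        using grid_bounds[of s t _ "Suc n"] grid_mono[of s t i "Suc i"] st that by auto
      then have "N (?g (Suc i)) = N (?g i) + card (jump_set T N \<inter> {?g i<..?g (Suc i)})"
        using st by (intro unit_jumps_increment[OF N]) auto
      moreover have "jump_set T N \<inter> {?g i<..?g (Suc i)} = ?J \<inter> {?g i<..?g (Suc i)}"
        using \<open>s \<le> ?g i\<close> \<open>?g (Suc i) \<le> t\<close> by auto
      ultimately show ?thesis by simp
    qed
    then have "(\<Sum>i<Suc n. f (?g i) * (real (N (?g (Suc i))) - real (N (?g i)))) =
       (\<Sum>i<Suc n. f (?g i) * real (card (?J \<inter> {?g i<..?g (Suc i)})))"
      by (simp del: sum.lessThan_Suc)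
    also have "\<dots> = (\<Sum>w\<in>?J. f (?g (below s t (Suc n) w)))"
      using st fin by (intro sum_grid_cells) auto
    finally show ?thesis by simp
  qed
  ultimately show ?thesis by (simp only:)
qed

section \<open>Measure-theoretic preliminaries\<close>

text \<open>By completeness every subset of the exceptional null set is a null set and hence belongs
  to \<open>A\<close>. Most measurability claims about path quantities rest on this.\<close>

lemma measurable_AE_eq_complete:
  assumes M: "complete_measure M" and A: "subalgebra M A" "null_sets M \<subseteq> sets A"
    and g: "g \<in> measurable A N" and eq: "AE x in M. f x = g x" and f: "f \<in> space M \<rightarrow> space N"
  shows "f \<in> measurable A N"
proof (rule measurableI)
  have sp: "space A = space M" using A by (simp add: subalgebra_def)
  obtain Z where Z: "Z \<in> null_sets M" "{x\<in>space M. f x \<noteq> g x} \<subseteq> Z" using eq unfolding eventually_ae_filter by auto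
  show "f x \<in> space N" if "x \<in> space A" for x using f that sp by auto
  fix B assume B: "B \<in> sets N"
  have sub: "C \<in> sets A" if "C \<subseteq> Z" for C
  proof -
    have "C \<in> sets M" using complete_measure.complete[OF M that Z(1)] .
    then have "C \<in> null_sets M" using null_sets_subset[OF Z(1) _ that] by blast
    then show ?thesis using A by auto
  qed
  have "f -` B \<inter> space A = (g -` B \<inter> space A - Z) \<union> (f -` B \<inter> space A \<inter> Z)"
    using Z(2) sp by auto
  also have "\<dots> \<in> sets A"
    using measurable_sets[OF g B] sub by (intro sets.Un sets.Diff) auto
  finally show "f -` B \<inter> space A \<in> sets A" .
qed

lemma sets_sigma_rv: "sets (sigma_rv M Z) = {Z -` A \<inter> space M |A. True}"
  unfolding sigma_rv_def by (subst sets_vimage_algebra2) auto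

lemma sigma_rv_subset:
  assumes "Z \<in> measurable A (count_space UNIV)" "space A = space M"
  shows "sets (sigma_rv M Z) \<subseteq> sets A"
  unfolding sets_sigma_rv using assms measurable_sets[OF assms(1)] by auto

lemma sigma_rv_measurable:
  assumes "space A = space M" "sets (sigma_rv M Z) \<subseteq> sets A"
  shows "Z \<in> measurable A (count_space UNIV)"
  using assms unfolding sets_sigma_rv by (intro measurableI) auto

lemma space_join_alg [simp]: "space (join_alg A B) = space A"
  unfolding join_alg_def by (simp add: space_measure_of_conv)

lemma sets_join_alg:
  "space B = space A \<Longrightarrow> sets (join_alg A B) = sigma_sets (space A) (sets A \<union> sets B)"
  unfolding join_alg_def using sets.space_closed[of A] sets.space_closed[of B]
  by (simp add: sets_measure_of)

lemma join_alg_upper: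
  "space B = space A \<Longrightarrow> sets A \<subseteq> sets (join_alg A B)"
  "space B = space A \<Longrightarrow> sets B \<subseteq> sets (join_alg A B)"
  by (auto simp: sets_join_alg)

lemma join_alg_least:
  assumes "space B = space A" "space C = space A" "sets A \<subseteq> sets C" "sets B \<subseteq> sets C"
  shows "sets (join_alg A B) \<subseteq> sets C"
  using assms sets.sigma_sets_subset[of "sets A \<union> sets B" C] by (simp add: sets_join_alg)

lemma measurable_mono_sets:
  "f \<in> measurable A N \<Longrightarrow> sets A \<subseteq> sets B \<Longrightarrow> space A = space B \<Longrightarrow> f \<in> measurable B N"
  unfolding measurable_def by auto

text \<open>The two densities define measures that agree on an intersection-stable generator of
  \<open>W\<close> containing the whole space; a finite total mass makes the extension
  unique.\<close>

lemma nn_integral_eq_on_generator: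
  fixes f g V :: "'a \<Rightarrow> ennreal"
  assumes W: "subalgebra M W" "sets W = sigma_sets (space M) E" "Int_stable E" "space M \<in> E"
    and fg: "f \<in> borel_measurable M" "g \<in> borel_measurable M" "(\<integral>\<^sup>+x. f x \<partial>M) < \<infinity>"
    and eq: "\<And>A. A \<in> E \<Longrightarrow> (\<integral>\<^sup>+x. f x * indicator A x \<partial>M) = (\<integral>\<^sup>+x. g x * indicator A x \<partial>M)"
    and V: "V \<in> borel_measurable W"
  shows "(\<integral>\<^sup>+x. f x * V x \<partial>M) = (\<integral>\<^sup>+x. g x * V x \<partial>M)"
proof -
  have E: "E \<subseteq> sets M" using W unfolding subalgebra_def by auto
  have sa: "subalgebra (density M h) W" for h using W by (simp add: subalgebra_def)
  have VM: "V \<in> borel_measurable M" by (rule measurable_from_subalg[OF W(1) V])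
  have "restr_to_subalg (density M f) W = restr_to_subalg (density M g) W"
  proof (rule measure_eqI_generator_eq[of E "space M" _ _ "\<lambda>_. space M"])
    fix X assume X: "X \<in> E"
    then have "X \<in> sets W" using W by auto
    then show "emeasure (restr_to_subalg (density M f) W) X = emeasure (restr_to_subalg (density M g) W) X"
      using eq[OF X] X E fg by (subst (1 2) emeasure_restr_to_subalg[OF sa]) (auto simp: emeasure_density)
  next
    have "emeasure (restr_to_subalg (density M f) W) (space M) = (\<integral>\<^sup>+x. f x \<partial>M)"
      using W fg by (subst emeasure_restr_to_subalg[OF sa])
        (auto simp: emeasure_density subalgebra_def intro!: nn_integral_cong)
    then show "emeasure (restr_to_subalg (density M f) W) (space M) \<noteq> \<infinity>" using fg by simp
  qed (use W E sets.space_closed[of M] sets_restr_to_subalg[OF sa] in auto)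
  then have "(\<integral>\<^sup>+x. V x \<partial>restr_to_subalg (density M f) W) = (\<integral>\<^sup>+x. V x \<partial>restr_to_subalg (density M g) W)"
    by simp
  then show ?thesis
    using fg V VM by (simp add: nn_integral_subalgebra2[OF sa V] nn_integral_density)
qed

lemma (in prob_space) indep_event_on_generator:
  assumes "sets W = sigma_sets (space M) E" "space W = space M" "Int_stable E" "space M \<in> E" "E \<subseteq> events" "D \<in> events"
    and eq: "\<And>A. A \<in> E \<Longrightarrow> prob (A \<inter> D) = prob A * c" and c: "0 \<le> c"
    and V: "V \<in> borel_measurable W"
  shows "(\<integral>\<^sup>+x. V x * indicator D x \<partial>M) = (\<integral>\<^sup>+x. V x \<partial>M) * ennreal c"
proof -
  have W: "subalgebra M W" using assms(1,2,5) sets.sigma_sets_subset[of E M] by (simp add: subalgebra_def)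
  have "(\<integral>\<^sup>+x. indicator D x * V x \<partial>M) = (\<integral>\<^sup>+x. ennreal c * V x \<partial>M)"
  proof (rule nn_integral_eq_on_generator[OF W assms(1,3,4) _ _ _ _ V])
    fix A assume A: "A \<in> E"
    then have A': "A \<in> events" using assms by auto
    have "(\<integral>\<^sup>+x. indicator D x * indicator A x \<partial>M) = ennreal (prob (A \<inter> D))"
      using A' assms(6) by (simp add: emeasure_eq_measure Int_commute flip: indicator_inter_arith)
    also have "\<dots> = ennreal c * ennreal (prob A)" using eq[OF A] c by (simp add: ennreal_mult mult.commute)
    also have "\<dots> = (\<integral>\<^sup>+x. ennreal c * indicator A x \<partial>M)"
      using A' by (simp add: nn_integral_cmult emeasure_eq_measure)
    finally show "(\<integral>\<^sup>+x. indicator D x * indicator A x \<partial>M) = (\<integral>\<^sup>+x. ennreal c * indicator A x \<partial>M)" .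
  next
    show "(\<integral>\<^sup>+x. indicator D x \<partial>M) < \<infinity>" using assms(6) by (simp add: emeasure_eq_measure)
  qed (use assms in auto)
  then show ?thesis
    using measurable_from_subalg[OF W V] by (simp add: nn_integral_cmult mult.commute)
qed

section \<open>Increments of a Poisson process\<close>

lemma increment_event:
  fixes U V :: "'a \<Rightarrow> nat"
  assumes "U \<in> measurable M (count_space UNIV)" "V \<in> measurable M (count_space UNIV)"
  shows "{\<omega>\<in>space M. V \<omega> = U \<omega> + k} \<in> sets M"
proof -
  have "{\<omega>\<in>space M. V \<omega> = U \<omega> + k} = (\<Union>j. (U -` {j} \<inter> space M) \<inter> (V -` {j + k} \<inter> space M))" by auto
  then show ?thesis using measurable_sets[OF assms(1)] measurable_sets[OF assms(2)] by auto
qed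

definition poisson_weight :: "real \<Rightarrow> nat \<Rightarrow> real" where
  "poisson_weight b k = exp (- b) * b ^ k / fact k"

text \<open>Without null sets and right limits, as in the independence hypotheses; completion and
  right-continuity are brought in afterwards.\<close>

definition history :: "'a measure \<Rightarrow> (real \<Rightarrow> 'a \<Rightarrow> nat) \<Rightarrow> real \<Rightarrow> 'a set set" where
  "history Q U t = sigma_sets (space Q) (\<Union>s\<in>{0..t}. sets (sigma_rv Q (U s)))"

lemma history_sets:
  assumes "\<And>t. 0 \<le> t \<Longrightarrow> t \<le> u \<Longrightarrow> U t \<in> measurable Q (count_space UNIV)"
  shows "history Q U u \<subseteq> sets Q"
  unfolding history_def
proof (intro sets.sigma_sets_subset UN_least)
  fix s assume "s \<in> {0..u}"
  then show "sets (sigma_rv Q (U s)) \<subseteq> sets Q" using assms by (intro sigma_rv_subset) auto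
qed

lemma history_mono: "s \<le> t \<Longrightarrow> history Q U s \<subseteq> history Q U t"
  unfolding history_def by (intro sigma_sets_mono' UN_mono) auto

text \<open>Independence of increments is given along finite chains of times only. Once
  \<open>R\<close> is sorted, values on \<open>R\<close> amount to successive increments up to a
  null set, as the path starts at 0; appending \<open>v\<close> makes the increment after
  \<open>u\<close> one more member of the chain.\<close>

lemma (in prob_space) poisson_own_history_generator:
  assumes N: "poisson_process M T c N" and uv: "0 \<le> u" "u \<le> v" "v \<le> T"
    and R: "finite R" "0 \<in> R" "u \<in> R" "R \<subseteq> {0..u}"
  shows "prob ({\<omega>\<in>space M. \<forall>s\<in>R. N s \<omega> = f s} \<inter> {\<omega>\<in>space M. N v \<omega> = N u \<omega> + k}) =
    prob {\<omega>\<in>space M. \<forall>s\<in>R. N s \<omega> = f s} * poisson_weight (c * (v - u)) k"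
proof -
  let ?E = "{\<omega>\<in>space M. \<forall>s\<in>R. N s \<omega> = f s}" and ?D = "{\<omega>\<in>space M. N v \<omega> = N u \<omega> + k}"
  have meas: "N t \<in> measurable M (count_space UNIV)" if "0 \<le> t" "t \<le> T" for t
    using N that by (auto simp: poisson_process_def)
  have Em: "?E \<in> events"
  proof -
    have "{\<omega>\<in>space M. N s \<omega> = f s} \<in> events" if "s \<in> R" for s
      using measurable_sets[OF meas, of s "{f s}"] that R uv by (auto simp: vimage_def Int_def conj_commute)
    then show ?thesis using R by (intro sets.sets_Collect_finite_All) auto
  qed
  have Dm: "?D \<in> events" using meas uv by (intro increment_event) auto
  have D: "prob ?D = poisson_weight (c * (v - u)) k"
    using N uv by (auto simp: poisson_process_def poisson_weight_def)
  have N0: "AE \<omega> in M. N 0 \<omega> = 0" using N by (auto simp: poisson_process_def)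
  show ?thesis
  \<comment> \<open>A prescribed starting value other than 0 describes a null event.\<close>
  proof (cases "f 0 = 0")
    case False
    have "AE \<omega> in M. \<omega> \<in> ?E \<longleftrightarrow> \<omega> \<in> {}" using N0 by eventually_elim (use False R in \<open>auto intro!: bexI[of _ 0]\<close>)
    then have "prob ?E = prob {}" by (rule measure_eq_AE) (use Em in auto)
    moreover have "prob (?E \<inter> ?D) \<le> prob ?E" using Em Dm by (intro finite_measure_mono) auto
    ultimately show ?thesis by (simp add: measure_le_0_iff)
  next
    case f0: True
    define l where "l = sorted_list_of_set R"
    define n where "n = length l - 1"
    have l: "set l = R" "sorted l" "length l = Suc n"
      using R card_gt_0_iff[of R] unfolding n_def l_def by auto
    define r where "r i = (if i \<le> n then l ! i else v)" for i
    have rR: "r i \<in> R" if "i \<le> n" for i using that l unfolding r_def by (auto intro!: nth_mem simp flip: l(1))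
    have r0: "r 0 = 0"
    proof -
      obtain j where "j < length l" "l ! j = 0" using R(2) l(1) by (metis in_set_conv_nth)
      then have "l ! 0 \<le> 0" using l(2) by (metis le0 sorted_nth_mono)
      moreover have "l ! 0 \<in> R" using l by (auto simp flip: l(1))
      ultimately show ?thesis using R(4) unfolding r_def by force
    qed
    have rn: "r n = u"
    proof -
      obtain j where "j < length l" "l ! j = u" using R(3) l(1) by (metis in_set_conv_nth)
      then have "u \<le> l ! n" using l by (metis less_Suc_eq_le sorted_nth_mono lessI)
      moreover have "l ! n \<in> R" using l by (auto simp flip: l(1))
      ultimately show ?thesis using R(4) unfolding r_def by force
    qed
    have rS: "r (Suc n) = v" by (simp add: r_def)
    have mono: "\<forall>i<Suc n. r i \<le> r (Suc i)"
    proof (intro allI impI)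
      fix i assume "i < Suc n"
      then consider "i < n" | "i = n" by linarith
      then show "r i \<le> r (Suc i)"
        by cases (use rn rS uv l(2,3) in \<open>auto simp: r_def intro!: sorted_nth_mono\<close>)
    qed
    define Y where "Y i \<omega> = int (N (r (Suc i)) \<omega>) - int (N (r i) \<omega>)" for i \<omega>
    have ind: "indep_vars (\<lambda>_. count_space UNIV) Y {..<Suc n}"
      unfolding Y_def using N mono r0 rS uv unfolding poisson_process_def by auto
    \<comment> \<open>Integer targets, since the prescribed values need not increase along the
      sorted times. Index \<open>n\<close> belongs to the increment from \<open>u\<close> to
      \<open>v\<close>.\<close>
    define z where "z i = (if i < n then int (f (r (Suc i))) - int (f (r i)) else int k)" for i
    let ?A = "\<lambda>i. Y i -` {z i} \<inter> space M"
    have eq: "(\<forall>s\<in>R. N s \<omega> = f s) \<longleftrightarrow> (\<forall>i<n. Y i \<omega> = z i)" if "N 0 \<omega> = 0" for \<omega>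
    proof
      assume "\<forall>s\<in>R. N s \<omega> = f s"
      then show "\<forall>i<n. Y i \<omega> = z i" using rR by (auto simp: Y_def z_def)
    next
      assume h: "\<forall>i<n. Y i \<omega> = z i"
      have *: "i \<le> n \<Longrightarrow> N (r i) \<omega> = f (r i)" for i
      proof (induction i)
        case (Suc i) then show ?case using h[rule_format, of i] by (auto simp: Y_def z_def)
      qed (use that r0 f0 in auto)
      show "\<forall>s\<in>R. N s \<omega> = f s"
      proof
        fix s assume "s \<in> R"
        then obtain j where "j < Suc n" "s = l ! j" using l by (metis in_set_conv_nth)
        then show "N s \<omega> = f s" using *[of j] by (auto simp: r_def)
      qed
    qed
    have Dn: "?D = ?A n" by (auto simp: Y_def z_def rn rS)
    have Am: "?A i \<in> events" if "i \<le> n" for i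
      using ind that by (intro measurable_sets[of "Y i" M "count_space UNIV"]) (auto simp: indep_vars_def)
    have "prob (?E \<inter> ?D) = prob (\<Inter>i\<in>{..<Suc n}. ?A i)"
    proof (rule measure_eq_AE)
      show "AE \<omega> in M. \<omega> \<in> ?E \<inter> ?D \<longleftrightarrow> \<omega> \<in> (\<Inter>i\<in>{..<Suc n}. ?A i)"
        using N0 unfolding Dn by eventually_elim (auto simp: eq less_Suc_eq)
      show "(\<Inter>i\<in>{..<Suc n}. ?A i) \<in> events" using Am by (intro sets.finite_INT) auto
    qed (use Em Dm in auto)
    also have "\<dots> = (\<Prod>i\<in>{..<Suc n}. prob (?A i))" by (rule indep_varsD[OF ind]) auto
    also have "\<dots> = (\<Prod>i\<in>{..<n}. prob (?A i)) * prob ?D" unfolding Dn by simp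
    also have "(\<Prod>i\<in>{..<n}. prob (?A i)) = prob ?E"
    \<comment> \<open>\<open>n = 0\<close> means \<open>R = {0}\<close>: the event then has full
      measure, and the product rule is applied to nonempty index sets only.\<close>
    proof (cases "n = 0")
      case True
      have "prob ?E = prob (space M)"
        by (rule measure_eq_AE) (use N0 Em True eq in \<open>auto elim!: eventually_mono\<close>)
      then show ?thesis using True by (simp add: prob_space)
    next
      case False
      have "(\<Prod>i\<in>{..<n}. prob (?A i)) = prob (\<Inter>i\<in>{..<n}. ?A i)"
        using False by (intro indep_varsD[OF ind, symmetric]) auto
      also have "\<dots> = prob ?E"
      proof (rule measure_eq_AE)
        show "AE \<omega> in M. \<omega> \<in> (\<Inter>i\<in>{..<n}. ?A i) \<longleftrightarrow> \<omega> \<in> ?E"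
          using N0 AE_space by eventually_elim (use False in \<open>auto simp: eq\<close>)
        show "(\<Inter>i\<in>{..<n}. ?A i) \<in> events" using False Am by (intro sets.finite_INT) auto
      qed fact
      finally show ?thesis .
    qed
    finally show ?thesis using D by simp
  qed
qed

text \<open>Dynkin's argument: the sets satisfying the identity are closed under complements and
  disjoint countable unions and include the cylinders of the preceding lemma.\<close>

lemma (in prob_space) poisson_own_history:
  assumes N: "poisson_process M T c N" and c: "0 \<le> c" and uv: "0 \<le> u" "u \<le> v" "v \<le> T"
    and B: "B \<in> history M N u"
  shows "prob (B \<inter> {\<omega>\<in>space M. N v \<omega> = N u \<omega> + k}) = prob B * poisson_weight (c * (v - u)) k"
proof -
  let ?D = "{\<omega>\<in>space M. N v \<omega> = N u \<omega> + k}"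
  \<comment> \<open>The empty set gives stability under intersection, as two prescriptions may
    contradict each other. The times 0 and \<open>u\<close> are always included to fit the preceding
    lemma.\<close>
  define E where "E = insert {} {{\<omega>\<in>space M. \<forall>s\<in>R. N s \<omega> = f s} | R f. finite R \<and> 0 \<in> R \<and> u \<in> R \<and> R \<subseteq> {0..u}}"
  have meas: "N t \<in> measurable M (count_space UNIV)" if "0 \<le> t" "t \<le> T" for t
    using N that by (auto simp: poisson_process_def)
  have D: "?D \<in> events" using meas uv by (intro increment_event) auto
  have Esub: "E \<subseteq> events"
  proof -
    have "{\<omega>\<in>space M. \<forall>s\<in>R. N s \<omega> = f s} \<in> events" if "finite R" "R \<subseteq> {0..u}" for R f
    proof -
      have "{\<omega>\<in>space M. N s \<omega> = f s} \<in> events" if "s \<in> R" for s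
        using measurable_sets[OF meas, of s "{f s}"] that \<open>R \<subseteq> {0..u}\<close> uv
        by (auto simp: vimage_def Int_def conj_commute)
      then show ?thesis using that by (intro sets.sets_Collect_finite_All) auto
    qed
    then show ?thesis unfolding E_def by auto
  qed
  have IS: "Int_stable E"
  proof (rule Int_stableI)
    fix A B assume "A \<in> E" "B \<in> E"
    then consider "A = {} \<or> B = {}" | R f R' f' where
      "A = {\<omega>\<in>space M. \<forall>s\<in>R. N s \<omega> = f s}" "B = {\<omega>\<in>space M. \<forall>s\<in>R'. N s \<omega> = f' s}"
      "finite R" "0 \<in> R" "u \<in> R" "R \<subseteq> {0..u}" "finite R'" "R' \<subseteq> {0..u}"
      unfolding E_def by auto
    then show "A \<inter> B \<in> E"
    proof cases
      case 2
      show ?thesis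
      proof (cases "\<forall>s\<in>R \<inter> R'. f s = f' s")
        case True
        have "A \<inter> B = {\<omega>\<in>space M. \<forall>s\<in>R \<union> R'. N s \<omega> = (if s \<in> R then f s else f' s)}"
          unfolding 2 using True by auto
        then show ?thesis unfolding E_def using 2
          by (intro insertI2 CollectI exI[of _ "R \<union> R'"] exI[of _ "\<lambda>s. if s \<in> R then f s else f' s"]) auto
      next
        case False
        then have "A \<inter> B = {}" unfolding 2 by force
        then show ?thesis by (simp add: E_def)
      qed
    qed (auto simp: E_def)
  qed
  have gen: "history M N u \<subseteq> sigma_sets (space M) E"
    unfolding history_def
  proof (rule sigma_sets_mono, clarify)
    fix s A assume s: "s \<in> {0..u}" and A: "A \<in> sets (sigma_rv M (N s))"
    interpret SA: sigma_algebra "space M" "sigma_sets (space M) E"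
      using Esub sets.space_closed by (intro sigma_algebra_sigma_sets) blast
    obtain C where C: "A = N s -` C \<inter> space M" using A by (auto simp: sets_sigma_rv)
    \<comment> \<open>An event at one time is a countable union over the values at 0,
      \<open>u\<close> and \<open>s\<close>. Testing \<open>x = s\<close> first lets
      \<open>C\<close> decide when \<open>s\<close> coincides with 0 or \<open>u\<close>.\<close>
    have "A = (\<Union>(i, j, k)\<in>UNIV \<times> UNIV \<times> C. {\<omega>\<in>space M. \<forall>x\<in>{0, u, s}. N x \<omega> = (if x = s then k else if x = 0 then i else j)} )"
    proof (intro set_eqI iffI)
      fix \<omega> assume "\<omega> \<in> A"
      then show "\<omega> \<in> (\<Union>(i, j, k)\<in>UNIV \<times> UNIV \<times> C. {\<omega>\<in>space M. \<forall>x\<in>{0, u, s}. N x \<omega> = (if x = s then k else if x = 0 then i else j)} )"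
        unfolding C by (intro UN_I[of "(N 0 \<omega>, N u \<omega>, N s \<omega>)"]) auto
    qed (auto simp: C)
    also have "\<dots> \<in> sigma_sets (space M) E"
    proof (intro SA.countable_UN')
      show "(\<lambda>(i, j, k). {\<omega>\<in>space M. \<forall>x\<in>{0, u, s}. N x \<omega> = (if x = s then k else if x = 0 then i else j)}) ` (UNIV \<times> UNIV \<times> C)
        \<subseteq> sigma_sets (space M) E"
      proof (rule image_subsetI, clarify)
        fix i j k
        show "{\<omega>\<in>space M. \<forall>x\<in>{0, u, s}. N x \<omega> = (if x = s then k else if x = 0 then i else j)} \<in> sigma_sets (space M) E"
          unfolding E_def using s uv
          by (intro sigma_sets.Basic insertI2 CollectI exI[of _ "{0, u, s}"]
            exI[of _ "\<lambda>x. if x = s then k else if x = 0 then i else j"]) auto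
      qed
    qed auto
    finally show "A \<in> sigma_sets (space M) E" .
  qed
  have closed: "E \<subseteq> Pow (space M)" using Esub sets.space_closed by blast
  have "B \<in> sigma_sets (space M) E" using gen B by auto
  then show ?thesis
  proof (induction rule: sigma_sets_induct_disjoint[OF IS closed, consumes 1, case_names 2 3 4 5])
    case (2 A)
    then show ?case
      using poisson_own_history_generator[OF N uv] by (auto simp: E_def)
  next
    case 3 then show ?case by simp
  next
    case (4 A)
    have A: "A \<in> events" using 4(1) Esub sets.sigma_sets_subset by blast
    have pD: "prob ?D = poisson_weight (c * (v - u)) k"
      using N uv by (auto simp: poisson_process_def poisson_weight_def)
    have "(space M - A) \<inter> ?D = ?D - A \<inter> ?D" by auto
    then have "prob ((space M - A) \<inter> ?D) = prob ?D - prob (A \<inter> ?D)"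
      using A D by (simp add: finite_measure_Diff)
    then have "prob ((space M - A) \<inter> ?D) = poisson_weight (c * (v - u)) k - prob A * poisson_weight (c * (v - u)) k"
      by (simp only: pD 4)
    then show ?case using A by (simp only: prob_compl left_diff_distrib mult_1_left)
  next
    case (5 A)
    have A: "range A \<subseteq> events" using 5(2) Esub sets.sigma_sets_subset by blast
    have "(\<lambda>i. prob (A i \<inter> ?D)) sums prob (\<Union>i. A i \<inter> ?D)"
      using A D 5(1) by (intro finite_measure_UNION) (auto simp: disjoint_family_on_def)
    moreover have "(\<lambda>i. prob (A i) * poisson_weight (c * (v - u)) k) sums (prob (\<Union>i. A i) * poisson_weight (c * (v - u)) k)"
      using A 5(1) by (intro sums_mult2 finite_measure_UNION) auto
    moreover have "(\<Union>i. A i \<inter> ?D) = (\<Union>i. A i) \<inter> ?D" by auto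
    ultimately show ?case using 5(3) by (simp only: sums_unique2)
  qed
qed

section \<open>The driving noise\<close>

locale cmc_setup = prob_space Q for Q :: "'a measure" +
  fixes T :: real and d :: nat and S :: "nat set"
    and F G :: "real \<Rightarrow> 'a measure"
    and \<xi> :: "'a \<Rightarrow> nat" and \<mu> :: "nat \<Rightarrow> 'a \<Rightarrow> real"
    and a :: "nat \<Rightarrow> nat \<Rightarrow> real" and N :: "nat \<Rightarrow> nat \<Rightarrow> real \<Rightarrow> 'a \<Rightarrow> nat"
    and \<Lambda> :: "nat \<Rightarrow> nat \<Rightarrow> real \<Rightarrow> 'a \<Rightarrow> real"
    and X :: "real \<Rightarrow> 'a \<Rightarrow> nat"
  assumes T_pos: "T > 0"
    and S_def: "S = {1..d}"
    and complete: "complete_measure Q"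
    and F: "usual_conditions Q T F"
    and \<xi>: "\<xi> \<in> measurable Q (count_space UNIV)" "\<And>\<omega>. \<omega> \<in> space Q \<Longrightarrow> \<xi> \<omega> \<in> S"
    and N_poisson: "\<And>x y. x \<in> S \<Longrightarrow> y \<in> S \<Longrightarrow> x \<noteq> y \<Longrightarrow> poisson_process Q T (a x y) (N x y)"
    and N_indep: "independent_drivers Q T S N (join_alg (F T) (sigma_rv Q \<xi>))"
    and G_def: "G = driver_filtration Q T S N \<xi>"
    and canonical: "canonical_conditions Q T S F \<Lambda>"
    and \<mu>_measurable: "\<And>x. x \<in> S \<Longrightarrow> \<mu> x \<in> borel_measurable (F 0)"
    and \<mu>_range: "\<And>x \<omega>. x \<in> S \<Longrightarrow> \<omega> \<in> space Q \<Longrightarrow> \<mu> x \<omega> \<in> {0..1}"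
    and \<xi>_cond: "\<And>x. x \<in> S \<Longrightarrow> AE \<omega> in Q. cond_prob_alg Q (F T) (\<lambda>\<omega>. \<xi> \<omega> = x) \<omega> = \<mu> x \<omega>"
    and a_pos: "\<And>x y. x \<in> S \<Longrightarrow> y \<in> S \<Longrightarrow> x \<noteq> y \<Longrightarrow> a x y > 0"
    and X_SDE: "solves_SDE Q T S N \<xi> X"
begin

abbreviation "I \<equiv> off_diagonal S"
abbreviation "Np p \<equiv> N (fst p) (snd p)"
abbreviation "ap p \<equiv> a (fst p) (snd p)"
abbreviation "Lp p \<equiv> \<Lambda> (fst p) (snd p)"

text \<open>All of \<open>F T\<close> is known from the start, so beyond \<open>K 0\<close> only the
  Poisson noise is random. Identities tested on \<open>K s\<close> hold in particular on the smaller
  \<open>J s\<close>, the filtration of the theorem.\<close>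

definition "K t = join_alg (F T) (G t)"
definition "J t = join_alg (F t) (G t)"
definition "base = join_alg (F T) (sigma_rv Q \<xi>)"
text \<open>Everything but the part of driver \<open>p\<close> after \<open>u\<close>. The other
  drivers enter with their whole paths, which permits treating the drivers one at a time.\<close>

definition "past p u = sigma (space Q)
  (sets base \<union> (\<Union>q\<in>I - {p}. history Q (Np q) T) \<union> history Q (Np p) u)"
text \<open>In contrast to \<open>past p t\<close> this contains \<open>G t\<close>, hence what the
  right-continuous filtration reveals at \<open>t\<close> about driver \<open>p\<close>
  itself.\<close>

definition "others p t = sigma (space Q) (sets (K t) \<union> (\<Union>q\<in>I - {p}. history Q (Np q) T))"

lemma finite_I: "finite I"
proof (rule finite_subset[of I "S \<times> S"])
  show "finite (S \<times> S)" by (simp add: S_def)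
qed (auto simp: off_diagonal_def)

lemma I_D: "p \<in> I \<Longrightarrow> fst p \<in> S" "p \<in> I \<Longrightarrow> snd p \<in> S" "p \<in> I \<Longrightarrow> fst p \<noteq> snd p"
  by (auto simp: off_diagonal_def)

lemma poisson: "p \<in> I \<Longrightarrow> poisson_process Q T (ap p) (Np p)"
  using N_poisson I_D by auto

lemma ap_pos: "p \<in> I \<Longrightarrow> 0 < ap p"
  using a_pos I_D by auto

lemma poisson_prob:
  assumes "p \<in> I" "0 \<le> u" "u \<le> v" "v \<le> T"
  shows "prob {\<omega>\<in>space Q. Np p v \<omega> = Np p u \<omega> + k} = poisson_weight (ap p * (v - u)) k"
  using poisson[OF assms(1)] assms by (simp add: poisson_process_def poisson_weight_def)

lemma F_sub: "0 \<le> t \<Longrightarrow> t \<le> T \<Longrightarrow> subalgebra Q (F t)"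
  "0 \<le> t \<Longrightarrow> t \<le> T \<Longrightarrow> null_sets Q \<subseteq> sets (F t)"
  using F by (auto simp: usual_conditions_def)

lemma space_F [simp]: "0 \<le> t \<Longrightarrow> t \<le> T \<Longrightarrow> space (F t) = space Q"
  using F_sub(1) by (simp add: subalgebra_def)

lemma space_FT [simp]: "space (F T) = space Q" using T_pos by simp

lemma F_mono: "0 \<le> s \<Longrightarrow> s \<le> t \<Longrightarrow> t \<le> T \<Longrightarrow> sets (F s) \<subseteq> sets (F t)"
  using F by (auto simp: usual_conditions_def)

lemma Np_meas: "p \<in> I \<Longrightarrow> 0 \<le> t \<Longrightarrow> t \<le> T \<Longrightarrow> Np p t \<in> measurable Q (count_space UNIV)"
  using poisson by (auto simp: poisson_process_def)

lemma history_events: "p \<in> I \<Longrightarrow> u \<le> T \<Longrightarrow> history Q (Np p) u \<subseteq> events"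
  by (rule history_sets) (auto intro: Np_meas)

lemma space_sigma_rv [simp]: "space (sigma_rv M Z) = space M"
  by (simp add: sigma_rv_def)

lemma space_base [simp]: "space base = space Q" by (simp add: base_def)

lemma base_sub: "sets base \<subseteq> events"
  unfolding base_def using F_sub(1)[of T] T_pos \<xi>(1)
  by (intro join_alg_least sigma_rv_subset) (auto simp: subalgebra_def)

lemma FT_base: "sets (F T) \<subseteq> sets base"
  unfolding base_def by (intro join_alg_upper) simp

lemma \<xi>_base: "sets (sigma_rv Q \<xi>) \<subseteq> sets base"
  unfolding base_def by (intro join_alg_upper) simp

lemma sets_sigmaQ: "A \<subseteq> events \<Longrightarrow> sets (sigma (space Q) A) = sigma_sets (space Q) A"
  using sets.space_closed[of Q] by (simp add: sets_measure_of)

lemma past_gen: "p \<in> I \<Longrightarrow> u \<le> T \<Longrightarrow>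
  sets base \<union> (\<Union>q\<in>I - {p}. history Q (Np q) T) \<union> history Q (Np p) u \<subseteq> events"
  by (intro Un_least UN_least base_sub history_events) auto

lemma space_past [simp]: "space (past p u) = space Q"
  by (simp add: past_def space_measure_of_conv)

lemma past_events: "p \<in> I \<Longrightarrow> u \<le> T \<Longrightarrow> sets (past p u) \<subseteq> events"
  unfolding past_def by (subst sets_sigmaQ[OF past_gen]; (intro sets.sigma_sets_subset past_gen)?)

lemma past_upper:
  assumes "p \<in> I" "u \<le> T"
  shows "sets base \<subseteq> sets (past p u)" "q \<in> I - {p} \<Longrightarrow> history Q (Np q) T \<subseteq> sets (past p u)"
    "history Q (Np p) u \<subseteq> sets (past p u)"
  unfolding past_def using past_gen[OF assms] by (auto simp: sets_sigmaQ intro!: sigma_sets.Basic)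

lemma indep_histories: "indep_sets (\<lambda>p. history Q (Np p) T) I"
  and indep_base: "indep_set (sets base) (sigma_sets (space Q) (\<Union>p\<in>I. history Q (Np p) T))"
  using N_indep unfolding independent_drivers_def Let_def base_def history_def case_prod_beta by auto

lemma history_sigma_algebra: "sigma_algebra (space Q) (history Q U u)"
  unfolding history_def
proof (rule sigma_algebra_sigma_sets)
  show "(\<Union>s\<in>{0..u}. sets (sigma_rv Q (U s))) \<subseteq> Pow (space Q)"
    using sets.space_closed[of "sigma_rv Q (U _)"] by auto
qed

text \<open>On a generator of intersections, mutual independence of the drivers and their
  independence of \<open>base\<close> give a product formula. Adding the increment event alters only
  the factor of driver \<open>p\<close>, where independence of its own history applies.\<close>

lemma increment_indep_past:
  assumes p: "p \<in> I" and uv: "0 \<le> u" "u \<le> v" "v \<le> T" and C: "C \<in> sets (past p u)"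
  shows "prob (C \<inter> {\<omega>\<in>space Q. Np p v \<omega> = Np p u \<omega> + k}) = prob C * poisson_weight (ap p * (v - u)) k"
proof -
  let ?D = "{\<omega>\<in>space Q. Np p v \<omega> = Np p u \<omega> + k}" and ?w = "poisson_weight (ap p * (v - u)) k"
  define E where "E = {A \<inter> (\<Inter>q\<in>I. B q) | A B. A \<in> sets base \<and> B p \<in> history Q (Np p) u \<and>
    (\<forall>q\<in>I - {p}. B q \<in> history Q (Np q) T)}"
  have uT: "u \<le> T" using uv by auto
  have D: "?D \<in> events" using uv p by (intro increment_event Np_meas) auto
  have DH: "?D \<in> history Q (Np p) T"
  proof -
    have m: "Np p t \<in> measurable (sigma (space Q) (\<Union>s\<in>{0..T}. sets (sigma_rv Q (Np p s)))) (count_space UNIV)"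
      if "0 \<le> t" "t \<le> T" for t
    proof (rule sigma_rv_measurable[of _ Q])
      have "(\<Union>s\<in>{0..T}. sets (sigma_rv Q (Np p s))) \<subseteq> Pow (space Q)"
        using sets.space_closed[of "sigma_rv Q (Np p _)"] by auto
      then show "sets (sigma_rv Q (Np p t)) \<subseteq> sets (sigma (space Q) (\<Union>s\<in>{0..T}. sets (sigma_rv Q (Np p s))))"
        using that by (auto simp: sets_measure_of intro!: sigma_sets.Basic)
    qed (simp add: space_measure_of_conv)
    have "(\<Union>s\<in>{0..T}. sets (sigma_rv Q (Np p s))) \<subseteq> Pow (space Q)"
      using sets.space_closed[of "sigma_rv Q (Np p _)"] by auto
    then show ?thesis
      using increment_event[OF m m, of u v k] uv
      by (simp add: history_def space_measure_of_conv sets_measure_of)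
  qed
  have full: "history Q (Np q) u \<subseteq> history Q (Np q) T" for q by (rule history_mono[OF uT])
  have Hint: "A \<inter> B \<in> history Q U t" if "A \<in> history Q U t" "B \<in> history Q U t" for A B U t
  proof -
    interpret sigma_algebra "space Q" "history Q U t" by (rule history_sigma_algebra)
    show ?thesis using that by blast
  qed
  have Htop: "space Q \<in> history Q U t" for U t unfolding history_def by (rule sigma_sets_top)
  have IS: "Int_stable E"
  proof (rule Int_stableI)
    fix A1 A2 assume "A1 \<in> E" "A2 \<in> E"
    then obtain C1 B1 C2 B2 where h: "A1 = C1 \<inter> (\<Inter>q\<in>I. B1 q)" "A2 = C2 \<inter> (\<Inter>q\<in>I. B2 q)"
      "C1 \<in> sets base" "B1 p \<in> history Q (Np p) u" "\<forall>q\<in>I - {p}. B1 q \<in> history Q (Np q) T"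
      "C2 \<in> sets base" "B2 p \<in> history Q (Np p) u" "\<forall>q\<in>I - {p}. B2 q \<in> history Q (Np q) T"
      unfolding E_def by blast
    have "A1 \<inter> A2 = (C1 \<inter> C2) \<inter> (\<Inter>q\<in>I. B1 q \<inter> B2 q)" using h by auto
    then show "A1 \<inter> A2 \<in> E" unfolding E_def using h Hint
      by (intro CollectI exI[of _ "C1 \<inter> C2"] exI[of _ "\<lambda>q. B1 q \<inter> B2 q"]) auto
  qed
  have Int_full: "(\<Inter>q\<in>I. B q) \<in> sigma_sets (space Q) (\<Union>p\<in>I. history Q (Np p) T)"
    if "\<And>q. q \<in> I \<Longrightarrow> B q \<in> history Q (Np q) T" for B
  proof -
    have "(\<Union>p\<in>I. history Q (Np p) T) \<subseteq> Pow (space Q)"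
      using history_events[OF _ order_refl] sets.space_closed[of Q] by blast
    then interpret sigma_algebra "space Q" "sigma_sets (space Q) (\<Union>p\<in>I. history Q (Np p) T)"
      by (rule sigma_algebra_sigma_sets)
    show ?thesis using that p finite_I by (intro finite_INT) auto
  qed
  have prod: "prob (A \<inter> (\<Inter>q\<in>I. B q)) = prob A * (\<Prod>q\<in>I. prob (B q))"
    if "A \<in> sets base" "\<And>q. q \<in> I \<Longrightarrow> B q \<in> history Q (Np q) T" for A B
  proof -
    have "prob (A \<inter> (\<Inter>q\<in>I. B q)) = prob A * prob (\<Inter>q\<in>I. B q)"
      using that by (intro indep_setD[OF indep_base] Int_full) auto
    also have "prob (\<Inter>q\<in>I. B q) = (\<Prod>q\<in>I. prob (B q))"
      using that p finite_I by (intro indep_setsD[OF indep_histories]) auto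
    finally show ?thesis .
  qed
  have Bin: "B q \<in> history Q (Np q) T"
    if "B p \<in> history Q (Np p) u" "\<forall>q\<in>I - {p}. B q \<in> history Q (Np q) T" "q \<in> I" for B q
    using that subsetD[OF full[of p]] by (cases "q = p") auto
  have Eev: "E \<subseteq> events"
  proof
    fix A assume "A \<in> E"
    then obtain C B where h: "A = C \<inter> (\<Inter>q\<in>I. B q)" "C \<in> sets base" "B p \<in> history Q (Np p) u"
      "\<forall>q\<in>I - {p}. B q \<in> history Q (Np q) T" unfolding E_def by blast
    have "(\<Inter>q\<in>I. B q) \<in> events"
    proof (rule sets.finite_INT[OF finite_I])
      show "I \<noteq> {}" using p by auto
      show "B q \<in> events" if "q \<in> I" for q using Bin[OF h(3,4) that] history_events[OF that order_refl] by auto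
    qed
    then show "A \<in> events" using h base_sub by auto
  qed
  have key: "prob (A \<inter> ?D) = prob A * ?w" if AE: "A \<in> E" for A
  proof -
    obtain C B where h: "A = C \<inter> (\<Inter>q\<in>I. B q)" "C \<in> sets base" "B p \<in> history Q (Np p) u"
      "\<forall>q\<in>I - {p}. B q \<in> history Q (Np q) T" using AE unfolding E_def by blast
    define B' where "B' = B(p := B p \<inter> ?D)"
    have "A \<inter> ?D = C \<inter> (\<Inter>q\<in>I. B' q)" using h p unfolding B'_def by (auto split: if_splits)
    also have "prob \<dots> = prob C * (\<Prod>q\<in>I. prob (B' q))"
    proof (rule prod[OF h(2)])
      have "B p \<inter> ?D \<in> history Q (Np p) T" using Hint[OF subsetD[OF full h(3)] DH] .
      then show "B' q \<in> history Q (Np q) T" if "q \<in> I" for q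
        using h(4) that unfolding B'_def by auto
    qed
    also have "(\<Prod>q\<in>I. prob (B' q)) = prob (B p \<inter> ?D) * (\<Prod>q\<in>I - {p}. prob (B q))"
      using p finite_I by (subst prod.remove[of I p]) (auto simp: B'_def intro!: prod.cong)
    also have "prob (B p \<inter> ?D) = prob (B p) * ?w"
      using poisson[OF p] ap_pos[OF p] uv h by (intro poisson_own_history) auto
    also have "prob C * (prob (B p) * ?w * (\<Prod>q\<in>I - {p}. prob (B q))) = prob C * (\<Prod>q\<in>I. prob (B q)) * ?w"
      using p finite_I by (simp add: prod.remove[of I p])
    also have "prob C * (\<Prod>q\<in>I. prob (B q)) = prob A" unfolding h(1)
      using h Bin by (intro prod[symmetric]) auto
    finally show ?thesis .
  qed
  have spE: "space Q \<in> E"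
    unfolding E_def using p Htop sets.top[of base]
    by (intro CollectI exI[of _ "space Q"] exI[of _ "\<lambda>_. space Q"]) auto
  have gen: "sets (past p u) = sigma_sets (space Q) E"
  proof (rule antisym)
    show "sets (past p u) \<subseteq> sigma_sets (space Q) E"
      unfolding past_def sets_sigmaQ[OF past_gen[OF p uT]]
    proof (rule sigma_sets_mono, rule subsetI)
      fix A assume A: "A \<in> sets base \<union> (\<Union>q\<in>I - {p}. history Q (Np q) T) \<union> history Q (Np p) u"
      then have "A \<in> events" using past_gen[OF p uT] by blast
      then have AQ: "A \<subseteq> space Q" by (rule sets.sets_into_space)
      have "\<exists>q\<in>I. A \<in> history Q (Np q) (if q = p then u else T)" if "A \<notin> sets base"
        using A that p by (cases "A \<in> history Q (Np p) u") auto
      then consider "A \<in> sets base" | q where "q \<in> I" "A \<in> history Q (Np q) (if q = p then u else T)" by blast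
      then have "A \<in> E"
      proof cases
        case 1
        then show ?thesis unfolding E_def using Htop p AQ
          by (intro CollectI exI[of _ A] exI[of _ "\<lambda>_. space Q"]) auto
      next
        case 2
        have "A = space Q \<inter> (\<Inter>r\<in>I. if r = q then A else space Q)" using 2 AQ by auto
        then show ?thesis unfolding E_def using Htop 2 sets.top[of base]
          by (intro CollectI exI[of _ "space Q"] exI[of _ "\<lambda>r. if r = q then A else space Q"]) auto
      qed
      then show "A \<in> sigma_sets (space Q) E" ..
    qed
    show "sigma_sets (space Q) E \<subseteq> sets (past p u)"
    proof -
      have "E \<subseteq> sets (past p u)"
      proof
        fix A assume "A \<in> E"
        then obtain C B where h: "A = C \<inter> (\<Inter>q\<in>I. B q)" "C \<in> sets base" "B p \<in> history Q (Np p) u"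
          "\<forall>q\<in>I - {p}. B q \<in> history Q (Np q) T" unfolding E_def by blast
        have "(\<Inter>q\<in>I. B q) \<in> sets (past p u)"
        proof (rule sets.finite_INT[OF finite_I])
          show "I \<noteq> {}" using p by auto
          show "B q \<in> sets (past p u)" if "q \<in> I" for q
            using h that past_upper(2)[OF p uT, of q] past_upper(3)[OF p uT] by (cases "q = p") auto
        qed
        then show "A \<in> sets (past p u)" using h past_upper(1)[OF p uT] by auto
      qed
      then show ?thesis using sets.sigma_sets_subset[of E "past p u"] by simp
    qed
  qed
  have w: "0 \<le> ?w" using ap_pos[OF p] uv by (simp add: poisson_weight_def)
  have CQ: "C \<in> events" using C past_events[OF p uT] by auto
  have ind: "indicator C \<in> borel_measurable (past p u)" using C by simp
  have "(\<integral>\<^sup>+\<omega>. indicator C \<omega> * indicator ?D \<omega> \<partial>Q) = (\<integral>\<^sup>+\<omega>. indicator C \<omega> \<partial>Q) * ennreal ?w"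
    by (rule indep_event_on_generator[of "past p u" E]) (use gen IS Eev D key w ind spE in auto)
  then have "ennreal (prob (C \<inter> ?D)) = ennreal (prob C * ?w)"
    using CQ D w by (simp add: emeasure_eq_measure ennreal_mult flip: indicator_inter_arith)
  then show ?thesis using w by simp
qed

lemma expect_ind: "A \<in> events \<Longrightarrow> (\<integral>\<omega>. indicator A \<omega> \<partial>Q) = prob A"
  by (simp add: Int_absorb2 sets.sets_into_space)

text \<open>A right-continuous \<sigma>-algebra at \<open>u\<close> need not lie in
  \<open>past p u\<close>, but it lies in \<open>past p w\<close> for each later \<open>w\<close>.
  Independence of the increments from \<open>w\<close> is carried to \<open>u\<close> by
  right-continuity of the path and continuity of the Poisson weights.\<close>

lemma increment_indep_right_limit:
  assumes p: "p \<in> I" and uv: "0 \<le> u" "u < v" "v \<le> T"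
    and C: "\<And>w. u < w \<Longrightarrow> w \<le> v \<Longrightarrow> C \<in> sets (past p w)"
  shows "prob (C \<inter> {\<omega>\<in>space Q. Np p v \<omega> = Np p u \<omega> + k}) = prob C * poisson_weight (ap p * (v - u)) k"
proof -
  define w where "w j = u + (v - u) / real (Suc j)" for j
  have w: "u < w j" "w j \<le> v" for j
  proof -
    have "(v - u) / real (Suc j) \<le> (v - u) / 1" using uv by (intro divide_left_mono) auto
    then show "w j \<le> v" by (simp add: w_def)
    show "u < w j" using uv by (simp add: w_def)
  qed
  have wl: "w \<longlonglongrightarrow> u"
    using tendsto_add[OF tendsto_const LIMSEQ_Suc[OF lim_const_over_n[of "v - u"]], of u] unfolding w_def by simp
  let ?D = "\<lambda>u. {\<omega>\<in>space Q. Np p v \<omega> = Np p u \<omega> + k}"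
  have D: "?D u \<in> events" if "0 \<le> u" "u \<le> v" for u using uv p that by (intro increment_event Np_meas) auto
  have CQ: "C \<in> events" using C[of v] past_events[OF p, of v] uv by auto
  have "(\<lambda>j. \<integral>\<omega>. indicator (C \<inter> ?D (w j)) \<omega> \<partial>Q) \<longlonglongrightarrow> (\<integral>\<omega>. indicator (C \<inter> ?D u) \<omega> \<partial>Q :: real)"
  proof (rule integral_dominated_convergence[where w = "\<lambda>_. 1"])
    have "AE \<omega> in Q. cadlag T (\<lambda>t. Np p t \<omega>)" using poisson[OF p] by (simp add: poisson_process_def)
    then show "AE \<omega> in Q. (\<lambda>j. indicator (C \<inter> ?D (w j)) \<omega> :: real) \<longlonglongrightarrow> indicator (C \<inter> ?D u) \<omega>"
    proof eventually_elim
      case (elim \<omega>)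
      have "u \<le> T" using uv by simp
      from cadlag_right_const[OF elim uv(1) this]
      obtain e where e: "e > 0" "\<And>s. s \<le> T \<Longrightarrow> u \<le> s \<Longrightarrow> s < u + e \<Longrightarrow> Np p s \<omega> = Np p u \<omega>"
        by blast
      have "\<forall>\<^sub>F j in sequentially. w j < u + e" using wl e(1) by (intro order_tendstoD) auto
      then have "\<forall>\<^sub>F j in sequentially. indicator (C \<inter> ?D (w j)) \<omega> = (indicator (C \<inter> ?D u) \<omega> :: real)"
      proof eventually_elim
        case (elim j)
        have "Np p (w j) \<omega> = Np p u \<omega>" by (rule e(2)) (use w[of j] uv elim in auto)
        then show ?case by (simp add: indicator_def)
      qed
      then show ?case by (rule tendsto_eventually)
    qed
    show "(\<lambda>\<omega>. indicator (C \<inter> ?D (w j)) \<omega> :: real) \<in> borel_measurable Q" for j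
      using CQ D[of "w j"] w[of j] uv by (intro borel_measurable_indicator) auto
    show "(\<lambda>\<omega>. indicator (C \<inter> ?D u) \<omega> :: real) \<in> borel_measurable Q"
      using CQ D[of u] uv by (intro borel_measurable_indicator) auto
  qed (auto simp: indicator_def)
  moreover have "(\<integral>\<omega>. indicator (C \<inter> ?D (w j)) \<omega> \<partial>Q) = prob C * poisson_weight (ap p * (v - w j)) k" for j
  proof -
    have "C \<inter> ?D (w j) \<in> events" using CQ D[of "w j"] w[of j] uv by auto
    then have "(\<integral>\<omega>. indicator (C \<inter> ?D (w j)) \<omega> \<partial>Q) = prob (C \<inter> ?D (w j))" by (rule expect_ind)
    also have "\<dots> = prob C * poisson_weight (ap p * (v - w j)) k"
      using w[of j] uv C[of "w j"] by (intro increment_indep_past[OF p]) auto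
    finally show ?thesis .
  qed
  moreover have "(\<lambda>j. prob C * poisson_weight (ap p * (v - w j)) k) \<longlonglongrightarrow> prob C * poisson_weight (ap p * (v - u)) k"
    unfolding poisson_weight_def by (intro tendsto_intros wl) auto
  moreover have "(\<integral>\<omega>. indicator (C \<inter> ?D u) \<omega> \<partial>Q) = prob (C \<inter> ?D u)"
    using CQ D[of u] uv by (intro expect_ind) auto
  ultimately show ?thesis by (simp add: LIMSEQ_unique)
qed

section \<open>The filtrations\<close>

lemma space_G [simp]: "space (G t) = space Q"
  by (simp add: G_def driver_filtration_def space_measure_of_conv)

lemma space_K [simp]: "space (K t) = space Q" by (simp add: K_def)
lemma space_J [simp]: "0 \<le> t \<Longrightarrow> t \<le> T \<Longrightarrow> space (J t) = space Q" by (simp add: J_def)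

lemma sets_completed_history:
  "sets (completed_history Q U u) = sigma_sets (space Q) ((\<Union>s\<in>{0..u}. sets (sigma_rv Q (U s))) \<union> null_sets Q)"
proof -
  have "(\<Union>s\<in>{0..u}. sets (sigma_rv Q (U s))) \<union> null_sets Q \<subseteq> Pow (space Q)"
    using sets.space_closed[of "sigma_rv Q (U _)"] sets.space_closed[of Q] by auto
  then show ?thesis unfolding completed_history_def by (simp add: sets_measure_of)
qed

lemma space_completed_history [simp]: "space (completed_history Q U u) = space Q"
  by (simp add: completed_history_def space_measure_of_conv)

lemma sets_natural_filtration:
  "sets (natural_filtration Q T U t) = (\<Inter>u\<in>insert T {t<..T}. sets (completed_history Q U u))"
proof -
  let ?A = "\<Inter>u\<in>insert T {t<..T}. sets (completed_history Q U u)"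
  have "?A \<subseteq> Pow (space Q)" using sets.space_closed[of "completed_history Q U T"] by auto
  then have "sets (natural_filtration Q T U t) = sigma_sets (space Q) ?A"
    unfolding natural_filtration_def by (simp add: sets_measure_of)
  also have "\<dots> = ?A"
  proof (rule antisym)
    show "sigma_sets (space Q) ?A \<subseteq> ?A"
    proof (rule INT_greatest)
      fix u assume "u \<in> insert T {t<..T}"
      then have "?A \<subseteq> sets (completed_history Q U u)" by blast
      then show "sigma_sets (space Q) ?A \<subseteq> sets (completed_history Q U u)"
        using sets.sigma_sets_subset[of ?A "completed_history Q U u"] by simp
    qed
  qed (auto intro: sigma_sets.Basic)
  finally show ?thesis .
qed

lemma history_natural: "t \<le> T \<Longrightarrow> history Q U t \<subseteq> sets (natural_filtration Q T U t)"
  unfolding sets_natural_filtration sets_completed_history history_def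
  by (intro INT_greatest sigma_sets_mono') auto

lemma sets_G:
  "sets (G t) = sigma_sets (space Q) ((\<Union>p\<in>I. sets (natural_filtration Q T (Np p) t)) \<union> sets (sigma_rv Q \<xi>) \<union> null_sets Q)"
proof -
  have "(\<Union>p\<in>I. sets (natural_filtration Q T (Np p) t)) \<union> sets (sigma_rv Q \<xi>) \<union> null_sets Q \<subseteq> Pow (space Q)"
    using sets.space_closed[of "natural_filtration Q T (Np _) t"] sets.space_closed[of "sigma_rv Q \<xi>"]
      sets.space_closed[of Q]
    by (auto simp: natural_filtration_def space_measure_of_conv)
  then show ?thesis unfolding G_def driver_filtration_def case_prod_beta by (simp add: sets_measure_of)
qed

lemma G_upper:
  shows history_G: "p \<in> I \<Longrightarrow> t \<le> T \<Longrightarrow> history Q (Np p) t \<subseteq> sets (G t)"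
    and \<xi>_G: "sets (sigma_rv Q \<xi>) \<subseteq> sets (G t)"
    and null_G: "null_sets Q \<subseteq> sets (G t)"
  using history_natural[of t "Np p"] unfolding sets_G by (auto intro!: sigma_sets.Basic)

lemma G_mono: "s \<le> t \<Longrightarrow> sets (G s) \<subseteq> sets (G t)"
  unfolding sets_G sets_natural_filtration by (intro sigma_sets_mono' Un_mono UN_mono INT_anti_mono) auto

text \<open>The right-continuous filtration is an intersection over later times, so a single index
  \<open>w\<close> bounds it from above.\<close>

lemma G_least:
  assumes W: "space W = space Q" "null_sets Q \<subseteq> sets W" "sets (sigma_rv Q \<xi>) \<subseteq> sets W"
    and w: "w \<in> insert T {t<..T}" and h: "\<And>q. q \<in> I \<Longrightarrow> history Q (Np q) w \<subseteq> sets W"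
  shows "sets (G t) \<subseteq> sets W"
proof -
  have "sets (natural_filtration Q T (Np q) t) \<subseteq> sets W" if "q \<in> I" for q
  proof -
    have "(\<Union>s\<in>{0..w}. sets (sigma_rv Q (Np q s))) \<union> null_sets Q \<subseteq> sets W"
      using h[OF that] W unfolding history_def by (auto intro: sigma_sets.Basic)
    then have "sets (completed_history Q (Np q) w) \<subseteq> sets W"
      using sets.sigma_sets_subset[of "(\<Union>s\<in>{0..w}. sets (sigma_rv Q (Np q s))) \<union> null_sets Q" W] W(1)
      unfolding sets_completed_history by simp
    then show ?thesis using w unfolding sets_natural_filtration by blast
  qed
  then have "(\<Union>p\<in>I. sets (natural_filtration Q T (Np p) t)) \<union> sets (sigma_rv Q \<xi>) \<union> null_sets Q \<subseteq> sets W"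
    using W by blast
  from sets.sigma_sets_subset[OF this] show ?thesis using W(1) by (simp add: sets_G)
qed

lemma G_events: "sets (G t) \<subseteq> events"
  by (rule G_least[of Q T]) (use history_events sigma_rv_subset[OF \<xi>(1)] in auto)

lemma K_upper: "sets (F T) \<subseteq> sets (K t)" "sets (G t) \<subseteq> sets (K t)"
  unfolding K_def by (simp_all add: join_alg_upper)

lemma J_upper: "0 \<le> t \<Longrightarrow> t \<le> T \<Longrightarrow> sets (F t) \<subseteq> sets (J t)" "0 \<le> t \<Longrightarrow> t \<le> T \<Longrightarrow> sets (G t) \<subseteq> sets (J t)"
  unfolding J_def by (simp_all add: join_alg_upper)

lemma K_mono: "s \<le> t \<Longrightarrow> sets (K s) \<subseteq> sets (K t)"
  unfolding K_def[of s] by (intro join_alg_least K_upper order_trans[OF G_mono K_upper(2)]) auto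

lemma J_K: "0 \<le> t \<Longrightarrow> t \<le> T \<Longrightarrow> sets (J t) \<subseteq> sets (K t)"
  unfolding J_def by (intro join_alg_least K_upper order_trans[OF F_mono K_upper(1)]) auto

lemma J_mono: "0 \<le> s \<Longrightarrow> s \<le> t \<Longrightarrow> t \<le> T \<Longrightarrow> sets (J s) \<subseteq> sets (J t)"
  unfolding J_def[of s]
  by (intro join_alg_least order_trans[OF F_mono J_upper(1)] order_trans[OF G_mono J_upper(2)]) auto

lemma K_events: "sets (K t) \<subseteq> events"
  using F_sub(1)[of T] T_pos G_events unfolding K_def by (intro join_alg_least) (auto simp: subalgebra_def)

lemma K_sub: "subalgebra Q (K t)" using K_events by (simp add: subalgebra_def)

lemma J_sub: "0 \<le> t \<Longrightarrow> t \<le> T \<Longrightarrow> subalgebra Q (J t)"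
  using K_events J_K by (auto simp: subalgebra_def)

lemma null_J: "0 \<le> t \<Longrightarrow> t \<le> T \<Longrightarrow> null_sets Q \<subseteq> sets (J t)"
  using null_G[of t] J_upper(2)[of t] by auto

lemma null_K: "null_sets Q \<subseteq> sets (K t)"
  using null_G[of t] K_upper(2)[of t] by auto

lemma Np_history: "0 \<le> s \<Longrightarrow> s \<le> t \<Longrightarrow> space W = space Q \<Longrightarrow> history Q U t \<subseteq> sets W \<Longrightarrow> U s \<in> measurable W (count_space UNIV)"
proof (rule sigma_rv_measurable[of _ Q])
  assume h: "0 \<le> s" "s \<le> t" "history Q U t \<subseteq> sets W"
  have "sets (sigma_rv Q (U s)) \<subseteq> history Q U t"
    unfolding history_def using h by (auto intro!: sigma_sets.Basic)
  then show "sets (sigma_rv Q (U s)) \<subseteq> sets W" using h by blast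
qed

lemma Np_G: "p \<in> I \<Longrightarrow> 0 \<le> s \<Longrightarrow> s \<le> t \<Longrightarrow> t \<le> T \<Longrightarrow> Np p s \<in> measurable (G t) (count_space UNIV)"
  by (rule Np_history[OF _ _ _ history_G]) auto

lemma \<xi>_G_meas: "\<xi> \<in> measurable (G t) (count_space UNIV)"
  by (rule sigma_rv_measurable[of _ Q]) (auto simp: \<xi>_G[THEN subsetD])

lemma K_past:
  assumes p: "p \<in> I" and t: "t < w" "w \<le> T"
  shows "sets (K t) \<subseteq> sets (past p w)"
proof -
  note up = past_upper[OF p t(2)]
  have "sets (G t) \<subseteq> sets (past p w)"
  proof (rule G_least[of _ w])
    show "null_sets Q \<subseteq> sets (past p w)" using F_sub(2)[of T] T_pos FT_base up(1) by auto
    show "sets (sigma_rv Q \<xi>) \<subseteq> sets (past p w)" using \<xi>_base up(1) by auto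
    show "history Q (Np q) w \<subseteq> sets (past p w)" if "q \<in> I" for q
      using up(2)[of q] up(3) that history_mono[OF t(2), of Q "Np q"] by (cases "q = p") auto
  qed (use t in auto)
  then show ?thesis using FT_base up(1) unfolding K_def by (intro join_alg_least) auto
qed

lemma space_others [simp]: "space (others p t) = space Q"
  by (simp add: others_def space_measure_of_conv)

lemma others_gen: "sets (K t) \<union> (\<Union>q\<in>I - {p}. history Q (Np q) T) \<subseteq> events"
  by (intro Un_least UN_least K_events history_events) auto

lemma others_upper: "sets (K t) \<subseteq> sets (others p t)" "q \<in> I - {p} \<Longrightarrow> history Q (Np q) T \<subseteq> sets (others p t)"
  unfolding others_def using others_gen[of t p] by (auto simp: sets_sigmaQ intro!: sigma_sets.Basic)

lemma others_past:
  assumes p: "p \<in> I" and t: "t < w" "w \<le> T"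
  shows "sets (others p t) \<subseteq> sets (past p w)"
proof -
  have "sets (K t) \<union> (\<Union>q\<in>I - {p}. history Q (Np q) T) \<subseteq> sets (past p w)"
    using past_upper(2)[OF p t(2)] K_past[OF p t] by auto
  then show ?thesis
    using sets.sigma_sets_subset[of "sets (K t) \<union> (\<Union>q\<in>I - {p}. history Q (Np q) T)" "past p w"]
    unfolding others_def by (simp add: sets_sigmaQ[OF others_gen])
qed

lemma others_events: "sets (others p t) \<subseteq> events"
  unfolding others_def by (subst sets_sigmaQ[OF others_gen]) (intro sets.sigma_sets_subset others_gen)

lemma increment_indep_others:
  assumes p: "p \<in> I" and uv: "0 \<le> u" "u \<le> v" "v \<le> T" and V: "V \<in> borel_measurable (others p u)"
  shows "(\<integral>\<^sup>+\<omega>. V \<omega> * indicator {\<omega>\<in>space Q. Np p v \<omega> = Np p u \<omega> + k} \<omega> \<partial>Q) =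
    (\<integral>\<^sup>+\<omega>. V \<omega> \<partial>Q) * ennreal (poisson_weight (ap p * (v - u)) k)"
proof (rule indep_event_on_generator[of "others p u" "sets (others p u)"])
  show "sets (others p u) = sigma_sets (space Q) (sets (others p u))"
    using sets.sigma_sets_eq[of "others p u"] by simp
  show "Int_stable (sets (others p u))" by (rule sets.Int_stable)
  show "space Q \<in> sets (others p u)" using sets.top[of "others p u"] by simp
  show "{\<omega>\<in>space Q. Np p v \<omega> = Np p u \<omega> + k} \<in> events"
    using uv p by (intro increment_event Np_meas) auto
  show "0 \<le> poisson_weight (ap p * (v - u)) k" using ap_pos[OF p] uv by (simp add: poisson_weight_def)
  fix A assume A: "A \<in> sets (others p u)"
  show "prob (A \<inter> {\<omega>\<in>space Q. Np p v \<omega> = Np p u \<omega> + k}) = prob A * poisson_weight (ap p * (v - u)) k"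
  \<comment> \<open>No time lies strictly between, and the increment event is everything or empty;
    the Poisson weight agrees because \<open>0 ^ 0 = 1\<close>.\<close>
  proof (cases "u = v")
    case True
    then show ?thesis using sets.sets_into_space[OF A]
      by (cases "k = 0") (auto simp: poisson_weight_def Int_absorb2)
  next
    case False
    have "A \<in> sets (past p w)" if "u < w" "w \<le> v" for w
      using others_past[OF p that(1)] A that uv by auto
    then show ?thesis using False uv by (intro increment_indep_right_limit[OF p]) auto
  qed
qed (use V others_events in auto)

section \<open>Regularity of the driving paths\<close>

text \<open>With \<open>n\<close> cells of length \<open>T / n\<close> the union bound is
  \<open>C T^2 / n\<close>, which tends to 0. Hence almost surely some grid has no bad cell at
  all.\<close>

lemma prob_le_square_imp_AE:
  assumes E: "\<And>u v. 0 \<le> u \<Longrightarrow> u \<le> v \<Longrightarrow> v \<le> T \<Longrightarrow> E u v \<in> events"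
    and le: "\<And>u v. 0 \<le> u \<Longrightarrow> u \<le> v \<Longrightarrow> v \<le> T \<Longrightarrow> prob (E u v) \<le> C * (v - u)\<^sup>2"
  shows "AE \<omega> in Q. \<exists>n. \<forall>i<Suc n. \<omega> \<notin> E (grid 0 T (Suc n) i) (grid 0 T (Suc n) (Suc i))"
proof -
  let ?E = "\<lambda>n i. E (grid 0 T (Suc n) i) (grid 0 T (Suc n) (Suc i))"
  have g: "0 \<le> grid 0 T (Suc n) i" "grid 0 T (Suc n) i \<le> grid 0 T (Suc n) (Suc i)" "grid 0 T (Suc n) (Suc i) \<le> T"
    if "i < Suc n" for n i
    using grid_bounds[of 0 T _ "Suc n"] grid_mono[of 0 T i "Suc i"] T_pos that by auto
  define B where "B = (\<Inter>n. \<Union>i<Suc n. ?E n i)"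
  have Ev: "(\<Union>i<Suc n. ?E n i) \<in> events" for n using g by (intro sets.finite_UN E) auto
  then have B: "B \<in> events" unfolding B_def by auto
  have "prob B \<le> C * T\<^sup>2 / real (Suc n)" for n
  proof -
    have "prob B \<le> prob (\<Union>i<Suc n. ?E n i)" using Ev B by (intro finite_measure_mono) (auto simp: B_def)
    also have "\<dots> \<le> (\<Sum>i<Suc n. prob (?E n i))" using g E by (intro finite_measure_subadditive_finite) auto
    also have "\<dots> \<le> (\<Sum>i<Suc n. C * (T / real (Suc n))\<^sup>2)"
      using g by (intro sum_mono order_trans[OF le]) (auto simp: grid_Suc simp del: of_nat_Suc)
    also have "\<dots> = C * T\<^sup>2 / real (Suc n)" by (simp add: power2_eq_square field_simps del: of_nat_Suc)
    finally show ?thesis .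
  qed
  moreover have "(\<lambda>n. C * T\<^sup>2 / real (Suc n)) \<longlonglongrightarrow> 0" by (rule LIMSEQ_Suc[OF lim_const_over_n])
  ultimately have "prob B \<le> 0" by (intro LIMSEQ_le_const) auto
  then have "B \<in> null_sets Q" using B by (simp add: null_sets_def emeasure_eq_measure measure_le_0_iff)
  then have "AE \<omega> in Q. \<omega> \<notin> B" by (rule AE_not_in)
  then show ?thesis unfolding B_def by auto
qed

text \<open>At fixed times the Poisson weights of nonnegative increments sum to 1. Countably many
  pairs of times and right-continuity give all times; \<open>T\<close> joins the rationals because
  nothing lies to its right.\<close>

lemma AE_driver_mono:
  assumes p: "p \<in> I"
  shows "AE \<omega> in Q. \<forall>s t. 0 \<le> s \<longrightarrow> s \<le> t \<longrightarrow> t \<le> T \<longrightarrow> Np p s \<omega> \<le> Np p t \<omega>"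
proof -
  have 1: "AE \<omega> in Q. Np p s \<omega> \<le> Np p t \<omega>" if st: "0 \<le> s" "s \<le> t" "t \<le> T" for s t
  proof -
    have D: "{\<omega>\<in>space Q. Np p t \<omega> = Np p s \<omega> + k} \<in> events" for k using st p by (intro increment_event Np_meas) auto
    have "(\<lambda>k. prob {\<omega>\<in>space Q. Np p t \<omega> = Np p s \<omega> + k}) sums prob (\<Union>k. {\<omega>\<in>space Q. Np p t \<omega> = Np p s \<omega> + k})"
      using D by (intro finite_measure_UNION) (auto simp: disjoint_family_on_def)
    moreover have "prob {\<omega>\<in>space Q. Np p t \<omega> = Np p s \<omega> + k} = exp (- (ap p * (t - s))) * ((ap p * (t - s)) ^ k /\<^sub>R fact k)" for k
      using poisson[OF p] st by (simp add: poisson_process_def divide_inverse)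
    moreover have "(\<lambda>k. exp (- (ap p * (t - s))) * ((ap p * (t - s)) ^ k /\<^sub>R fact k)) sums (exp (- (ap p * (t - s))) * exp (ap p * (t - s)))"
      by (intro sums_mult exp_converges)
    ultimately have "prob (\<Union>k. {\<omega>\<in>space Q. Np p t \<omega> = Np p s \<omega> + k}) = exp (- (ap p * (t - s))) * exp (ap p * (t - s))"
      by (simp add: sums_unique2)
    also have "\<dots> = 1" by (simp flip: exp_add)
    finally have "AE \<omega> in Q. \<omega> \<in> (\<Union>k. {\<omega>\<in>space Q. Np p t \<omega> = Np p s \<omega> + k})"
      by (intro AE_prob_1)
    then show ?thesis by eventually_elim auto
  qed
  have "AE \<omega> in Q. \<forall>s\<in>insert T \<rat>. \<forall>t\<in>insert T \<rat>. 0 \<le> s \<longrightarrow> s \<le> t \<longrightarrow> t \<le> T \<longrightarrow> Np p s \<omega> \<le> Np p t \<omega>"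
    using 1 countable_rat by (intro AE_ball_countable' countable_insert) (auto intro: AE_I2)
  moreover have "AE \<omega> in Q. cadlag T (\<lambda>t. Np p t \<omega>)" using poisson[OF p] by (simp add: poisson_process_def)
  ultimately show ?thesis
  proof eventually_elim
    case (elim \<omega>)
    have rat: "\<exists>q\<in>insert T \<rat>. s \<le> q \<and> q \<le> b \<and> Np p q \<omega> = Np p s \<omega>" if s: "0 \<le> s" "s < b" "b \<le> T" for s b
    proof -
      have "s \<le> T" using s by simp
      from cadlag_right_const[OF elim(2) s(1) this]
      obtain e where e: "e > 0" "\<And>r. r \<le> T \<Longrightarrow> s \<le> r \<Longrightarrow> r < s + e \<Longrightarrow> Np p r \<omega> = Np p s \<omega>"
        by blast
      obtain q where q: "q \<in> \<rat>" "s < q" "q < min b (s + e)" using Rats_dense_in_real[of s "min b (s + e)"] e s by auto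
      have "Np p q \<omega> = Np p s \<omega>" by (rule e(2)) (use s q in auto)
      then show ?thesis using q by (intro bexI[of _ q]) auto
    qed
    show ?case
    proof (intro allI impI)
      fix s t assume st: "0 \<le> s" "s \<le> t" "t \<le> T"
      show "Np p s \<omega> \<le> Np p t \<omega>"
      proof (cases "s = t")
        case False
        then have "s < t" using st by simp
        from rat[OF st(1) this st(3)]
        obtain q where q: "q \<in> insert T \<rat>" "s \<le> q" "q \<le> t" "Np p q \<omega> = Np p s \<omega>" by blast
        have "\<exists>r\<in>insert T \<rat>. t \<le> r \<and> r \<le> T \<and> Np p r \<omega> = Np p t \<omega>"
        proof (cases "t = T")
          case False
          then show ?thesis using rat[of t T] st by simp
        qed auto
        then obtain r where r: "r \<in> insert T \<rat>" "t \<le> r" "r \<le> T" "Np p r \<omega> = Np p t \<omega>" by blast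
        have "0 \<le> q" "q \<le> r" using q r st by auto
        then have "Np p q \<omega> \<le> Np p r \<omega>" using elim(1) q(1) r(1,3) by blast
        then show ?thesis unfolding q(4) r(4) .
      qed simp
    qed
  qed
qed

lemma left_lim_between:
  fixes f :: "real \<Rightarrow> nat"
  assumes f: "cadlag T f" and mono: "\<forall>s t. 0 \<le> s \<longrightarrow> s \<le> t \<longrightarrow> t \<le> T \<longrightarrow> f s \<le> f t"
    and w: "0 \<le> s" "s < w" "w \<le> T"
  shows "f s \<le> left_lim f w" "left_lim f w \<le> f w"
proof -
  have "0 \<le> w" using w by simp
  from cadlag_left_const[OF f this w(3)]
  obtain e where e: "e > 0" "\<And>r. 0 \<le> r \<Longrightarrow> w - e < r \<Longrightarrow> r < w \<Longrightarrow> f r = left_lim f w"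
    by blast
  define r where "r = max s (w - e / 2)"
  have r: "s \<le> r" "r < w" using e(1) w by (auto simp: r_def)
  have fr: "f r = left_lim f w" by (rule e(2)) (use e(1) w r in \<open>auto simp: r_def\<close>)
  have "f s \<le> f r" "f r \<le> f w"
    using mono[rule_format, of s r] mono[rule_format, of r w] r(1,2) w by auto
  then show "f s \<le> left_lim f w" "left_lim f w \<le> f w" unfolding fr .
qed

text \<open>A cell of mean \<open>b\<close> has two or more points with probability 1 - exp(-b)(1 +
  b), which is at most \<open>b^2\<close>. On a grid without such a cell, monotonicity excludes a
  jump larger than 1.\<close>

lemma AE_unit_jumps:
  assumes p: "p \<in> I"
  shows "AE \<omega> in Q. unit_jumps T (\<lambda>t. Np p t \<omega>)"
proof -
  let ?E = "\<lambda>u v. space Q - {\<omega>\<in>space Q. Np p v \<omega> = Np p u \<omega> + 0} - {\<omega>\<in>space Q. Np p v \<omega> = Np p u \<omega> + 1}"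
  have "AE \<omega> in Q. \<exists>n. \<forall>i<Suc n. \<omega> \<notin> ?E (grid 0 T (Suc n) i) (grid 0 T (Suc n) (Suc i))"
  proof (rule prob_le_square_imp_AE[where C = "(ap p)\<^sup>2"])
    fix u v assume uv: "0 \<le> u" "u \<le> v" "v \<le> T"
    have D: "{\<omega>\<in>space Q. Np p v \<omega> = Np p u \<omega> + k} \<in> events" for k using uv p by (intro increment_event Np_meas) auto
    then show "?E u v \<in> events" by blast
    let ?b = "ap p * (v - u)"
    have w: "prob {\<omega>\<in>space Q. Np p v \<omega> = Np p u \<omega> + k} = exp (- ?b) * ?b ^ k / fact k" for k
      using poisson_prob[OF p uv] by (simp add: poisson_weight_def)
    have "?E u v = space Q - ({\<omega>\<in>space Q. Np p v \<omega> = Np p u \<omega> + 0} \<union> {\<omega>\<in>space Q. Np p v \<omega> = Np p u \<omega> + 1})"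
      by auto
    moreover have "prob ({\<omega>\<in>space Q. Np p v \<omega> = Np p u \<omega> + 0} \<union> {\<omega>\<in>space Q. Np p v \<omega> = Np p u \<omega> + 1}) =
      prob {\<omega>\<in>space Q. Np p v \<omega> = Np p u \<omega> + 0} + prob {\<omega>\<in>space Q. Np p v \<omega> = Np p u \<omega> + 1}"
      by (intro finite_measure_Union D) auto
    moreover have "prob (space Q - ({\<omega>\<in>space Q. Np p v \<omega> = Np p u \<omega> + 0} \<union> {\<omega>\<in>space Q. Np p v \<omega> = Np p u \<omega> + 1})) =
      1 - prob ({\<omega>\<in>space Q. Np p v \<omega> = Np p u \<omega> + 0} \<union> {\<omega>\<in>space Q. Np p v \<omega> = Np p u \<omega> + 1})"
      using D by (intro prob_compl sets.Un)
    ultimately have "prob (?E u v) = 1 - prob {\<omega>\<in>space Q. Np p v \<omega> = Np p u \<omega> + 0} - prob {\<omega>\<in>space Q. Np p v \<omega> = Np p u \<omega> + 1}"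
      by simp
    also have "\<dots> = 1 - exp (- ?b) * (1 + ?b)" unfolding w by (simp add: algebra_simps)
    also have "\<dots> \<le> 1 - (1 - ?b) * (1 + ?b)"
      using exp_ge_add_one_self[of "- ?b"] ap_pos[OF p] uv by (intro diff_left_mono mult_right_mono) auto
    also have "\<dots> = (ap p)\<^sup>2 * (v - u)\<^sup>2" by (simp add: power2_eq_square algebra_simps)
    finally show "prob (?E u v) \<le> (ap p)\<^sup>2 * (v - u)\<^sup>2" .
  qed
  moreover have "AE \<omega> in Q. cadlag T (\<lambda>t. Np p t \<omega>)" using poisson[OF p] by (simp add: poisson_process_def)
  ultimately show ?thesis using AE_driver_mono[OF p] AE_space
  proof eventually_elim
    case (elim \<omega>)
    obtain n where n: "\<And>i. i < Suc n \<Longrightarrow> \<omega> \<notin> ?E (grid 0 T (Suc n) i) (grid 0 T (Suc n) (Suc i))" using elim(1) by blast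
    have "Np p w \<omega> = Suc (left_lim (\<lambda>t. Np p t \<omega>) w)" if w: "w \<in> jump_set T (\<lambda>t. Np p t \<omega>)" for w
    proof -
      let ?g = "grid 0 T (Suc n)" and ?i = "below 0 T (Suc n) w"
      have w': "0 < w" "w \<le> T" "Np p w \<omega> \<noteq> left_lim (\<lambda>t. Np p t \<omega>) w" using w by (auto simp: jump_set_def)
      have b: "?i < Suc n" "?g ?i < w" "w \<le> ?g (Suc ?i)" using below_grid[of 0 w T "Suc n"] w' by auto
      have g: "0 \<le> ?g ?i" "?g (Suc ?i) \<le> T" using grid_bounds[of 0 T _ "Suc n"] b T_pos by auto
      have "Np p (?g (Suc ?i)) \<omega> \<le> Suc (Np p (?g ?i) \<omega>)" using n[OF b(1)] elim(4) by auto
      moreover have "Np p w \<omega> \<le> Np p (?g (Suc ?i)) \<omega>" using elim(3) b g w' by auto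
      moreover note left_lim_between[OF elim(2,3) g(1) b(2) w'(2)]
      ultimately show ?thesis using w'(3) by linarith
    qed
    then show ?case using elim(2) by (simp add: unit_jumps_def)
  qed
qed

text \<open>Two independent drivers both move in one cell with probability at most the product of
  the two means, which is quadratic in its length; a common jump would make some cell bad on every
  grid.\<close>

lemma AE_no_common_jumps:
  assumes p: "p \<in> I" and q: "q \<in> I" and pq: "p \<noteq> q"
  shows "AE \<omega> in Q. jump_set T (\<lambda>t. Np p t \<omega>) \<inter> jump_set T (\<lambda>t. Np q t \<omega>) = {}"
proof -
  let ?D = "\<lambda>p u v. {\<omega>\<in>space Q. Np p v \<omega> = Np p u \<omega> + 0}"
  let ?E = "\<lambda>u v. (space Q - ?D q u v) - ?D p u v"
  have "AE \<omega> in Q. \<exists>n. \<forall>i<Suc n. \<omega> \<notin> ?E (grid 0 T (Suc n) i) (grid 0 T (Suc n) (Suc i))"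
  proof (rule prob_le_square_imp_AE[where C = "ap p * ap q"])
    fix u v assume uv: "0 \<le> u" "u \<le> v" "v \<le> T"
    have D: "?D r u v \<in> events" if "r \<in> I" for r using uv that by (intro increment_event Np_meas) auto
    then show "?E u v \<in> events" using p q by blast
    have uT: "u \<le> T" using uv by auto
    have C: "space Q - ?D q u v \<in> sets (past p u)"
    proof -
      have "Np q r \<in> measurable (past p u) (count_space UNIV)" if "0 \<le> r" "r \<le> T" for r
        using past_upper(2)[OF p uT, of q] q pq that by (intro Np_history[of r T]) auto
      then have "{\<omega>\<in>space (past p u). Np q v \<omega> = Np q u \<omega> + 0} \<in> sets (past p u)"
        using uv by (intro increment_event) auto
      then show ?thesis using sets.compl_sets[of "?D q u v" "past p u"] by simp
    qed
    have w: "prob (?D r u v) = exp (- (ap r * (v - u)))" if "r \<in> I" for r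
      using poisson_prob[OF that uv, of 0] by (simp add: poisson_weight_def)
    let ?C = "space Q - ?D q u v"
    have "?E u v = ?C - ?C \<inter> ?D p u v" by auto
    then have "prob (?E u v) = prob ?C - prob (?C \<inter> ?D p u v)"
      using D[OF p] D[OF q] finite_measure_Diff[of ?C "?C \<inter> ?D p u v"] by simp
    moreover have "prob (?C \<inter> ?D p u v) = prob ?C * exp (- (ap p * (v - u)))"
      using increment_indep_past[OF p uv C, of 0] by (simp add: poisson_weight_def)
    moreover have "prob ?C = 1 - exp (- (ap q * (v - u)))" using D[OF q] w[OF q] prob_compl[of "?D q u v"] by simp
    ultimately have "prob (?E u v) = (1 - exp (- (ap q * (v - u)))) * (1 - exp (- (ap p * (v - u))))"
      by (simp only: right_diff_distrib mult_1_right)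
    also have "\<dots> \<le> (ap q * (v - u)) * (ap p * (v - u))"
      using exp_ge_add_one_self[of "- (ap q * (v - u))"] exp_ge_add_one_self[of "- (ap p * (v - u))"] ap_pos[OF p] ap_pos[OF q] uv
      by (intro mult_mono) auto
    also have "\<dots> = ap p * ap q * (v - u)\<^sup>2" by (simp add: power2_eq_square)
    finally show "prob (?E u v) \<le> ap p * ap q * (v - u)\<^sup>2" .
  qed
  moreover have "AE \<omega> in Q. cadlag T (\<lambda>t. Np p t \<omega>)" "AE \<omega> in Q. cadlag T (\<lambda>t. Np q t \<omega>)"
    using poisson[OF p] poisson[OF q] by (simp_all add: poisson_process_def)
  ultimately show ?thesis using AE_driver_mono[OF p] AE_driver_mono[OF q] AE_space
  proof eventually_elim
    case (elim \<omega>)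
    obtain n where n: "\<And>i. i < Suc n \<Longrightarrow> \<omega> \<notin> ?E (grid 0 T (Suc n) i) (grid 0 T (Suc n) (Suc i))" using elim(1) by blast
    have False if w: "w \<in> jump_set T (\<lambda>t. Np p t \<omega>)" "w \<in> jump_set T (\<lambda>t. Np q t \<omega>)" for w
    proof -
      let ?g = "grid 0 T (Suc n)" and ?i = "below 0 T (Suc n) w"
      have w': "0 < w" "w \<le> T" "Np p w \<omega> \<noteq> left_lim (\<lambda>t. Np p t \<omega>) w" "Np q w \<omega> \<noteq> left_lim (\<lambda>t. Np q t \<omega>) w"
        using w by (auto simp: jump_set_def)
      have b: "?i < Suc n" "?g ?i < w" "w \<le> ?g (Suc ?i)" using below_grid[of 0 w T "Suc n"] w' by auto
      have g: "0 \<le> ?g ?i" "?g (Suc ?i) \<le> T" using grid_bounds[of 0 T _ "Suc n"] b T_pos by auto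
      have "Np p (?g (Suc ?i)) \<omega> = Np p (?g ?i) \<omega> \<or> Np q (?g (Suc ?i)) \<omega> = Np q (?g ?i) \<omega>"
        using n[OF b(1)] elim(6) by auto
      moreover have "Np p w \<omega> \<le> Np p (?g (Suc ?i)) \<omega>" using elim(4) b g w' by auto
      moreover have "Np q w \<omega> \<le> Np q (?g (Suc ?i)) \<omega>" using elim(5) b g w' by auto
      moreover note left_lim_between[OF elim(2,4) g(1) b(2) w'(2)] left_lim_between[OF elim(3,5) g(1) b(2) w'(2)]
      ultimately show False using w'(3,4) by linarith
    qed
    then show ?case by blast
  qed
qed

end

section \<open>The supermartingale inequality for exponential densities\<close>

lemma ennreal_mult_liminf_le:
  fixes c :: ennreal
  shows "c * liminf f \<le> liminf (\<lambda>n. c * f n)"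
  unfolding liminf_SUP_INF SUP_mult_left_ennreal
  by (intro SUP_mono') (auto intro!: INF_greatest mult_left_mono INF_lower)

lemma borel_measurable_power_nat:
  fixes f :: "'a \<Rightarrow> real" and k :: "'a \<Rightarrow> nat"
  assumes "f \<in> borel_measurable M" "k \<in> measurable M (count_space UNIV)"
  shows "(\<lambda>x. f x ^ k x) \<in> borel_measurable M"
  by (rule measurable_compose_countable[OF borel_measurable_power[OF assms(1)] assms(2)])

lemma measurable_diff_nat:
  fixes f g :: "'a \<Rightarrow> nat"
  assumes "f \<in> measurable M (count_space UNIV)" "g \<in> measurable M (count_space UNIV)"
  shows "(\<lambda>x. f x - g x) \<in> measurable M (count_space UNIV)"
  by (rule measurable_compose_countable[OF measurable_compose_countable[OF _ assms(2)] assms(1)]) simp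

lemma poisson_exponential_sums:
  assumes "0 \<le> b" "0 \<le> x"
  shows "(\<Sum>k. ennreal (x ^ k) * ennreal (poisson_weight b k)) = ennreal (exp (b * (x - 1)))"
proof -
  have "(\<lambda>k. x ^ k * poisson_weight b k) sums (exp (- b) * exp (b * x))"
    using sums_mult[OF exp_converges[of "b * x"], of "exp (- b)"]
    by (simp add: poisson_weight_def power_mult_distrib divide_inverse mult_ac)
  then have "(\<Sum>k. ennreal (x ^ k * poisson_weight b k)) = ennreal (exp (- b) * exp (b * x))"
    using assms by (intro suminf_ennreal_eq) (auto simp: poisson_weight_def)
  moreover have "ennreal (x ^ k * poisson_weight b k) = ennreal (x ^ k) * ennreal (poisson_weight b k)" for k
    using assms by (intro ennreal_mult) (auto simp: poisson_weight_def)
  moreover have "exp (- b) * exp (b * x) = exp (b * (x - 1))" by (simp add: algebra_simps flip: exp_add)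
  ultimately show ?thesis by (simp only:)
qed

context cmc_setup
begin

lemma others_sub: "subalgebra Q (others p u)" using others_events by (simp add: subalgebra_def)

lemma K_others: "f \<in> measurable (K u) M \<Longrightarrow> f \<in> measurable (others p u) M"
  by (erule measurable_mono_sets) (auto intro: others_upper(1)[THEN subsetD])

lemma K_Q: "f \<in> measurable (K u) M \<Longrightarrow> f \<in> measurable Q M"
  by (rule measurable_from_subalg[OF K_sub])

lemma K_incr: "f \<in> measurable (K s) M \<Longrightarrow> s \<le> t \<Longrightarrow> f \<in> measurable (K t) M"
  by (erule measurable_mono_sets) (auto intro: K_mono[THEN subsetD])

lemma G_K: "f \<in> measurable (G t) M \<Longrightarrow> f \<in> measurable (K t) M"
  by (erule measurable_mono_sets) (auto intro: K_upper(2)[THEN subsetD])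

lemma Np_K: "p \<in> I \<Longrightarrow> 0 \<le> s \<Longrightarrow> s \<le> t \<Longrightarrow> t \<le> T \<Longrightarrow> Np p s \<in> measurable (K t) (count_space UNIV)"
  by (intro G_K Np_G)

lemma Np_others: "p \<in> I \<Longrightarrow> q \<in> I \<Longrightarrow> q \<noteq> p \<Longrightarrow> 0 \<le> s \<Longrightarrow> s \<le> T \<Longrightarrow> Np q s \<in> measurable (others p u) (count_space UNIV)"
  by (rule Np_history[OF _ _ _ others_upper(2)]) auto

definition "cell_dens p \<phi> u v \<omega> =
  exp (- ap p * (\<phi> \<omega> - 1) * (v - u)) * \<phi> \<omega> ^ (Np p v \<omega> - Np p u \<omega>)"

lemma cell_dens_measurable:
  assumes "\<phi> \<in> borel_measurable M" "(\<lambda>\<omega>. Np p v \<omega> - Np p u \<omega>) \<in> measurable M (count_space UNIV)"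
  shows "cell_dens p \<phi> u v \<in> borel_measurable M"
  unfolding cell_dens_def[abs_def] using assms
  by (intro borel_measurable_times borel_measurable_power_nat) auto

text \<open>The generating function of a Poisson increment makes the compensation exact on every cell,
  without any error term.\<close>

lemma one_step:
  assumes p: "p \<in> I" and uv: "0 \<le> u" "u \<le> v" "v \<le> T"
    and V: "V \<in> borel_measurable (others p u)"
    and \<phi>: "\<phi> \<in> borel_measurable (K u)" "\<And>\<omega>. \<omega> \<in> space Q \<Longrightarrow> 0 \<le> \<phi> \<omega>"
  shows "(\<integral>\<^sup>+\<omega>. V \<omega> * ennreal (cell_dens p \<phi> u v \<omega>) \<partial>Q) = (\<integral>\<^sup>+\<omega>. V \<omega> \<partial>Q)"
proof -
  let ?b = "ap p * (v - u)" and ?D = "\<lambda>k. {\<omega>\<in>space Q. Np p v \<omega> = Np p u \<omega> + k}"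
  have b: "0 \<le> ?b" using ap_pos[OF p] uv by simp
  define W where "W \<omega> = V \<omega> * ennreal (exp (- ap p * (\<phi> \<omega> - 1) * (v - u)))" for \<omega>
  note \<phi>o = K_others[OF \<phi>(1), of p]
  have W: "W \<in> borel_measurable (others p u)" unfolding W_def[abs_def] using V \<phi>o by measurable
  have WQ: "(\<lambda>\<omega>. W \<omega> * ennreal (\<phi> \<omega> ^ k)) \<in> borel_measurable (others p u)" for k
    using W \<phi>o by measurable
  note WQ' = measurable_from_subalg[OF others_sub WQ]
  have D: "?D k \<in> events" for k using uv p by (intro increment_event Np_meas) auto
  have "(\<integral>\<^sup>+\<omega>. V \<omega> * ennreal (cell_dens p \<phi> u v \<omega>) \<partial>Q) =
      (\<integral>\<^sup>+\<omega>. (\<Sum>k. W \<omega> * ennreal (\<phi> \<omega> ^ k) * indicator (?D k) \<omega>) \<partial>Q)"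
  proof (rule nn_integral_cong_AE)
    show "AE \<omega> in Q. V \<omega> * ennreal (cell_dens p \<phi> u v \<omega>) = (\<Sum>k. W \<omega> * ennreal (\<phi> \<omega> ^ k) * indicator (?D k) \<omega>)"
      using AE_driver_mono[OF p] AE_space
    proof eventually_elim
      case (elim \<omega>)
      have le: "Np p u \<omega> \<le> Np p v \<omega>" using elim(1) uv by auto
      let ?k = "Np p v \<omega> - Np p u \<omega>"
      have "(\<Sum>k. W \<omega> * ennreal (\<phi> \<omega> ^ k) * indicator (?D k) \<omega>) =
          (\<Sum>k\<in>{?k}. W \<omega> * ennreal (\<phi> \<omega> ^ k) * indicator (?D k) \<omega>)"
        using le by (intro suminf_finite) (auto simp: indicator_def)
      also have "\<dots> = V \<omega> * ennreal (cell_dens p \<phi> u v \<omega>)"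
        using le elim(2) \<phi>(2)[OF elim(2)] by (simp add: W_def cell_dens_def ennreal_mult mult.assoc)
      finally show ?case by simp
    qed
  qed
  also have "\<dots> = (\<Sum>k. \<integral>\<^sup>+\<omega>. W \<omega> * ennreal (\<phi> \<omega> ^ k) * indicator (?D k) \<omega> \<partial>Q)"
    using WQ' D by (intro nn_integral_suminf) auto
  also have "\<dots> = (\<Sum>k. \<integral>\<^sup>+\<omega>. W \<omega> * (ennreal (\<phi> \<omega> ^ k) * ennreal (poisson_weight ?b k)) \<partial>Q)"
    using increment_indep_others[OF p uv WQ] WQ'
    by (simp add: nn_integral_multc flip: mult.assoc)
  also have "\<dots> = (\<integral>\<^sup>+\<omega>. (\<Sum>k. W \<omega> * (ennreal (\<phi> \<omega> ^ k) * ennreal (poisson_weight ?b k))) \<partial>Q)"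
    using WQ' by (intro nn_integral_suminf[symmetric]) (simp flip: mult.assoc)
  also have "\<dots> = (\<integral>\<^sup>+\<omega>. V \<omega> \<partial>Q)"
  proof (rule nn_integral_cong)
    fix \<omega> assume \<omega>: "\<omega> \<in> space Q"
    have "(\<Sum>k. W \<omega> * (ennreal (\<phi> \<omega> ^ k) * ennreal (poisson_weight ?b k))) = W \<omega> * ennreal (exp (?b * (\<phi> \<omega> - 1)))"
      using poisson_exponential_sums[OF b \<phi>(2)[OF \<omega>]] by simp
    also have "\<dots> = V \<omega> * ennreal (exp (- ap p * (\<phi> \<omega> - 1) * (v - u)) * exp (?b * (\<phi> \<omega> - 1)))"
      by (simp add: W_def ennreal_mult mult.assoc)
    also have "exp (- ap p * (\<phi> \<omega> - 1) * (v - u)) * exp (?b * (\<phi> \<omega> - 1)) = 1"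
      by (simp flip: exp_add)
    finally show "(\<Sum>k. W \<omega> * (ennreal (\<phi> \<omega> ^ k) * ennreal (poisson_weight ?b k))) = V \<omega>" by simp
  qed
  finally show ?thesis .
qed

lemma cell_dens_nonneg: "0 \<le> \<phi> \<omega> \<Longrightarrow> 0 \<le> cell_dens p \<phi> u v \<omega>"
  by (simp add: cell_dens_def)

text \<open>The drivers are integrated out one by one. The factors of the others are measurable for
  \<open>others p u\<close>, where these drivers are known up to \<open>T\<close>, so they can be
  absorbed into the test function of \<open>one_step\<close>.\<close>

lemma joint_step:
  assumes uv: "0 \<le> u" "u \<le> v" "v \<le> T" and V: "V \<in> borel_measurable (K u)" and R: "R \<subseteq> I"
    and \<phi>: "\<And>p. p \<in> I \<Longrightarrow> \<phi> p \<in> borel_measurable (K u)" "\<And>p \<omega>. p \<in> I \<Longrightarrow> \<omega> \<in> space Q \<Longrightarrow> 0 \<le> \<phi> p \<omega>"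
  shows "(\<integral>\<^sup>+\<omega>. V \<omega> * ennreal (\<Prod>p\<in>R. cell_dens p (\<phi> p) u v \<omega>) \<partial>Q) = (\<integral>\<^sup>+\<omega>. V \<omega> \<partial>Q)"
  using finite_subset[OF R finite_I] R
proof (induction R)
  case (insert p R)
  have "(\<integral>\<^sup>+\<omega>. V \<omega> * ennreal (\<Prod>p\<in>insert p R. cell_dens p (\<phi> p) u v \<omega>) \<partial>Q) =
      (\<integral>\<^sup>+\<omega>. (V \<omega> * ennreal (\<Prod>p\<in>R. cell_dens p (\<phi> p) u v \<omega>)) * ennreal (cell_dens p (\<phi> p) u v \<omega>) \<partial>Q)"
  proof (rule nn_integral_cong)
    fix \<omega> assume \<omega>: "\<omega> \<in> space Q"
    have "0 \<le> cell_dens q (\<phi> q) u v \<omega>" if "q \<in> insert p R" for q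
      using that insert(4) \<omega> by (intro cell_dens_nonneg \<phi>(2)) auto
    then have "0 \<le> (\<Prod>p\<in>R. cell_dens p (\<phi> p) u v \<omega>)" "0 \<le> cell_dens p (\<phi> p) u v \<omega>"
      by (auto intro!: prod_nonneg)
    then show "V \<omega> * ennreal (\<Prod>p\<in>insert p R. cell_dens p (\<phi> p) u v \<omega>) =
        (V \<omega> * ennreal (\<Prod>p\<in>R. cell_dens p (\<phi> p) u v \<omega>)) * ennreal (cell_dens p (\<phi> p) u v \<omega>)"
      using insert(1,2) by (simp add: ennreal_mult mult_ac)
  qed
  also have "\<dots> = (\<integral>\<^sup>+\<omega>. V \<omega> * ennreal (\<Prod>p\<in>R. cell_dens p (\<phi> p) u v \<omega>) \<partial>Q)"
  proof (rule one_step)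
    have "(\<lambda>\<omega>. \<Prod>p\<in>R. cell_dens p (\<phi> p) u v \<omega>) \<in> borel_measurable (others p u)"
    proof (intro borel_measurable_prod cell_dens_measurable measurable_diff_nat)
      fix q assume q: "q \<in> R"
      then have "q \<in> I" "q \<noteq> p" using insert by auto
      then show "\<phi> q \<in> borel_measurable (others p u)" "Np q u \<in> measurable (others p u) (count_space UNIV)"
        "Np q v \<in> measurable (others p u) (count_space UNIV)"
        using uv insert(4) by (auto intro!: K_others[OF \<phi>(1)] Np_others)
    qed
    then show "(\<lambda>\<omega>. V \<omega> * ennreal (\<Prod>p\<in>R. cell_dens p (\<phi> p) u v \<omega>)) \<in> borel_measurable (others p u)"
      using K_others[OF V, of p] by measurable
  qed (use insert uv \<phi> in auto)
  also have "\<dots> = (\<integral>\<^sup>+\<omega>. V \<omega> \<partial>Q)" using insert by auto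
  finally show ?case .
qed simp

section \<open>Densities of the whole family of drivers, on grids and in the limit\<close>

definition "grid_density \<psi> s t m n \<omega> =
  (\<Prod>p\<in>I. grid_dens (ap p) (\<lambda>u. \<psi> p u \<omega>) (\<lambda>u. Np p u \<omega>) s t m n)"

definition "path_density \<phi> s t \<omega> =
  (\<Prod>p\<in>I. path_dens (ap p) (\<phi> p \<omega>) (jump_set T (\<lambda>u. Np p u \<omega>)) s t)"

lemma grid_density_eq: "grid_density \<psi> s t m n \<omega> =
  (\<Prod>i<n. \<Prod>p\<in>I. cell_dens p (\<lambda>\<omega>. min (\<psi> p (grid s t n i) \<omega>) m) (grid s t n i) (grid s t n (Suc i)) \<omega>)"
  unfolding grid_density_def grid_dens_def cell_dens_def grid_Suc by (rule prod.swap)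

lemma grid_density_measurable:
  assumes st: "s \<le> t" "0 < n"
    and \<psi>: "\<And>p u. p \<in> I \<Longrightarrow> s \<le> u \<Longrightarrow> u \<le> t \<Longrightarrow> \<psi> p u \<in> borel_measurable M"
    and N: "\<And>p u v. p \<in> I \<Longrightarrow> s \<le> u \<Longrightarrow> u \<le> v \<Longrightarrow> v \<le> t \<Longrightarrow>
      (\<lambda>\<omega>. Np p v \<omega> - Np p u \<omega>) \<in> measurable M (count_space UNIV)"
  shows "grid_density \<psi> s t m n \<in> borel_measurable M"
  unfolding grid_density_eq[abs_def]
proof (intro borel_measurable_prod cell_dens_measurable borel_measurable_min borel_measurable_const \<psi> N)
  fix i p assume "i \<in> {..<n}" "p \<in> I"
  then show "s \<le> grid s t n i" "grid s t n i \<le> t" "s \<le> grid s t n i"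
    "grid s t n i \<le> grid s t n (Suc i)" "grid s t n (Suc i) \<le> t"
    using grid_bounds[of s t i n] grid_bounds[of s t "Suc i" n] grid_mono[of s t i "Suc i"] st by auto
qed

text \<open>Induction over the cells, removing the last one. Sampling at left end points makes the
  coefficient of cell \<open>j\<close> and all earlier factors measurable for \<open>K\<close> at
  the start of that cell.\<close>

lemma grid_martingale:
  assumes st: "0 \<le> s" "s \<le> t" "t \<le> T" and n: "0 < n" and m: "0 \<le> m" and V: "V \<in> borel_measurable (K s)"
    and \<psi>: "\<And>p u. p \<in> I \<Longrightarrow> s \<le> u \<Longrightarrow> u \<le> t \<Longrightarrow> \<psi> p u \<in> borel_measurable (K u)"
    "\<And>p u \<omega>. p \<in> I \<Longrightarrow> s \<le> u \<Longrightarrow> u \<le> t \<Longrightarrow> \<omega> \<in> space Q \<Longrightarrow> 0 \<le> \<psi> p u \<omega>"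
  shows "(\<integral>\<^sup>+\<omega>. V \<omega> * ennreal (grid_density \<psi> s t m n \<omega>) \<partial>Q) = (\<integral>\<^sup>+\<omega>. V \<omega> \<partial>Q)"
proof -
  let ?g = "grid s t n"
  let ?c = "\<lambda>i p. cell_dens p (\<lambda>\<omega>. min (\<psi> p (?g i) \<omega>) m) (?g i) (?g (Suc i))"
  have g: "s \<le> ?g i" "?g i \<le> t" if "i \<le> n" for i using grid_bounds[of s t i n] st n that by auto
  have gm: "?g i \<le> ?g j" if "i \<le> j" for i j using grid_mono[of s t i j n] st that by auto
  have nn: "0 \<le> ?c i p \<omega>" if "i < n" "p \<in> I" "\<omega> \<in> space Q" for i p \<omega>
    using \<psi>(2)[of p "?g i" \<omega>] g[of i] that m by (intro cell_dens_nonneg) auto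
  have "(\<integral>\<^sup>+\<omega>. V \<omega> * ennreal (\<Prod>i<j. \<Prod>p\<in>I. ?c i p \<omega>) \<partial>Q) = (\<integral>\<^sup>+\<omega>. V \<omega> \<partial>Q)" if "j \<le> n" for j
    using that
  proof (induction j)
    case (Suc j)
    have "(\<integral>\<^sup>+\<omega>. V \<omega> * ennreal (\<Prod>i<Suc j. \<Prod>p\<in>I. ?c i p \<omega>) \<partial>Q) =
       (\<integral>\<^sup>+\<omega>. V \<omega> * ennreal (\<Prod>i<j. \<Prod>p\<in>I. ?c i p \<omega>) * ennreal (\<Prod>p\<in>I. ?c j p \<omega>) \<partial>Q)"
    proof (rule nn_integral_cong)
      fix \<omega> assume \<omega>: "\<omega> \<in> space Q"
      have "0 \<le> (\<Prod>i<j. \<Prod>p\<in>I. ?c i p \<omega>)" "0 \<le> (\<Prod>p\<in>I. ?c j p \<omega>)"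
        using Suc.prems \<omega> by (intro prod_nonneg ballI nn; simp)+
      then show "V \<omega> * ennreal (\<Prod>i<Suc j. \<Prod>p\<in>I. ?c i p \<omega>) =
          V \<omega> * ennreal (\<Prod>i<j. \<Prod>p\<in>I. ?c i p \<omega>) * ennreal (\<Prod>p\<in>I. ?c j p \<omega>)"
        by (simp add: ennreal_mult mult.assoc)
    qed
    also have "\<dots> = (\<integral>\<^sup>+\<omega>. V \<omega> * ennreal (\<Prod>i<j. \<Prod>p\<in>I. ?c i p \<omega>) \<partial>Q)"
    proof (rule joint_step)
      have "(\<lambda>\<omega>. \<Prod>i<j. \<Prod>p\<in>I. ?c i p \<omega>) \<in> borel_measurable (K (?g j))"
      proof (intro borel_measurable_prod cell_dens_measurable borel_measurable_min borel_measurable_const measurable_diff_nat)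
        fix i p assume i: "i \<in> {..<j}" and p: "p \<in> I"
        show "\<psi> p (?g i) \<in> borel_measurable (K (?g j))"
          using i g[of i] gm[of i j] Suc.prems p by (intro K_incr[OF \<psi>(1)]) auto
        show "Np p (?g i) \<in> measurable (K (?g j)) (count_space UNIV)"
          "Np p (?g (Suc i)) \<in> measurable (K (?g j)) (count_space UNIV)"
          using i g[of i] g[of "Suc i"] g[of j] gm[of i j] gm[of "Suc i" j] Suc.prems p st by (auto intro!: Np_K)
      qed
      moreover have "V \<in> borel_measurable (K (?g j))" using K_incr[OF V] g[of j] Suc.prems by auto
      ultimately show "(\<lambda>\<omega>. V \<omega> * ennreal (\<Prod>i<j. \<Prod>p\<in>I. ?c i p \<omega>)) \<in> borel_measurable (K (?g j))"
        by measurable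
      show "(\<lambda>\<omega>. min (\<psi> p (?g j) \<omega>) m) \<in> borel_measurable (K (?g j))" if "p \<in> I" for p
        using \<psi>(1)[OF that, of "?g j"] g[of j] Suc.prems by auto
      show "0 \<le> min (\<psi> p (?g j) \<omega>) m" if "p \<in> I" "\<omega> \<in> space Q" for p \<omega>
        using \<psi>(2)[of p "?g j" \<omega>] g[of j] Suc.prems that m by auto
    qed (use g[of j] g[of "Suc j"] gm[of j "Suc j"] Suc.prems st in auto)
    also have "\<dots> = (\<integral>\<^sup>+\<omega>. V \<omega> \<partial>Q)" using Suc by simp
    finally show ?case .
  qed simp
  then show ?thesis unfolding grid_density_eq by simp
qed

text \<open>An everywhere defined version of the path density, measurable because it only involves the
  values on the grids.\<close>

definition "lim_density \<psi> s t \<omega> =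
  liminf (\<lambda>m. liminf (\<lambda>n. ennreal (grid_density \<psi> s t (real m) (Suc n) \<omega>)))"

lemma lim_density_measurable:
  assumes st: "s \<le> t"
    and \<psi>: "\<And>p u. p \<in> I \<Longrightarrow> s \<le> u \<Longrightarrow> u \<le> t \<Longrightarrow> \<psi> p u \<in> borel_measurable M"
    and N: "\<And>p u v. p \<in> I \<Longrightarrow> s \<le> u \<Longrightarrow> u \<le> v \<Longrightarrow> v \<le> t \<Longrightarrow>
      (\<lambda>\<omega>. Np p v \<omega> - Np p u \<omega>) \<in> measurable M (count_space UNIV)"
  shows "lim_density \<psi> s t \<in> borel_measurable M"
  unfolding lim_density_def[abs_def] using grid_density_measurable[OF st _ \<psi> N] by measurable

text \<open>On every grid and truncation level there is equality; Fatou's lemma, once for the mesh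
  and once for the level, leaves an inequality. Path regularity does not enter here.\<close>

lemma lim_density_supermartingale:
  assumes st: "0 \<le> s" "s \<le> t" "t \<le> T" and V: "V \<in> borel_measurable (K s)"
    and \<psi>: "\<And>p u. p \<in> I \<Longrightarrow> s \<le> u \<Longrightarrow> u \<le> t \<Longrightarrow> \<psi> p u \<in> borel_measurable (K u)"
    "\<And>p u \<omega>. p \<in> I \<Longrightarrow> s \<le> u \<Longrightarrow> u \<le> t \<Longrightarrow> \<omega> \<in> space Q \<Longrightarrow> 0 \<le> \<psi> p u \<omega>"
  shows "(\<integral>\<^sup>+\<omega>. V \<omega> * lim_density \<psi> s t \<omega> \<partial>Q) \<le> (\<integral>\<^sup>+\<omega>. V \<omega> \<partial>Q)"
proof -
  let ?g = "\<lambda>m n \<omega>. V \<omega> * ennreal (grid_density \<psi> s t (real m) (Suc n) \<omega>)"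
  have "grid_density \<psi> s t (real m) (Suc n) \<in> borel_measurable Q" for m n
    using K_Q[OF \<psi>(1)] Np_meas st by (intro grid_density_measurable measurable_diff_nat) auto
  note [measurable] = this K_Q[OF V]
  have "(\<integral>\<^sup>+\<omega>. V \<omega> * lim_density \<psi> s t \<omega> \<partial>Q) \<le> (\<integral>\<^sup>+\<omega>. liminf (\<lambda>m. liminf (\<lambda>n. ?g m n \<omega>)) \<partial>Q)"
    unfolding lim_density_def
    by (intro nn_integral_mono order_trans[OF ennreal_mult_liminf_le] Liminf_mono always_eventually
        allI ennreal_mult_liminf_le)
  also have "\<dots> \<le> liminf (\<lambda>m. \<integral>\<^sup>+\<omega>. liminf (\<lambda>n. ?g m n \<omega>) \<partial>Q)"
    by (intro nn_integral_liminf) measurable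
  also have "\<dots> \<le> liminf (\<lambda>m. liminf (\<lambda>n. \<integral>\<^sup>+\<omega>. ?g m n \<omega> \<partial>Q))"
    by (intro Liminf_mono always_eventually allI nn_integral_liminf) measurable
  also have "\<dots> = liminf (\<lambda>m::nat. liminf (\<lambda>n::nat. \<integral>\<^sup>+\<omega>. V \<omega> \<partial>Q))"
    using grid_martingale[OF st _ _ V \<psi>] by simp
  also have "\<dots> = (\<integral>\<^sup>+\<omega>. V \<omega> \<partial>Q)" by (simp add: Liminf_const)
  finally show ?thesis .
qed

lemma lim_density_cong:
  assumes "s \<le> t" "\<And>p u. p \<in> I \<Longrightarrow> s \<le> u \<Longrightarrow> u \<le> t \<Longrightarrow> \<psi> p u \<omega> = \<psi>' p u \<omega>"
  shows "lim_density \<psi> s t \<omega> = lim_density \<psi>' s t \<omega>"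
proof -
  have "grid_density \<psi> s t m (Suc n) \<omega> = grid_density \<psi>' s t m (Suc n) \<omega>" for m n
    unfolding grid_density_def grid_dens_def
    using assms grid_bounds[of s t _ "Suc n"] by (intro prod.cong refl) auto
  then show ?thesis by (simp add: lim_density_def)
qed

text \<open>On a regular path both lower limits are limits: first the mesh at a fixed truncation
  level, then the level.\<close>

lemma lim_density_eq:
  assumes unit: "\<And>p. p \<in> I \<Longrightarrow> unit_jumps T (\<lambda>u. Np p u \<omega>)" and st: "0 \<le> s" "s \<le> t" "t \<le> T"
    and lim: "\<And>p u. p \<in> I \<Longrightarrow> s < u \<Longrightarrow> u \<le> t \<Longrightarrow> ((\<lambda>u. \<psi> p u \<omega>) \<longlongrightarrow> \<phi> p \<omega> u) (at_left u)"
    and nn: "\<And>p u. p \<in> I \<Longrightarrow> s \<le> u \<Longrightarrow> u \<le> t \<Longrightarrow> 0 \<le> \<psi> p u \<omega>"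
  shows "lim_density \<psi> s t \<omega> = ennreal (path_density \<phi> s t \<omega>)"
proof -
  let ?J = "\<lambda>p. jump_set T (\<lambda>u. Np p u \<omega>)"
  have \<phi>nn: "0 \<le> \<phi> p \<omega> u" if "p \<in> I" "s < u" "u \<le> t" for p u
  proof (rule tendsto_lowerbound[OF lim[OF that]])
    show "\<forall>\<^sub>F x in at_left u. 0 \<le> \<psi> p x \<omega>"
      unfolding eventually_at_left_field using nn that by (intro exI[of _ s]) auto
  qed simp
  have 1: "(\<lambda>n. grid_density \<psi> s t (real m) (Suc n) \<omega>) \<longlonglongrightarrow>
    (\<Prod>p\<in>I. trunc_dens (ap p) (\<phi> p \<omega>) (?J p) s t (real m))" for m
    unfolding grid_density_def using unit st lim nn by (intro tendsto_prod grid_dens_tendsto) auto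
  have 2: "(\<lambda>m. \<Prod>p\<in>I. trunc_dens (ap p) (\<phi> p \<omega>) (?J p) s t (real m)) \<longlonglongrightarrow> path_density \<phi> s t \<omega>"
    unfolding path_density_def using lim \<phi>nn ap_pos by (intro tendsto_prod trunc_dens_tendsto) auto
  have "liminf (\<lambda>n. ennreal (grid_density \<psi> s t (real m) (Suc n) \<omega>)) =
    ennreal (\<Prod>p\<in>I. trunc_dens (ap p) (\<phi> p \<omega>) (?J p) s t (real m))" for m
    using tendsto_ennrealI[OF 1] by (intro lim_imp_Liminf) auto
  then show ?thesis unfolding lim_density_def
    using tendsto_ennrealI[OF 2] by (simp add: lim_imp_Liminf)
qed

end

section \<open>The chain as a functional of the noise\<close>

lemma finite_separated:
  fixes R :: "real set"
  assumes "finite R"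
  shows "\<exists>\<delta>>0. \<forall>x\<in>R. \<forall>y\<in>R. x \<noteq> y \<longrightarrow> \<delta> \<le> \<bar>x - y\<bar>"
proof -
  define D where "D = insert 1 ((\<lambda>(x, y). \<bar>x - y\<bar>) ` {(x, y)\<in>R \<times> R. x \<noteq> y})"
  have "finite {(x, y)\<in>R \<times> R. x \<noteq> y}"
    by (rule finite_subset[of _ "R \<times> R"]) (use assms in auto)
  then have D: "finite D" "D \<noteq> {}" by (simp_all add: D_def)
  have "0 < Min D" using D by (subst Min_gr_iff) (auto simp: D_def)
  moreover have "Min D \<le> \<bar>x - y\<bar>" if "x \<in> R" "y \<in> R" "x \<noteq> y" for x y
    using D that by (intro Min_le) (auto simp: D_def intro!: image_eqI[of _ _ "(x, y)"])
  ultimately show ?thesis by blast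
qed

text \<open>\<open>R\<close> stands for the set of drivers that moved. If just one moved, the step
  follows it when it starts from the present state; \<open>LEAST\<close> merely settles the choice
  in coarse cells.\<close>

definition chain_step :: "nat \<Rightarrow> (nat \<times> nat) set \<Rightarrow> nat" where
  "chain_step x R = (if \<exists>y. (x, y) \<in> R then LEAST y. (x, y) \<in> R else x)"

lemma jump_integral_unit:
  assumes N: "unit_jumps T N" and t: "t \<le> T"
  shows "jump_integral f (\<lambda>s. real (N s)) t = (\<Sum>u\<in>jump_set T N \<inter> {0<..t}. f u)"
proof -
  have c: "cadlag T N" using N by (simp add: unit_jumps_def)
  have j: "jump (\<lambda>s. real (N s)) u = real (N u) - real (left_lim N u)" if "0 < u" "u \<le> T" for u
    unfolding jump_def using left_lim_comp[OF c that, of real] by simp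
  have "jump_times (\<lambda>s. real (N s)) t = jump_set T N \<inter> {0<..t}"
  proof (intro set_eqI)
    fix u show "u \<in> jump_times (\<lambda>s. real (N s)) t \<longleftrightarrow> u \<in> jump_set T N \<inter> {0<..t}"
      using t j[of u] by (cases "0 < u \<and> u \<le> t") (auto simp: jump_times_def jump_set_def)
  qed
  then show ?thesis unfolding jump_integral_def
    using N j t by (intro sum.cong) (auto simp: unit_jumps_def jump_set_def)
qed

context cmc_setup
begin

abbreviation "NJ p \<omega> \<equiv> jump_set T (\<lambda>t. Np p t \<omega>)"
abbreviation "XJ \<omega> \<equiv> jump_set T (\<lambda>t. X t \<omega>)"
abbreviation "Xl \<omega> \<equiv> left_lim (\<lambda>t. X t \<omega>)"

text \<open>The path properties used later, on one event of full measure; the equation is stored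
  with its integrals already written as sums over driver jumps. Countably many intensity jumps mean
  that left limits may replace values under a Lebesgue integral.\<close>

definition "good \<omega> \<longleftrightarrow> \<omega> \<in> space Q \<and> cadlag T (\<lambda>t. X t \<omega>) \<and> X 0 \<omega> = \<xi> \<omega> \<and>
  (\<forall>t\<in>{0..T}. real (X t \<omega>) = real (\<xi> \<omega>) +
     (\<Sum>p\<in>I. \<Sum>u\<in>NJ p \<omega> \<inter> {0<..t}. (real (snd p) - real (fst p)) * of_bool (Xl \<omega> u = fst p))) \<and>
  (\<forall>p\<in>I. unit_jumps T (\<lambda>t. Np p t \<omega>) \<and> countable (jump_times (\<lambda>t. Lp p t \<omega>) T) \<and>
     (\<forall>q\<in>I. p \<noteq> q \<longrightarrow> NJ p \<omega> \<inter> NJ q \<omega> = {}))"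

lemma AE_good: "AE \<omega> in Q. good \<omega>"
proof -
  have "AE \<omega> in Q. \<forall>p\<in>I. unit_jumps T (\<lambda>t. Np p t \<omega>)"
    using finite_I AE_unit_jumps by (intro AE_finite_allI) auto
  moreover have "AE \<omega> in Q. \<forall>p\<in>I. countable (jump_times (\<lambda>t. Lp p t \<omega>) T)"
    using canonical by (intro AE_finite_allI finite_I) (auto simp: canonical_conditions_def)
  moreover have "AE \<omega> in Q. \<forall>p\<in>I. \<forall>q\<in>I. p \<noteq> q \<longrightarrow> NJ p \<omega> \<inter> NJ q \<omega> = {}"
  proof (intro AE_finite_allI finite_I)
    fix p q assume "p \<in> I" "q \<in> I"
    then show "AE \<omega> in Q. p \<noteq> q \<longrightarrow> NJ p \<omega> \<inter> NJ q \<omega> = {}"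
      using AE_no_common_jumps[of p q] by (cases "p = q") auto
  qed
  moreover note X_SDE[unfolded solves_SDE_def] AE_space
  ultimately show ?thesis
  proof eventually_elim
    case (elim \<omega>)
    have "real (X t \<omega>) = real (\<xi> \<omega>) +
     (\<Sum>p\<in>I. \<Sum>u\<in>NJ p \<omega> \<inter> {0<..t}. (real (snd p) - real (fst p)) * of_bool (Xl \<omega> u = fst p))" if t: "t \<in> {0..T}" for t
    proof -
      have "real (X t \<omega>) = real (\<xi> \<omega>) + (\<Sum>(x, y)\<in>I.
          jump_integral (\<lambda>u. (real y - real x) * of_bool (left_lim (\<lambda>s. X s \<omega>) u = x)) (\<lambda>s. real (N x y s \<omega>)) t)"
        using elim(4) t by auto
      also have "(\<Sum>(x, y)\<in>I.
          jump_integral (\<lambda>u. (real y - real x) * of_bool (left_lim (\<lambda>s. X s \<omega>) u = x)) (\<lambda>s. real (N x y s \<omega>)) t) =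
         (\<Sum>p\<in>I. \<Sum>u\<in>NJ p \<omega> \<inter> {0<..t}. (real (snd p) - real (fst p)) * of_bool (Xl \<omega> u = fst p))"
      proof (intro sum.cong refl)
        fix p assume p: "p \<in> I"
        show "(case p of (x, y) \<Rightarrow>
          jump_integral (\<lambda>u. (real y - real x) * of_bool (left_lim (\<lambda>s. X s \<omega>) u = x)) (\<lambda>s. real (N x y s \<omega>)) t) =
          (\<Sum>u\<in>NJ p \<omega> \<inter> {0<..t}. (real (snd p) - real (fst p)) * of_bool (Xl \<omega> u = fst p))"
          unfolding case_prod_beta
          using elim(1) p t by (intro jump_integral_unit) auto
      qed
      finally show ?thesis .
    qed
    then show ?case unfolding good_def using elim by auto
  qed
qed

lemma good_space: "good \<omega> \<Longrightarrow> \<omega> \<in> space Q"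
  and good_cadlag: "good \<omega> \<Longrightarrow> cadlag T (\<lambda>t. X t \<omega>)"
  and good_0: "good \<omega> \<Longrightarrow> X 0 \<omega> = \<xi> \<omega>"
  and good_unit: "good \<omega> \<Longrightarrow> p \<in> I \<Longrightarrow> unit_jumps T (\<lambda>t. Np p t \<omega>)"
  and good_countable: "good \<omega> \<Longrightarrow> p \<in> I \<Longrightarrow> countable (jump_times (\<lambda>t. Lp p t \<omega>) T)"
  and good_disjoint: "good \<omega> \<Longrightarrow> p \<in> I \<Longrightarrow> q \<in> I \<Longrightarrow> w \<in> NJ p \<omega> \<Longrightarrow> w \<in> NJ q \<omega> \<Longrightarrow> p = q"
  unfolding good_def by auto

lemma good_SDE: "good \<omega> \<Longrightarrow> 0 \<le> t \<Longrightarrow> t \<le> T \<Longrightarrow> real (X t \<omega>) = real (\<xi> \<omega>) +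
     (\<Sum>p\<in>I. \<Sum>u\<in>NJ p \<omega> \<inter> {0<..t}. (real (snd p) - real (fst p)) * of_bool (Xl \<omega> u = fst p))"
  unfolding good_def by auto

lemma finite_NJ: "good \<omega> \<Longrightarrow> p \<in> I \<Longrightarrow> finite (NJ p \<omega>)"
  using good_unit[of \<omega> p] finite_jump_set by (auto simp: unit_jumps_def)

definition "NJs \<omega> = (\<Union>p\<in>I. NJ p \<omega>)"

lemma finite_NJs: "good \<omega> \<Longrightarrow> finite (NJs \<omega>)"
  unfolding NJs_def using finite_I finite_NJ by auto

text \<open>Subtracting the equation at a time just before \<open>w\<close> from the equation at
  \<open>w\<close> isolates the terms at \<open>w\<close>.\<close>

lemma X_jump_sum:
  assumes g: "good \<omega>" and w: "0 < w" "w \<le> T"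
  shows "real (X w \<omega>) - real (Xl \<omega> w) =
    (\<Sum>p\<in>I. if w \<in> NJ p \<omega> \<and> Xl \<omega> w = fst p then real (snd p) - real (fst p) else 0)"
proof -
  have "0 \<le> w" using w by simp
  from cadlag_left_const[OF good_cadlag[OF g] this w(2)]
  obtain d where d: "d > 0" "\<And>s. 0 \<le> s \<Longrightarrow> w - d < s \<Longrightarrow> s < w \<Longrightarrow> X s \<omega> = Xl \<omega> w" by blast
  obtain \<delta> where \<delta>: "\<delta> > 0" "\<And>x y. x \<in> insert w (NJs \<omega>) \<Longrightarrow> y \<in> insert w (NJs \<omega>) \<Longrightarrow> x \<noteq> y \<Longrightarrow> \<delta> \<le> \<bar>x - y\<bar>"
    using finite_separated[of "insert w (NJs \<omega>)"] finite_NJs[OF g] by auto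
  \<comment> \<open>\<open>w / 2\<close> keeps \<open>s\<close> positive, \<open>w - d / 2\<close>
    puts it where the path already has its left limit, and \<open>w - \<delta> / 2\<close> after
    every driver jump preceding \<open>w\<close>.\<close>
  define s where "s = max (w / 2) (max (w - d / 2) (w - \<delta> / 2))"
  have s: "0 < s" "s < w" "w - d < s" "w - \<delta> < s" using w d \<delta> by (auto simp: s_def)
  have Xs: "X s \<omega> = Xl \<omega> w" by (rule d(2)) (use s in auto)
  have cell: "NJ p \<omega> \<inter> {s<..w} = (if w \<in> NJ p \<omega> then {w} else {})" if p: "p \<in> I" for p
  proof -
    have "u = w" if "u \<in> NJ p \<omega>" "s < u" "u \<le> w" for u
      using \<delta>(2)[of u w] that p s by (force simp: NJs_def)
    then show ?thesis using s(2) by (cases "w \<in> NJ p \<omega>") (auto, blast+)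
  qed
  have "real (X w \<omega>) - real (X s \<omega>) =
    (\<Sum>p\<in>I. (\<Sum>u\<in>NJ p \<omega> \<inter> {0<..w}. (real (snd p) - real (fst p)) * of_bool (Xl \<omega> u = fst p)) -
      (\<Sum>u\<in>NJ p \<omega> \<inter> {0<..s}. (real (snd p) - real (fst p)) * of_bool (Xl \<omega> u = fst p)))"
    using good_SDE[OF g, of w] good_SDE[OF g, of s] w s by (simp add: sum_subtractf)
  also have "\<dots> = (\<Sum>p\<in>I. if w \<in> NJ p \<omega> \<and> Xl \<omega> w = fst p then real (snd p) - real (fst p) else 0)"
  proof (intro sum.cong refl)
    fix p assume p: "p \<in> I"
    have "NJ p \<omega> \<inter> {0<..w} = NJ p \<omega> \<inter> {0<..s} \<union> NJ p \<omega> \<inter> {s<..w}" using s by auto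
    then have "(\<Sum>u\<in>NJ p \<omega> \<inter> {0<..w}. (real (snd p) - real (fst p)) * of_bool (Xl \<omega> u = fst p)) =
      (\<Sum>u\<in>NJ p \<omega> \<inter> {0<..s}. (real (snd p) - real (fst p)) * of_bool (Xl \<omega> u = fst p)) +
      (\<Sum>u\<in>NJ p \<omega> \<inter> {s<..w}. (real (snd p) - real (fst p)) * of_bool (Xl \<omega> u = fst p))"
      using finite_NJ[OF g p] by (simp only:) (subst sum.union_disjoint, auto)
    then show "(\<Sum>u\<in>NJ p \<omega> \<inter> {0<..w}. (real (snd p) - real (fst p)) * of_bool (Xl \<omega> u = fst p)) -
      (\<Sum>u\<in>NJ p \<omega> \<inter> {0<..s}. (real (snd p) - real (fst p)) * of_bool (Xl \<omega> u = fst p)) =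
      (if w \<in> NJ p \<omega> \<and> Xl \<omega> w = fst p then real (snd p) - real (fst p) else 0)"
      unfolding cell[OF p] by simp
  qed
  finally show ?thesis unfolding Xs .
qed

lemma X_jump:
  assumes g: "good \<omega>" and w: "0 < w" "w \<le> T" and p: "p \<in> I" "w \<in> NJ p \<omega>" "Xl \<omega> w = fst p"
  shows "X w \<omega> = snd p"
proof -
  have "(\<Sum>q\<in>I. if w \<in> NJ q \<omega> \<and> Xl \<omega> w = fst q then real (snd q) - real (fst q) else 0) =
    (\<Sum>q\<in>{p}. if w \<in> NJ q \<omega> \<and> Xl \<omega> w = fst q then real (snd q) - real (fst q) else 0)"
  proof (rule sum.mono_neutral_right[OF finite_I])
    have "w \<notin> NJ q \<omega>" if "q \<in> I" "q \<noteq> p" for q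
      using good_disjoint[OF g that(1) p(1) _ p(2)] that(2) by blast
    then show "\<forall>q\<in>I - {p}. (if w \<in> NJ q \<omega> \<and> Xl \<omega> w = fst q then real (snd q) - real (fst q) else 0) = 0"
      by simp
  qed (use p in simp)
  then show ?thesis using X_jump_sum[OF g w] p by simp
qed

lemma X_no_jump:
  assumes g: "good \<omega>" and w: "0 < w" "w \<le> T" and p: "\<And>p. p \<in> I \<Longrightarrow> w \<in> NJ p \<omega> \<Longrightarrow> Xl \<omega> w \<noteq> fst p"
  shows "X w \<omega> = Xl \<omega> w"
proof -
  have "(\<Sum>q\<in>I. if w \<in> NJ q \<omega> \<and> Xl \<omega> w = fst q then real (snd q) - real (fst q) else 0) = 0"
    using p by (intro sum.neutral) auto
  then show ?thesis using X_jump_sum[OF g w] by simp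
qed

lemma XJ_NJs: "good \<omega> \<Longrightarrow> XJ \<omega> \<subseteq> NJs \<omega>"
  using X_no_jump[of \<omega>] by (force simp: jump_set_def[of T "\<lambda>t. X t \<omega>"] NJs_def)

lemma X_in_S:
  assumes g: "good \<omega>" and t: "0 \<le> t" "t \<le> T"
  shows "X t \<omega> \<in> S"
proof -
  have "X 0 \<omega> \<in> S \<longrightarrow> X t \<omega> \<in> S"
    using good_cadlag[OF g] order_refl t
  proof (induction rule: cadlag_Bolzano[where P = "\<lambda>a b. X a \<omega> \<in> S \<longrightarrow> X b \<omega> \<in> S"])
    case (single a x b)
    show ?case
    proof (cases "X x \<omega> = Xl \<omega> x")
      case True then show ?thesis using single by auto
    next
      case False
      then obtain p where "p \<in> I" "x \<in> NJ p \<omega>" "Xl \<omega> x = fst p" using X_no_jump[OF g, of x] single by auto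
      then have "X x \<omega> = snd p" "snd p \<in> S" using X_jump[OF g, of x p] single I_D by auto
      then show ?thesis using single by auto
    qed
  qed auto
  then show ?thesis using good_0[OF g] \<xi>(2)[OF good_space[OF g]] by simp
qed

text \<open>Written with natural subtraction so that it is a function of driver increments alone;
  this makes it measurable for the noise after \<open>l\<close>.\<close>

definition "changed l h \<omega> = {p\<in>I. Np p h \<omega> - Np p l \<omega> \<noteq> 0}"

lemma changed_iff:
  assumes "good \<omega>" "p \<in> I" "0 \<le> l" "l \<le> h" "h \<le> T"
  shows "p \<in> changed l h \<omega> \<longleftrightarrow> NJ p \<omega> \<inter> {l<..h} \<noteq> {}"
  using unit_jumps_increment[OF good_unit[OF assms(1,2)] assms(3-5)] finite_NJ[OF assms(1,2)] assms(2)
  by (auto simp: changed_def)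

lemma X_cell:
  assumes g: "good \<omega>" and ab: "0 \<le> l" "l \<le> h" "h \<le> T"
    and one: "\<And>u v. u \<in> NJs \<omega> \<inter> {l<..h} \<Longrightarrow> v \<in> NJs \<omega> \<inter> {l<..h} \<Longrightarrow> u = v"
  shows "X h \<omega> = chain_step (X l \<omega>) (changed l h \<omega>)"
proof (cases "NJs \<omega> \<inter> {l<..h} = {}")
  case True
  then have "XJ \<omega> \<inter> {l<..h} = {}" using XJ_NJs[OF g] by auto
  then have "X h \<omega> = X l \<omega>" using cadlag_const[OF good_cadlag[OF g] ab] by simp
  moreover have "changed l h \<omega> = {}"
    using True changed_iff[OF g _ ab] by (fastforce simp: NJs_def changed_def)
  ultimately show ?thesis by (simp add: chain_step_def)
next
  case False
  then obtain w where w: "w \<in> NJs \<omega>" "l < w" "w \<le> h" by auto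
  have only: "u = w" if "u \<in> NJs \<omega>" "l < u" "u \<le> h" for u using one[of u w] w that by auto
  obtain p where p: "p \<in> I" "w \<in> NJ p \<omega>" using w by (auto simp: NJs_def)
  have w0: "0 < w" "w \<le> T" using w ab by auto
  have nX: "u \<notin> XJ \<omega>" if "l < u" "u \<le> h" "u \<noteq> w" for u
    using only[of u] subsetD[OF XJ_NJs[OF g], of u] that by blast
  have "XJ \<omega> \<inter> {l<..<w} = {}" "XJ \<omega> \<inter> {w<..h} = {}" using nX w by auto
  then have Xa: "Xl \<omega> w = X l \<omega>" and Xb: "X h \<omega> = X w \<omega>"
    using w ab left_lim_const[OF good_cadlag[OF g], of l w] cadlag_const[OF good_cadlag[OF g], of w h] by auto
  have ch: "changed l h \<omega> = {p}"
  proof (intro set_eqI iffI)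
    fix q assume q: "q \<in> changed l h \<omega>"
    then have qI: "q \<in> I" by (simp add: changed_def)
    then obtain u where "u \<in> NJ q \<omega>" "l < u" "u \<le> h" using q changed_iff[OF g qI ab] by auto
    then have "w \<in> NJ q \<omega>" using only[of u] qI by (auto simp: NJs_def)
    then show "q \<in> {p}" using good_disjoint[OF g qI p(1) _ p(2)] by simp
  next
    fix q assume "q \<in> {p}"
    then show "q \<in> changed l h \<omega>" using changed_iff[OF g p(1) ab] p w by auto
  qed
  show ?thesis
  proof (cases "X l \<omega> = fst p")
    case True
    then have "X w \<omega> = snd p" using X_jump[OF g w0 p] Xa by simp
    moreover have "chain_step (fst p) {p} = snd p"
      by (cases p) (auto simp: chain_step_def intro!: Least_equality)
    ultimately show ?thesis using Xb True ch by simp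
  next
    case False
    have "X w \<omega> = Xl \<omega> w"
    proof (rule X_no_jump[OF g w0])
      fix q assume "q \<in> I" "w \<in> NJ q \<omega>"
      then have "q = p" using good_disjoint[OF g _ p(1) _ p(2)] by simp
      then show "Xl \<omega> w \<noteq> fst q" using False Xa by simp
    qed
    moreover have "chain_step (X l \<omega>) {p} = X l \<omega>" using False by (auto simp: chain_step_def)
    ultimately show ?thesis using Xb Xa ch by simp
  qed
qed

text \<open>The scheme sees the noise only through its increments over cells, and the starting state
  is a parameter.\<close>

primrec euler :: "real \<Rightarrow> real \<Rightarrow> nat \<Rightarrow> nat \<Rightarrow> nat \<Rightarrow> 'a \<Rightarrow> nat" where
  "euler s v n x 0 \<omega> = x"
| "euler s v n x (Suc i) \<omega> = chain_step (euler s v n x i \<omega>) (changed (grid s v n i) (grid s v n (Suc i)) \<omega>)"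

text \<open>Once the mesh is below the least distance between driver jumps, each cell contains at
  most one, and the scheme is exact at all grid points.\<close>

lemma euler_eventually:
  assumes g: "good \<omega>" and sv: "0 \<le> s" "s \<le> v" "v \<le> T"
  shows "\<forall>\<^sub>F n in sequentially. euler s v (Suc n) (X s \<omega>) (Suc n) \<omega> = X v \<omega>"
proof -
  obtain \<delta> where \<delta>: "\<delta> > 0" "\<And>x y. x \<in> NJs \<omega> \<Longrightarrow> y \<in> NJs \<omega> \<Longrightarrow> x \<noteq> y \<Longrightarrow> \<delta> \<le> \<bar>x - y\<bar>"
    using finite_separated[OF finite_NJs[OF g]] by blast
  have "(\<lambda>n. (v - s) / real (Suc n)) \<longlonglongrightarrow> 0" by (rule LIMSEQ_Suc[OF lim_const_over_n])
  then have "\<forall>\<^sub>F n in sequentially. (v - s) / real (Suc n) < \<delta>" using \<delta>(1) by (rule order_tendstoD)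
  then show ?thesis
  proof eventually_elim
    case (elim n)
    have "euler s v (Suc n) (X s \<omega>) i \<omega> = X (grid s v (Suc n) i) \<omega>" if "i \<le> Suc n" for i
      using that
    proof (induction i)
      case (Suc i)
      let ?g = "grid s v (Suc n)"
      have h: "0 \<le> ?g i" "?g i \<le> ?g (Suc i)" "?g (Suc i) \<le> T"
        using grid_bounds[of s v i "Suc n"] grid_bounds[of s v "Suc i" "Suc n"] grid_mono[of s v i "Suc i"] Suc.prems sv by auto
      have "X (?g (Suc i)) \<omega> = chain_step (X (?g i) \<omega>) (changed (?g i) (?g (Suc i)) \<omega>)"
      proof (rule X_cell[OF g h])
        fix x y assume xy: "x \<in> NJs \<omega> \<inter> {?g i<..?g (Suc i)}" "y \<in> NJs \<omega> \<inter> {?g i<..?g (Suc i)}"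
        then have "\<bar>x - y\<bar> < \<delta>" using elim grid_Suc[of s v "Suc n" i] by auto
        then show "x = y" using \<delta>(2)[of x y] xy by force
      qed
      then show ?case using Suc by simp
    qed simp
    from this[of "Suc n"] show ?case by simp
  qed
qed

lemma changed_measurable:
  assumes "\<And>p. p \<in> I \<Longrightarrow> (\<lambda>\<omega>. Np p h \<omega> - Np p l \<omega>) \<in> measurable M (count_space UNIV)"
  shows "changed l h \<in> measurable M (count_space (Pow I))"
proof -
  have "changed l h -` {R} \<inter> space M \<in> sets M" if R: "R \<in> Pow I" for R
  proof -
    have eq: "changed l h -` {R} \<inter> space M = {\<omega>\<in>space M. \<forall>p\<in>I. Np p h \<omega> - Np p l \<omega> \<noteq> 0 \<longleftrightarrow> p \<in> R}"
    proof -
      have "changed l h \<omega> = R \<longleftrightarrow> (\<forall>p\<in>I. Np p h \<omega> - Np p l \<omega> \<noteq> 0 \<longleftrightarrow> p \<in> R)" for \<omega>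
        using R unfolding changed_def by blast
      then show ?thesis by auto
    qed
    have "{\<omega>\<in>space M. Np p h \<omega> - Np p l \<omega> \<noteq> 0 \<longleftrightarrow> p \<in> R} \<in> sets M" if "p \<in> I" for p
      using measurable_sets[OF assms[OF that], of "{k. k \<noteq> 0 \<longleftrightarrow> p \<in> R}"]
      by (auto simp: vimage_def Int_def conj_commute not_le)
    then show ?thesis unfolding eq using finite_I by (intro sets.sets_Collect_finite_All) auto
  qed
  then show ?thesis
    using finite_I by (subst measurable_count_space_eq2) (auto simp: changed_def)
qed

lemma euler_measurable:
  assumes "\<And>j. j < i \<Longrightarrow> changed (grid s v n j) (grid s v n (Suc j)) \<in> measurable M (count_space (Pow I))"
  shows "euler s v n x i \<in> measurable M (count_space UNIV)"
  using assms
proof (induction i)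
  case (Suc i)
  have 1: "(\<lambda>\<omega>. chain_step k (changed (grid s v n i) (grid s v n (Suc i)) \<omega>)) \<in> measurable M (count_space UNIV)" for k
    by (rule measurable_compose[OF Suc.prems]) auto
  have 2: "euler s v n x i \<in> measurable M (count_space UNIV)" using Suc by simp
  show ?case using measurable_compose_countable[OF 1 2] by simp
qed (simp add: measurable_const cong: measurable_cong)

text \<open>Defined for every \<omega> as a limit over grids, so that measurability needs the
  increments after \<open>s\<close> only. Keeping the state at \<open>s\<close> as a parameter
  separates the future noise from the past.\<close>

definition "chain_from s x v \<omega> = nat \<lfloor>lim (\<lambda>n. real (euler s v (Suc n) x (Suc n) \<omega>))\<rfloor>"

lemma chain_from_eq:
  assumes "good \<omega>" "0 \<le> s" "s \<le> v" "v \<le> T" "X s \<omega> = x"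
  shows "chain_from s x v \<omega> = X v \<omega>"
proof -
  have "\<forall>\<^sub>F n in sequentially. real (euler s v (Suc n) x (Suc n) \<omega>) = real (X v \<omega>)"
    using euler_eventually[OF assms(1-4)] assms(5) by (auto elim: eventually_mono)
  then have "(\<lambda>n. real (euler s v (Suc n) x (Suc n) \<omega>)) \<longlonglongrightarrow> real (X v \<omega>)" by (rule tendsto_eventually)
  then show ?thesis unfolding chain_from_def by (simp add: limI)
qed

lemma chain_from_measurable:
  assumes "\<And>l h. s \<le> l \<Longrightarrow> l \<le> h \<Longrightarrow> h \<le> v \<Longrightarrow> changed l h \<in> measurable M (count_space (Pow I))" "s \<le> v"
  shows "chain_from s x v \<in> measurable M (count_space UNIV)"
proof -
  have e: "euler s v (Suc n) x (Suc n) \<in> measurable M (count_space UNIV)" for n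
  proof (rule euler_measurable, rule assms(1))
    fix j assume "j < Suc n"
    then show "s \<le> grid s v (Suc n) j" "grid s v (Suc n) j \<le> grid s v (Suc n) (Suc j)" "grid s v (Suc n) (Suc j) \<le> v"
      using grid_bounds[of s v j "Suc n"] grid_bounds[of s v "Suc j" "Suc n"] grid_mono[of s v j "Suc j"] assms(2) by auto
  qed
  have "(\<lambda>\<omega>. real (euler s v (Suc n) x (Suc n) \<omega>)) \<in> borel_measurable M" for n
    by (rule measurable_compose[OF e]) simp
  then have "(\<lambda>\<omega>. lim (\<lambda>n. real (euler s v (Suc n) x (Suc n) \<omega>))) \<in> borel_measurable M"
    by (rule borel_measurable_lim_metric)
  then show ?thesis unfolding chain_from_def[abs_def] by measurable
qed

lemma changed_measurable_G:
  assumes "0 \<le> l" "l \<le> h" "h \<le> v" "v \<le> T"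
  shows "changed l h \<in> measurable (G v) (count_space (Pow I))"
  by (intro changed_measurable measurable_diff_nat Np_G) (use assms in auto)

lemma null_complete:
  assumes "subalgebra Q A" "null_sets Q \<subseteq> sets A" "g \<in> measurable A M" "\<And>\<omega>. good \<omega> \<Longrightarrow> f \<omega> = g \<omega>" "f \<in> space Q \<rightarrow> space M"
  shows "f \<in> measurable A M"
  using AE_good assms(4) by (intro measurable_AE_eq_complete[OF complete assms(1-3) _ assms(5)]) (auto elim: eventually_mono)

lemma G_sub: "subalgebra Q (G t)" using G_events by (simp add: subalgebra_def)

text \<open>The solution is reconstructed from \<xi> and the noise; as \<xi> takes countably many
  values, it can be inserted for the starting state.\<close>

lemma X_G:
  assumes "0 \<le> v" "v \<le> T"
  shows "X v \<in> measurable (G v) (count_space UNIV)"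
proof (rule null_complete[OF G_sub null_G])
  have "chain_from 0 x v \<in> measurable (G v) (count_space UNIV)" for x
    using changed_measurable_G assms by (intro chain_from_measurable) auto
  then show "(\<lambda>\<omega>. chain_from 0 (\<xi> \<omega>) v \<omega>) \<in> measurable (G v) (count_space UNIV)"
    by (rule measurable_compose_countable[OF _ \<xi>_G_meas])
qed (use assms good_0 in \<open>auto simp: chain_from_eq\<close>)

end

section \<open>The density process\<close>

lemma path_dens_nonneg:
  assumes "\<And>u. s < u \<Longrightarrow> u \<le> t \<Longrightarrow> 0 \<le> \<phi> u"
  shows "0 \<le> path_dens a \<phi> J s t"
  unfolding path_dens_def using assms by (intro mult_nonneg_nonneg prod_nonneg) (auto simp: exp_neg_def)

lemma path_dens_same [simp]: "path_dens a \<phi> J s s = 1"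
  by (simp add: path_dens_def exp_neg_def path_int_def)

text \<open>The integrand is affine in \<open>\<phi>\<close> except at 0, where the left limit is a
  mere convention; that single point is carried along explicitly and contributes nothing.\<close>

lemma set_integrable_path_int:
  fixes f g \<phi> :: "real \<Rightarrow> real"
  assumes lim: "\<And>u. 0 < u \<Longrightarrow> u \<le> t \<Longrightarrow> (g \<longlongrightarrow> \<phi> u) (at_left u)"
    and nn: "\<And>u. 0 < u \<Longrightarrow> u \<le> t \<Longrightarrow> 0 \<le> \<phi> u" and a: "0 < a" and t: "0 \<le> t"
    and f: "\<And>u. 0 < u \<Longrightarrow> u \<le> t \<Longrightarrow> f u = a * (\<phi> u - 1)"
  shows "set_integrable lborel {0..t} f \<longleftrightarrow> path_int \<phi> 0 t < \<infinity>"
    and "path_int \<phi> 0 t < \<infinity> \<Longrightarrow> set_lebesgue_integral lborel {0..t} f = a * enn2real (path_int \<phi> 0 t) - a * t"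
proof -
  let ?h = "\<lambda>u. indicator {0<..t} u * \<phi> u"
  have hm: "?h \<in> borel_measurable borel" by (rule left_limits_measurable[OF lim])
  have h0: "0 \<le> ?h u" for u using nn by (auto simp: indicator_def)
  have int0: "integrable lborel (\<lambda>u. f 0 * indicator {0::real} u)"
    by (intro integrable_mult_right integrable_real_indicator) auto
  have int1: "integrable lborel (\<lambda>u. a * indicator {0<..t} u)"
    using t by (intro integrable_mult_right integrable_real_indicator) auto
  have eq: "indicator {0..t} u *\<^sub>R f u = a * ?h u + (f 0 * indicator {0} u - a * indicator {0<..t} u)" for u
    using f[of u] t by (auto simp: indicator_def algebra_simps)
  have int01: "integrable lborel (\<lambda>u. f 0 * indicator {0} u - a * indicator {0<..t} u)"
    using int0 int1 by (rule Bochner_Integration.integrable_diff)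
  have "set_integrable lborel {0..t} f \<longleftrightarrow> integrable lborel (\<lambda>u. a * ?h u)"
  proof
    assume "set_integrable lborel {0..t} f"
    then have "integrable lborel (\<lambda>u. indicator {0..t} u *\<^sub>R f u - (f 0 * indicator {0} u - a * indicator {0<..t} u))"
      unfolding set_integrable_def by (rule Bochner_Integration.integrable_diff[OF _ int01])
    then show "integrable lborel (\<lambda>u. a * ?h u)" by (simp only: eq add_diff_cancel_right')
  next
    assume "integrable lborel (\<lambda>u. a * ?h u)"
    then have "integrable lborel (\<lambda>u. a * ?h u + (f 0 * indicator {0} u - a * indicator {0<..t} u))"
      by (rule Bochner_Integration.integrable_add[OF _ int01])
    then show "set_integrable lborel {0..t} f" unfolding set_integrable_def by (simp only: eq)
  qed
  also have "\<dots> \<longleftrightarrow> integrable lborel ?h" using a by (intro integrable_mult_left_iff[THEN trans]) auto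
  also have "\<dots> \<longleftrightarrow> path_int \<phi> 0 t < \<infinity>"
    using hm h0 by (auto simp: integrable_iff_bounded path_int_def)
  finally show iff: "set_integrable lborel {0..t} f \<longleftrightarrow> path_int \<phi> 0 t < \<infinity>" .
  assume fin: "path_int \<phi> 0 t < \<infinity>"
  then have hi: "integrable lborel ?h" using hm h0 by (auto simp: integrable_iff_bounded path_int_def)
  have "set_lebesgue_integral lborel {0..t} f = (\<integral>u. a * ?h u + (f 0 * indicator {0} u - a * indicator {0<..t} u) \<partial>lborel)"
    unfolding set_lebesgue_integral_def by (simp only: eq)
  also have "\<dots> = a * (\<integral>u. ?h u \<partial>lborel) + (f 0 * (\<integral>u. indicator {0::real} u \<partial>lborel) - a * (\<integral>u. indicator {0<..t} u \<partial>lborel))"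
    using hi int0 int1 int01 by (simp only: Bochner_Integration.integral_add[OF integrable_mult_right[OF hi] int01]
        Bochner_Integration.integral_diff[OF int0 int1] integral_mult_right_zero)
  also have "\<dots> = a * (\<integral>u. ?h u \<partial>lborel) - a * t" using t by simp
  also have "(\<integral>u. ?h u \<partial>lborel) = enn2real (path_int \<phi> 0 t)"
    unfolding path_int_def using h0 hi
    by (simp add: nn_integral_eq_integral Bochner_Integration.integral_nonneg)
  finally show "set_lebesgue_integral lborel {0..t} f = a * enn2real (path_int \<phi> 0 t) - a * t" .
qed

lemma exp_neg_integral_eq:
  fixes f g \<phi> :: "real \<Rightarrow> real"
  assumes "\<And>u. 0 < u \<Longrightarrow> u \<le> t \<Longrightarrow> (g \<longlongrightarrow> \<phi> u) (at_left u)"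
    and "\<And>u. 0 < u \<Longrightarrow> u \<le> t \<Longrightarrow> 0 \<le> \<phi> u" and "0 < a" and "0 \<le> t"
    and "\<And>u. 0 < u \<Longrightarrow> u \<le> t \<Longrightarrow> f u = a * (\<phi> u - 1)"
  shows "exp_neg_integral t f = exp (a * (t - 0)) * exp_neg a (path_int \<phi> 0 t)"
  using set_integrable_path_int[OF assms]
  by (auto simp: exp_neg_integral_def exp_neg_def less_top simp flip: exp_add)

lemma left_lim_card:
  fixes R :: "real set"
  assumes R: "finite R" and u: "0 < u" "u \<le> T" and f: "\<And>t. 0 \<le> t \<Longrightarrow> t \<le> T \<Longrightarrow> f t = real (card (R \<inter> {0<..t}))"
  shows "jump f u = of_bool (u \<in> R)"
proof -
  obtain \<delta> where \<delta>: "\<delta> > 0" "\<And>x y. x \<in> insert u R \<Longrightarrow> y \<in> insert u R \<Longrightarrow> x \<noteq> y \<Longrightarrow> \<delta> \<le> \<bar>x - y\<bar>"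
    using finite_separated[of "insert u R"] R by auto
  have "left_lim f u = real (card (R \<inter> {0<..<u}))"
  proof (rule left_lim_eq[OF u(1)], rule tendsto_eventually)
    have eq: "f s = real (card (R \<inter> {0<..<u}))" if s: "max 0 (u - \<delta>) < s" "s < u" for s
    proof -
      have "R \<inter> {0<..s} = R \<inter> {0<..<u}"
      proof (intro set_eqI iffI)
        fix r assume r: "r \<in> R \<inter> {0<..<u}"
        then have "\<delta> \<le> \<bar>u - r\<bar>" using \<delta>(2)[of u r] by auto
        then show "r \<in> R \<inter> {0<..s}" using r s by auto
      qed (use s in auto)
      then show ?thesis using f[of s] s u by simp
    qed
    have "max 0 (u - \<delta>) < u" using u \<delta>(1) by simp
    then show "\<forall>\<^sub>F s in at_left u. f s = real (card (R \<inter> {0<..<u}))"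
      unfolding eventually_at_left_field using eq by blast
  qed
  moreover have "R \<inter> {0<..u} = (if u \<in> R then insert u (R \<inter> {0<..<u}) else R \<inter> {0<..<u})"
    using u by (auto simp: le_less)
  then have "card (R \<inter> {0<..u}) = card (R \<inter> {0<..<u}) + of_bool (u \<in> R)" using R by auto
  ultimately show ?thesis unfolding jump_def using f[of u] u by simp
qed

context cmc_setup
begin

text \<open>Only drivers leaving the current state are reweighted; elsewhere the factor is 1 and the
  driver keeps its rate. \<open>psi\<close> is the adapted version sampled on grids;
  \<open>phi\<close> is its left limit, one plus the left limit of the state indicator times
  \<open>kappa\<close>.\<close>

definition "psi p u \<omega> = 1 + of_bool (X u \<omega> = fst p) * (Lp p u \<omega> / ap p - 1)"
definition "phi p \<omega> u = 1 + of_bool (Xl \<omega> u = fst p) * (left_lim (\<lambda>u. Lp p u \<omega>) u / ap p - 1)"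

lemma \<Lambda>_F:
  assumes "x \<in> S" "y \<in> S" "0 \<le> u" "u \<le> T"
  shows "\<Lambda> x y u \<in> borel_measurable (F u)"
proof -
  have "(\<lambda>(u, \<omega>). \<Lambda> x y u \<omega>) \<in> borel_measurable (restrict_space borel {0..u} \<Otimes>\<^sub>M F u)"
    using canonical assms unfolding canonical_conditions_def progressively_measurable_def by auto
  moreover have "Pair u \<in> measurable (F u) (restrict_space borel {0..u} \<Otimes>\<^sub>M F u)"
    using assms by (intro measurable_Pair1') (auto simp: space_restrict_space)
  ultimately have "(\<lambda>\<omega>. (\<lambda>(u, \<omega>). \<Lambda> x y u \<omega>) (u, \<omega>)) \<in> borel_measurable (F u)"
    by (rule measurable_compose[rotated])
  then show ?thesis by simp
qed

lemma \<Lambda>_nonneg: "p \<in> I \<Longrightarrow> 0 \<le> u \<Longrightarrow> u \<le> T \<Longrightarrow> \<omega> \<in> space Q \<Longrightarrow> 0 \<le> Lp p u \<omega>"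
  using canonical by (auto simp: canonical_conditions_def)

lemma \<Lambda>_left:
  assumes "p \<in> I" "0 < u" "u \<le> T" "\<omega> \<in> space Q"
  shows "((\<lambda>u. Lp p u \<omega>) \<longlongrightarrow> left_lim (\<lambda>u. Lp p u \<omega>) u) (at_left u)"
proof -
  have "\<exists>l. ((\<lambda>u. Lp p u \<omega>) \<longlongrightarrow> l) (at_left u)"
    using canonical assms by (auto simp: canonical_conditions_def case_prod_beta)
  then show ?thesis using assms(2) by (intro tendsto_left_lim)
qed

lemma left_lim_nonneg:
  fixes f :: "real \<Rightarrow> real"
  assumes "(f \<longlongrightarrow> l) (at_left u)" "s < u" "\<And>v. s \<le> v \<Longrightarrow> v < u \<Longrightarrow> 0 \<le> f v"
  shows "0 \<le> l"
proof (rule tendsto_lowerbound[OF assms(1)])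
  show "\<forall>\<^sub>F x in at_left u. 0 \<le> f x"
    unfolding eventually_at_left_field using assms by (intro exI[of _ s]) auto
qed simp

lemma F_J: "f \<in> measurable (F s) M \<Longrightarrow> 0 \<le> s \<Longrightarrow> s \<le> t \<Longrightarrow> t \<le> T \<Longrightarrow> f \<in> measurable (J t) M"
  by (erule measurable_mono_sets) (use F_mono[of s t] J_upper(1)[of t] in auto)

lemma G_J: "f \<in> measurable (G s) M \<Longrightarrow> s \<le> t \<Longrightarrow> 0 \<le> t \<Longrightarrow> t \<le> T \<Longrightarrow> f \<in> measurable (J t) M"
  by (erule measurable_mono_sets) (use G_mono[of s t] J_upper(2)[of t] in auto)

lemma J_K_meas: "f \<in> measurable (J s) M \<Longrightarrow> 0 \<le> s \<Longrightarrow> s \<le> T \<Longrightarrow> s \<le> t \<Longrightarrow> f \<in> measurable (K t) M"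
  by (erule measurable_mono_sets) (use J_K[of s] K_mono[of s t] in auto)

lemma X_J: "0 \<le> s \<Longrightarrow> s \<le> t \<Longrightarrow> t \<le> T \<Longrightarrow> X s \<in> measurable (J t) (count_space UNIV)"
  by (intro G_J[OF X_G]) auto

lemma of_bool_measurable:
  assumes "f \<in> measurable M (count_space (UNIV :: nat set))"
  shows "(\<lambda>\<omega>. of_bool (f \<omega> = x) :: real) \<in> borel_measurable M"
  by (rule measurable_compose[OF assms]) simp

lemma psi_J:
  assumes "p \<in> I" "0 \<le> u" "u \<le> t" "t \<le> T"
  shows "psi p u \<in> borel_measurable (J t)"
proof -
  have "Lp p u \<in> borel_measurable (J t)" using assms I_D by (intro F_J[OF \<Lambda>_F]) auto
  moreover have "(\<lambda>\<omega>. of_bool (X u \<omega> = fst p) :: real) \<in> borel_measurable (J t)"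
    using assms by (intro of_bool_measurable X_J)
  ultimately show ?thesis unfolding psi_def[abs_def] by measurable
qed

lemma psi_K: "p \<in> I \<Longrightarrow> 0 \<le> u \<Longrightarrow> u \<le> T \<Longrightarrow> psi p u \<in> borel_measurable (K u)"
  by (rule J_K_meas[OF psi_J[of p u u]]) auto

lemma psi_nonneg: "p \<in> I \<Longrightarrow> 0 \<le> u \<Longrightarrow> u \<le> T \<Longrightarrow> \<omega> \<in> space Q \<Longrightarrow> 0 \<le> psi p u \<omega>"
  using \<Lambda>_nonneg[of p u \<omega>] ap_pos[of p] by (simp add: psi_def)

lemma X_left: "good \<omega> \<Longrightarrow> 0 < u \<Longrightarrow> u \<le> T \<Longrightarrow>
    ((\<lambda>u. of_bool (X u \<omega> = x) :: real) \<longlongrightarrow> of_bool (Xl \<omega> u = x)) (at_left u)"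
  by (rule tendsto_left_lim_comp[OF good_cadlag])

lemma psi_left:
  assumes "good \<omega>" "p \<in> I" "0 < u" "u \<le> T"
  shows "((\<lambda>u. psi p u \<omega>) \<longlongrightarrow> phi p \<omega> u) (at_left u)"
  unfolding psi_def phi_def
  using ap_pos[OF assms(2)]
  by (intro tendsto_intros X_left \<Lambda>_left assms good_space[OF assms(1)]) auto

lemma phi_nonneg: "good \<omega> \<Longrightarrow> p \<in> I \<Longrightarrow> 0 < u \<Longrightarrow> u \<le> T \<Longrightarrow> 0 \<le> phi p \<omega> u"
  by (rule left_lim_nonneg[OF psi_left, of _ _ _ 0]) (auto intro: psi_nonneg good_space)

text \<open>\<open>Z\<close> is read off the path and carries the algebra; \<open>Zh\<close> is
  measurable by construction and carries the integrals. They agree on good paths.\<close>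

definition "Z s t \<omega> = path_density phi s t \<omega>"
definition "Zh = lim_density psi"

lemma Z_nonneg: "good \<omega> \<Longrightarrow> 0 \<le> s \<Longrightarrow> t \<le> T \<Longrightarrow> 0 \<le> Z s t \<omega>"
  unfolding Z_def path_density_def by (intro prod_nonneg path_dens_nonneg ballI phi_nonneg) auto

lemma Zh_eq: "good \<omega> \<Longrightarrow> 0 \<le> s \<Longrightarrow> s \<le> t \<Longrightarrow> t \<le> T \<Longrightarrow> Zh s t \<omega> = ennreal (Z s t \<omega>)"
  unfolding Zh_def Z_def by (intro lim_density_eq good_unit psi_left psi_nonneg good_space) auto

lemma Z_split: "good \<omega> \<Longrightarrow> 0 \<le> s \<Longrightarrow> s \<le> t \<Longrightarrow> t \<le> v \<Longrightarrow> v \<le> T \<Longrightarrow> Z s v \<omega> = Z s t \<omega> * Z t v \<omega>"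
  unfolding Z_def path_density_def prod.distrib[symmetric]
proof (rule prod.cong[OF refl])
  fix p assume h: "good \<omega>" "0 \<le> s" "s \<le> t" "t \<le> v" "v \<le> T" and p: "p \<in> I"
  show "path_dens (ap p) (phi p \<omega>) (NJ p \<omega>) s v =
      path_dens (ap p) (phi p \<omega>) (NJ p \<omega>) s t * path_dens (ap p) (phi p \<omega>) (NJ p \<omega>) t v"
    using h p psi_left[OF h(1) p] finite_NJ[OF h(1) p]
    by (intro path_dens_split[where f = "\<lambda>u. psi p u \<omega>"]) auto
qed

lemma Z_same [simp]: "Z s s \<omega> = 1" by (simp add: Z_def path_density_def)

lemma Np_J: "p \<in> I \<Longrightarrow> 0 \<le> s \<Longrightarrow> s \<le> t \<Longrightarrow> t \<le> T \<Longrightarrow> Np p s \<in> measurable (J t) (count_space UNIV)"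
  by (rule G_J[OF Np_G]) auto

lemma Zh_J: "0 \<le> s \<Longrightarrow> s \<le> t \<Longrightarrow> t \<le> T \<Longrightarrow> Zh s t \<in> borel_measurable (J t)"
  unfolding Zh_def by (intro lim_density_measurable measurable_diff_nat psi_J Np_J) auto

lemma Zh_K: "0 \<le> s \<Longrightarrow> s \<le> t \<Longrightarrow> t \<le> T \<Longrightarrow> Zh s t \<in> borel_measurable (K t)"
  by (rule J_K_meas[OF Zh_J]) auto

text \<open>The transitions from x to y are exactly the jumps of their driver that find the chain in
  x, since distinct drivers never jump together. At the remaining driver jumps \<open>phi\<close> is
  1, so the two products coincide.\<close>

lemma doleans_eq_Z:
  assumes g: "good \<omega>"
  shows "doleans_density T S \<Lambda> a X \<omega> = Z 0 T \<omega>"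
  unfolding doleans_density_def Z_def path_density_def case_prod_beta
proof (rule prod.cong[OF refl])
  fix p assume p: "p \<in> I"
  let ?x = "fst p" and ?y = "snd p"
  note Xc = good_cadlag[OF g]
  have xy: "?x \<noteq> ?y" using I_D(3)[OF p] .
  have Hl: "left_lim (state_ind X z \<omega>) u = of_bool (Xl \<omega> u = z)" if "0 < u" "u \<le> T" for u z
    unfolding state_ind_def using left_lim_comp[OF Xc that, of "\<lambda>k. of_bool (k = z)"] by simp
  define R where "R = {u. 0 < u \<and> u \<le> T \<and> Xl \<omega> u = ?x \<and> X u \<omega> = ?y}"
  have "R \<subseteq> XJ \<omega>" using xy by (auto simp: R_def jump_set_def)
  then have Rfin: "finite R" using finite_jump_set[OF Xc] finite_subset by blast
  have RN: "{w\<in>NJ p \<omega>. Xl \<omega> w = ?x} = R"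
  proof (intro set_eqI iffI)
    fix w assume w: "w \<in> {w\<in>NJ p \<omega>. Xl \<omega> w = ?x}"
    then have "0 < w" "w \<le> T" by (auto simp: jump_set_def)
    then show "w \<in> R" using X_jump[OF g _ _ p, of w] w by (auto simp: R_def)
  next
    fix w assume w: "w \<in> R"
    then have w': "0 < w" "w \<le> T" "X w \<omega> \<noteq> Xl \<omega> w" "Xl \<omega> w = ?x" "X w \<omega> = ?y" using xy by (auto simp: R_def)
    then obtain q where q: "q \<in> I" "w \<in> NJ q \<omega>" "Xl \<omega> w = fst q" using X_no_jump[OF g, of w] by blast
    then have "snd q = ?y" using X_jump[OF g w'(1,2) q] w' by simp
    then have "q = p" using q w' by (simp add: prod_eq_iff)
    then show "w \<in> {w\<in>NJ p \<omega>. Xl \<omega> w = ?x}" using q by simp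
  qed
  have tc: "transition_count X ?x ?y \<omega> t = real (card (R \<inter> {0<..t}))" if t: "0 \<le> t" "t \<le> T" for t
  proof -
    let ?J = "jump_times (state_ind X ?y \<omega>) t"
    have j: "jump (state_ind X ?y \<omega>) u = of_bool (X u \<omega> = ?y) - of_bool (Xl \<omega> u = ?y)" if "0 < u" "u \<le> T" for u
      using Hl[OF that] by (simp add: jump_def state_ind_def)
    have "?J \<subseteq> XJ \<omega>"
    proof
      fix u assume u: "u \<in> ?J"
      then have "0 < u" "u \<le> T" using t by (auto simp: jump_times_def)
      then show "u \<in> XJ \<omega>" using u j[of u] by (auto simp: jump_times_def jump_set_def)
    qed
    then have Jfin: "finite ?J" using finite_jump_set[OF Xc] finite_subset by blast
    have "transition_count X ?x ?y \<omega> t = (\<Sum>u\<in>?J. of_bool (u \<in> R))"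
      unfolding transition_count_def jump_integral_def
    proof (rule sum.cong[OF refl])
      fix u assume "u \<in> ?J"
      then have u: "0 < u" "u \<le> T" "jump (state_ind X ?y \<omega>) u \<noteq> 0" using t by (auto simp: jump_times_def)
      then show "left_lim (state_ind X ?x \<omega>) u * jump (state_ind X ?y \<omega>) u = of_bool (u \<in> R)"
        using Hl[OF u(1,2)] j[OF u(1,2)] xy by (auto simp: R_def split: if_splits)
    qed
    also have "\<dots> = real (card (?J \<inter> R))"
      using Jfin by (simp add: of_bool_def sum.If_cases Int_def)
    also have "?J \<inter> R = R \<inter> {0<..t}"
      using t j xy by (auto simp: jump_times_def R_def)
    finally show ?thesis .
  qed
  have jtc: "jump (transition_count X ?x ?y \<omega>) u = of_bool (u \<in> R)" if "0 < u" "u \<le> T" for u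
    using left_lim_card[OF Rfin that tc] .
  have jt: "jump_times (transition_count X ?x ?y \<omega>) T = R"
    using jtc by (auto simp: jump_times_def R_def)
  have "(\<Prod>u\<in>jump_times (transition_count X ?x ?y \<omega>) T.
      1 + kappa \<Lambda> a ?x ?y \<omega> u * jump (transition_count X ?x ?y \<omega>) u) = (\<Prod>u\<in>R. phi p \<omega> u)"
    unfolding jt by (intro prod.cong refl) (auto simp: jtc R_def phi_def kappa_def)
  also have "\<dots> = (\<Prod>w\<in>NJ p \<omega>. phi p \<omega> w)"
    unfolding RN[symmetric] using finite_NJ[OF g p] by (intro prod.mono_neutral_left) (auto simp: phi_def)
  also have "NJ p \<omega> = NJ p \<omega> \<inter> {0<..T}" by (auto simp: jump_set_def)
  finally have 1: "(\<Prod>u\<in>jump_times (transition_count X ?x ?y \<omega>) T.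
      1 + kappa \<Lambda> a ?x ?y \<omega> u * jump (transition_count X ?x ?y \<omega>) u) = (\<Prod>w\<in>NJ p \<omega> \<inter> {0<..T}. phi p \<omega> w)" .
  have 2: "exp_neg_integral T (\<lambda>u. left_lim (state_ind X ?x \<omega>) u * ap p * kappa \<Lambda> a ?x ?y \<omega> u) =
      exp (ap p * (T - 0)) * exp_neg (ap p) (path_int (phi p \<omega>) 0 T)"
    using psi_left[OF g p] phi_nonneg[OF g p] ap_pos[OF p] T_pos Hl
    by (intro exp_neg_integral_eq[where g = "\<lambda>u. psi p u \<omega>"]) (auto simp: phi_def kappa_def)
  show "exp_neg_integral T (\<lambda>u. left_lim (state_ind X ?x \<omega>) u * ap p * kappa \<Lambda> a ?x ?y \<omega> u) *
    (\<Prod>u\<in>jump_times (transition_count X ?x ?y \<omega>) T. 1 + kappa \<Lambda> a ?x ?y \<omega> u * jump (transition_count X ?x ?y \<omega>) u) =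
    path_dens (ap p) (phi p \<omega>) (NJ p \<omega>) 0 T"
    unfolding 1 2 path_dens_def ..
qed

end

lemma (in prob_space) cond_prob_charact:
  assumes A: "subalgebra M A" and E: "{\<omega>\<in>space M. E \<omega>} \<in> events"
    and f: "f \<in> borel_measurable A" "AE \<omega> in M. 0 \<le> f \<omega>"
    and eq: "\<And>C. C \<in> sets A \<Longrightarrow> (\<integral>\<^sup>+\<omega>. indicator C \<omega> * ennreal (f \<omega>) \<partial>M) = emeasure M (C \<inter> {\<omega>\<in>space M. E \<omega>})"
  shows "AE \<omega> in M. cond_prob_alg M A E \<omega> = f \<omega>"
proof -
  interpret finite_measure_subalgebra M A using A by unfold_locales
  let ?E = "{\<omega>\<in>space M. E \<omega>}"
  have fM: "f \<in> borel_measurable M" by (rule measurable_from_subalg[OF A f(1)])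
  have "(\<integral>\<^sup>+\<omega>. ennreal (f \<omega>) \<partial>M) = emeasure M ?E"
    using eq[of "space A"] A by (simp add: subalgebra_def Int_absorb1 cong: nn_integral_cong_simp)
  then have fi: "integrable M f"
    using f(2) fM by (intro integrableI_nonneg) (auto simp: emeasure_eq_measure)
  have Ei: "integrable M (indicator ?E :: _ \<Rightarrow> real)"
    using E by (intro integrable_real_indicator) (auto simp: emeasure_eq_measure)
  show ?thesis unfolding cond_prob_alg_def
  proof (rule real_cond_exp_charact[OF _ Ei fi f(1)])
    fix C assume C: "C \<in> sets A"
    then have CM: "C \<in> events" using A by (auto simp: subalgebra_def)
    have "ennreal (set_lebesgue_integral M C f) = (\<integral>\<^sup>+\<omega>. ennreal (indicator C \<omega> * f \<omega>) \<partial>M)"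
      unfolding set_lebesgue_integral_def using fi CM f(2)
      by (subst nn_integral_eq_integral) (auto intro!: integrable_real_mult_indicator simp: mult.commute elim!: eventually_mono)
    also have "\<dots> = (\<integral>\<^sup>+\<omega>. indicator C \<omega> * ennreal (f \<omega>) \<partial>M)"
      by (intro nn_integral_cong) (auto simp: indicator_def)
    also have "\<dots> = ennreal (prob (C \<inter> ?E))" using eq[OF C] by (simp add: emeasure_eq_measure)
    finally have "set_lebesgue_integral M C f = prob (C \<inter> ?E)"
      using f(2) unfolding set_lebesgue_integral_def
      by (subst (asm) ennreal_inj) (auto intro!: integral_nonneg_AE elim!: eventually_mono)
    moreover have "set_lebesgue_integral M C (indicator ?E) = prob (C \<inter> ?E)"
    proof -
      have "set_lebesgue_integral M C (indicator ?E) = (\<integral>\<omega>. indicator (C \<inter> ?E) \<omega> \<partial>M)"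
        unfolding set_lebesgue_integral_def by (intro Bochner_Integration.integral_cong) (auto simp: indicator_def)
      also have "\<dots> = prob (C \<inter> ?E)" using CM E by (simp add: Int_absorb2 sets.sets_into_space sets.Int)
      finally show ?thesis .
    qed
    ultimately show "set_lebesgue_integral M C (indicator ?E) = set_lebesgue_integral M C f" by simp
  qed
qed

section \<open>The change of measure\<close>

context cmc_setup
begin

lemma \<mu>_F: "x \<in> S \<Longrightarrow> 0 \<le> t \<Longrightarrow> t \<le> T \<Longrightarrow> \<mu> x \<in> borel_measurable (F t)"
  using \<mu>_measurable by (rule measurable_mono_sets) (use F_mono[of 0 t] in auto)

lemma \<xi>_cond_emeasure:
  assumes x: "x \<in> S" and C: "C \<in> sets (F T)"
  shows "(\<integral>\<^sup>+\<omega>. indicator C \<omega> * ennreal (\<mu> x \<omega>) \<partial>Q) = emeasure Q (C \<inter> {\<omega>\<in>space Q. \<xi> \<omega> = x})"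
proof -
  let ?E = "{\<omega>\<in>space Q. \<xi> \<omega> = x}"
  have EQ: "?E \<in> events" using measurable_sets[OF \<xi>(1), of "{x}"] by (auto simp: vimage_def Int_def conj_commute)
  have sub: "subalgebra Q (F T)" using F_sub(1) T_pos by simp
  then interpret FT: finite_measure_subalgebra Q "F T" by unfold_locales
  have CQ: "C \<in> events" using C sub by (auto simp: subalgebra_def)
  have \<mu>Q: "\<mu> x \<in> borel_measurable Q" using \<mu>_F[OF x, of T] T_pos by (intro measurable_from_subalg[OF sub]) auto
  have "(\<integral>\<^sup>+\<omega>. indicator C \<omega> * ennreal (\<mu> x \<omega>) \<partial>Q) = (\<integral>\<^sup>+\<omega>. ennreal (indicator C \<omega> * \<mu> x \<omega>) \<partial>Q)"
    by (intro nn_integral_cong) (auto simp: indicator_def)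
  also have "\<dots> = ennreal (\<integral>\<omega>. indicator C \<omega> * \<mu> x \<omega> \<partial>Q)"
  proof (rule nn_integral_eq_integral)
    show "integrable Q (\<lambda>\<omega>. indicator C \<omega> * \<mu> x \<omega>)"
    proof (rule integrable_const_bound[where B = 1])
      show "AE \<omega> in Q. norm (indicator C \<omega> * \<mu> x \<omega>) \<le> 1"
        using \<mu>_range[OF x] by (intro AE_I2) (auto simp: indicator_def)
    qed (use CQ \<mu>Q in simp)
    show "AE \<omega> in Q. 0 \<le> indicator C \<omega> * \<mu> x \<omega>" using \<mu>_range[OF x] by (intro AE_I2) (auto simp: indicator_def)
  qed
  also have "(\<integral>\<omega>. indicator C \<omega> * \<mu> x \<omega> \<partial>Q) = (\<integral>\<omega>. indicator C \<omega> * real_cond_exp Q (F T) (indicator ?E) \<omega> \<partial>Q)"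
  proof (rule integral_cong_AE)
    show "AE \<omega> in Q. indicator C \<omega> * \<mu> x \<omega> = indicator C \<omega> * real_cond_exp Q (F T) (indicator ?E) \<omega>"
      using \<xi>_cond[OF x] unfolding cond_prob_alg_def by eventually_elim simp
    have "real_cond_exp Q (F T) (indicator ?E) \<in> borel_measurable Q" by (rule borel_measurable_cond_exp2)
    then show "(\<lambda>\<omega>. indicator C \<omega> * real_cond_exp Q (F T) (indicator ?E) \<omega>) \<in> borel_measurable Q"
      using CQ by simp
  qed (use CQ \<mu>Q in simp)
  also have "\<dots> = (\<integral>\<omega>. indicator C \<omega> * indicator ?E \<omega> \<partial>Q)"
  proof (rule FT.real_cond_exp_intg(2))
    have "integrable Q (indicator (C \<inter> ?E) :: _ \<Rightarrow> real)"
      using CQ EQ by (intro integrable_real_indicator) (auto simp: emeasure_eq_measure)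
    then show "integrable Q (\<lambda>\<omega>. indicator C \<omega> * indicator ?E \<omega> :: real)"
      by (rule Bochner_Integration.integrable_cong[THEN iffD1, rotated 2]) (auto simp: indicator_inter_arith)
  qed (use C EQ in auto)
  also have "\<dots> = prob (C \<inter> ?E)"
    using expect_ind[of "C \<inter> ?E"] CQ EQ by (simp only: indicator_inter_arith sets.Int)
  finally show ?thesis by (simp add: emeasure_eq_measure)
qed

end

locale cmc_change = cmc_setup +
  fixes \<theta> :: "'a \<Rightarrow> real" and P :: "'a measure"
  assumes \<theta>_def: "\<theta> = doleans_density T S \<Lambda> a X"
    and \<theta>_mean: "expectation \<theta> = 1"
    and P_def: "P = density (restr_to_subalg Q (join_alg (F T) (G T))) (\<lambda>\<omega>. ennreal (\<theta> \<omega>))"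
begin

lemma \<theta>_Z: "good \<omega> \<Longrightarrow> \<theta> \<omega> = Z 0 T \<omega>"
  by (simp add: \<theta>_def doleans_eq_Z)

lemma \<theta>_nonneg: "good \<omega> \<Longrightarrow> 0 \<le> \<theta> \<omega>"
  by (simp add: \<theta>_Z Z_nonneg)

lemma \<theta>_Zh: "good \<omega> \<Longrightarrow> ennreal (\<theta> \<omega>) = Zh 0 T \<omega>"
  using T_pos by (simp add: \<theta>_Z Zh_eq)

lemma \<theta>_K: "\<theta> \<in> borel_measurable (K T)"
proof (rule null_complete[OF K_sub null_K])
  show "(\<lambda>\<omega>. enn2real (Zh 0 T \<omega>)) \<in> borel_measurable (K T)"
    using Zh_K[of 0 T] T_pos by auto
  show "\<theta> \<omega> = enn2real (Zh 0 T \<omega>)" if "good \<omega>" for \<omega>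
    using \<theta>_Zh[OF that, symmetric] \<theta>_nonneg[OF that] by simp
qed simp

lemma \<theta>_Q: "\<theta> \<in> borel_measurable Q" by (rule K_Q[OF \<theta>_K])

lemma \<theta>_integral: "(\<integral>\<^sup>+\<omega>. ennreal (\<theta> \<omega>) \<partial>Q) = 1"
proof -
  have "integrable Q \<theta>" using \<theta>_mean not_integrable_integral_eq[of Q \<theta>] by fastforce
  moreover have "AE \<omega> in Q. 0 \<le> \<theta> \<omega>" using AE_good by eventually_elim (rule \<theta>_nonneg)
  ultimately show ?thesis using \<theta>_mean by (simp add: nn_integral_eq_integral)
qed

lemma Zh_supermartingale:
  assumes "0 \<le> s" "s \<le> t" "t \<le> T" "V \<in> borel_measurable (K s)"
  shows "(\<integral>\<^sup>+\<omega>. V \<omega> * Zh s t \<omega> \<partial>Q) \<le> (\<integral>\<^sup>+\<omega>. V \<omega> \<partial>Q)"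
  unfolding Zh_def using assms psi_K psi_nonneg by (intro lim_density_supermartingale) auto

lemma \<theta>_split: "good \<omega> \<Longrightarrow> 0 \<le> s \<Longrightarrow> s \<le> T \<Longrightarrow> ennreal (\<theta> \<omega>) = Zh 0 s \<omega> * Zh s T \<omega>"
  using Z_split[of \<omega> 0 s T] by (simp add: \<theta>_Z Zh_eq Z_nonneg ennreal_mult)

text \<open>The supermartingale has constant expectation, hence is a martingale.\<close>

lemma Zh_martingale:
  assumes s: "0 \<le> s" "s \<le> T" and V: "V \<in> borel_measurable (K s)"
  shows "(\<integral>\<^sup>+\<omega>. ennreal (\<theta> \<omega>) * V \<omega> \<partial>Q) = (\<integral>\<^sup>+\<omega>. Zh 0 s \<omega> * V \<omega> \<partial>Q)"
proof (rule nn_integral_eq_on_generator[OF K_sub _ _ _ _ _ _ _ V])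
  show "sets (K s) = sigma_sets (space Q) (sets (K s))" using sets.sigma_sets_eq[of "K s"] by simp
  show "Int_stable (sets (K s))" by (rule sets.Int_stable)
  show "space Q \<in> sets (K s)" using sets.top[of "K s"] by simp
  show "(\<lambda>\<omega>. ennreal (\<theta> \<omega>)) \<in> borel_measurable Q" using \<theta>_Q by simp
  show ZQ: "Zh 0 s \<in> borel_measurable Q" using K_Q[OF Zh_K] s by auto
  show "(\<integral>\<^sup>+\<omega>. ennreal (\<theta> \<omega>) \<partial>Q) < \<infinity>" by (simp add: \<theta>_integral)
  fix C assume C: "C \<in> sets (K s)"
  have le: "(\<integral>\<^sup>+\<omega>. ennreal (\<theta> \<omega>) * indicator C \<omega> \<partial>Q) \<le> (\<integral>\<^sup>+\<omega>. Zh 0 s \<omega> * indicator C \<omega> \<partial>Q)"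
    if C: "C \<in> sets (K s)" for C
  proof -
    have "(\<integral>\<^sup>+\<omega>. ennreal (\<theta> \<omega>) * indicator C \<omega> \<partial>Q) = (\<integral>\<^sup>+\<omega>. (Zh 0 s \<omega> * indicator C \<omega>) * Zh s T \<omega> \<partial>Q)"
      using AE_good by (intro nn_integral_cong_AE) (auto elim!: eventually_mono simp: \<theta>_split[OF _ s] mult_ac)
    also have "\<dots> \<le> (\<integral>\<^sup>+\<omega>. Zh 0 s \<omega> * indicator C \<omega> \<partial>Q)"
      using s C Zh_K[of 0 s] by (intro Zh_supermartingale) auto
    finally show ?thesis .
  qed
  let ?D = "space Q - C"
  have D: "?D \<in> sets (K s)" using sets.compl_sets[OF C] by simp
  have CQ: "C \<in> events" using C K_events by auto
  have split: "(\<integral>\<^sup>+\<omega>. f \<omega> * indicator C \<omega> \<partial>Q) + (\<integral>\<^sup>+\<omega>. f \<omega> * indicator ?D \<omega> \<partial>Q) = (\<integral>\<^sup>+\<omega>. f \<omega> \<partial>Q)"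
    if "f \<in> borel_measurable Q" for f
    using that CQ by (subst nn_integral_add[symmetric]) (auto intro!: nn_integral_cong simp: indicator_def)
  have "(\<integral>\<^sup>+\<omega>. Zh 0 s \<omega> \<partial>Q) \<le> 1"
    using Zh_supermartingale[of 0 s "\<lambda>_. 1"] s by (simp add: emeasure_space_1)
  then have "(\<integral>\<^sup>+\<omega>. Zh 0 s \<omega> * indicator C \<omega> \<partial>Q) + (\<integral>\<^sup>+\<omega>. Zh 0 s \<omega> * indicator ?D \<omega> \<partial>Q) \<le>
     (\<integral>\<^sup>+\<omega>. ennreal (\<theta> \<omega>) * indicator C \<omega> \<partial>Q) + (\<integral>\<^sup>+\<omega>. ennreal (\<theta> \<omega>) * indicator ?D \<omega> \<partial>Q)"
    using split[OF ZQ] split[of "\<lambda>\<omega>. ennreal (\<theta> \<omega>)"] \<theta>_Q \<theta>_integral by simp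
  also have "\<dots> \<le> (\<integral>\<^sup>+\<omega>. ennreal (\<theta> \<omega>) * indicator C \<omega> \<partial>Q) + (\<integral>\<^sup>+\<omega>. Zh 0 s \<omega> * indicator ?D \<omega> \<partial>Q)"
    by (intro add_left_mono le D)
  finally have "(\<integral>\<^sup>+\<omega>. Zh 0 s \<omega> * indicator ?D \<omega> \<partial>Q) + (\<integral>\<^sup>+\<omega>. Zh 0 s \<omega> * indicator C \<omega> \<partial>Q)
      \<le> (\<integral>\<^sup>+\<omega>. Zh 0 s \<omega> * indicator ?D \<omega> \<partial>Q) + (\<integral>\<^sup>+\<omega>. ennreal (\<theta> \<omega>) * indicator C \<omega> \<partial>Q)"
    by (simp add: add.commute)
  moreover have "(\<integral>\<^sup>+\<omega>. Zh 0 s \<omega> * indicator ?D \<omega> \<partial>Q) \<noteq> top"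
  proof -
    have "(\<integral>\<^sup>+\<omega>. Zh 0 s \<omega> * indicator ?D \<omega> \<partial>Q) \<le> (\<integral>\<^sup>+\<omega>. Zh 0 s \<omega> \<partial>Q)"
      by (intro nn_integral_mono) (auto simp: indicator_def)
    also have "\<dots> \<le> 1" by fact
    finally show ?thesis by (auto simp: top_unique)
  qed
  ultimately have "(\<integral>\<^sup>+\<omega>. Zh 0 s \<omega> * indicator C \<omega> \<partial>Q) \<le> (\<integral>\<^sup>+\<omega>. ennreal (\<theta> \<omega>) * indicator C \<omega> \<partial>Q)"
    by (simp add: ennreal_add_left_cancel_le)
  with le[OF C] show "(\<integral>\<^sup>+\<omega>. ennreal (\<theta> \<omega>) * indicator C \<omega> \<partial>Q) = (\<integral>\<^sup>+\<omega>. Zh 0 s \<omega> * indicator C \<omega> \<partial>Q)"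
    by (rule antisym)
qed

lemma P_K: "P = density (restr_to_subalg Q (K T)) (\<lambda>\<omega>. ennreal (\<theta> \<omega>))"
  by (simp add: P_def K_def)

lemma space_P [simp]: "space P = space Q" by (simp add: P_K space_restr_to_subalg)

lemma sets_P: "sets P = sets (K T)" by (simp add: P_K sets_restr_to_subalg[OF K_sub])

lemma P_nn_integral:
  assumes f: "f \<in> borel_measurable (K T)"
  shows "(\<integral>\<^sup>+\<omega>. f \<omega> \<partial>P) = (\<integral>\<^sup>+\<omega>. ennreal (\<theta> \<omega>) * f \<omega> \<partial>Q)"
proof -
  have m: "f \<in> borel_measurable (restr_to_subalg Q (K T))" "\<theta> \<in> borel_measurable (restr_to_subalg Q (K T))"
    using f \<theta>_K sets_restr_to_subalg[OF K_sub, of T] by (auto cong: measurable_cong_sets)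
  have "(\<integral>\<^sup>+\<omega>. f \<omega> \<partial>P) = (\<integral>\<^sup>+\<omega>. ennreal (\<theta> \<omega>) * f \<omega> \<partial>restr_to_subalg Q (K T))"
    unfolding P_K using m by (subst nn_integral_density) auto
  also have "\<dots> = (\<integral>\<^sup>+\<omega>. ennreal (\<theta> \<omega>) * f \<omega> \<partial>Q)"
    using f \<theta>_K by (intro nn_integral_subalgebra2[OF K_sub]) auto
  finally show ?thesis .
qed

lemma P_nn_integral_K:
  assumes s: "0 \<le> s" "s \<le> T" and f: "f \<in> borel_measurable (K s)"
  shows "(\<integral>\<^sup>+\<omega>. f \<omega> \<partial>P) = (\<integral>\<^sup>+\<omega>. Zh 0 s \<omega> * f \<omega> \<partial>Q)"
  using P_nn_integral[OF K_incr[OF f s(2)]] Zh_martingale[OF s f] by simp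

lemma AE_P:
  assumes "AE \<omega> in Q. R \<omega>"
  shows "AE \<omega> in P. R \<omega>"
proof -
  obtain Y where Y: "Y \<in> null_sets Q" "{\<omega>\<in>space Q. \<not> R \<omega>} \<subseteq> Y" using assms unfolding eventually_ae_filter by auto
  have YK: "Y \<in> sets (K T)" using null_K Y by auto
  have "(\<integral>\<^sup>+\<omega>. indicator Y \<omega> \<partial>P) = (\<integral>\<^sup>+\<omega>. ennreal (\<theta> \<omega>) * indicator Y \<omega> \<partial>Q)"
    using YK by (intro P_nn_integral) auto
  also have "\<dots> = (\<integral>\<^sup>+\<omega>. 0 \<partial>Q)"
    using AE_not_in[OF Y(1)] by (intro nn_integral_cong_AE) (auto elim!: eventually_mono)
  finally have "Y \<in> null_sets P" using YK by (intro null_setsI) (simp_all add: sets_P)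
  then show ?thesis using Y(2) unfolding eventually_ae_filter by auto
qed

lemma prob_P: "prob_space P"
proof
  have "emeasure P (space P) = (\<integral>\<^sup>+\<omega>. 1 \<partial>P)" by simp
  also have "\<dots> = 1" using P_nn_integral[of "\<lambda>_. 1"] \<theta>_integral by simp
  finally show "emeasure P (space P) = 1" .
qed

text \<open>A measure with density \<open>\<theta>\<close> does not charge the zeros of
  \<open>\<theta>\<close>. Positivity rules out an infinite integral in the exponent, so the
  intensities along the path are integrable almost surely under \<open>P\<close>.\<close>

lemma AE_P_good: "AE \<omega> in P. good \<omega> \<and> 0 < \<theta> \<omega>"
proof -
  have "AE \<omega> in P. 0 < \<theta> \<omega>"
  proof -
    have B: "{\<omega>\<in>space Q. \<theta> \<omega> \<le> 0} \<in> sets (K T)"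
      using \<theta>_K measurable_sets[OF \<theta>_K, of "{..0}"] by (auto simp: vimage_def Int_def conj_commute)
    have "emeasure P {\<omega>\<in>space Q. \<theta> \<omega> \<le> 0} = (\<integral>\<^sup>+\<omega>. ennreal (\<theta> \<omega>) * indicator {\<omega>\<in>space Q. \<theta> \<omega> \<le> 0} \<omega> \<partial>Q)"
      using B P_nn_integral[of "indicator {\<omega>\<in>space Q. \<theta> \<omega> \<le> 0}"] by (simp add: sets_P)
    also have "\<dots> = (\<integral>\<^sup>+\<omega>. 0 \<partial>Q)" by (intro nn_integral_cong) (auto simp: indicator_def ennreal_neg)
    finally have "{\<omega>\<in>space Q. \<theta> \<omega> \<le> 0} \<in> null_sets P" using B by (simp add: null_sets_def sets_P)
    then show ?thesis by (rule AE_I') (auto simp: not_less)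
  qed
  with AE_P[OF AE_good] show ?thesis by eventually_elim simp
qed

text \<open>The density process is 1 at time 0, and \<open>K 0\<close> already contains all of
  \<open>F T\<close> as well as the events of \<open>X 0\<close>.\<close>

lemma P_emeasure_K0:
  assumes C: "C \<in> sets (K 0)"
  shows "emeasure P C = emeasure Q C"
proof -
  have "emeasure P C = (\<integral>\<^sup>+\<omega>. indicator C \<omega> \<partial>P)"
    using C K_mono[of 0 T] T_pos by (simp add: sets_P subset_iff)
  also have "\<dots> = (\<integral>\<^sup>+\<omega>. Zh 0 0 \<omega> * indicator C \<omega> \<partial>Q)"
    using C T_pos by (intro P_nn_integral_K) auto
  also have "\<dots> = (\<integral>\<^sup>+\<omega>. indicator C \<omega> \<partial>Q)"
    using AE_good T_pos by (intro nn_integral_cong_AE) (auto elim!: eventually_mono simp: Zh_eq)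
  also have "\<dots> = emeasure Q C" using C K_events by (simp add: subset_iff)
  finally show ?thesis .
qed

lemma P_nn_integral_FT:
  assumes f: "f \<in> borel_measurable (F T)"
  shows "(\<integral>\<^sup>+\<omega>. f \<omega> \<partial>P) = (\<integral>\<^sup>+\<omega>. f \<omega> \<partial>Q)"
proof -
  have "f \<in> borel_measurable (K 0)"
    using f K_upper(1)[of 0] by (auto intro: measurable_mono_sets)
  then have "(\<integral>\<^sup>+\<omega>. f \<omega> \<partial>P) = (\<integral>\<^sup>+\<omega>. Zh 0 0 \<omega> * f \<omega> \<partial>Q)" using T_pos by (intro P_nn_integral_K) auto
  also have "\<dots> = (\<integral>\<^sup>+\<omega>. f \<omega> \<partial>Q)"
    using AE_good T_pos by (intro nn_integral_cong_AE) (auto elim!: eventually_mono simp: Zh_eq)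
  finally show ?thesis .
qed

lemma subalg_P: "subalgebra P A" if "space A = space Q" "sets A \<subseteq> sets (K T)"
  using that by (simp add: subalgebra_def sets_P)

lemma FT_sub_P: "0 \<le> t \<Longrightarrow> t \<le> T \<Longrightarrow> subalgebra P (F t)"
  using F_mono[of t T] K_upper(1)[of T] by (intro subalg_P) auto

lemma P_eq_Q_on_FT: "restr_to_subalg P (F T) = restr_to_subalg Q (F T)"
proof (rule measure_eqI)
  have sP: "subalgebra P (F T)" and sQ: "subalgebra Q (F T)" using FT_sub_P F_sub(1) T_pos by auto
  show "sets (restr_to_subalg P (F T)) = sets (restr_to_subalg Q (F T))"
    by (simp add: sets_restr_to_subalg[OF sP] sets_restr_to_subalg[OF sQ])
  fix A assume "A \<in> sets (restr_to_subalg P (F T))"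
  then have A: "A \<in> sets (F T)" by (simp add: sets_restr_to_subalg[OF sP])
  then have "emeasure P A = emeasure Q A" using K_upper(1) by (intro P_emeasure_K0) auto
  then show "emeasure (restr_to_subalg P (F T)) A = emeasure (restr_to_subalg Q (F T)) A"
    using A by (simp add: emeasure_restr_to_subalg[OF sP] emeasure_restr_to_subalg[OF sQ])
qed

text \<open>\<open>\<mu> x\<close> is \<open>F 0\<close>-measurable and satisfies the defining
  identity on all of \<open>F T\<close>, so it is a version of all three conditional probabilities.
  Under \<open>P\<close> the identity persists because it only involves events of
  \<open>K 0\<close>.\<close>

lemma initial_law:
  assumes x: "x \<in> S"
  shows "AE \<omega> in P.
    cond_prob_alg P (F T) (\<lambda>\<omega>. X 0 \<omega> = x) \<omega> = cond_prob_alg P (F 0) (\<lambda>\<omega>. X 0 \<omega> = x) \<omega> \<and>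
    cond_prob_alg P (F 0) (\<lambda>\<omega>. X 0 \<omega> = x) \<omega> = cond_prob_alg Q (F T) (\<lambda>\<omega>. X 0 \<omega> = x) \<omega>"
proof -
  interpret P: prob_space P by (rule prob_P)
  let ?E = "{\<omega>\<in>space Q. X 0 \<omega> = x}"
  have EK: "?E \<in> sets (K 0)"
    using measurable_sets[OF G_K[OF X_G[of 0]], of "{x}"] T_pos by (auto simp: vimage_def Int_def conj_commute)
  have EQ: "?E \<in> events" using EK K_events by auto
  have E\<xi>: "{\<omega>\<in>space Q. \<xi> \<omega> = x} \<in> events" using measurable_sets[OF \<xi>(1), of "{x}"] by (auto simp: vimage_def Int_def conj_commute)
  have AEx: "AE \<omega> in Q. X 0 \<omega> = \<xi> \<omega>" using AE_good by (auto elim!: eventually_mono simp: good_0)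
  have sub: "subalgebra Q (F T)" using F_sub(1) T_pos by simp
  then interpret FT: finite_measure_subalgebra Q "F T" by unfold_locales
  have cQ: "AE \<omega> in Q. cond_prob_alg Q (F T) (\<lambda>\<omega>. X 0 \<omega> = x) \<omega> = \<mu> x \<omega>"
  proof -
    have "AE \<omega> in Q. cond_prob_alg Q (F T) (\<lambda>\<omega>. X 0 \<omega> = x) \<omega> = cond_prob_alg Q (F T) (\<lambda>\<omega>. \<xi> \<omega> = x) \<omega>"
      unfolding cond_prob_alg_def using AEx EQ E\<xi>
      by (intro FT.real_cond_exp_cong) (auto elim!: eventually_mono simp: indicator_def)
    with \<xi>_cond[OF x] show ?thesis by eventually_elim simp
  qed
  have key: "(\<integral>\<^sup>+\<omega>. indicator C \<omega> * ennreal (\<mu> x \<omega>) \<partial>P) = emeasure P (C \<inter> ?E)" if C: "C \<in> sets (F T)" for C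
  proof -
    have "(\<integral>\<^sup>+\<omega>. indicator C \<omega> * ennreal (\<mu> x \<omega>) \<partial>P) = (\<integral>\<^sup>+\<omega>. indicator C \<omega> * ennreal (\<mu> x \<omega>) \<partial>Q)"
      using C \<mu>_F[OF x, of T] T_pos by (intro P_nn_integral_FT) auto
    also have "\<dots> = emeasure Q (C \<inter> {\<omega>\<in>space Q. \<xi> \<omega> = x})" by (rule \<xi>_cond_emeasure[OF x C])
    also have "\<dots> = emeasure Q (C \<inter> ?E)"
      using AEx C E\<xi> EQ sub by (intro emeasure_eq_AE) (auto elim!: eventually_mono simp: subalgebra_def)
    also have "\<dots> = emeasure P (C \<inter> ?E)"
      using C EK K_upper(1)[of 0] by (intro P_emeasure_K0[symmetric]) auto
    finally show ?thesis .
  qed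
  have main: "AE \<omega> in P. cond_prob_alg P (F t) (\<lambda>\<omega>. X 0 \<omega> = x) \<omega> = \<mu> x \<omega>" if t: "0 \<le> t" "t \<le> T" for t
  proof (rule P.cond_prob_charact[OF FT_sub_P[OF t]])
    show "{\<omega>\<in>space P. X 0 \<omega> = x} \<in> sets P" using EK K_mono[of 0 T] T_pos by (auto simp: sets_P)
    show "AE \<omega> in P. 0 \<le> \<mu> x \<omega>" using \<mu>_range[OF x] by (intro AE_I2) auto
    show "(\<integral>\<^sup>+\<omega>. indicator C \<omega> * ennreal (\<mu> x \<omega>) \<partial>P) = emeasure P (C \<inter> {\<omega>\<in>space P. X 0 \<omega> = x})"
      if "C \<in> sets (F t)" for C
      using key[of C] that F_mono[OF t(1,2)] by auto
  qed (rule \<mu>_F[OF x t])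
  have "AE \<omega> in P. cond_prob_alg P (F T) (\<lambda>\<omega>. X 0 \<omega> = x) \<omega> = \<mu> x \<omega>"
    "AE \<omega> in P. cond_prob_alg P (F 0) (\<lambda>\<omega>. X 0 \<omega> = x) \<omega> = \<mu> x \<omega>" using main T_pos by simp_all
  with AE_P[OF cQ] show ?thesis by eventually_elim simp
qed

end

section \<open>Conditional independence of past and future\<close>

lemma nn_integral_eq_on_subalgebra:
  fixes f g V :: "'a \<Rightarrow> ennreal"
  assumes W: "subalgebra M W" and fg: "f \<in> borel_measurable M" "g \<in> borel_measurable M"
    and eq: "\<And>A. A \<in> sets W \<Longrightarrow> (\<integral>\<^sup>+x. f x * indicator A x \<partial>M) = (\<integral>\<^sup>+x. g x * indicator A x \<partial>M)"
    and V: "V \<in> borel_measurable W"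
  shows "(\<integral>\<^sup>+x. f x * V x \<partial>M) = (\<integral>\<^sup>+x. g x * V x \<partial>M)"
proof -
  have sa: "subalgebra (density M h) W" for h using W by (simp add: subalgebra_def)
  have VM: "V \<in> borel_measurable M" by (rule measurable_from_subalg[OF W V])
  have "restr_to_subalg (density M f) W = restr_to_subalg (density M g) W"
  proof (rule measure_eqI)
    show "sets (restr_to_subalg (density M f) W) = sets (restr_to_subalg (density M g) W)"
      by (simp add: sets_restr_to_subalg[OF sa])
    fix A assume "A \<in> sets (restr_to_subalg (density M f) W)"
    then have A: "A \<in> sets W" by (simp add: sets_restr_to_subalg[OF sa])
    then have "A \<in> sets M" using W by (auto simp: subalgebra_def)
    then show "emeasure (restr_to_subalg (density M f) W) A = emeasure (restr_to_subalg (density M g) W) A"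
      using A eq[OF A] fg by (simp add: emeasure_restr_to_subalg[OF sa] emeasure_density)
  qed
  then have "(\<integral>\<^sup>+x. V x \<partial>restr_to_subalg (density M f) W) = (\<integral>\<^sup>+x. V x \<partial>restr_to_subalg (density M g) W)"
    by simp
  then show ?thesis
    using fg V VM by (simp add: nn_integral_subalgebra2[OF sa V] nn_integral_density)
qed

lemma sets_AE_eq_complete:
  assumes M: "complete_measure M" and A: "subalgebra M A" "null_sets M \<subseteq> sets A"
    and B: "B \<in> sets A" and eq: "AE x in M. x \<in> C \<longleftrightarrow> x \<in> B" and C: "C \<subseteq> space A"
  shows "C \<in> sets A"
proof -
  have "(\<lambda>x. x \<in> C) \<in> measurable A (count_space UNIV)"
    by (rule measurable_AE_eq_complete[OF M A _ eq]) (use B in auto)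
  then have "{x\<in>space A. x \<in> C} \<in> sets A" by (rule predE)
  then show ?thesis using C by (simp add: Int_absorb1 flip: Int_def Collect_conj_eq)
qed

context cmc_setup
begin

text \<open>Integer increments, so that differences of arbitrary prescribed values need no case
  distinction.\<close>

definition "incr_is p u v z = {\<omega>\<in>space Q. int (Np p v \<omega>) = int (Np p u \<omega>) + z}"

lemma incr_is_measurable:
  assumes "Np p u \<in> measurable M (count_space UNIV)" "Np p v \<in> measurable M (count_space UNIV)" "space M = space Q"
  shows "incr_is p u v z \<in> sets M"
proof -
  have "incr_is p u v z = (\<Union>j. (Np p u -` {j} \<inter> space M) \<inter> (Np p v -` {k. int k = int j + z} \<inter> space M))"
    using assms(3) by (auto simp: incr_is_def)
  moreover have "(Np p u -` {j} \<inter> space M) \<inter> (Np p v -` {k. int k = int j + z} \<inter> space M) \<in> sets M" for j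
    by (rule sets.Int[OF measurable_sets[OF assms(1)] measurable_sets[OF assms(2)]]) simp_all
  ultimately show ?thesis by (simp only:) (rule sets.countable_UN, blast)
qed

text \<open>A negative increment gives a null event, otherwise the Poisson weight is the factor.
  Only the factorization is used later, hence the unspecified constant.\<close>

lemma incr_is_indep:
  assumes p: "p \<in> I" and uv: "0 \<le> u" "u \<le> v" "v \<le> T"
  shows "\<exists>c. \<forall>V\<in>borel_measurable (others p u).
    (\<integral>\<^sup>+\<omega>. V \<omega> * indicator (incr_is p u v z) \<omega> \<partial>Q) = (\<integral>\<^sup>+\<omega>. V \<omega> \<partial>Q) * c"
proof (cases "0 \<le> z")
  case True
  then have "incr_is p u v z = {\<omega>\<in>space Q. Np p v \<omega> = Np p u \<omega> + nat z}" by (auto simp: incr_is_def)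
  then show ?thesis using increment_indep_others[OF p uv] by auto
next
  case False
  have "AE \<omega> in Q. \<omega> \<notin> incr_is p u v z"
    using AE_driver_mono[OF p]
  proof eventually_elim
    case (elim \<omega>)
    then have "Np p u \<omega> \<le> Np p v \<omega>" using uv by auto
    then show ?case using False by (auto simp: incr_is_def)
  qed
  then have "(\<integral>\<^sup>+\<omega>. V \<omega> * indicator (incr_is p u v z) \<omega> \<partial>Q) = (\<integral>\<^sup>+\<omega>. 0 \<partial>Q)" for V
    by (intro nn_integral_cong_AE) (auto elim!: eventually_mono)
  then show ?thesis by (intro exI[of _ 0]) simp
qed

lemma incr_is_indep_joint:
  assumes uv: "0 \<le> u" "u \<le> v" "v \<le> T" and R: "R \<subseteq> I"
  shows "\<exists>c. \<forall>V\<in>borel_measurable (K u).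
    (\<integral>\<^sup>+\<omega>. V \<omega> * (\<Prod>p\<in>R. indicator (incr_is p u v (z p)) \<omega>) \<partial>Q) = (\<integral>\<^sup>+\<omega>. V \<omega> \<partial>Q) * c"
  using finite_subset[OF R finite_I] R
proof (induction R)
  case empty
  show ?case by (intro exI[of _ 1]) simp
next
  case (insert p R)
  then obtain c where c: "\<And>V. V \<in> borel_measurable (K u) \<Longrightarrow>
    (\<integral>\<^sup>+\<omega>. V \<omega> * (\<Prod>p\<in>R. indicator (incr_is p u v (z p)) \<omega>) \<partial>Q) = (\<integral>\<^sup>+\<omega>. V \<omega> \<partial>Q) * c" by auto
  have p: "p \<in> I" using insert by auto
  obtain c' where c': "\<And>V. V \<in> borel_measurable (others p u) \<Longrightarrow>
    (\<integral>\<^sup>+\<omega>. V \<omega> * indicator (incr_is p u v (z p)) \<omega> \<partial>Q) = (\<integral>\<^sup>+\<omega>. V \<omega> \<partial>Q) * c'"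
    using incr_is_indep[OF p uv] by blast
  show ?case
  proof (intro exI[of _ "c * c'"] ballI)
    fix V :: "'a \<Rightarrow> ennreal" assume V: "V \<in> borel_measurable (K u)"
    have m: "(\<lambda>\<omega>. \<Prod>p\<in>R. indicator (incr_is p u v (z p)) \<omega> :: ennreal) \<in> borel_measurable (others p u)"
    proof (intro borel_measurable_prod_ennreal borel_measurable_indicator incr_is_measurable)
      fix q assume "q \<in> R"
      then have "q \<in> I" "q \<noteq> p" using insert by auto
      then show "Np q u \<in> measurable (others p u) (count_space UNIV)" "Np q v \<in> measurable (others p u) (count_space UNIV)"
        using uv p by (auto intro!: Np_others)
    qed simp
    have "(\<integral>\<^sup>+\<omega>. V \<omega> * (\<Prod>p\<in>insert p R. indicator (incr_is p u v (z p)) \<omega>) \<partial>Q) =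
       (\<integral>\<^sup>+\<omega>. (V \<omega> * (\<Prod>p\<in>R. indicator (incr_is p u v (z p)) \<omega>)) * indicator (incr_is p u v (z p)) \<omega> \<partial>Q)"
      using insert by (intro nn_integral_cong) (simp add: mult_ac)
    also have "\<dots> = (\<integral>\<^sup>+\<omega>. V \<omega> * (\<Prod>p\<in>R. indicator (incr_is p u v (z p)) \<omega>) \<partial>Q) * c'"
      using K_others[OF V, of p] m by (intro c') measurable
    also have "\<dots> = (\<integral>\<^sup>+\<omega>. V \<omega> \<partial>Q) * (c * c')" using c[OF V] by (simp add: mult.assoc)
    finally show "(\<integral>\<^sup>+\<omega>. V \<omega> * (\<Prod>p\<in>insert p R. indicator (incr_is p u v (z p)) \<omega>) \<partial>Q) =
      (\<integral>\<^sup>+\<omega>. V \<omega> \<partial>Q) * (c * c')" .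
  qed
qed

lemma incr_is_indep_chain:
  fixes r :: "nat \<Rightarrow> real"
  assumes "0 \<le> r 0" "\<And>i. i < m \<Longrightarrow> r i \<le> r (Suc i)" "r m \<le> T"
  shows "\<exists>c. \<forall>V\<in>borel_measurable (K (r 0)).
    (\<integral>\<^sup>+\<omega>. V \<omega> * (\<Prod>i<m. \<Prod>p\<in>I. indicator (incr_is p (r i) (r (Suc i)) (z i p)) \<omega>) \<partial>Q) = (\<integral>\<^sup>+\<omega>. V \<omega> \<partial>Q) * c"
  using assms(2,3)
proof (induction m)
  case 0
  show ?case by (intro exI[of _ 1]) simp
next
  case (Suc m)
  have mono: "r i \<le> r j" if "i \<le> j" "j \<le> Suc m" for i j
    using that by (induction j) (auto simp: le_Suc_eq intro: order_trans[OF _ Suc.prems(1)])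
  have "r m \<le> T" using mono[of m "Suc m"] Suc.prems(2) by simp
  then obtain c where c: "\<And>V. V \<in> borel_measurable (K (r 0)) \<Longrightarrow>
    (\<integral>\<^sup>+\<omega>. V \<omega> * (\<Prod>i<m. \<Prod>p\<in>I. indicator (incr_is p (r i) (r (Suc i)) (z i p)) \<omega>) \<partial>Q) = (\<integral>\<^sup>+\<omega>. V \<omega> \<partial>Q) * c"
    using Suc by auto
  have r: "0 \<le> r m" "r m \<le> r (Suc m)" "r (Suc m) \<le> T" using mono[of 0 m] assms(1) Suc.prems by auto
  obtain c' where c': "\<And>V. V \<in> borel_measurable (K (r m)) \<Longrightarrow>
    (\<integral>\<^sup>+\<omega>. V \<omega> * (\<Prod>p\<in>I. indicator (incr_is p (r m) (r (Suc m)) (z m p)) \<omega>) \<partial>Q) = (\<integral>\<^sup>+\<omega>. V \<omega> \<partial>Q) * c'"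
    using incr_is_indep_joint[OF r order_refl] by blast
  show ?case
  proof (intro exI[of _ "c * c'"] ballI)
    fix V :: "'a \<Rightarrow> ennreal" assume V: "V \<in> borel_measurable (K (r 0))"
    have m: "(\<lambda>\<omega>. \<Prod>i<m. \<Prod>p\<in>I. indicator (incr_is p (r i) (r (Suc i)) (z i p)) \<omega> :: ennreal) \<in> borel_measurable (K (r m))"
    proof (intro borel_measurable_prod_ennreal borel_measurable_indicator incr_is_measurable)
      fix i p assume i: "i \<in> {..<m}" and p: "p \<in> I"
      have "0 \<le> r i" "r i \<le> r m" "0 \<le> r (Suc i)" "r (Suc i) \<le> r m" "r m \<le> T"
        using mono[of 0 i] mono[of i m] mono[of 0 "Suc i"] mono[of "Suc i" m] i r assms(1) by auto
      then show "Np p (r i) \<in> measurable (K (r m)) (count_space UNIV)" "Np p (r (Suc i)) \<in> measurable (K (r m)) (count_space UNIV)"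
        using p by (auto intro!: Np_K)
    qed simp
    have V': "V \<in> borel_measurable (K (r m))" using mono[of 0 m] by (intro K_incr[OF V]) simp
    have "(\<integral>\<^sup>+\<omega>. V \<omega> * (\<Prod>i<Suc m. \<Prod>p\<in>I. indicator (incr_is p (r i) (r (Suc i)) (z i p)) \<omega>) \<partial>Q) =
       (\<integral>\<^sup>+\<omega>. (V \<omega> * (\<Prod>i<m. \<Prod>p\<in>I. indicator (incr_is p (r i) (r (Suc i)) (z i p)) \<omega>)) *
         (\<Prod>p\<in>I. indicator (incr_is p (r m) (r (Suc m)) (z m p)) \<omega>) \<partial>Q)"
      by (intro nn_integral_cong) (simp add: mult_ac)
    also have "\<dots> = (\<integral>\<^sup>+\<omega>. V \<omega> * (\<Prod>i<m. \<Prod>p\<in>I. indicator (incr_is p (r i) (r (Suc i)) (z i p)) \<omega>) \<partial>Q) * c'"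
      using V' m by (intro c') measurable
    also have "\<dots> = (\<integral>\<^sup>+\<omega>. V \<omega> \<partial>Q) * (c * c')" using c[OF V] by (simp add: mult.assoc)
    finally show "(\<integral>\<^sup>+\<omega>. V \<omega> * (\<Prod>i<Suc m. \<Prod>p\<in>I. indicator (incr_is p (r i) (r (Suc i)) (z i p)) \<omega>) \<partial>Q) =
      (\<integral>\<^sup>+\<omega>. V \<omega> \<partial>Q) * (c * c')" .
  qed
qed

text \<open>Increments counted from \<open>t\<close> rather than values, which would involve the
  past. The empty set is added for stability under intersection.\<close>

definition "future t = insert {} {{\<omega>\<in>space Q. \<forall>p\<in>I. \<forall>r\<in>R. Np p r \<omega> = Np p t \<omega> + f p r} | R f. finite R \<and> R \<subseteq> {t<..T}}"

lemma future_indep: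
  assumes t: "0 \<le> t" "t \<le> T" and e: "e \<in> future t"
  shows "\<exists>c. \<forall>V\<in>borel_measurable (K t). (\<integral>\<^sup>+\<omega>. V \<omega> * indicator e \<omega> \<partial>Q) = (\<integral>\<^sup>+\<omega>. V \<omega> \<partial>Q) * c"
proof (cases "e = {}")
  case True
  then show ?thesis by (intro exI[of _ 0]) simp
next
  case False
  then obtain R f where R: "finite R" "R \<subseteq> {t<..T}" and
    e: "e = {\<omega>\<in>space Q. \<forall>p\<in>I. \<forall>r\<in>R. Np p r \<omega> = Np p t \<omega> + f p r}"
    using e unfolding future_def by blast
  define l where "l = sorted_list_of_set R"
  define m where "m = length l"
  have l: "set l = R" "sorted l" using R by (auto simp: l_def)
  define r where "r i = (t # l) ! i" for i
  have r0: "r 0 = t" by (simp add: r_def)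
  have rS: "r (Suc i) = l ! i" for i by (simp add: r_def)
  have rR: "r (Suc i) \<in> R" if "i < m" for i using that l(1) by (auto simp: rS m_def)
  have "sorted (t # l)" using l R by auto
  then have mono: "r i \<le> r (Suc i)" if "i < m" for i
    using that unfolding r_def m_def by (intro sorted_nth_mono) auto
  have rT: "r m \<le> T" using rR[of "m - 1"] R t r0 by (cases m) auto
  \<comment> \<open>Increments from \<open>t\<close> are converted into increments between
    consecutive times; index 0 refers to \<open>t\<close> itself.\<close>
  define g where "g p i = (if i = 0 then 0 else int (f p (r i)))" for p i
  define z where "z i p = g p (Suc i) - g p i" for i p
  obtain c where c: "\<And>V. V \<in> borel_measurable (K t) \<Longrightarrow>
    (\<integral>\<^sup>+\<omega>. V \<omega> * (\<Prod>i<m. \<Prod>p\<in>I. indicator (incr_is p (r i) (r (Suc i)) (z i p)) \<omega>) \<partial>Q) = (\<integral>\<^sup>+\<omega>. V \<omega> \<partial>Q) * c"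
    using incr_is_indep_chain[of r m z] t mono rT unfolding r0 by blast
  have eq: "(\<forall>p\<in>I. \<forall>x\<in>R. Np p x \<omega> = Np p t \<omega> + f p x) \<longleftrightarrow>
     (\<forall>i<m. \<forall>p\<in>I. int (Np p (r (Suc i)) \<omega>) = int (Np p (r i) \<omega>) + z i p)" for \<omega>
  proof
    assume h: "\<forall>p\<in>I. \<forall>x\<in>R. Np p x \<omega> = Np p t \<omega> + f p x"
    have "int (Np p (r i) \<omega>) = int (Np p t \<omega>) + g p i" if "i \<le> m" "p \<in> I" for i p
      using that h rR[of "i - 1"] by (cases i) (auto simp: g_def r0)
    then show "\<forall>i<m. \<forall>p\<in>I. int (Np p (r (Suc i)) \<omega>) = int (Np p (r i) \<omega>) + z i p"
      by (simp add: z_def)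
  next
    assume h: "\<forall>i<m. \<forall>p\<in>I. int (Np p (r (Suc i)) \<omega>) = int (Np p (r i) \<omega>) + z i p"
    have *: "i \<le> m \<Longrightarrow> p \<in> I \<Longrightarrow> int (Np p (r i) \<omega>) = int (Np p t \<omega>) + g p i" for i p
      using h by (induction i) (auto simp: z_def g_def r0)
    show "\<forall>p\<in>I. \<forall>x\<in>R. Np p x \<omega> = Np p t \<omega> + f p x"
    proof (intro ballI)
      fix p x assume p: "p \<in> I" and "x \<in> R"
      then obtain i where i: "i < m" "x = r (Suc i)" using l(1) by (metis in_set_conv_nth m_def rS)
      then have "int (Np p x \<omega>) = int (Np p t \<omega>) + int (f p x)" using *[of "Suc i" p] p by (simp add: g_def)
      then show "Np p x \<omega> = Np p t \<omega> + f p x" by linarith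
    qed
  qed
  have ind: "(\<Prod>i<m. \<Prod>p\<in>I. indicator (incr_is p (r i) (r (Suc i)) (z i p)) \<omega>) = (indicator e \<omega> :: ennreal)"
    if "\<omega> \<in> space Q" for \<omega>
  proof (cases "\<omega> \<in> e")
    case True
    then show ?thesis using that unfolding e eq by (simp add: incr_is_def)
  next
    case False
    then have "\<exists>i<m. \<exists>p\<in>I. \<omega> \<notin> incr_is p (r i) (r (Suc i)) (z i p)" using that unfolding e eq by (auto simp: incr_is_def)
    then have "\<exists>i\<in>{..<m}. (\<Prod>p\<in>I. indicator (incr_is p (r i) (r (Suc i)) (z i p)) \<omega> :: ennreal) = 0"
      using finite_I by (auto intro!: prod_zero bexI)
    then have "(\<Prod>i<m. \<Prod>p\<in>I. indicator (incr_is p (r i) (r (Suc i)) (z i p)) \<omega> :: ennreal) = 0"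
      by (intro prod_zero) auto
    then show ?thesis using False by simp
  qed
  have "(\<integral>\<^sup>+\<omega>. V \<omega> * indicator e \<omega> \<partial>Q) = (\<integral>\<^sup>+\<omega>. V \<omega> \<partial>Q) * c" if "V \<in> borel_measurable (K t)" for V
    using c[OF that] ind by (simp cong: nn_integral_cong)
  then show ?thesis by blast
qed

lemma future_events: "0 \<le> t \<Longrightarrow> future t \<subseteq> events"
proof
  fix e assume t: "0 \<le> t" and e: "e \<in> future t"
  show "e \<in> events"
  proof (cases "e = {}")
    case False
    then obtain R f where R: "finite R" "R \<subseteq> {t<..T}" and
      e: "e = {\<omega>\<in>space Q. \<forall>p\<in>I. \<forall>r\<in>R. Np p r \<omega> = Np p t \<omega> + f p r}"
      using e unfolding future_def by blast
    have "{\<omega>\<in>space Q. Np p r \<omega> = Np p t \<omega> + f p r} \<in> events" if "p \<in> I" "r \<in> R" for p r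
      using that R t by (intro increment_event Np_meas) force+
    then show ?thesis unfolding e using finite_I R by (intro sets.sets_Collect_finite_All) auto
  qed simp
qed

lemma Int_stable_future: "Int_stable (future t)"
proof (rule Int_stableI)
  fix A B assume "A \<in> future t" "B \<in> future t"
  then consider "A = {} \<or> B = {}" | R f R' f' where
    "A = {\<omega>\<in>space Q. \<forall>p\<in>I. \<forall>s\<in>R. Np p s \<omega> = Np p t \<omega> + f p s}"
    "B = {\<omega>\<in>space Q. \<forall>p\<in>I. \<forall>s\<in>R'. Np p s \<omega> = Np p t \<omega> + f' p s}"
    "finite R" "R \<subseteq> {t<..T}" "finite R'" "R' \<subseteq> {t<..T}"
    unfolding future_def by auto
  then show "A \<inter> B \<in> future t"
  proof cases
    case 2
    show ?thesis
    proof (cases "\<forall>p\<in>I. \<forall>s\<in>R \<inter> R'. f p s = f' p s")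
      case True
      have "A \<inter> B = {\<omega>\<in>space Q. \<forall>p\<in>I. \<forall>s\<in>R \<union> R'. Np p s \<omega> = Np p t \<omega> + (if s \<in> R then f p s else f' p s)}"
      proof (intro set_eqI iffI)
        fix \<omega> assume h: "\<omega> \<in> {\<omega>\<in>space Q. \<forall>p\<in>I. \<forall>s\<in>R \<union> R'. Np p s \<omega> = Np p t \<omega> + (if s \<in> R then f p s else f' p s)}"
        have "Np p s \<omega> = Np p t \<omega> + f' p s" if "p \<in> I" "s \<in> R'" for p s
          using h True that by (cases "s \<in> R") auto
        then show "\<omega> \<in> A \<inter> B" unfolding 2 using h by auto
      qed (auto simp: 2)
      then show ?thesis unfolding future_def using 2
        by (intro insertI2 CollectI exI[of _ "R \<union> R'"] exI[of _ "\<lambda>p s. if s \<in> R then f p s else f' p s"]) auto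
    next
      case False
      then have "A \<inter> B = {}" unfolding 2 by force
      then show ?thesis by (simp add: future_def)
    qed
  qed (auto simp: future_def)
qed

lemma future_top: "space Q \<in> future t"
proof -
  have "space Q = {\<omega>\<in>space Q. \<forall>p\<in>I. \<forall>r\<in>{}. Np p r \<omega> = Np p t \<omega> + 0}" by auto
  then show ?thesis unfolding future_def by (intro insertI2 CollectI exI[of _ "{}"] exI[of _ "\<lambda>_ _. 0"]) auto
qed

text \<open>What determines the chain and its density after \<open>t\<close> once the state at
  \<open>t\<close> is given: the intensities and the future noise.\<close>

definition "post t = sigma (space Q) (sets (F T) \<union> future t)"

lemma post_gen: "0 \<le> t \<Longrightarrow> sets (F T) \<union> future t \<subseteq> events"
  using future_events[of t] F_sub(1)[of T] T_pos by (auto simp: subalgebra_def)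

lemma space_post [simp]: "space (post t) = space Q" by (simp add: post_def space_measure_of_conv)

lemma post_upper:
  assumes "0 \<le> t" shows "sets (F T) \<subseteq> sets (post t)" "future t \<subseteq> sets (post t)"
  unfolding post_def using post_gen[OF assms] by (auto simp: sets_sigmaQ intro!: sigma_sets.Basic)

lemma post_sub: "0 \<le> t \<Longrightarrow> subalgebra Q (post t)"
  using sets.sigma_sets_subset[OF post_gen[of t]] sets_sigmaQ[OF post_gen[of t]] by (simp add: subalgebra_def post_def space_measure_of_conv)

lemma F_post: "f \<in> measurable (F s) M \<Longrightarrow> 0 \<le> s \<Longrightarrow> s \<le> T \<Longrightarrow> 0 \<le> t \<Longrightarrow> f \<in> measurable (post t) M"
  by (erule measurable_mono_sets) (use F_mono[of s T] post_upper(1)[of t] in auto)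

lemma null_post: "0 \<le> t \<Longrightarrow> null_sets Q \<subseteq> sets (post t)"
  using F_sub(2)[of T] T_pos post_upper(1)[of t] by auto

text \<open>An increment over \<open>[r, s]\<close> is a difference of two increments from
  \<open>t\<close>. With natural subtraction this holds where the driver is monotone, so
  completeness is used.\<close>

lemma incr_post:
  assumes p: "p \<in> I" and t: "0 \<le> t" "t \<le> r" "r \<le> s" "s \<le> T"
  shows "(\<lambda>\<omega>. Np p s \<omega> - Np p r \<omega>) \<in> measurable (post t) (count_space UNIV)"
proof (rule measurable_AE_eq_complete[OF complete post_sub[OF t(1)] null_post[OF t(1)]])
  have base: "(\<lambda>\<omega>. Np p r \<omega> - Np p t \<omega>) \<in> measurable (post t) (count_space UNIV)" if r: "t \<le> r" "r \<le> T" for r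
  proof (cases "r = t")
    case False
    have "(\<lambda>\<omega>. Np p r \<omega> - Np p t \<omega>) -` {k} \<inter> space (post t) \<in> sets (post t)" for k
    proof (rule sets_AE_eq_complete[OF complete post_sub[OF t(1)] null_post[OF t(1)]])
      \<comment> \<open>A future event prescribes all drivers, so an event about \<open>p\<close>
        alone is a union over the increments of the others, countable because \<open>I\<close> is
        finite.\<close>
      let ?\<kappa> = "{\<kappa>\<in>PiE I (\<lambda>_. UNIV). \<kappa> p = k}"
      have c: "countable ?\<kappa>" by (rule countable_subset[OF _ countable_PiE[OF finite_I]]) auto
      have "{\<omega>\<in>space Q. \<forall>q\<in>I. \<forall>x\<in>{r}. Np q x \<omega> = Np q t \<omega> + \<kappa> q} \<in> future t" for \<kappa>
        unfolding future_def using r False by (intro insertI2 CollectI exI[of _ "{r}"] exI[of _ "\<lambda>q _. \<kappa> q"]) auto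
      then show "(\<Union>\<kappa>\<in>?\<kappa>. {\<omega>\<in>space Q. \<forall>q\<in>I. \<forall>x\<in>{r}. Np q x \<omega> = Np q t \<omega> + \<kappa> q}) \<in> sets (post t)"
        using post_upper(2)[OF t(1)] by (intro sets.countable_UN'[OF c]) auto
      have "AE \<omega> in Q. \<forall>q\<in>I. Np q t \<omega> \<le> Np q r \<omega>"
      proof (intro AE_finite_allI finite_I)
        fix q assume "q \<in> I"
        from AE_driver_mono[OF this] show "AE \<omega> in Q. Np q t \<omega> \<le> Np q r \<omega>"
          by eventually_elim (use t r in auto)
      qed
      then show "AE \<omega> in Q. \<omega> \<in> (\<lambda>\<omega>. Np p r \<omega> - Np p t \<omega>) -` {k} \<inter> space (post t) \<longleftrightarrow>
        \<omega> \<in> (\<Union>\<kappa>\<in>?\<kappa>. {\<omega>\<in>space Q. \<forall>q\<in>I. \<forall>x\<in>{r}. Np q x \<omega> = Np q t \<omega> + \<kappa> q})"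
        using AE_space
      proof eventually_elim
        case (elim \<omega>)
        show ?case
        proof
          assume h: "\<omega> \<in> (\<lambda>\<omega>. Np p r \<omega> - Np p t \<omega>) -` {k} \<inter> space (post t)"
          show "\<omega> \<in> (\<Union>\<kappa>\<in>?\<kappa>. {\<omega>\<in>space Q. \<forall>q\<in>I. \<forall>x\<in>{r}. Np q x \<omega> = Np q t \<omega> + \<kappa> q})"
            by (rule UN_I[of "\<lambda>q\<in>I. Np q r \<omega> - Np q t \<omega>"]) (use h elim p in auto)
        next
          assume "\<omega> \<in> (\<Union>\<kappa>\<in>?\<kappa>. {\<omega>\<in>space Q. \<forall>q\<in>I. \<forall>x\<in>{r}. Np q x \<omega> = Np q t \<omega> + \<kappa> q})"
          then show "\<omega> \<in> (\<lambda>\<omega>. Np p r \<omega> - Np p t \<omega>) -` {k} \<inter> space (post t)" using p by auto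
        qed
      qed
    qed auto
    then show ?thesis by (subst measurable_count_space_eq2_countable) auto
  qed simp
  show "(\<lambda>\<omega>. (Np p s \<omega> - Np p t \<omega>) - (Np p r \<omega> - Np p t \<omega>)) \<in> measurable (post t) (count_space UNIV)"
    using t by (intro measurable_diff_nat base) auto
  show "AE \<omega> in Q. Np p s \<omega> - Np p r \<omega> = (Np p s \<omega> - Np p t \<omega>) - (Np p r \<omega> - Np p t \<omega>)"
    using AE_driver_mono[OF p]
  proof eventually_elim
    case (elim \<omega>)
    then have "Np p t \<omega> \<le> Np p r \<omega>" using t by auto
    then show ?case by linarith
  qed
qed auto

text \<open>Events \<open>A \<inter> e\<close> with \<open>A\<close> in \<open>F T\<close> and \<open>e\<close> a future event of the noise generate \<open>post t\<close>, and \<open>e\<close> is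
  independent of \<open>K t\<close>; so an identity tested on \<open>F T\<close> extends to \<open>post t\<close>.\<close>

lemma nn_integral_post:
  assumes t: "0 \<le> t" "t \<le> T" and f: "f \<in> borel_measurable Q" "(\<integral>\<^sup>+\<omega>. f \<omega> \<partial>Q) < \<infinity>"
    and g: "g \<in> borel_measurable Q" and fK: "f \<in> borel_measurable (K t)" and gK: "g \<in> borel_measurable (K t)"
    and eq: "\<And>A. A \<in> sets (F T) \<Longrightarrow> (\<integral>\<^sup>+\<omega>. f \<omega> * indicator A \<omega> \<partial>Q) = (\<integral>\<^sup>+\<omega>. g \<omega> * indicator A \<omega> \<partial>Q)"
    and R: "R \<in> borel_measurable (post t)"
  shows "(\<integral>\<^sup>+\<omega>. f \<omega> * R \<omega> \<partial>Q) = (\<integral>\<^sup>+\<omega>. g \<omega> * R \<omega> \<partial>Q)"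
proof (rule nn_integral_eq_on_generator[OF post_sub[OF t(1)] _ _ _ f(1) g f(2) _ R])
  define E where "E = {A \<inter> e | A e. A \<in> sets (F T) \<and> e \<in> future t}"
  have F_K: "A \<in> sets (K t)" if "A \<in> sets (F T)" for A using K_upper(1) that by auto
  show "Int_stable E"
  proof (rule Int_stableI)
    fix A1 A2 assume "A1 \<in> E" "A2 \<in> E"
    then obtain B1 e1 B2 e2 where h: "A1 = B1 \<inter> e1" "A2 = B2 \<inter> e2" "B1 \<in> sets (F T)" "B2 \<in> sets (F T)"
      "e1 \<in> future t" "e2 \<in> future t" unfolding E_def by blast
    have "e1 \<inter> e2 \<in> future t" using Int_stable_future h by (auto simp: Int_stable_def)
    moreover have "A1 \<inter> A2 = (B1 \<inter> B2) \<inter> (e1 \<inter> e2)" using h by auto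
    moreover have "B1 \<inter> B2 \<in> sets (F T)" using h by auto
    ultimately show "A1 \<inter> A2 \<in> E" unfolding E_def by blast
  qed
  have topF: "space Q \<in> sets (F T)" using sets.top[of "F T"] by simp
  then show "space Q \<in> E" unfolding E_def using future_top
    by (intro CollectI exI[of _ "space Q"]) auto
  show "sets (post t) = sigma_sets (space Q) E"
  proof (rule antisym)
    have "A \<in> E" if "A \<in> sets (F T) \<union> future t" for A
    proof -
      have "A \<subseteq> space Q" using that post_gen[OF t(1)] sets.sets_into_space by blast
      then show ?thesis using that topF future_top[of t] unfolding E_def by (auto simp: Int_absorb1 Int_absorb2)
    qed
    then show "sets (post t) \<subseteq> sigma_sets (space Q) E"
      unfolding post_def sets_sigmaQ[OF post_gen[OF t(1)]] by (intro sigma_sets_mono') auto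
    have "E \<subseteq> sets (post t)" unfolding E_def using post_upper[OF t(1)] by auto
    then show "sigma_sets (space Q) E \<subseteq> sets (post t)" using sets.sigma_sets_subset[of E "post t"] by simp
  qed
  fix D assume "D \<in> E"
  then obtain A e where D: "D = A \<inter> e" "A \<in> sets (F T)" "e \<in> future t" unfolding E_def by blast
  obtain c where c: "\<And>V. V \<in> borel_measurable (K t) \<Longrightarrow> (\<integral>\<^sup>+\<omega>. V \<omega> * indicator e \<omega> \<partial>Q) = (\<integral>\<^sup>+\<omega>. V \<omega> \<partial>Q) * c"
    using future_indep[OF t D(3)] by blast
  have *: "(\<integral>\<^sup>+\<omega>. h \<omega> * indicator D \<omega> \<partial>Q) = (\<integral>\<^sup>+\<omega>. h \<omega> * indicator A \<omega> \<partial>Q) * c" if "h \<in> borel_measurable (K t)" for h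
    using c[of "\<lambda>\<omega>. h \<omega> * indicator A \<omega>"] that F_K[OF D(2)] by (simp add: D(1) indicator_inter_arith mult.assoc)
  show "(\<integral>\<^sup>+\<omega>. f \<omega> * indicator D \<omega> \<partial>Q) = (\<integral>\<^sup>+\<omega>. g \<omega> * indicator D \<omega> \<partial>Q)"
    using *[OF fK] *[OF gK] eq[OF D(2)] by simp
qed

section \<open>Conditional independence of the reference filtration and the past\<close>

definition "noise = sigma_sets (space Q) (\<Union>p\<in>I. history Q (Np p) T)"

lemma noise_indep:
  assumes B: "B \<in> noise" and V: "V \<in> borel_measurable base"
  shows "(\<integral>\<^sup>+\<omega>. V \<omega> * indicator B \<omega> \<partial>Q) = (\<integral>\<^sup>+\<omega>. V \<omega> \<partial>Q) * ennreal (prob B)"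
proof (rule indep_event_on_generator[OF _ _ _ _ _ _ _ _ V])
  show "sets base = sigma_sets (space Q) (sets base)" using sets.sigma_sets_eq[of base] by simp
  show "Int_stable (sets base)" by (rule sets.Int_stable)
  show "space Q \<in> sets base" using sets.top[of base] by simp
  show "B \<in> events" using B indep_setD_ev2[OF indep_base] by (auto simp: noise_def)
  show "prob (A \<inter> B) = prob A * prob B" if "A \<in> sets base" for A
    using indep_setD[OF indep_base that] B by (simp add: noise_def)
qed (use base_sub in auto)

text \<open>A version of the conditional probability given \<open>F T\<close> that \<xi> lies in
  \<open>Y\<close>. Being measurable already for \<open>F 0\<close>, it lets \<xi> join the past
  without revealing the future of \<open>F\<close>.\<close>

definition "\<mu>s Y \<omega> = (\<Sum>x\<in>S \<inter> Y. ennreal (\<mu> x \<omega>))"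

lemma \<mu>s_F: "0 \<le> t \<Longrightarrow> t \<le> T \<Longrightarrow> \<mu>s Y \<in> borel_measurable (F t)"
  unfolding \<mu>s_def[abs_def] using \<mu>_F by (intro borel_measurable_sum) auto

lemma FT_sub: "subalgebra Q (F T)" using F_sub(1) T_pos by simp

lemma \<xi>_cond_nn_integral:
  assumes f: "f \<in> borel_measurable (F T)"
  shows "(\<integral>\<^sup>+\<omega>. f \<omega> * indicator {\<omega>\<in>space Q. \<xi> \<omega> \<in> Y} \<omega> \<partial>Q) = (\<integral>\<^sup>+\<omega>. f \<omega> * \<mu>s Y \<omega> \<partial>Q)"
proof -
  have fQ: "f \<in> borel_measurable Q" by (rule measurable_from_subalg[OF FT_sub f])
  have E\<xi>: "{\<omega>\<in>space Q. \<xi> \<omega> = x} \<in> events" for x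
    using measurable_sets[OF \<xi>(1), of "{x}"] by (auto simp: vimage_def Int_def conj_commute)
  have \<mu>Q: "\<mu> x \<in> borel_measurable Q" if "x \<in> S" for x
    using \<mu>_F[OF that, of T] T_pos by (intro measurable_from_subalg[OF FT_sub]) auto
  have 1: "(\<integral>\<^sup>+\<omega>. indicator {\<omega>\<in>space Q. \<xi> \<omega> = x} \<omega> * f \<omega> \<partial>Q) = (\<integral>\<^sup>+\<omega>. ennreal (\<mu> x \<omega>) * f \<omega> \<partial>Q)" if x: "x \<in> S" for x
  proof (rule nn_integral_eq_on_subalgebra[OF FT_sub _ _ _ f])
    fix A assume A: "A \<in> sets (F T)"
    then have AQ: "A \<in> events" using FT_sub by (auto simp: subalgebra_def)
    have "(\<integral>\<^sup>+\<omega>. indicator {\<omega>\<in>space Q. \<xi> \<omega> = x} \<omega> * indicator A \<omega> \<partial>Q) = emeasure Q (A \<inter> {\<omega>\<in>space Q. \<xi> \<omega> = x})"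
      using AQ E\<xi>[of x] by (simp add: Int_commute flip: indicator_inter_arith)
    also have "\<dots> = (\<integral>\<^sup>+\<omega>. ennreal (\<mu> x \<omega>) * indicator A \<omega> \<partial>Q)"
      using \<xi>_cond_emeasure[OF x A] by (simp add: mult.commute)
    finally show "(\<integral>\<^sup>+\<omega>. indicator {\<omega>\<in>space Q. \<xi> \<omega> = x} \<omega> * indicator A \<omega> \<partial>Q) = (\<integral>\<^sup>+\<omega>. ennreal (\<mu> x \<omega>) * indicator A \<omega> \<partial>Q)" .
  qed (use E\<xi> \<mu>Q[OF x] in auto)
  have "(\<integral>\<^sup>+\<omega>. f \<omega> * indicator {\<omega>\<in>space Q. \<xi> \<omega> \<in> Y} \<omega> \<partial>Q) =
      (\<integral>\<^sup>+\<omega>. (\<Sum>x\<in>S \<inter> Y. indicator {\<omega>\<in>space Q. \<xi> \<omega> = x} \<omega> * f \<omega>) \<partial>Q)"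
  proof (rule nn_integral_cong)
    fix \<omega> assume \<omega>: "\<omega> \<in> space Q"
    have "(\<Sum>x\<in>S \<inter> Y. indicator {\<omega>\<in>space Q. \<xi> \<omega> = x} \<omega> :: ennreal) = (\<Sum>x\<in>S \<inter> Y. if x = \<xi> \<omega> then 1 else 0)"
      using \<omega> by (intro sum.cong) auto
    also have "\<dots> = indicator {\<omega>\<in>space Q. \<xi> \<omega> \<in> Y} \<omega>"
      using \<xi>(2)[OF \<omega>] \<omega> by (simp add: S_def indicator_def)
    finally have s: "(\<Sum>x\<in>S \<inter> Y. indicator {\<omega>\<in>space Q. \<xi> \<omega> = x} \<omega> :: ennreal) = indicator {\<omega>\<in>space Q. \<xi> \<omega> \<in> Y} \<omega>" .
    show "f \<omega> * indicator {\<omega>\<in>space Q. \<xi> \<omega> \<in> Y} \<omega> = (\<Sum>x\<in>S \<inter> Y. indicator {\<omega>\<in>space Q. \<xi> \<omega> = x} \<omega> * f \<omega>)"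
      unfolding sum_distrib_right[symmetric] s by (rule mult.commute)
  qed
  also have "\<dots> = (\<Sum>x\<in>S \<inter> Y. \<integral>\<^sup>+\<omega>. indicator {\<omega>\<in>space Q. \<xi> \<omega> = x} \<omega> * f \<omega> \<partial>Q)"
    using fQ E\<xi> by (intro nn_integral_sum) auto
  also have "\<dots> = (\<Sum>x\<in>S \<inter> Y. \<integral>\<^sup>+\<omega>. ennreal (\<mu> x \<omega>) * f \<omega> \<partial>Q)" using 1 by (intro sum.cong) auto
  also have "\<dots> = (\<integral>\<^sup>+\<omega>. (\<Sum>x\<in>S \<inter> Y. ennreal (\<mu> x \<omega>) * f \<omega>) \<partial>Q)"
    using fQ \<mu>Q by (intro nn_integral_sum[symmetric]) auto
  also have "\<dots> = (\<integral>\<^sup>+\<omega>. f \<omega> * \<mu>s Y \<omega> \<partial>Q)"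
    unfolding \<mu>s_def sum_distrib_right[symmetric] by (simp only: mult.commute)
  finally show ?thesis .
qed

lemma Ft_sigma_finite: "0 \<le> t \<Longrightarrow> t \<le> T \<Longrightarrow> sigma_finite_subalgebra Q (F t)"
  using F_sub(1)[of t] finite_measure_subalgebra_is_sigma_finite[of Q "F t"]
  by (auto simp: finite_measure_subalgebra_def finite_measure_subalgebra_axioms_def finite_measure_axioms)

text \<open>Given \<open>F T\<close>, the law of \<xi> is \<open>F 0\<close>-measurable and the
  noise is independent of both, so conditioning an event of \<open>J t\<close> on \<open>F T\<close>
  yields something \<open>F t\<close>-measurable. In other words, \<open>F T\<close> and
  \<open>J t\<close> are conditionally independent given \<open>F t\<close>.\<close>

lemma immersion:
  assumes t: "0 \<le> t" "t \<le> T" and A: "A \<in> sets (F T)" and C: "C \<in> sets (J t)"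
  shows "(\<integral>\<^sup>+\<omega>. indicator A \<omega> * indicator C \<omega> \<partial>Q) = (\<integral>\<^sup>+\<omega>. nn_cond_exp Q (F t) (indicator A) \<omega> * indicator C \<omega> \<partial>Q)"
proof -
  interpret Ft: sigma_finite_subalgebra Q "F t" by (rule Ft_sigma_finite[OF t])
  \<comment> \<open>The noise enters up to \<open>T\<close>, beyond what \<open>J t\<close> knows:
    the product form of the generator persists, and right limits of the noise need no separate
    treatment.\<close>
  define E where "E = {A' \<inter> {\<omega>\<in>space Q. \<xi> \<omega> \<in> Y} \<inter> B | A' Y B. A' \<in> sets (F t) \<and> B \<in> noise}"
  define W where "W = sigma (space Q) E"
  let ?q = "nn_cond_exp Q (F t) (indicator A)"
  have AQ: "A \<in> events" using A FT_sub by (auto simp: subalgebra_def)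
  have FtT: "f \<in> borel_measurable (F T)" if "f \<in> borel_measurable (F t)" for f :: "'a \<Rightarrow> ennreal"
    using that by (rule measurable_mono_sets) (use F_mono[OF t order_refl] t in auto)
  have noise_ev: "noise \<subseteq> events" using indep_setD_ev2[OF indep_base] by (simp add: noise_def)
  have noise_Int: "B1 \<inter> B2 \<in> noise" if "B1 \<in> noise" "B2 \<in> noise" for B1 B2
  proof -
    have "(\<Union>p\<in>I. history Q (Np p) T) \<subseteq> Pow (space Q)"
      using history_events[OF _ order_refl] sets.space_closed[of Q] by blast
    then interpret sigma_algebra "space Q" noise unfolding noise_def by (rule sigma_algebra_sigma_sets)
    show ?thesis using that by blast
  qed
  have topn: "space Q \<in> noise" unfolding noise_def by (rule sigma_sets_top)
  have topF: "space Q \<in> sets (F t)" using sets.top[of "F t"] t by simp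
  have Fev: "sets (F t) \<subseteq> events" using F_sub(1)[OF t] by (simp add: subalgebra_def)
  have \<xi>B: "{\<omega>\<in>space Q. \<xi> \<omega> \<in> Y} \<in> sets base" for Y
    using \<xi>_base by (auto simp: sets_sigma_rv vimage_def Int_def conj_commute)
  have Eev: "E \<subseteq> events"
    unfolding E_def using Fev noise_ev \<xi>B base_sub by blast
  have setsW: "sets W = sigma_sets (space Q) E" unfolding W_def by (rule sets_sigmaQ[OF Eev])
  have spW: "space W = space Q" by (simp add: W_def space_measure_of_conv)
  have Wsub: "subalgebra Q W" using sets.sigma_sets_subset[OF Eev] by (simp add: subalgebra_def setsW spW)
  have inW: "A' \<inter> {\<omega>\<in>space Q. \<xi> \<omega> \<in> Y} \<inter> B \<in> sets W" if "A' \<in> sets (F t)" "B \<in> noise" for A' Y B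
    using that unfolding setsW E_def by (intro sigma_sets.Basic) blast
  have JW: "sets (J t) \<subseteq> sets W"
  proof -
    have 1: "sets (F t) \<subseteq> sets W"
    proof
      fix A' assume A': "A' \<in> sets (F t)"
      then have "A' \<subseteq> space Q" using sets.sets_into_space t by fastforce
      then have "A' = A' \<inter> {\<omega>\<in>space Q. \<xi> \<omega> \<in> UNIV} \<inter> space Q" by auto
      then show "A' \<in> sets W" using inW[OF A' topn, of UNIV] by simp
    qed
    have "sets (G t) \<subseteq> sets W"
    proof (rule G_least[of W T])
      show "null_sets Q \<subseteq> sets W" using F_sub(2)[OF t] 1 by auto
      show "sets (sigma_rv Q \<xi>) \<subseteq> sets W"
      proof
        fix D assume "D \<in> sets (sigma_rv Q \<xi>)"
        then obtain Y where "D = space Q \<inter> {\<omega>\<in>space Q. \<xi> \<omega> \<in> Y} \<inter> space Q" by (auto simp: sets_sigma_rv vimage_def)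
        then show "D \<in> sets W" using inW[OF topF topn, of Y] by simp
      qed
      fix q assume q: "q \<in> I"
      show "history Q (Np q) T \<subseteq> sets W"
      proof
        fix B assume B: "B \<in> history Q (Np q) T"
        then have Bn: "B \<in> noise" using q unfolding noise_def by (intro sigma_sets.Basic) auto
        then have "B = space Q \<inter> {\<omega>\<in>space Q. \<xi> \<omega> \<in> UNIV} \<inter> B" using noise_ev sets.sets_into_space by auto
        then show "B \<in> sets W" using inW[OF topF Bn, of UNIV] by simp
      qed
    qed (use spW in auto)
    then show ?thesis unfolding J_def using 1 spW t by (intro join_alg_least) auto
  qed
  have qm: "?q \<in> borel_measurable (F t)" by simp
  have "(\<integral>\<^sup>+\<omega>. indicator A \<omega> * (indicator C \<omega> :: ennreal) \<partial>Q) = (\<integral>\<^sup>+\<omega>. ?q \<omega> * indicator C \<omega> \<partial>Q)"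
  proof (rule nn_integral_eq_on_generator[OF Wsub setsW])
    show "Int_stable E"
    proof (rule Int_stableI)
      fix D1 D2 assume "D1 \<in> E" "D2 \<in> E"
      then obtain A1 Y1 B1 A2 Y2 B2 where h: "D1 = A1 \<inter> {\<omega>\<in>space Q. \<xi> \<omega> \<in> Y1} \<inter> B1" "D2 = A2 \<inter> {\<omega>\<in>space Q. \<xi> \<omega> \<in> Y2} \<inter> B2"
        "A1 \<in> sets (F t)" "A2 \<in> sets (F t)" "B1 \<in> noise" "B2 \<in> noise" unfolding E_def by blast
      have "D1 \<inter> D2 = (A1 \<inter> A2) \<inter> {\<omega>\<in>space Q. \<xi> \<omega> \<in> Y1 \<inter> Y2} \<inter> (B1 \<inter> B2)" using h by auto
      then show "D1 \<inter> D2 \<in> E" unfolding E_def using h noise_Int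
        by (intro CollectI exI[of _ "A1 \<inter> A2"] exI[of _ "Y1 \<inter> Y2"] exI[of _ "B1 \<inter> B2"]) auto
    qed
    have "space Q = space Q \<inter> {\<omega>\<in>space Q. \<xi> \<omega> \<in> UNIV} \<inter> space Q" by auto
    then show "space Q \<in> E" unfolding E_def using topF topn by blast
    show "indicator C \<in> borel_measurable W" using C JW by auto
    show "(\<integral>\<^sup>+\<omega>. indicator A \<omega> \<partial>Q) < \<infinity>" using AQ by (simp add: emeasure_eq_measure)
    fix D assume "D \<in> E"
    then obtain A' Y B where D: "D = A' \<inter> {\<omega>\<in>space Q. \<xi> \<omega> \<in> Y} \<inter> B" "A' \<in> sets (F t)" "B \<in> noise" unfolding E_def by blast
    have A'T: "A' \<in> sets (F T)" using D(2) F_mono[OF t order_refl] by auto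
    have *: "(\<integral>\<^sup>+\<omega>. h \<omega> * indicator D \<omega> \<partial>Q) = (\<integral>\<^sup>+\<omega>. (indicator A' \<omega> * \<mu>s Y \<omega>) * h \<omega> \<partial>Q) * ennreal (prob B)"
      if h: "h \<in> borel_measurable (F T)" for h
    proof -
      have hb: "h \<in> borel_measurable base" "A' \<in> sets base"
        using h FT_base A'T by (auto intro: measurable_mono_sets)
      have "(\<integral>\<^sup>+\<omega>. h \<omega> * indicator D \<omega> \<partial>Q) =
        (\<integral>\<^sup>+\<omega>. (h \<omega> * indicator A' \<omega> * indicator {\<omega>\<in>space Q. \<xi> \<omega> \<in> Y} \<omega>) * indicator B \<omega> \<partial>Q)"
        unfolding D(1) by (simp add: indicator_inter_arith mult.assoc)
      also have "\<dots> = (\<integral>\<^sup>+\<omega>. h \<omega> * indicator A' \<omega> * indicator {\<omega>\<in>space Q. \<xi> \<omega> \<in> Y} \<omega> \<partial>Q) * ennreal (prob B)"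
        using hb \<xi>B[of Y] D(3) by (intro noise_indep borel_measurable_times_ennreal borel_measurable_indicator)
      also have "(\<integral>\<^sup>+\<omega>. h \<omega> * indicator A' \<omega> * indicator {\<omega>\<in>space Q. \<xi> \<omega> \<in> Y} \<omega> \<partial>Q) =
          (\<integral>\<^sup>+\<omega>. h \<omega> * indicator A' \<omega> * \<mu>s Y \<omega> \<partial>Q)"
        using h A'T by (intro \<xi>_cond_nn_integral borel_measurable_times_ennreal borel_measurable_indicator)
      finally show ?thesis by (simp add: mult_ac)
    qed
    have "(\<integral>\<^sup>+\<omega>. (indicator A' \<omega> * \<mu>s Y \<omega>) * ?q \<omega> \<partial>Q) = (\<integral>\<^sup>+\<omega>. (indicator A' \<omega> * \<mu>s Y \<omega>) * indicator A \<omega> \<partial>Q)"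
      using D(2) \<mu>s_F[OF t] AQ
      by (intro Ft.nn_cond_exp_intg borel_measurable_times_ennreal borel_measurable_indicator) auto
    then show "(\<integral>\<^sup>+\<omega>. indicator A \<omega> * indicator D \<omega> \<partial>Q) = (\<integral>\<^sup>+\<omega>. ?q \<omega> * indicator D \<omega> \<partial>Q)"
      using *[OF FtT[OF qm]] *[of "indicator A"] A by simp
  qed (use AQ in auto)
  then show ?thesis .
qed

text \<open>On events of \<open>F T\<close>, immersion lets the indicator of an event of
  \<open>J t\<close> be replaced by its conditional probability given \<open>F t\<close>. By
  \<open>nn_integral_post\<close> the same holds against functions of \<open>F T\<close> and the
  future noise.\<close>

lemma past_future_cond_indep:
  assumes t: "0 \<le> t" "t \<le> T" and V: "V \<in> borel_measurable (J t)" and R: "R \<in> borel_measurable (post t)"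
  shows "(\<integral>\<^sup>+\<omega>. R \<omega> * V \<omega> \<partial>Q) = (\<integral>\<^sup>+\<omega>. nn_cond_exp Q (F t) R \<omega> * V \<omega> \<partial>Q)"
proof (rule nn_integral_eq_on_subalgebra[OF J_sub[OF t] _ _ _ V])
  interpret Ft: sigma_finite_subalgebra Q "F t" by (rule Ft_sigma_finite[OF t])
  show RQ: "R \<in> borel_measurable Q" by (rule measurable_from_subalg[OF post_sub[OF t(1)] R])
  fix C assume C: "C \<in> sets (J t)"
  have CK: "C \<in> sets (K t)" and CQ: "C \<in> events" using C J_K[OF t] K_events by auto
  let ?c = "nn_cond_exp Q (F t) (indicator C)" and ?g = "nn_cond_exp Q (F t) R"
  have cF: "?c \<in> borel_measurable (F t)" by simp
  have cK: "?c \<in> borel_measurable (K t)" using J_upper(1)[OF t] J_K[OF t] t by (intro measurable_mono_sets[OF cF]) auto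
  have "(\<integral>\<^sup>+\<omega>. indicator C \<omega> * R \<omega> \<partial>Q) = (\<integral>\<^sup>+\<omega>. ?c \<omega> * R \<omega> \<partial>Q)"
  proof (rule nn_integral_post[OF t _ _ _ _ cK _ R])
    fix A assume A: "A \<in> sets (F T)"
    then have AQ: "A \<in> events" using FT_sub by (auto simp: subalgebra_def)
    let ?q = "nn_cond_exp Q (F t) (indicator A)"
    have "(\<integral>\<^sup>+\<omega>. indicator C \<omega> * (indicator A \<omega> :: ennreal) \<partial>Q) = (\<integral>\<^sup>+\<omega>. ?q \<omega> * indicator C \<omega> \<partial>Q)"
      using immersion[OF t A C] by (simp add: mult.commute)
    also have "\<dots> = (\<integral>\<^sup>+\<omega>. ?q \<omega> * ?c \<omega> \<partial>Q)"
      using CQ by (intro Ft.nn_cond_exp_intg[symmetric]) auto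
    also have "\<dots> = (\<integral>\<^sup>+\<omega>. ?c \<omega> * indicator A \<omega> \<partial>Q)"
      using AQ by (subst mult.commute, intro Ft.nn_cond_exp_intg) auto
    finally show "(\<integral>\<^sup>+\<omega>. indicator C \<omega> * indicator A \<omega> \<partial>Q) = (\<integral>\<^sup>+\<omega>. ?c \<omega> * indicator A \<omega> \<partial>Q)" .
  qed (use CK CQ in \<open>auto simp: emeasure_eq_measure\<close>)
  also have "\<dots> = (\<integral>\<^sup>+\<omega>. ?c \<omega> * ?g \<omega> \<partial>Q)" using RQ by (intro Ft.nn_cond_exp_intg[symmetric]) auto
  also have "\<dots> = (\<integral>\<^sup>+\<omega>. ?g \<omega> * indicator C \<omega> \<partial>Q)"
    using CQ by (subst mult.commute, intro Ft.nn_cond_exp_intg) auto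
  finally show "(\<integral>\<^sup>+\<omega>. R \<omega> * indicator C \<omega> \<partial>Q) = (\<integral>\<^sup>+\<omega>. ?g \<omega> * indicator C \<omega> \<partial>Q)" by (simp add: mult.commute)
qed simp

end

section \<open>The conditional Markov property\<close>

lemma sets_Collect_All_less:
  fixes n :: nat
  assumes "\<And>i. i < n \<Longrightarrow> {x\<in>space M. P i x} \<in> sets M"
  shows "{x\<in>space M. \<forall>i<n. P i x} \<in> sets M"
proof -
  have "{x\<in>space M. \<forall>i\<in>{..<n}. P i x} \<in> sets M"
  proof (rule sets.sets_Collect_finite_All)
    fix i assume "i \<in> {..<n}"
    then show "{x\<in>space M. P i x} \<in> sets M" using assms[of i] by (simp only: lessThan_iff)
  qed simp
  then show ?thesis by (simp only: Ball_def lessThan_iff)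
qed

context cmc_change
begin

lemma changed_post: "0 \<le> t \<Longrightarrow> t \<le> r \<Longrightarrow> r \<le> s \<Longrightarrow> s \<le> T \<Longrightarrow> changed r s \<in> measurable (post t) (count_space (Pow I))"
  by (intro changed_measurable incr_post)

lemma chain_from_post: "0 \<le> t \<Longrightarrow> t \<le> v \<Longrightarrow> v \<le> T \<Longrightarrow> chain_from t x v \<in> measurable (post t) (count_space UNIV)"
  by (intro chain_from_measurable changed_post) auto

text \<open>\<open>psi\<close> with the chain replaced by its reconstruction from state
  \<open>x\<close> at time \<open>t\<close>, hence free of the past.\<close>

definition "psi_from t x p u \<omega> = 1 + of_bool (chain_from t x u \<omega> = fst p) * (Lp p u \<omega> / ap p - 1)"

text \<open>On \<open>X t = x\<close> the density over \<open>{t<..T}\<close> and the event are functionals of \<open>F T\<close> and of the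
  increments of the noise after \<open>t\<close>; this is the functional.\<close>

definition "restart t x E \<omega> = lim_density (psi_from t x) t T \<omega> * indicator {\<omega>\<in>space Q. E (\<lambda>u. chain_from t x u \<omega>)} \<omega>"

lemma psi_from_post:
  assumes "p \<in> I" "0 \<le> t" "t \<le> u" "u \<le> T"
  shows "psi_from t x p u \<in> borel_measurable (post t)"
proof -
  have "Lp p u \<in> borel_measurable (post t)" using assms I_D by (intro F_post[OF \<Lambda>_F]) auto
  moreover have "(\<lambda>\<omega>. of_bool (chain_from t x u \<omega> = fst p) :: real) \<in> borel_measurable (post t)"
    using assms by (intro of_bool_measurable chain_from_post)
  ultimately show ?thesis unfolding psi_from_def[abs_def] by measurable
qed

lemma restart_post:
  fixes n :: nat
  assumes t: "0 \<le> t" "t \<le> T" and ts: "\<And>i. i < n \<Longrightarrow> t \<le> r i \<and> r i \<le> T"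
  shows "restart t x (\<lambda>f. \<forall>i<n. f (r i) = z i) \<in> borel_measurable (post t)"
proof -
  have "lim_density (psi_from t x) t T \<in> borel_measurable (post t)"
    using t by (intro lim_density_measurable psi_from_post incr_post) auto
  moreover have "{\<omega>\<in>space (post t). \<forall>i<n. chain_from t x (r i) \<omega> = z i} \<in> sets (post t)"
  proof (rule sets_Collect_All_less)
    fix i assume "i < n"
    then show "{\<omega>\<in>space (post t). chain_from t x (r i) \<omega> = z i} \<in> sets (post t)"
      using measurable_sets[OF chain_from_post[of t "r i" x], of "{z i}"] ts[of i] t
      by (auto simp: vimage_def Int_def conj_commute)
  qed
  ultimately show ?thesis unfolding restart_def[abs_def]
    by (intro borel_measurable_times_ennreal borel_measurable_indicator) (simp_all only: space_post)
qed

lemma restart_eq: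
  fixes n :: nat
  assumes g: "good \<omega>" and t: "0 \<le> t" "t \<le> T" and x: "X t \<omega> = x" and ts: "\<And>i. i < n \<Longrightarrow> t \<le> r i \<and> r i \<le> T"
  shows "restart t x (\<lambda>f. \<forall>i<n. f (r i) = z i) \<omega> = Zh t T \<omega> * indicator {\<omega>\<in>space Q. \<forall>i<n. X (r i) \<omega> = z i} \<omega>"
proof -
  have c: "chain_from t x u \<omega> = X u \<omega>" if "t \<le> u" "u \<le> T" for u
    using chain_from_eq[OF g t(1) that x] .
  have "lim_density (psi_from t x) t T \<omega> = lim_density psi t T \<omega>"
    using t(2) c by (intro lim_density_cong) (auto simp: psi_from_def psi_def)
  moreover have "(\<forall>i<n. chain_from t x (r i) \<omega> = z i) \<longleftrightarrow> (\<forall>i<n. X (r i) \<omega> = z i)" using c ts by auto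
  ultimately show ?thesis unfolding restart_def Zh_def by (simp add: indicator_def)
qed

text \<open>Bayes' rule without a denominator. \<open>\<theta>\<close> splits at \<open>t\<close>;
  on \<open>X t = x\<close> the later factor times the event is \<open>restart\<close>, which may be
  replaced by its conditional expectation \<open>g x\<close> given \<open>F t\<close>. The earlier
  factor then turns \<open>Q\<close> back into \<open>P\<close> on \<open>K t\<close>.\<close>

lemma Markov_kernel:
  fixes z :: "nat \<Rightarrow> nat" and r :: "nat \<Rightarrow> real" and n :: nat
  assumes t: "0 \<le> t" "t \<le> T" and ts: "\<And>i. i < n \<Longrightarrow> t \<le> r i \<and> r i \<le> T"
  defines "E \<equiv> {\<omega>\<in>space Q. \<forall>i<n. X (r i) \<omega> = z i}"
  shows "\<exists>g :: nat \<Rightarrow> 'a \<Rightarrow> ennreal. (\<forall>x. g x \<in> borel_measurable (F t)) \<and> (\<forall>C\<in>sets (J t).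
      (\<integral>\<^sup>+\<omega>. indicator C \<omega> * (\<Sum>x\<in>S. indicator {\<omega>\<in>space Q. X t \<omega> = x} \<omega> * g x \<omega>) \<partial>P) = emeasure P (C \<inter> E))"
proof -
  let ?R = "\<lambda>x. restart t x (\<lambda>f. \<forall>i<n. f (r i) = z i)"
  define g where "g x = nn_cond_exp Q (F t) (?R x)" for x
  have R: "?R x \<in> borel_measurable (post t)" for x by (rule restart_post[OF t ts])
  have RQ: "?R x \<in> borel_measurable Q" for x by (rule measurable_from_subalg[OF post_sub[OF t(1)] R])
  have gF: "g x \<in> borel_measurable (F t)" for x unfolding g_def by simp
  have gJ: "g x \<in> borel_measurable (J t)" for x using t by (intro F_J[OF gF]) auto
  have gQ: "g x \<in> borel_measurable Q" for x by (rule measurable_from_subalg[OF J_sub[OF t] gJ])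
  have H: "{\<omega>\<in>space Q. X t \<omega> = x} \<in> sets (J t)" for x
    using measurable_sets[OF X_J[of t t], of "{x}"] t by (auto simp: vimage_def Int_def conj_commute)
  have JT: "C \<in> sets (K T)" if "C \<in> sets (J t)" for C using that J_K[OF t] K_mono[OF t(2)] by auto
  have E: "E \<in> sets (K T)"
  proof -
    have "{\<omega>\<in>space (K T). \<forall>i<n. X (r i) \<omega> = z i} \<in> sets (K T)"
    proof (rule sets_Collect_All_less)
      fix i assume "i < n"
      then show "{\<omega>\<in>space (K T). X (r i) \<omega> = z i} \<in> sets (K T)"
        using measurable_sets[OF J_K_meas[OF X_J[of "r i" "r i"]], of T "{z i}"] ts[of i] t
        by (auto simp: vimage_def Int_def conj_commute)
    qed
    then show ?thesis unfolding E_def by (simp only: space_K)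
  qed
  show ?thesis
  proof (intro exI[of _ g] conjI allI ballI gF)
    fix C assume C: "C \<in> sets (J t)"
    let ?V = "\<lambda>x \<omega>. Zh 0 t \<omega> * (indicator C \<omega> * indicator {\<omega>\<in>space Q. X t \<omega> = x} \<omega>) :: ennreal"
    have V: "?V x \<in> borel_measurable (J t)" for x
      using C H Zh_J[of 0 t] t by (intro borel_measurable_times_ennreal borel_measurable_indicator) auto
    note VQ = measurable_from_subalg[OF J_sub[OF t] V]
    have one: "(\<Sum>x\<in>S. indicator {\<omega>\<in>space Q. X t \<omega> = x} \<omega> * h x) = h (X t \<omega>)" if "good \<omega>" for \<omega> and h :: "nat \<Rightarrow> ennreal"
    proof -
      have "(\<Sum>x\<in>S. indicator {\<omega>\<in>space Q. X t \<omega> = x} \<omega> * h x) = (\<Sum>x\<in>S. if x = X t \<omega> then h x else 0)"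
        using good_space[OF that] by (intro sum.cong) (auto simp: indicator_def)
      then show ?thesis using X_in_S[OF that t] by (simp add: S_def)
    qed
    have "emeasure P (C \<inter> E) = (\<integral>\<^sup>+\<omega>. ennreal (\<theta> \<omega>) * indicator (C \<inter> E) \<omega> \<partial>Q)"
      using E JT[OF C] P_nn_integral[of "indicator (C \<inter> E)"] by (simp add: sets_P)
    also have "\<dots> = (\<integral>\<^sup>+\<omega>. (\<Sum>x\<in>S. ?R x \<omega> * ?V x \<omega>) \<partial>Q)"
    proof (rule nn_integral_cong_AE)
      show "AE \<omega> in Q. ennreal (\<theta> \<omega>) * indicator (C \<inter> E) \<omega> = (\<Sum>x\<in>S. ?R x \<omega> * ?V x \<omega>)"
        using AE_good
      proof eventually_elim
        case (elim \<omega>)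
        have "(\<Sum>x\<in>S. ?R x \<omega> * ?V x \<omega>) = (\<Sum>x\<in>S. indicator {\<omega>\<in>space Q. X t \<omega> = x} \<omega> * (?R x \<omega> * (Zh 0 t \<omega> * indicator C \<omega>)))"
          by (intro sum.cong) (auto simp: mult_ac)
        also have "\<dots> = ?R (X t \<omega>) \<omega> * (Zh 0 t \<omega> * indicator C \<omega>)" using one[OF elim] .
        also have "?R (X t \<omega>) \<omega> = Zh t T \<omega> * indicator E \<omega>" unfolding E_def using ts by (intro restart_eq elim t) auto
        also have "Zh t T \<omega> * indicator E \<omega> * (Zh 0 t \<omega> * indicator C \<omega>) = ennreal (\<theta> \<omega>) * indicator (C \<inter> E) \<omega>"
          using \<theta>_split[OF elim t] by (simp add: indicator_inter_arith mult_ac)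
        finally show ?case by simp
      qed
    qed
    also have "\<dots> = (\<Sum>x\<in>S. \<integral>\<^sup>+\<omega>. ?R x \<omega> * ?V x \<omega> \<partial>Q)" using RQ VQ by (intro nn_integral_sum) auto
    also have "\<dots> = (\<Sum>x\<in>S. \<integral>\<^sup>+\<omega>. g x \<omega> * ?V x \<omega> \<partial>Q)"
      unfolding g_def by (intro sum.cong refl past_future_cond_indep[OF t V R])
    also have "\<dots> = (\<integral>\<^sup>+\<omega>. (\<Sum>x\<in>S. g x \<omega> * ?V x \<omega>) \<partial>Q)" using gQ VQ by (intro nn_integral_sum[symmetric]) auto
    also have "\<dots> = (\<integral>\<^sup>+\<omega>. Zh 0 t \<omega> * (indicator C \<omega> * (\<Sum>x\<in>S. indicator {\<omega>\<in>space Q. X t \<omega> = x} \<omega> * g x \<omega>)) \<partial>Q)"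
      by (simp add: sum_distrib_left mult_ac)
    also have "\<dots> = (\<integral>\<^sup>+\<omega>. indicator C \<omega> * (\<Sum>x\<in>S. indicator {\<omega>\<in>space Q. X t \<omega> = x} \<omega> * g x \<omega>) \<partial>P)"
    proof (rule P_nn_integral_K[OF t, symmetric])
      have "(\<lambda>\<omega>. indicator C \<omega> * (\<Sum>x\<in>S. indicator {\<omega>\<in>space Q. X t \<omega> = x} \<omega> * g x \<omega>)) \<in> borel_measurable (J t)"
        using C H gJ by (intro borel_measurable_times_ennreal borel_measurable_indicator borel_measurable_sum) auto
      then show "(\<lambda>\<omega>. indicator C \<omega> * (\<Sum>x\<in>S. indicator {\<omega>\<in>space Q. X t \<omega> = x} \<omega> * g x \<omega>)) \<in> borel_measurable (K t)"
        using t by (rule J_K_meas) auto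
    qed
    finally show "(\<integral>\<^sup>+\<omega>. indicator C \<omega> * (\<Sum>x\<in>S. indicator {\<omega>\<in>space Q. X t \<omega> = x} \<omega> * g x \<omega>) \<partial>P) = emeasure P (C \<inter> E)" by simp
  qed
qed

lemma J_sub_P: "0 \<le> t \<Longrightarrow> t \<le> T \<Longrightarrow> subalgebra P (J t)"
  using J_K[of t] K_mono[of t T] by (intro subalg_P) auto

text \<open>One function serves both \<sigma>-algebras: the kernel evaluated at the current state is
  measurable for \<open>F t\<close> and \<open>X t\<close> alone, yet has the defining property on
  the larger \<open>J t\<close>.\<close>

lemma Markov_property:
  fixes n :: nat
  assumes t: "0 \<le> t" "t \<le> T" and ts: "\<And>i. i < n \<Longrightarrow> t \<le> r i \<and> r i \<le> T"
  shows "AE \<omega> in P. cond_prob_alg P (J t) (\<lambda>\<omega>. \<forall>i<n. X (r i) \<omega> = z i) \<omega> =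
    cond_prob_alg P (join_alg (F t) (sigma_rv P (X t))) (\<lambda>\<omega>. \<forall>i<n. X (r i) \<omega> = z i) \<omega>"
proof -
  interpret P: prob_space P by (rule prob_P)
  let ?L = "join_alg (F t) (sigma_rv P (X t))" and ?E = "{\<omega>\<in>space Q. \<forall>i<n. X (r i) \<omega> = z i}"
  obtain g where g: "\<And>x. g x \<in> borel_measurable (F t)" and
    key: "\<And>C. C \<in> sets (J t) \<Longrightarrow>
      (\<integral>\<^sup>+\<omega>. indicator C \<omega> * (\<Sum>x\<in>S. indicator {\<omega>\<in>space Q. X t \<omega> = x} \<omega> * g x \<omega>) \<partial>P) = emeasure P (C \<inter> ?E)"
  proof -
    have "\<exists>g :: nat \<Rightarrow> 'a \<Rightarrow> ennreal. (\<forall>x. g x \<in> borel_measurable (F t)) \<and> (\<forall>C\<in>sets (J t).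
      (\<integral>\<^sup>+\<omega>. indicator C \<omega> * (\<Sum>x\<in>S. indicator {\<omega>\<in>space Q. X t \<omega> = x} \<omega> * g x \<omega>) \<partial>P) = emeasure P (C \<inter> ?E))"
      by (rule Markov_kernel[OF t]) (rule ts)
    then show ?thesis using that by blast
  qed
  define f where "f \<omega> = (\<Sum>x\<in>S. indicator {\<omega>\<in>space Q. X t \<omega> = x} \<omega> * g x \<omega>)" for \<omega>
  have spL: "space ?L = space Q" using t by simp
  have FL: "sets (F t) \<subseteq> sets ?L" and XL: "sets (sigma_rv P (X t)) \<subseteq> sets ?L"
    using t by (auto intro!: join_alg_upper)
  have rv: "sets (sigma_rv P (X t)) \<subseteq> sets (J t)" using t by (intro sigma_rv_subset X_J) auto
  have LJ: "sets ?L \<subseteq> sets (J t)" using t rv J_upper(1)[OF t] by (intro join_alg_least) auto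
  have subJ: "subalgebra P (J t)" by (rule J_sub_P[OF t])
  then have subL: "subalgebra P ?L" using LJ spL by (auto simp: subalgebra_def)
  have H: "{\<omega>\<in>space Q. X t \<omega> = x} \<in> sets ?L" for x
  proof -
    have "X t -` {x} \<inter> space P \<in> sets (sigma_rv P (X t))" by (auto simp: sets_sigma_rv)
    then show ?thesis using XL by (auto simp: vimage_def Int_def conj_commute)
  qed
  have fL: "f \<in> borel_measurable ?L"
  proof -
    have "g x \<in> borel_measurable ?L" for x
      by (rule measurable_mono_sets[OF g]) (use FL spL t in simp_all)
    then show ?thesis unfolding f_def[abs_def] using H
      by (intro borel_measurable_times_ennreal borel_measurable_indicator borel_measurable_sum) auto
  qed
  have fP: "f \<in> borel_measurable P" by (rule measurable_from_subalg[OF subL fL])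
  have E: "{\<omega>\<in>space P. \<forall>i<n. X (r i) \<omega> = z i} \<in> sets P"
  proof -
    have "{\<omega>\<in>space (K T). \<forall>i<n. X (r i) \<omega> = z i} \<in> sets (K T)"
    proof (rule sets_Collect_All_less)
      fix i assume "i < n"
      then show "{\<omega>\<in>space (K T). X (r i) \<omega> = z i} \<in> sets (K T)"
        using measurable_sets[OF J_K_meas[OF X_J[of "r i" "r i"]], of T "{z i}"] ts[of i] t
        by (auto simp: vimage_def Int_def conj_commute)
    qed
    then show ?thesis by (simp only: sets_P space_P space_K)
  qed
  have "(\<integral>\<^sup>+\<omega>. f \<omega> \<partial>P) = emeasure P ?E"
    using key[of "space Q"] sets.top[of "J t"] t
    by (simp add: f_def Int_absorb1 subset_eq cong: nn_integral_cong_simp)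
  \<comment> \<open>The integral of \<open>f\<close> under \<open>P\<close> is a probability, so
    \<open>f\<close> is finite almost everywhere and \<open>enn2real\<close> changes it on a null
    set only.\<close>
  then have fin: "AE \<omega> in P. f \<omega> \<noteq> \<infinity>"
    using fP by (intro nn_integral_PInf_AE) (auto simp: P.emeasure_eq_measure)
  have key': "(\<integral>\<^sup>+\<omega>. indicator C \<omega> * ennreal (enn2real (f \<omega>)) \<partial>P) = emeasure P (C \<inter> ?E)" if C: "C \<in> sets (J t)" for C
  proof -
    have "(\<integral>\<^sup>+\<omega>. indicator C \<omega> * ennreal (enn2real (f \<omega>)) \<partial>P) = (\<integral>\<^sup>+\<omega>. indicator C \<omega> * f \<omega> \<partial>P)"
      using fin by (intro nn_integral_cong_AE) (auto elim!: eventually_mono simp: less_top)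
    then show ?thesis using key[OF C] by (simp add: f_def)
  qed
  have fL': "(\<lambda>\<omega>. enn2real (f \<omega>)) \<in> borel_measurable ?L" using fL by measurable
  have fJ': "(\<lambda>\<omega>. enn2real (f \<omega>)) \<in> borel_measurable (J t)"
    using fL' LJ spL t by (auto intro: measurable_mono_sets)
  have "AE \<omega> in P. cond_prob_alg P (J t) (\<lambda>\<omega>. \<forall>i<n. X (r i) \<omega> = z i) \<omega> = enn2real (f \<omega>)"
    using key' by (intro P.cond_prob_charact subJ E fJ') auto
  moreover have "AE \<omega> in P. cond_prob_alg P ?L (\<lambda>\<omega>. \<forall>i<n. X (r i) \<omega> = z i) \<omega> = enn2real (f \<omega>)"
    using key' LJ by (intro P.cond_prob_charact subL E fL') auto
  ultimately show ?thesis by eventually_elim simp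
qed

lemma CMC: "is_CMC P T S F G X"
  unfolding is_CMC_def
proof (intro conjI allI impI)
  show "AE \<omega> in P. cadlag T (\<lambda>t. X t \<omega>) \<and> (\<forall>t\<in>{0..T}. X t \<omega> \<in> S)"
    using AE_P[OF AE_good] by eventually_elim (auto intro: good_cadlag X_in_S)
  show "adapted T G (count_space UNIV) X" unfolding adapted_def using X_G by auto
  fix t and ts :: "real list" and xs :: "nat list"
  assume h: "0 \<le> t \<and> sorted (t # ts) \<and> set ts \<subseteq> {..T} \<and> t \<le> T \<and> length xs = length ts \<and> set xs \<subseteq> S"
  have "t \<le> ts ! i \<and> ts ! i \<le> T" if "i < length ts" for i
    using h nth_mem[OF that] by auto
  then show "AE \<omega> in P. cond_prob_alg P (join_alg (F t) (G t)) (\<lambda>\<omega>. \<forall>i<length ts. X (ts ! i) \<omega> = xs ! i) \<omega> =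
    cond_prob_alg P (join_alg (F t) (sigma_rv P (X t))) (\<lambda>\<omega>. \<forall>i<length ts. X (ts ! i) \<omega> = xs ! i) \<omega>"
    using Markov_property[of t "length ts" "\<lambda>i. ts ! i" "\<lambda>i. xs ! i"] h unfolding J_def by auto
qed

end

section \<open>Compensation by perturbation of the density\<close>

text \<open>The product of Bernoulli's inequality and the tangent bound of the exponential. They may
  be multiplied when the second lower bound is nonnegative; otherwise \<epsilon> is positive and the
  left-hand side is at most 0.\<close>

lemma perturbation_ineq:
  fixes B \<epsilon> :: real
  assumes "-1 \<le> \<epsilon>" "0 \<le> B"
  shows "1 + \<epsilon> * (real D - B) - \<epsilon>\<^sup>2 * (real D * B) \<le> (1 + \<epsilon>) ^ D * exp (- \<epsilon> * B)"
proof -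
  have eq: "1 + \<epsilon> * (real D - B) - \<epsilon>\<^sup>2 * (real D * B) = (1 + real D * \<epsilon>) * (1 - \<epsilon> * B)"
    by (simp add: algebra_simps power2_eq_square)
  have ber: "1 + real D * \<epsilon> \<le> (1 + \<epsilon>) ^ D" using Bernoulli_inequality[OF assms(1)] .
  have e: "1 - \<epsilon> * B \<le> exp (- \<epsilon> * B)" using exp_ge_add_one_self[of "- \<epsilon> * B"] by simp
  have p: "0 \<le> (1 + \<epsilon>) ^ D" using assms by simp
  show ?thesis
  proof (cases "0 \<le> 1 - \<epsilon> * B")
    case True
    have "(1 + real D * \<epsilon>) * (1 - \<epsilon> * B) \<le> (1 + \<epsilon>) ^ D * (1 - \<epsilon> * B)" using ber True by (rule mult_right_mono)
    also have "\<dots> \<le> (1 + \<epsilon>) ^ D * exp (- \<epsilon> * B)" using e p by (rule mult_left_mono)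
    finally show ?thesis unfolding eq .
  next
    case False
    then have "0 < \<epsilon>" using assms(2) by (metis diff_ge_0_iff_ge linorder_not_less mult_nonpos_nonneg order_trans zero_le_one)
    then have "(1 + real D * \<epsilon>) * (1 - \<epsilon> * B) \<le> 0" using False by (intro mult_nonneg_nonpos) auto
    also have "0 \<le> (1 + \<epsilon>) ^ D * exp (- \<epsilon> * B)" using p by simp
    finally show ?thesis unfolding eq .
  qed
qed

text \<open>Differentiating the supermartingale inequality at \<open>\<epsilon> = 0\<close> from both sides identifies the compensator.\<close>

lemma (in prob_space) compensation_from_perturbation:
  fixes D :: "'a \<Rightarrow> nat" and B :: "'a \<Rightarrow> real"
  assumes D: "D \<in> measurable M (count_space UNIV)" and B: "B \<in> borel_measurable M" "AE \<omega> in M. 0 \<le> B \<omega> \<and> B \<omega> \<le> c"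
    and le: "\<And>\<epsilon> C. C \<in> \<C> \<Longrightarrow> -1 < \<epsilon> \<Longrightarrow> \<epsilon> \<le> 1 \<Longrightarrow>
      (\<integral>\<^sup>+\<omega>. indicator C \<omega> * ennreal ((1 + \<epsilon>) ^ D \<omega> * exp (- \<epsilon> * B \<omega>)) \<partial>M) \<le> emeasure M C"
    and C: "\<C> \<subseteq> events" "space M \<in> \<C>" "C \<in> \<C>"
  shows "integrable M (\<lambda>\<omega>. real (D \<omega>))" "integrable M B"
    and "(\<integral>\<omega>. indicator C \<omega> * (real (D \<omega>) - B \<omega>) \<partial>M) = 0"
proof -
  have Dr: "(\<lambda>\<omega>. real (D \<omega>)) \<in> borel_measurable M" using D by measurable
  have em: "(\<lambda>\<omega>. (1 + \<epsilon>) ^ D \<omega> * exp (- \<epsilon> * B \<omega>)) \<in> borel_measurable M" for \<epsilon> :: real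
  proof -
    have "(\<lambda>\<omega>. exp (- \<epsilon> * B \<omega>)) \<in> borel_measurable M" using B(1) by simp
    then show ?thesis using D by (intro borel_measurable_times borel_measurable_power_nat) auto
  qed
  show Bi: "integrable M B"
  proof (rule integrable_const_bound[where B = c])
    show "AE \<omega> in M. norm (B \<omega>) \<le> c" using B(2) by eventually_elim simp
  qed (rule B(1))
  \<comment> \<open>\<epsilon> = 1 bounds the mean of \<open>2 ^ D\<close>, hence of
    \<open>D\<close>; \<open>exp c\<close> undoes the factor with \<open>B\<close>, which is at most
    \<open>c\<close>.\<close>
  show Di: "integrable M (\<lambda>\<omega>. real (D \<omega>))"
  proof (rule integrableI_nonneg[OF Dr])
    have "(\<integral>\<^sup>+\<omega>. ennreal (real (D \<omega>)) \<partial>M) \<le> (\<integral>\<^sup>+\<omega>. ennreal (exp c) * (indicator (space M) \<omega> * ennreal ((1 + 1) ^ D \<omega> * exp (- 1 * B \<omega>))) \<partial>M)"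
    proof (rule nn_integral_mono_AE)
      show "AE \<omega> in M. ennreal (real (D \<omega>)) \<le> ennreal (exp c) * (indicator (space M) \<omega> * ennreal ((1 + 1) ^ D \<omega> * exp (- 1 * B \<omega>)))"
        using B(2) AE_space
      proof eventually_elim
        case (elim \<omega>)
        have "real (D \<omega>) \<le> 2 ^ D \<omega>" using of_nat_less_two_power[of "D \<omega>", where 'a = real] by simp
        also have "\<dots> \<le> exp c * (2 ^ D \<omega> * exp (- B \<omega>))"
        proof -
          have "1 \<le> exp c * exp (- B \<omega>)" using elim by (simp flip: exp_add)
          then show ?thesis by (simp add: mult.left_commute)
        qed
        finally have "ennreal (real (D \<omega>)) \<le> ennreal (exp c * (2 ^ D \<omega> * exp (- B \<omega>)))" by (rule ennreal_leI)
        then show ?case using elim by (simp add: ennreal_mult)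
      qed
    qed
    also have "\<dots> = ennreal (exp c) * (\<integral>\<^sup>+\<omega>. indicator (space M) \<omega> * ennreal ((1 + 1) ^ D \<omega> * exp (- 1 * B \<omega>)) \<partial>M)"
      using em[of 1] by (intro nn_integral_cmult borel_measurable_times_ennreal borel_measurable_indicator measurable_compose[OF _ measurable_ennreal]) auto
    also have "\<dots> \<le> ennreal (exp c) * emeasure M (space M)" using le[OF C(2), of 1] by (intro mult_left_mono) auto
    also have "\<dots> < \<infinity>" by (simp add: emeasure_space_1 ennreal_mult_less_top)
    finally show "(\<integral>\<^sup>+\<omega>. ennreal (real (D \<omega>)) \<partial>M) < \<infinity>" .
  qed simp
  have Cm: "C \<in> events" using C by auto
  let ?I = "\<lambda>f. \<integral>\<omega>. indicator C \<omega> * f \<omega> \<partial>M"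
  have int: "integrable M (\<lambda>\<omega>. indicator C \<omega> * f \<omega>)" if "integrable M f" for f :: "'a \<Rightarrow> real"
    using integrable_real_mult_indicator[OF Cm that] by (simp add: mult.commute)
  have DB: "integrable M (\<lambda>\<omega>. real (D \<omega>) * B \<omega>)"
  proof (rule Bochner_Integration.integrable_bound[OF integrable_mult_right[OF Di, of c]])
    show "AE \<omega> in M. norm (real (D \<omega>) * B \<omega>) \<le> norm (c * real (D \<omega>))"
      using B(2) by eventually_elim (auto simp: abs_mult mult.commute intro!: mult_right_mono)
  qed (use Dr B in measurable)
  have key: "\<epsilon> * ?I (\<lambda>\<omega>. real (D \<omega>) - B \<omega>) \<le> \<epsilon>\<^sup>2 * ?I (\<lambda>\<omega>. real (D \<omega>) * B \<omega>)" if \<epsilon>: "-1 < \<epsilon>" "\<epsilon> \<le> 1" for \<epsilon>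
  proof -
    let ?e = "\<lambda>\<omega>. (1 + \<epsilon>) ^ D \<omega> * exp (- \<epsilon> * B \<omega>)"
    have e0: "0 \<le> ?e \<omega>" for \<omega> using \<epsilon> by simp
    have eq: "(\<integral>\<^sup>+\<omega>. ennreal (indicator C \<omega> * ?e \<omega>) \<partial>M) = (\<integral>\<^sup>+\<omega>. indicator C \<omega> * ennreal (?e \<omega>) \<partial>M)"
      by (intro nn_integral_cong) (auto simp: indicator_def)
    have fin: "(\<integral>\<^sup>+\<omega>. ennreal (indicator C \<omega> * ?e \<omega>) \<partial>M) \<le> ennreal (prob C)"
      unfolding eq using le[OF C(3) \<epsilon>] by (simp add: emeasure_eq_measure)
    have ei: "integrable M (\<lambda>\<omega>. indicator C \<omega> * ?e \<omega>)"
      using em[of \<epsilon>] Cm e0 fin by (intro integrableI_nonneg) (auto intro: order.strict_trans1)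
    have "?I ?e \<le> prob C"
      using fin e0 ei by (subst (asm) nn_integral_eq_integral) (auto simp: ennreal_le_iff)
    have "?I (\<lambda>\<omega>. 1 + \<epsilon> * (real (D \<omega>) - B \<omega>) - \<epsilon>\<^sup>2 * (real (D \<omega>) * B \<omega>)) \<le> ?I ?e"
    proof (rule integral_mono_AE)
      show "AE \<omega> in M. indicator C \<omega> * (1 + \<epsilon> * (real (D \<omega>) - B \<omega>) - \<epsilon>\<^sup>2 * (real (D \<omega>) * B \<omega>)) \<le> indicator C \<omega> * ?e \<omega>"
        using B(2)
      proof eventually_elim
        case (elim \<omega>)
        then show ?case using \<epsilon> by (intro mult_left_mono perturbation_ineq) auto
      qed
      show "integrable M (\<lambda>\<omega>. indicator C \<omega> * (1 + \<epsilon> * (real (D \<omega>) - B \<omega>) - \<epsilon>\<^sup>2 * (real (D \<omega>) * B \<omega>)))"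
        by (intro int Bochner_Integration.integrable_diff Bochner_Integration.integrable_add integrable_mult_right Di Bi DB) simp
    qed fact
    also have "?I (\<lambda>\<omega>. 1 + \<epsilon> * (real (D \<omega>) - B \<omega>) - \<epsilon>\<^sup>2 * (real (D \<omega>) * B \<omega>)) =
       prob C + \<epsilon> * ?I (\<lambda>\<omega>. real (D \<omega>) - B \<omega>) - \<epsilon>\<^sup>2 * ?I (\<lambda>\<omega>. real (D \<omega>) * B \<omega>)"
    proof -
      have "?I (\<lambda>\<omega>. 1 + \<epsilon> * (real (D \<omega>) - B \<omega>) - \<epsilon>\<^sup>2 * (real (D \<omega>) * B \<omega>)) =
        (\<integral>\<omega>. (indicator C \<omega> + \<epsilon> * (indicator C \<omega> * (real (D \<omega>) - B \<omega>))) - \<epsilon>\<^sup>2 * (indicator C \<omega> * (real (D \<omega>) * B \<omega>)) \<partial>M)"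
        by (intro Bochner_Integration.integral_cong) (auto simp: algebra_simps)
      also have "\<dots> = (\<integral>\<omega>. indicator C \<omega> \<partial>M) + \<epsilon> * ?I (\<lambda>\<omega>. real (D \<omega>) - B \<omega>) - \<epsilon>\<^sup>2 * ?I (\<lambda>\<omega>. real (D \<omega>) * B \<omega>)"
      proof -
        have 1: "integrable M (indicator C :: _ \<Rightarrow> real)" using Cm by (intro integrable_real_indicator) (auto simp: emeasure_eq_measure)
        have 2: "integrable M (\<lambda>\<omega>. indicator C \<omega> * (real (D \<omega>) - B \<omega>))"
          by (intro int Bochner_Integration.integrable_diff Di Bi)
        show ?thesis using 1 2 int[OF DB]
          by (subst Bochner_Integration.integral_diff)
            (auto intro!: Bochner_Integration.integrable_add simp: Bochner_Integration.integral_add)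
      qed
      also have "(\<integral>\<omega>. indicator C \<omega> \<partial>M) = prob C" using Cm by (simp add: Int_absorb2 sets.sets_into_space)
      finally show ?thesis .
    qed
    finally show ?thesis using \<open>?I ?e \<le> prob C\<close> by linarith
  qed
  let ?a = "?I (\<lambda>\<omega>. real (D \<omega>) - B \<omega>)" and ?b = "?I (\<lambda>\<omega>. real (D \<omega>) * B \<omega>)"
  have 1: "?a \<le> ?b / real (Suc n)" for n
    using key[of "1 / real (Suc n)"] by (simp add: power2_eq_square field_simps del: of_nat_Suc)
  \<comment> \<open>The value \<epsilon> = -1 is excluded, so the denominators start at 2.\<close>
  have 2: "- ?a \<le> ?b / real (Suc (Suc n))" for n
    using key[of "- 1 / real (Suc (Suc n))"] by (simp add: power2_eq_square field_simps del: of_nat_Suc)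
  have 3: "(\<lambda>n. ?b / real (Suc n)) \<longlonglongrightarrow> 0" by (rule LIMSEQ_Suc[OF lim_const_over_n])
  have 4: "(\<lambda>n. ?b / real (Suc (Suc n))) \<longlonglongrightarrow> 0" by (rule LIMSEQ_Suc[OF 3])
  have "?a \<le> 0" using 1 by (intro LIMSEQ_le_const[OF 3]) blast
  moreover have "- ?a \<le> 0" using 2 by (intro LIMSEQ_le_const[OF 4]) blast
  ultimately have "?a \<le> 0 \<and> - ?a \<le> 0" ..
  then show "?a = 0" by linarith
qed

lemma path_int_real:
  fixes \<phi> :: "real \<Rightarrow> real"
  assumes "(\<lambda>u. indicator {s<..t} u * \<phi> u) \<in> borel_measurable borel" "\<And>u. s < u \<Longrightarrow> u \<le> t \<Longrightarrow> 0 \<le> \<phi> u"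
  shows "path_int \<phi> s t < \<infinity> \<longleftrightarrow> integrable lborel (\<lambda>u. indicator {s<..t} u * \<phi> u)"
    and "path_int \<phi> s t < \<infinity> \<Longrightarrow> path_int \<phi> s t = ennreal (\<integral>u. indicator {s<..t} u * \<phi> u \<partial>lborel)"
    and "0 \<le> (\<integral>u. indicator {s<..t} u * \<phi> u \<partial>lborel)"
proof -
  have nn: "0 \<le> indicator {s<..t} u * \<phi> u" for u using assms(2) by (auto simp: indicator_def)
  show iff: "path_int \<phi> s t < \<infinity> \<longleftrightarrow> integrable lborel (\<lambda>u. indicator {s<..t} u * \<phi> u)"
    using assms(1) nn by (auto simp: integrable_iff_bounded path_int_def)
  show "path_int \<phi> s t = ennreal (\<integral>u. indicator {s<..t} u * \<phi> u \<partial>lborel)" if "path_int \<phi> s t < \<infinity>"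
    unfolding path_int_def using that nn by (intro nn_integral_eq_integral) (simp_all add: iff[unfolded path_int_def, symmetric] path_int_def)
  show "0 \<le> (\<integral>u. indicator {s<..t} u * \<phi> u \<partial>lborel)" using nn by (intro Bochner_Integration.integral_nonneg)
qed

text \<open>Scaling by \<open>1 + \<epsilon>\<close> where \<open>q\<close> holds adds
  \<open>\<epsilon>\<close> times the integral over that set and gives one extra factor per jump in
  it. The exponential splits because the integral is finite.\<close>

lemma path_dens_perturb:
  fixes \<phi> :: "real \<Rightarrow> real" and q :: "real \<Rightarrow> bool"
  assumes \<phi>: "(\<lambda>u. indicator {s<..t} u * \<phi> u) \<in> borel_measurable borel" "\<And>u. s < u \<Longrightarrow> u \<le> t \<Longrightarrow> 0 \<le> \<phi> u"
    and q: "(\<lambda>u. indicator {s<..t} u * (\<phi> u * of_bool (q u))) \<in> borel_measurable borel"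
    and fin: "path_int \<phi> s t < \<infinity>" and \<epsilon>: "-1 \<le> \<epsilon>" and J: "finite J"
  shows "path_dens a (\<lambda>v. \<phi> v * (1 + \<epsilon> * of_bool (q v))) J s t =
    path_dens a \<phi> J s t * ((1 + \<epsilon>) ^ card {v\<in>J \<inter> {s<..t}. q v} *
      exp (- \<epsilon> * (a * (\<integral>u. indicator {s<..t} u * (\<phi> u * of_bool (q u)) \<partial>lborel))))"
proof -
  let ?\<phi>' = "\<lambda>v. \<phi> v * (1 + \<epsilon> * of_bool (q v))"
  have eq: "indicator {s<..t} u * ?\<phi>' u = indicator {s<..t} u * \<phi> u + \<epsilon> * (indicator {s<..t} u * (\<phi> u * of_bool (q u)))" for u
    by (simp add: algebra_simps)
  have i1: "integrable lborel (\<lambda>u. indicator {s<..t} u * \<phi> u)" using path_int_real(1)[OF \<phi>] fin by simp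
  have i2: "integrable lborel (\<lambda>u. indicator {s<..t} u * (\<phi> u * of_bool (q u)))"
    by (rule Bochner_Integration.integrable_bound[OF i1]) (use q in \<open>auto simp: indicator_def\<close>)
  have i3: "integrable lborel (\<lambda>u. indicator {s<..t} u * ?\<phi>' u)" unfolding eq using i1 i2 by simp
  have m3: "(\<lambda>u. indicator {s<..t} u * ?\<phi>' u) \<in> borel_measurable borel" unfolding eq using \<phi>(1) q by measurable
  have n3: "0 \<le> ?\<phi>' u" if "s < u" "u \<le> t" for u using \<phi>(2)[OF that] \<epsilon> by (cases "q u") auto
  have fin': "path_int ?\<phi>' s t < \<infinity>" using path_int_real(1)[OF m3 n3] i3 by simp
  have "enn2real (path_int ?\<phi>' s t) = (\<integral>u. indicator {s<..t} u * ?\<phi>' u \<partial>lborel)"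
    using path_int_real(2,3)[OF m3 n3] fin' by simp
  also have "\<dots> = enn2real (path_int \<phi> s t) + \<epsilon> * (\<integral>u. indicator {s<..t} u * (\<phi> u * of_bool (q u)) \<partial>lborel)"
    unfolding eq using path_int_real(2,3)[OF \<phi>] fin i1 i2 by simp
  finally have eqn: "enn2real (path_int ?\<phi>' s t) =
    enn2real (path_int \<phi> s t) + \<epsilon> * (\<integral>u. indicator {s<..t} u * (\<phi> u * of_bool (q u)) \<partial>lborel)" .
  have ne: "path_int \<phi> s t \<noteq> \<infinity>" "path_int ?\<phi>' s t \<noteq> \<infinity>" using fin fin' by auto
  have I: "exp_neg a (path_int ?\<phi>' s t) = exp_neg a (path_int \<phi> s t) *
      exp (- \<epsilon> * (a * (\<integral>u. indicator {s<..t} u * (\<phi> u * of_bool (q u)) \<partial>lborel)))"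
    by (simp only: exp_neg_def ne if_False eqn) (simp add: algebra_simps flip: exp_add)
  have "(\<Prod>w\<in>J \<inter> {s<..t}. 1 + \<epsilon> * of_bool (q w)) = (\<Prod>w\<in>{v\<in>J \<inter> {s<..t}. q v}. 1 + \<epsilon>)"
    using J by (intro prod.mono_neutral_cong_right) auto
  then have "(\<Prod>w\<in>J \<inter> {s<..t}. ?\<phi>' w) = (\<Prod>w\<in>J \<inter> {s<..t}. \<phi> w) * (1 + \<epsilon>) ^ card {v\<in>J \<inter> {s<..t}. q v}"
    by (simp add: prod.distrib)
  then show ?thesis unfolding path_dens_def I by simp
qed

text \<open>Left continuity in the end point: monotone convergence up to \<open>t\<close>, and a
  single point has measure zero.\<close>

lemma path_int_left_limit_le:
  fixes \<phi> :: "real \<Rightarrow> real"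
  assumes \<phi>: "(\<lambda>u. indicator {0<..t} u * \<phi> u) \<in> borel_measurable borel" "\<And>u. 0 < u \<Longrightarrow> u \<le> t \<Longrightarrow> 0 \<le> \<phi> u"
    and t: "0 < t" and le: "\<And>u. 0 \<le> u \<Longrightarrow> u < t \<Longrightarrow> path_int \<phi> 0 u \<le> c"
  shows "path_int \<phi> 0 t \<le> c"
proof -
  define v where "v n = t - t / real (Suc n)" for n
  have v: "0 \<le> v n" "v n < t" for n using t by (auto simp: v_def field_simps)
  have vl: "v \<longlonglongrightarrow> t"
    using tendsto_diff[OF tendsto_const LIMSEQ_Suc[OF lim_const_over_n[of t]], of t] unfolding v_def by simp
  let ?f = "\<lambda>n u. ennreal (indicator {0<..v n} u * \<phi> u)"
  have "(\<lambda>n. \<integral>\<^sup>+u. ?f n u \<partial>lborel) \<longlonglongrightarrow> (\<integral>\<^sup>+u. ennreal (indicator {0<..<t} u * \<phi> u) \<partial>lborel)"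
  proof (rule nn_integral_LIMSEQ)
    have "v n \<le> v m" if "n \<le> m" for n m using that t by (auto simp: v_def intro!: divide_left_mono)
    then show "incseq ?f" using \<phi>(2) v
      by (auto simp: incseq_def le_fun_def indicator_def intro!: ennreal_leI intro: order_trans)
    show "?f n \<in> borel_measurable lborel" for n
    proof -
      have "indicator {0<..v n} u * \<phi> u = indicator {0<..v n} u * (indicator {0<..t} u * \<phi> u)" for u
        using v[of n] by (auto simp: indicator_def)
      moreover have "(\<lambda>u. indicator {0<..v n} u * (indicator {0<..t} u * \<phi> u)) \<in> borel_measurable borel"
        using \<phi>(1) by measurable
      ultimately have "(\<lambda>u. indicator {0<..v n} u * \<phi> u) \<in> borel_measurable borel" by (simp only:)
      then show ?thesis by simp
    qed
    show "(\<lambda>n. ?f n u) \<longlonglongrightarrow> ennreal (indicator {0<..<t} u * \<phi> u)" for u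
    proof (rule tendsto_eventually)
      show "\<forall>\<^sub>F n in sequentially. ?f n u = ennreal (indicator {0<..<t} u * \<phi> u)"
      proof (cases "u < t")
        case True
        then have "\<forall>\<^sub>F n in sequentially. u < v n" using vl by (intro order_tendstoD)
        then show ?thesis by eventually_elim (use True in \<open>auto simp: indicator_def\<close>)
      next
        case False
        then have "u \<notin> {0<..v n}" for n using v(2)[of n] by auto
        then show ?thesis using False by (auto simp: indicator_def)
      qed
    qed
  qed
  moreover have "(\<integral>\<^sup>+u. ?f n u \<partial>lborel) \<le> c" for n using le[OF v] by (simp add: path_int_def)
  ultimately have "(\<integral>\<^sup>+u. ennreal (indicator {0<..<t} u * \<phi> u) \<partial>lborel) \<le> c" by (intro LIMSEQ_le_const2) auto
  moreover have "path_int \<phi> 0 t = (\<integral>\<^sup>+u. ennreal (indicator {0<..<t} u * \<phi> u) \<partial>lborel)"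
    unfolding path_int_def using AE_lborel_singleton[of t]
    by (intro nn_integral_cong_AE) (auto elim!: eventually_mono simp: indicator_def)
  ultimately show ?thesis by simp
qed

text \<open>Right continuity comes from dominated convergence, the majorant being the integrand on
  an interval where its integral is finite.\<close>

lemma path_int_right_limit:
  fixes \<phi> :: "real \<Rightarrow> real"
  assumes \<phi>: "(\<lambda>u. indicator {s<..t} u * \<phi> u) \<in> borel_measurable borel" "\<And>u. s < u \<Longrightarrow> u \<le> t \<Longrightarrow> 0 \<le> \<phi> u"
    and st: "s < t" and fin: "path_int \<phi> s t < \<infinity>" and c: "0 < c"
  shows "\<exists>v. s < v \<and> v \<le> t \<and> path_int \<phi> s v < c"
proof -
  define v where "v n = s + (t - s) / real (Suc n)" for n
  have v: "s < v n" "v n \<le> t" for n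
  proof -
    show "s < v n" using st by (simp add: v_def)
    have "(t - s) / real (Suc n) \<le> (t - s) / 1" using st by (intro divide_left_mono) auto
    then show "v n \<le> t" by (simp add: v_def)
  qed
  have vl: "v \<longlonglongrightarrow> s"
    using tendsto_add[OF tendsto_const LIMSEQ_Suc[OF lim_const_over_n[of "t - s"]], of s] unfolding v_def by simp
  let ?f = "\<lambda>n u. ennreal (indicator {s<..v n} u * \<phi> u)"
  have "(\<lambda>n. \<integral>\<^sup>+u. ?f n u \<partial>lborel) \<longlonglongrightarrow> (\<integral>\<^sup>+(u::real). 0 \<partial>lborel)"
  proof (rule nn_integral_dominated_convergence[where u = ?f and u' = "\<lambda>_. 0" and w = "\<lambda>u. ennreal (indicator {s<..t} u * \<phi> u)"])
    show "?f n \<in> borel_measurable lborel" for n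
    proof -
      have "indicator {s<..v n} u * \<phi> u = indicator {s<..v n} u * (indicator {s<..t} u * \<phi> u)" for u
        using v[of n] by (auto simp: indicator_def)
      moreover have "(\<lambda>u. indicator {s<..v n} u * (indicator {s<..t} u * \<phi> u)) \<in> borel_measurable borel"
        using \<phi>(1) by measurable
      ultimately have "(\<lambda>u. indicator {s<..v n} u * \<phi> u) \<in> borel_measurable borel" by (simp only:)
      then show ?thesis by simp
    qed
    show "AE u in lborel. ?f n u \<le> ennreal (indicator {s<..t} u * \<phi> u)" for n
      using v[of n] \<phi>(2) by (intro AE_I2 ennreal_leI) (auto simp: indicator_def)
    show "(\<integral>\<^sup>+u. ennreal (indicator {s<..t} u * \<phi> u) \<partial>lborel) < \<infinity>" using fin by (simp add: path_int_def)
    show "AE u in lborel. (\<lambda>n. ?f n u) \<longlonglongrightarrow> 0"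
    proof (intro AE_I2 tendsto_eventually)
      fix u
      show "\<forall>\<^sub>F n in sequentially. ?f n u = 0"
      proof (cases "s < u")
        case True
        then have "\<forall>\<^sub>F n in sequentially. v n < u" using vl by (intro order_tendstoD)
        then show ?thesis by eventually_elim (auto simp: indicator_def)
      qed (auto simp: indicator_def)
    qed
  qed (use \<phi>(1) in measurable)
  then have "(\<lambda>n. path_int \<phi> s (v n)) \<longlonglongrightarrow> 0" by (simp add: path_int_def)
  then have "\<forall>\<^sub>F n in sequentially. path_int \<phi> s (v n) < c" using c by (rule order_tendstoD)
  then obtain n where "path_int \<phi> s (v n) < c" using eventually_happens sequentially_bot by blast
  then show ?thesis using v by blast
qed

section \<open>The localizing clock\<close>

text \<open>Indicators of windows open on the left and closed on the right are left-continuous, so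
  they survive the passage from sampled values to left limits.\<close>

lemma window_left_limit:
  fixes s c v :: real
  shows "((\<lambda>u. of_bool (s < u \<and> u \<le> c) :: real) \<longlongrightarrow> of_bool (s < v \<and> v \<le> c)) (at_left v)"
proof (rule tendsto_eventually)
  consider "v \<le> s" | "s < v" "v \<le> c" | "s < v" "c < v" by linarith
  then show "\<forall>\<^sub>F u in at_left v. (of_bool (s < u \<and> u \<le> c) :: real) = of_bool (s < v \<and> v \<le> c)"
  proof cases
    case 1 then show ?thesis unfolding eventually_at_left_field by (intro exI[of _ "v - 1"]) auto
  next
    case 2 then show ?thesis unfolding eventually_at_left_field by (intro exI[of _ s]) auto
  next
    case 3 then show ?thesis unfolding eventually_at_left_field by (intro exI[of _ c]) auto
  qed
qed

lemma path_int_mono_time: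
  fixes \<phi> :: "real \<Rightarrow> real"
  assumes "\<And>u. 0 < u \<Longrightarrow> u \<le> v \<Longrightarrow> 0 \<le> \<phi> u" "s \<le> v"
  shows "path_int \<phi> 0 s \<le> path_int \<phi> 0 v"
  unfolding path_int_def using assms by (intro nn_integral_mono ennreal_leI) (auto simp: indicator_def)

lemma path_int_cong:
  assumes "\<And>u. s < u \<Longrightarrow> u \<le> v \<Longrightarrow> \<phi> u = \<psi> u"
  shows "path_int \<phi> s v = path_int \<psi> s v"
  unfolding path_int_def using assms by (intro nn_integral_cong) (auto simp: indicator_def)

lemma path_int_zero [simp]: "path_int \<phi> s s = 0" by (simp add: path_int_def)

context cmc_setup
begin

text \<open>The intensity of transitions of kind \<open>p\<close> along the path, as sampled on
  grids; \<open>rl\<close> is its left limit and differs from it at countably many times only, on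
  good paths.\<close>

definition "rate p u \<omega> = of_bool (X u \<omega> = fst p) * Lp p u \<omega>"
definition "rl p \<omega> u = of_bool (Xl \<omega> u = fst p) * left_lim (\<lambda>u. Lp p u \<omega>) u"

lemma rate_J:
  assumes "p \<in> I" "0 \<le> u" "u \<le> t" "t \<le> T"
  shows "rate p u \<in> borel_measurable (J t)"
proof -
  have "Lp p u \<in> borel_measurable (J t)" using assms I_D by (intro F_J[OF \<Lambda>_F]) auto
  moreover have "(\<lambda>\<omega>. of_bool (X u \<omega> = fst p) :: real) \<in> borel_measurable (J t)"
    using assms by (intro of_bool_measurable X_J)
  ultimately show ?thesis unfolding rate_def[abs_def] by measurable
qed

lemma rate_nonneg: "p \<in> I \<Longrightarrow> 0 \<le> u \<Longrightarrow> u \<le> T \<Longrightarrow> \<omega> \<in> space Q \<Longrightarrow> 0 \<le> rate p u \<omega>"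
  using \<Lambda>_nonneg[of p u \<omega>] by (simp add: rate_def)

lemma rate_left:
  assumes "good \<omega>" "p \<in> I" "0 < u" "u \<le> T"
  shows "((\<lambda>u. rate p u \<omega>) \<longlongrightarrow> rl p \<omega> u) (at_left u)"
  unfolding rate_def rl_def by (intro tendsto_intros X_left \<Lambda>_left assms good_space[OF assms(1)])

lemma rl_nonneg: "good \<omega> \<Longrightarrow> p \<in> I \<Longrightarrow> 0 < u \<Longrightarrow> u \<le> T \<Longrightarrow> 0 \<le> rl p \<omega> u"
  by (rule left_lim_nonneg[OF rate_left, of _ _ _ 0]) (auto intro: rate_nonneg good_space)

lemma rl_phi: "p \<in> I \<Longrightarrow> Xl \<omega> u = fst p \<Longrightarrow> rl p \<omega> u = ap p * phi p \<omega> u"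
  using ap_pos[of p] by (simp add: rl_def phi_def)

lemma rl_le_phi: "good \<omega> \<Longrightarrow> p \<in> I \<Longrightarrow> 0 < u \<Longrightarrow> u \<le> T \<Longrightarrow> rl p \<omega> u \<le> ap p * phi p \<omega> u"
  using phi_nonneg[of \<omega> p u] ap_pos[of p] by (cases "Xl \<omega> u = fst p") (simp_all add: rl_phi, simp add: rl_def)

text \<open>Lower limits of truncated Riemann sums only involve values at fixed times in
  \<open>[0, t]\<close>; on good paths they give the integral, finite or not.\<close>

lemma path_int_J:
  assumes t: "0 \<le> t" "t \<le> T" and f: "\<And>u. 0 \<le> u \<Longrightarrow> u \<le> t \<Longrightarrow> f u \<in> borel_measurable (J t)"
    and nn: "\<And>u \<omega>. 0 \<le> u \<Longrightarrow> u \<le> t \<Longrightarrow> \<omega> \<in> space Q \<Longrightarrow> 0 \<le> f u \<omega>"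
    and lim: "\<And>\<omega> u. good \<omega> \<Longrightarrow> 0 < u \<Longrightarrow> u \<le> t \<Longrightarrow> ((\<lambda>u. f u \<omega>) \<longlongrightarrow> \<phi> \<omega> u) (at_left u)"
  shows "(\<lambda>\<omega>. path_int (\<phi> \<omega>) 0 t) \<in> borel_measurable (J t)"
proof (rule null_complete[OF J_sub[OF t] null_J[OF t]])
  let ?S = "\<lambda>m n \<omega>. \<Sum>i<Suc n. min (f (grid 0 t (Suc n) i) \<omega>) (real m) * ((t - 0) / real (Suc n))"
  have "?S m n \<in> borel_measurable (J t)" for m n
  proof (intro borel_measurable_sum borel_measurable_times borel_measurable_min borel_measurable_const f)
    fix i assume "i \<in> {..<Suc n}"
    then show "0 \<le> grid 0 t (Suc n) i" "grid 0 t (Suc n) i \<le> t" using grid_bounds[of 0 t i "Suc n"] t by auto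
  qed
  then show "(\<lambda>\<omega>. liminf (\<lambda>m. liminf (\<lambda>n. ennreal (?S m n \<omega>)))) \<in> borel_measurable (J t)" by measurable
  fix \<omega> assume g: "good \<omega>"
  have 1: "liminf (\<lambda>n. ennreal (?S m n \<omega>)) = ennreal (\<integral>u. indicator {0<..t} u * min (\<phi> \<omega> u) (real m) \<partial>lborel)" for m
  proof (rule lim_imp_Liminf[OF sequentially_bot], rule tendsto_ennrealI)
    show "(\<lambda>n. ?S m n \<omega>) \<longlonglongrightarrow> (\<integral>u. indicator {0<..t} u * min (\<phi> \<omega> u) (real m) \<partial>lborel)"
      using nn good_space[OF g]
      by (intro Riemann_left_limits[OF t(1), where m = "real m"] tendsto_min_const lim g) (auto simp: min_def)
  qed
  have "\<phi> \<omega> u \<ge> 0" if "0 < u" "u \<le> t" for u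
    by (rule left_lim_nonneg[OF lim[OF g that], of 0]) (use that nn good_space[OF g] in auto)
  then have "(\<lambda>m. ennreal (\<integral>u. indicator {0<..t} u * min (\<phi> \<omega> u) (real m) \<partial>lborel)) \<longlonglongrightarrow> path_int (\<phi> \<omega>) 0 t"
    using lim[OF g] by (intro trunc_int_tendsto) auto
  then show "path_int (\<phi> \<omega>) 0 t = liminf (\<lambda>m. liminf (\<lambda>n. ennreal (?S m n \<omega>)))"
    unfolding 1 by (intro lim_imp_Liminf[OF sequentially_bot, symmetric])
qed simp

lemma jump_sum_J:
  assumes t: "0 \<le> t" "t \<le> T" and p: "p \<in> I" and f: "\<And>u. 0 \<le> u \<Longrightarrow> u \<le> t \<Longrightarrow> f u \<in> borel_measurable (J t)"
    and lim: "\<And>\<omega> u. good \<omega> \<Longrightarrow> 0 < u \<Longrightarrow> u \<le> t \<Longrightarrow> ((\<lambda>u. f u \<omega>) \<longlongrightarrow> \<phi> \<omega> u) (at_left u)"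
  shows "(\<lambda>\<omega>. \<Sum>w\<in>NJ p \<omega> \<inter> {0<..t}. \<phi> \<omega> w :: real) \<in> borel_measurable (J t)"
proof (rule null_complete[OF J_sub[OF t] null_J[OF t]])
  let ?g = "\<lambda>n i. grid 0 t (Suc n) i"
  let ?S = "\<lambda>n \<omega>. \<Sum>i<Suc n. f (?g n i) \<omega> * (real (Np p (?g n (Suc i)) \<omega>) - real (Np p (?g n i) \<omega>))"
  have "?S n \<in> borel_measurable (J t)" for n
  proof (intro borel_measurable_sum borel_measurable_times borel_measurable_diff f)
    fix i assume "i \<in> {..<Suc n}"
    then show b: "0 \<le> ?g n i" "?g n i \<le> t" using grid_bounds[of 0 t i "Suc n"] t by auto
    have b': "0 \<le> ?g n (Suc i)" "?g n (Suc i) \<le> t" using grid_bounds[of 0 t "Suc i" "Suc n"] t \<open>i \<in> _\<close> by auto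
    show "(\<lambda>\<omega>. real (Np p (?g n i) \<omega>)) \<in> borel_measurable (J t)"
      by (rule measurable_compose[OF Np_J[OF p b t(2)]]) simp
    show "(\<lambda>\<omega>. real (Np p (?g n (Suc i)) \<omega>)) \<in> borel_measurable (J t)"
      by (rule measurable_compose[OF Np_J[OF p b' t(2)]]) simp
  qed
  then show "(\<lambda>\<omega>. lim (\<lambda>n. ?S n \<omega>)) \<in> borel_measurable (J t)" by (rule borel_measurable_lim_metric)
  fix \<omega> assume g: "good \<omega>"
  have "(\<lambda>n. ?S n \<omega>) \<longlonglongrightarrow> (\<Sum>w\<in>NJ p \<omega> \<inter> {0<..t}. \<phi> \<omega> w)"
    using t by (intro count_sum_tendsto good_unit g p lim) auto
  then show "(\<Sum>w\<in>NJ p \<omega> \<inter> {0<..t}. \<phi> \<omega> w) = lim (\<lambda>n. ?S n \<omega>)" by (rule limI[symmetric])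
qed simp

section \<open>Total intensity, the stopped clock and its hitting times\<close>

definition "Rt A u \<omega> = (\<Sum>p\<in>A. rate p u \<omega>)"
definition "Rl A \<omega> u = (\<Sum>p\<in>A. rl p \<omega> u)"
definition "Atot \<omega> t = path_int (Rl I \<omega>) 0 t"

lemma Rt_J: "A \<subseteq> I \<Longrightarrow> 0 \<le> u \<Longrightarrow> u \<le> t \<Longrightarrow> t \<le> T \<Longrightarrow> Rt A u \<in> borel_measurable (J t)"
  unfolding Rt_def[abs_def] by (intro borel_measurable_sum rate_J) auto
lemma Rt_nonneg: "A \<subseteq> I \<Longrightarrow> 0 \<le> u \<Longrightarrow> u \<le> T \<Longrightarrow> \<omega> \<in> space Q \<Longrightarrow> 0 \<le> Rt A u \<omega>"
  unfolding Rt_def by (intro sum_nonneg rate_nonneg) auto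
lemma Rt_left: "A \<subseteq> I \<Longrightarrow> good \<omega> \<Longrightarrow> 0 < u \<Longrightarrow> u \<le> T \<Longrightarrow> ((\<lambda>u. Rt A u \<omega>) \<longlongrightarrow> Rl A \<omega> u) (at_left u)"
  unfolding Rt_def Rl_def by (intro tendsto_sum rate_left) auto
lemma Rl_nonneg: "A \<subseteq> I \<Longrightarrow> good \<omega> \<Longrightarrow> 0 < u \<Longrightarrow> u \<le> T \<Longrightarrow> 0 \<le> Rl A \<omega> u"
  unfolding Rl_def by (intro sum_nonneg rl_nonneg) auto
lemma rl_le_Rl: "good \<omega> \<Longrightarrow> p \<in> I \<Longrightarrow> 0 < u \<Longrightarrow> u \<le> T \<Longrightarrow> rl p \<omega> u \<le> Rl I \<omega> u"
  unfolding Rl_def using finite_I by (intro member_le_sum rl_nonneg) auto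

lemma path_int_Rl:
  assumes A: "A \<subseteq> I" and g: "good \<omega>" and l: "0 \<le> l" "h \<le> T"
  shows "path_int (Rl A \<omega>) l h = (\<Sum>p\<in>A. path_int (rl p \<omega>) l h)"
proof -
  have nn: "0 \<le> rl p \<omega> u" if "p \<in> A" "l < u" "u \<le> h" for p u
    using rl_nonneg[OF g, of p u] that A l by auto
  have "path_int (Rl A \<omega>) l h = (\<integral>\<^sup>+u. (\<Sum>p\<in>A. ennreal (indicator {l<..h} u * rl p \<omega> u)) \<partial>lborel)"
    unfolding path_int_def Rl_def
    using nn by (intro nn_integral_cong) (auto simp: indicator_def)
  also have "\<dots> = (\<Sum>p\<in>A. path_int (rl p \<omega>) l h)"
    unfolding path_int_def
  proof (rule nn_integral_sum)
    fix p assume p: "p \<in> A"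
    have "((\<lambda>u. rate p u \<omega>) \<longlongrightarrow> rl p \<omega> u) (at_left u)" if "l < u" "u \<le> h" for u
      by (rule rate_left[OF g]) (use p A l that in auto)
    then show "(\<lambda>u. ennreal (indicator {l<..h} u * rl p \<omega> u)) \<in> borel_measurable lborel"
      using path_int_measurable by simp
  qed
  finally show ?thesis .
qed

lemma Atot_J: "0 \<le> t \<Longrightarrow> t \<le> T \<Longrightarrow> (\<lambda>\<omega>. Atot \<omega> t) \<in> borel_measurable (J t)"
  unfolding Atot_def by (rule path_int_J[where f = "Rt I"]) (auto intro: Rt_J Rt_nonneg Rt_left)

lemma Atot_mono: "good \<omega> \<Longrightarrow> s \<le> t \<Longrightarrow> t \<le> T \<Longrightarrow> Atot \<omega> s \<le> Atot \<omega> t"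
  unfolding Atot_def by (intro path_int_mono_time Rl_nonneg) auto

text \<open>The total intensity may explode, and \<open>Atot\<close> may then jump to \<open>\<infinity>\<close>; its hitting times are not
  stopping times of the filtration \<open>J\<close>, which need not be right-continuous.  Stopping the clock
  at the explosion makes it continuous with values in \<open>[0,\<infinity>]\<close>.\<close>

definition "Cl \<omega> u = Rl I \<omega> u * of_bool (\<forall>v. 0 \<le> v \<and> v < u \<longrightarrow> Atot \<omega> v < \<infinity>)"
definition "clock \<omega> t = path_int (Cl \<omega>) 0 t"

text \<open>\<open>Atot\<close> is monotone, so finiteness is lost for good. Its indicator is
  eventually constant to the left of \<open>u\<close>, with limit 1 exactly if no earlier time has
  seen the explosion.\<close>

lemma Cl_left:
  assumes g: "good \<omega>" and u: "0 < u" "u \<le> T"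
  shows "((\<lambda>u. Rt I u \<omega> * of_bool (Atot \<omega> u < \<infinity>)) \<longlongrightarrow> Cl \<omega> u) (at_left u)"
  unfolding Cl_def
proof (intro tendsto_mult Rt_left[OF order_refl g u] tendsto_eventually)
  show "\<forall>\<^sub>F v in at_left u. (of_bool (Atot \<omega> v < \<infinity>) :: real) = of_bool (\<forall>v. 0 \<le> v \<and> v < u \<longrightarrow> Atot \<omega> v < \<infinity>)"
  proof (cases "\<forall>v. 0 \<le> v \<and> v < u \<longrightarrow> Atot \<omega> v < \<infinity>")
    case True
    then show ?thesis unfolding eventually_at_left_field using u by (intro exI[of _ 0]) auto
  next
    case False
    then obtain v where v: "0 \<le> v" "v < u" "Atot \<omega> v = \<infinity>" by (auto simp: not_less top_unique)
    have "Atot \<omega> w = \<infinity>" if "v < w" "w < u" for w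
      using Atot_mono[OF g, of v w] that u v by (auto simp: top_unique)
    then show ?thesis unfolding eventually_at_left_field using v False by (intro exI[of _ v]) auto
  qed
qed

lemma Cl_nonneg: "good \<omega> \<Longrightarrow> 0 < u \<Longrightarrow> u \<le> T \<Longrightarrow> 0 \<le> Cl \<omega> u"
  unfolding Cl_def by (intro mult_nonneg_nonneg Rl_nonneg) auto

lemma Cl_le: "good \<omega> \<Longrightarrow> 0 < u \<Longrightarrow> u \<le> T \<Longrightarrow> Cl \<omega> u \<le> Rl I \<omega> u"
  unfolding Cl_def using Rl_nonneg[of I \<omega> u] by auto

lemma clock_J:
  assumes t: "0 \<le> t" "t \<le> T"
  shows "(\<lambda>\<omega>. clock \<omega> t) \<in> borel_measurable (J t)"
  unfolding clock_def
proof (rule path_int_J[OF t, where f = "\<lambda>u \<omega>. Rt I u \<omega> * of_bool (Atot \<omega> u < \<infinity>)"])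
  fix u assume u: "0 \<le> u" "u \<le> t"
  have "(\<lambda>\<omega>. Atot \<omega> u) \<in> borel_measurable (J t)"
    by (rule measurable_mono_sets[OF Atot_J]) (use u t J_mono in auto)
  then have "(\<lambda>\<omega>. of_bool (Atot \<omega> u < \<infinity>) :: real) \<in> borel_measurable (J t)"
    unfolding of_bool_def by measurable
  then show "(\<lambda>\<omega>. Rt I u \<omega> * of_bool (Atot \<omega> u < \<infinity>)) \<in> borel_measurable (J t)"
    using Rt_J[OF order_refl u t(2)] by measurable
next
  show "((\<lambda>u. Rt I u \<omega> * of_bool (Atot \<omega> u < \<infinity>)) \<longlongrightarrow> Cl \<omega> u) (at_left u)" if "good \<omega>" "0 < u" "u \<le> t" for \<omega> u
    using Cl_left[OF that(1,2)] that t by simp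
qed (use t in \<open>auto intro!: mult_nonneg_nonneg Rt_nonneg\<close>)

lemma clock_mono: "good \<omega> \<Longrightarrow> s \<le> t \<Longrightarrow> t \<le> T \<Longrightarrow> clock \<omega> s \<le> clock \<omega> t"
  unfolding clock_def by (intro path_int_mono_time Cl_nonneg) auto

definition "hits n \<omega> = {s\<in>{0..T}. ennreal (real (Suc n)) \<le> clock \<omega> s}"
text \<open>A level that is never hit gives the value \<open>T\<close>, so a finite clock makes the
  sequence equal to \<open>T\<close> after finitely many steps.\<close>

definition "\<tau> n \<omega> = (if hits n \<omega> = {} then T else Inf (hits n \<omega>))"

lemma \<tau>_range: "0 \<le> \<tau> n \<omega>" "\<tau> n \<omega> \<le> T"
proof -
  have "bdd_below (hits n \<omega>)" by (rule bdd_belowI[of _ 0]) (auto simp: hits_def)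
  moreover have "x \<in> {0..T}" if "x \<in> hits n \<omega>" for x using that by (auto simp: hits_def)
  ultimately show "0 \<le> \<tau> n \<omega>" "\<tau> n \<omega> \<le> T" unfolding \<tau>_def using T_pos
    by (auto intro!: cInf_greatest intro: cInf_lower2)
qed

lemma \<tau>_le: "s \<in> hits n \<omega> \<Longrightarrow> \<tau> n \<omega> \<le> s"
  unfolding \<tau>_def by (auto intro!: cInf_lower bdd_belowI[of _ 0] simp: hits_def)

text \<open>The level is attained by right continuity of the clock. If \<open>Atot\<close> stays
  finite a little longer, its integral provides the majorant; if it is infinite at all later times,
  the stopped integrand vanishes there and the clock is constant.\<close>

lemma \<tau>_hit:
  assumes g: "good \<omega>" and ne: "hits n \<omega> \<noteq> {}"
  shows "\<tau> n \<omega> \<in> hits n \<omega>"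
proof (rule ccontr)
  assume no: "\<tau> n \<omega> \<notin> hits n \<omega>"
  let ?s = "\<tau> n \<omega>" and ?c = "ennreal (real (Suc n))"
  have lt: "clock \<omega> ?s < ?c" using no \<tau>_range[of n \<omega>] by (auto simp: hits_def not_le)
  obtain r where r: "r \<in> hits n \<omega>" using ne by blast
  then have sr: "?s < r" using \<tau>_le[OF r] no by (cases "?s = r") auto
  have sT: "?s < T" using sr r by (auto simp: hits_def)
  have meas: "(\<lambda>u. indicator {?s<..v} u * Cl \<omega> u) \<in> borel_measurable borel" if "v \<le> T" for v
    using Cl_left[OF g] \<tau>_range(1)[of n \<omega>] that
    by (intro left_limits_measurable[where f = "\<lambda>u. Rt I u \<omega> * of_bool (Atot \<omega> u < \<infinity>)"]) auto
  have nn: "0 \<le> Cl \<omega> u" if "?s < u" "u \<le> T" for u using Cl_nonneg[OF g, of u] \<tau>_range(1)[of n \<omega>] that by auto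
  have "\<exists>v. ?s < v \<and> v \<le> T \<and> path_int (Cl \<omega>) ?s v < \<infinity>"
  proof (cases "\<exists>v. ?s < v \<and> v \<le> T \<and> Atot \<omega> v < \<infinity>")
    case True
    then obtain v where v: "?s < v" "v \<le> T" "Atot \<omega> v < \<infinity>" by blast
    have "path_int (Cl \<omega>) ?s v \<le> path_int (Rl I \<omega>) 0 v"
      unfolding path_int_def using Cl_le[OF g] Rl_nonneg[OF order_refl g] v \<tau>_range(1)[of n \<omega>]
      by (intro nn_integral_mono ennreal_leI) (auto simp: indicator_def)
    then show ?thesis using v by (auto simp: Atot_def intro: order.strict_trans1)
  next
    case False
    have "Cl \<omega> u = 0" if u: "?s < u" "u \<le> T" for u
    proof -
      have "?s < (?s + u) / 2" "(?s + u) / 2 \<le> T" "(?s + u) / 2 < u" using u by auto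
      moreover from this have "\<not> Atot \<omega> ((?s + u) / 2) < \<infinity>" using False by blast
      moreover have "0 \<le> (?s + u) / 2" using \<tau>_range(1)[of n \<omega>] u by simp
      ultimately show ?thesis unfolding Cl_def by auto
    qed
    then have "path_int (Cl \<omega>) ?s T = path_int (\<lambda>_. 0) ?s T" by (intro path_int_cong) auto
    then show ?thesis using sT by (intro exI[of _ T]) (simp add: path_int_def)
  qed
  then obtain v1 where v1: "?s < v1" "v1 \<le> T" "path_int (Cl \<omega>) ?s v1 < \<infinity>" by blast
  have "0 < ?c - clock \<omega> ?s" using lt by (simp add: diff_gr0_ennreal)
  then obtain v where v: "?s < v" "v \<le> v1" "path_int (Cl \<omega>) ?s v < ?c - clock \<omega> ?s"
    using path_int_right_limit[OF meas nn v1(1,3)] v1(2) by auto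
  have "clock \<omega> v = clock \<omega> ?s + path_int (Cl \<omega>) ?s v"
    unfolding clock_def using Cl_left[OF g] \<tau>_range(1)[of n \<omega>] v v1
    by (intro path_int_split[where f = "\<lambda>u. Rt I u \<omega> * of_bool (Atot \<omega> u < \<infinity>)"]) auto
  also have "\<dots> < ?c" using v(3) less_diff_eq_ennreal[of ?c "clock \<omega> ?s" "path_int (Cl \<omega>) ?s v"]
    by (simp add: add.commute)
  finally have "clock \<omega> v < ?c" .
  moreover have "\<exists>x\<in>hits n \<omega>. x < v"
    using v(1) ne by (auto simp: \<tau>_def intro!: cInf_lessD)
  then obtain x where "x \<in> hits n \<omega>" "x < v" by blast
  then have "?c \<le> clock \<omega> v"
    using clock_mono[OF g, of x v] v v1 by (auto simp: hits_def intro: order_trans)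
  ultimately show False by simp
qed

text \<open>As the level is attained, the clock at \<open>t\<close> alone decides the event, with no
  look beyond \<open>t\<close>. At \<open>t = T\<close> the default value of \<open>\<tau>\<close>
  would break the equivalence.\<close>

lemma \<tau>_le_iff:
  assumes g: "good \<omega>" and t: "0 \<le> t" "t < T"
  shows "\<tau> n \<omega> \<le> t \<longleftrightarrow> ennreal (real (Suc n)) \<le> clock \<omega> t"
proof
  assume le: "\<tau> n \<omega> \<le> t"
  then have "hits n \<omega> \<noteq> {}" using t by (auto simp: \<tau>_def)
  then have "ennreal (real (Suc n)) \<le> clock \<omega> (\<tau> n \<omega>)" using \<tau>_hit[OF g] by (auto simp: hits_def)
  also have "\<dots> \<le> clock \<omega> t" using le t by (intro clock_mono[OF g]) auto
  finally show "ennreal (real (Suc n)) \<le> clock \<omega> t" .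
next
  assume "ennreal (real (Suc n)) \<le> clock \<omega> t"
  then show "\<tau> n \<omega> \<le> t" using t by (intro \<tau>_le) (auto simp: hits_def)
qed

lemma \<tau>_stopping:
  assumes t: "0 \<le> t" "t \<le> T"
  shows "{\<omega>\<in>space Q. \<tau> n \<omega> \<le> t} \<in> sets (J t)"
proof (cases "t = T")
  case True
  then show ?thesis using \<tau>_range sets.top[of "J t"] t by (simp del: sets.top)
next
  case False
  show ?thesis
  proof (rule sets_AE_eq_complete[OF complete J_sub[OF t] null_J[OF t]])
    have "{\<omega>\<in>space (J t). ennreal (real (Suc n)) \<le> clock \<omega> t} \<in> sets (J t)"
      using clock_J[OF t] by measurable
    then show "{\<omega>\<in>space Q. ennreal (real (Suc n)) \<le> clock \<omega> t} \<in> sets (J t)" using t by simp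
    show "AE \<omega> in Q. \<omega> \<in> {\<omega>\<in>space Q. \<tau> n \<omega> \<le> t} \<longleftrightarrow> \<omega> \<in> {\<omega>\<in>space Q. ennreal (real (Suc n)) \<le> clock \<omega> t}"
      using AE_good by eventually_elim (use \<tau>_le_iff t False in auto)
  qed (use t in auto)
qed

text \<open>\<open>\<tau> n \<omega> < u\<close> is a countable union over rational times before
  \<open>u\<close> of events of the stopping time; the window needs its negation.\<close>

lemma window_J:
  assumes u: "0 \<le> u" "u \<le> t" "t \<le> T"
  shows "(\<lambda>\<omega>. of_bool (s < u \<and> u \<le> min c (\<tau> n \<omega>)) :: real) \<in> borel_measurable (J t)"
proof -
  have sp: "space (J t) = space Q" using u by simp
  have "{\<omega>\<in>space Q. \<tau> n \<omega> < u} = (\<Union>q\<in>\<rat> \<inter> {0..<u}. {\<omega>\<in>space Q. \<tau> n \<omega> \<le> q})"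
  proof (intro set_eqI iffI)
    fix \<omega> assume \<omega>: "\<omega> \<in> {\<omega>\<in>space Q. \<tau> n \<omega> < u}"
    then obtain q where "q \<in> \<rat>" "\<tau> n \<omega> < q" "q < u" using Rats_dense_in_real by blast
    then show "\<omega> \<in> (\<Union>q\<in>\<rat> \<inter> {0..<u}. {\<omega>\<in>space Q. \<tau> n \<omega> \<le> q})"
      using \<tau>_range(1)[of n \<omega>] \<omega> by (intro UN_I[of q]) auto
  qed auto
  also have "\<dots> \<in> sets (J t)"
  proof (rule sets.countable_UN'')
    show "countable (\<rat> \<inter> {0..<u})" using countable_rat by blast
    fix q assume "q \<in> \<rat> \<inter> {0..<u}"
    then show "{\<omega>\<in>space Q. \<tau> n \<omega> \<le> q} \<in> sets (J t)"
      using \<tau>_stopping[of q n] J_mono[of q t] u by auto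
  qed
  finally have "{\<omega>\<in>space (J t). \<not> \<tau> n \<omega> < u} \<in> sets (J t)"
    by (rule sets.sets_Collect_neg[OF back_subst[of "\<lambda>A. A \<in> sets (J t)"]]) (simp add: sp)
  then have m: "Measurable.pred (J t) (\<lambda>\<omega>. \<not> \<tau> n \<omega> < u)" by (simp add: pred_def)
  have eq: "(of_bool (s < u \<and> u \<le> min c (\<tau> n \<omega>)) :: real) = (if \<not> \<tau> n \<omega> < u then of_bool (s < u \<and> u \<le> c) else 0)" for \<omega>
    by auto
  show ?thesis unfolding eq using m by measurable
qed

end

section \<open>Compensators of the transition counts\<close>

context cmc_change
begin

text \<open>An infinite integral would make a factor of the product zero. The bound
  \<open>rl_le_phi\<close> passes finiteness on to the transition rates.\<close>

lemma \<theta>_pos_finite: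
  assumes g: "good \<omega>" and pos: "0 < \<theta> \<omega>" and p: "p \<in> I"
  shows "path_int (phi p \<omega>) 0 T < \<infinity>" "path_int (rl p \<omega>) 0 T < \<infinity>"
proof -
  have "(\<Prod>p\<in>I. path_dens (ap p) (phi p \<omega>) (NJ p \<omega>) 0 T) \<noteq> 0"
    using pos \<theta>_Z[OF g] by (simp add: Z_def path_density_def)
  then have "path_dens (ap p) (phi p \<omega>) (NJ p \<omega>) 0 T \<noteq> 0" using p finite_I by auto
  then show fin: "path_int (phi p \<omega>) 0 T < \<infinity>"
    by (auto simp: path_dens_def exp_neg_def less_top[symmetric] split: if_splits)
  have "path_int (rl p \<omega>) 0 T \<le> (\<integral>\<^sup>+u. ennreal (ap p) * ennreal (indicator {0<..T} u * phi p \<omega> u) \<partial>lborel)"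
    unfolding path_int_def
  proof (rule nn_integral_mono)
    fix u :: real
    have "indicator {0<..T} u * rl p \<omega> u \<le> ap p * (indicator {0<..T} u * phi p \<omega> u)"
      using rl_le_phi[OF g p, of u] by (auto simp: indicator_def)
    then have "ennreal (indicator {0<..T} u * rl p \<omega> u) \<le> ennreal (ap p * (indicator {0<..T} u * phi p \<omega> u))"
      by (rule ennreal_leI)
    also have "\<dots> = ennreal (ap p) * ennreal (indicator {0<..T} u * phi p \<omega> u)"
      using ap_pos[OF p] phi_nonneg[OF g p, of u] by (intro ennreal_mult) (auto simp: indicator_def)
    finally show "ennreal (indicator {0<..T} u * rl p \<omega> u) \<le> ennreal (ap p) * ennreal (indicator {0<..T} u * phi p \<omega> u)" .
  qed
  also have "\<dots> = ennreal (ap p) * path_int (phi p \<omega>) 0 T"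
    unfolding path_int_def using psi_left[OF g p]
    by (intro nn_integral_cmult) (simp add: path_int_measurable[where f = "\<lambda>u. psi p u \<omega>"])
  also have "\<dots> < \<infinity>" using fin by (simp add: ennreal_mult_less_top)
  finally show "path_int (rl p \<omega>) 0 T < \<infinity>" .
qed

lemma Atot_finite:
  assumes g: "good \<omega>" and pos: "0 < \<theta> \<omega>"
  shows "Atot \<omega> T < \<infinity>"
proof -
  have "Atot \<omega> T = (\<Sum>p\<in>I. path_int (rl p \<omega>) 0 T)"
    unfolding Atot_def using g by (intro path_int_Rl) auto
  also have "\<dots> < \<infinity>" using \<theta>_pos_finite(2)[OF g pos] finite_I by (simp add: infinity_ennreal_def)
  finally show ?thesis .
qed

text \<open>Where \<open>\<theta>\<close> is positive nothing explodes, so stopping the clock has no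
  effect.\<close>

lemma clock_eq_Atot:
  assumes g: "good \<omega>" and pos: "0 < \<theta> \<omega>" and t: "t \<le> T"
  shows "clock \<omega> t = Atot \<omega> t"
  unfolding clock_def Atot_def
proof (rule path_int_cong)
  fix u assume u: "0 < u" "u \<le> t"
  have "Atot \<omega> v < \<infinity>" if "v < u" for v
    using Atot_mono[OF g, of v T] Atot_finite[OF g pos] that u t by (auto intro: order.strict_trans1)
  then show "Cl \<omega> u = Rl I \<omega> u" by (simp add: Cl_def)
qed

text \<open>Before \<open>\<tau> n\<close> the clock is below the level, and left continuity extends
  the bound to \<open>\<tau> n\<close> itself. This makes the compensators bounded.\<close>

lemma Atot_\<tau>_le:
  assumes g: "good \<omega>" and pos: "0 < \<theta> \<omega>"
  shows "Atot \<omega> (\<tau> n \<omega>) \<le> ennreal (real (Suc n))"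
proof (cases "\<tau> n \<omega> = 0")
  case True then show ?thesis by (simp add: Atot_def)
next
  case False
  note r = \<tau>_range[of n \<omega>]
  show ?thesis unfolding Atot_def
  proof (rule path_int_left_limit_le)
    show "(\<lambda>u. indicator {0<..\<tau> n \<omega>} u * Rl I \<omega> u) \<in> borel_measurable borel"
      using Rt_left[OF order_refl g] r by (intro left_limits_measurable[where f = "\<lambda>u. Rt I u \<omega>"]) auto
    fix u assume u: "0 \<le> u" "u < \<tau> n \<omega>"
    then have "u \<notin> hits n \<omega>" using \<tau>_le[of u n \<omega>] by auto
    then have "clock \<omega> u \<le> ennreal (real (Suc n))" using u r by (auto simp: hits_def not_le)
    then show "path_int (Rl I \<omega>) 0 u \<le> ennreal (real (Suc n))"
      using clock_eq_Atot[OF g pos, of u] u r by (simp add: Atot_def)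
  qed (use False r Rl_nonneg[OF order_refl g] in auto)
qed

text \<open>A count written as a rounded real sum, so that its measurability comes from
  \<open>jump_sum_J\<close>; on good paths the rounding changes nothing.\<close>

definition "jumps_in p s t n \<omega> =
  nat \<lfloor>\<Sum>w\<in>NJ p \<omega> \<inter> {0<..t}. of_bool (s < w \<and> w \<le> min t (\<tau> n \<omega>)) * of_bool (Xl \<omega> w = fst p) :: real\<rfloor>"
definition "comp_in p s t n \<omega> =
  enn2real (path_int (\<lambda>u. of_bool (s < u \<and> u \<le> min t (\<tau> n \<omega>)) * rl p \<omega> u) 0 t)"

lemma jumps_in_J:
  assumes "p \<in> I" "0 \<le> t" "t \<le> T"
  shows "jumps_in p s t n \<in> measurable (J t) (count_space UNIV)"
proof -
  have "(\<lambda>\<omega>. \<Sum>w\<in>NJ p \<omega> \<inter> {0<..t}. of_bool (s < w \<and> w \<le> min t (\<tau> n \<omega>)) * of_bool (Xl \<omega> w = fst p) :: real) \<in> borel_measurable (J t)"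
    using assms
    by (intro jump_sum_J[where f = "\<lambda>u \<omega>. of_bool (s < u \<and> u \<le> min t (\<tau> n \<omega>)) * of_bool (X u \<omega> = fst p)"]
        borel_measurable_times window_J of_bool_measurable X_J tendsto_mult window_left_limit X_left) auto
  then show ?thesis unfolding jumps_in_def[abs_def] by measurable
qed

lemma comp_in_path_int_J:
  assumes "p \<in> I" "0 \<le> t" "t \<le> T"
  shows "(\<lambda>\<omega>. path_int (\<lambda>u. of_bool (s < u \<and> u \<le> min t (\<tau> n \<omega>)) * rl p \<omega> u) 0 t) \<in> borel_measurable (J t)"
  using assms
  by (intro path_int_J[where f = "\<lambda>u \<omega>. of_bool (s < u \<and> u \<le> min t (\<tau> n \<omega>)) * rate p u \<omega>"]
      borel_measurable_times window_J rate_J tendsto_mult window_left_limit rate_left mult_nonneg_nonneg rate_nonneg) auto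

lemma comp_in_J: "p \<in> I \<Longrightarrow> 0 \<le> t \<Longrightarrow> t \<le> T \<Longrightarrow> comp_in p s t n \<in> borel_measurable (J t)"
  unfolding comp_in_def[abs_def] using comp_in_path_int_J by measurable

lemma jumps_in_eq:
  assumes g: "good \<omega>" and p: "p \<in> I"
  shows "jumps_in p s t n \<omega> = card {w\<in>NJ p \<omega> \<inter> {0<..t}. (s < w \<and> w \<le> min t (\<tau> n \<omega>)) \<and> Xl \<omega> w = fst p}"
proof -
  have "(\<Sum>w\<in>NJ p \<omega> \<inter> {0<..t}. of_bool (s < w \<and> w \<le> min t (\<tau> n \<omega>)) * of_bool (Xl \<omega> w = fst p) :: real) =
    (\<Sum>w\<in>{w\<in>NJ p \<omega> \<inter> {0<..t}. (s < w \<and> w \<le> min t (\<tau> n \<omega>)) \<and> Xl \<omega> w = fst p}. 1)"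
    using finite_NJ[OF g p] by (intro sum.mono_neutral_cong_right) auto
  then show ?thesis unfolding jumps_in_def by simp
qed

lemma comp_in_le:
  assumes g: "good \<omega>" and pos: "0 < \<theta> \<omega>" and p: "p \<in> I" and t: "0 \<le> t" "t \<le> T"
  shows "path_int (\<lambda>u. of_bool (s < u \<and> u \<le> min t (\<tau> n \<omega>)) * rl p \<omega> u) 0 t \<le> ennreal (real (Suc n))"
    and "comp_in p s t n \<omega> \<le> real (Suc n)"
proof -
  have "path_int (\<lambda>u. of_bool (s < u \<and> u \<le> min t (\<tau> n \<omega>)) * rl p \<omega> u) 0 t \<le> Atot \<omega> (\<tau> n \<omega>)"
    unfolding path_int_def Atot_def using rl_le_Rl[OF g p] Rl_nonneg[OF order_refl g] t \<tau>_range[of n \<omega>]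
    by (intro nn_integral_mono ennreal_leI) (auto simp: indicator_def)
  also have "\<dots> \<le> ennreal (real (Suc n))" by (rule Atot_\<tau>_le[OF g pos])
  finally show *: "path_int (\<lambda>u. of_bool (s < u \<and> u \<le> min t (\<tau> n \<omega>)) * rl p \<omega> u) 0 t \<le> ennreal (real (Suc n))" .
  have "comp_in p s t n \<omega> \<le> enn2real (ennreal (real (Suc n)))"
    unfolding comp_in_def by (rule enn2real_mono[OF *]) simp
  then show "comp_in p s t n \<omega> \<le> real (Suc n)" by (simp only: enn2real_ennreal of_nat_0_le_iff)
qed

text \<open>Still adapted, because the window ends at a stopping time, and nonnegative for
  \<epsilon> \<ge> -1; hence \<open>lim_density_supermartingale\<close> applies to it as it does to
  \<open>psi\<close>.\<close>

definition "psi_pert p0 s t n \<epsilon> p u \<omega> = psi p u \<omega> * (1 + \<epsilon> * (if p = p0 then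
  of_bool (s < u \<and> u \<le> min t (\<tau> n \<omega>)) * of_bool (X u \<omega> = fst p0) else 0))"

text \<open>Only the component \<open>p0\<close> changes, as described by
  \<open>path_dens_perturb\<close>. In state \<open>fst p0\<close> the product of
  \<open>ap p0\<close> and \<open>phi\<close> is the transition rate, so the exponent is the
  compensator on the window.\<close>

lemma perturbed_density:
  assumes g: "good \<omega>" and pos: "0 < \<theta> \<omega>" and p0: "p0 \<in> I" and st: "0 \<le> s" "s \<le> t" "t \<le> T"
    and \<epsilon>: "-1 \<le> \<epsilon>"
  shows "lim_density (psi_pert p0 s t n \<epsilon>) s T \<omega> =
    ennreal (Z s T \<omega> * ((1 + \<epsilon>) ^ jumps_in p0 s t n \<omega> * exp (- \<epsilon> * comp_in p0 s t n \<omega>)))"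
proof -
  define q where "q u \<longleftrightarrow> (s < u \<and> u \<le> min t (\<tau> n \<omega>)) \<and> Xl \<omega> u = fst p0" for u
  define \<phi>' where "\<phi>' p u = phi p \<omega> u * (1 + \<epsilon> * (if p = p0 then of_bool (q u) else 0))" for p u
  have "lim_density (psi_pert p0 s t n \<epsilon>) s T \<omega> = ennreal (path_density (\<lambda>p \<omega>. \<phi>' p) s T \<omega>)"
  proof (rule lim_density_eq[OF good_unit[OF g]])
    fix p u assume p: "p \<in> I" and u: "s < u" "u \<le> T"
    have "((\<lambda>u. of_bool (s < u \<and> u \<le> min t (\<tau> n \<omega>)) * of_bool (X u \<omega> = fst p0) :: real) \<longlongrightarrow> of_bool (q u)) (at_left u)"
      using tendsto_mult[OF window_left_limit X_left[OF g, of u "fst p0"], of s "min t (\<tau> n \<omega>)"] u st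
      by (simp only: q_def of_bool_conj)
    then have "((\<lambda>u. if p = p0 then of_bool (s < u \<and> u \<le> min t (\<tau> n \<omega>)) * of_bool (X u \<omega> = fst p0) else 0 :: real)
        \<longlongrightarrow> (if p = p0 then of_bool (q u) else 0)) (at_left u)"
      by (cases "p = p0") (simp_all only: if_True if_False refl tendsto_const)
    then show "((\<lambda>u. psi_pert p0 s t n \<epsilon> p u \<omega>) \<longlongrightarrow> \<phi>' p u) (at_left u)"
      unfolding psi_pert_def \<phi>'_def
      by (intro tendsto_mult tendsto_add tendsto_const psi_left[OF g p]) (use u st in auto)
  next
    fix p u assume "p \<in> I" "s \<le> u" "u \<le> T"
    then show "0 \<le> psi_pert p0 s t n \<epsilon> p u \<omega>"
      unfolding psi_pert_def using psi_nonneg[of p u \<omega>] good_space[OF g] st \<epsilon> by (intro mult_nonneg_nonneg) auto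
  qed (use st in auto)
  also have "path_density (\<lambda>p \<omega>. \<phi>' p) s T \<omega> =
    path_dens (ap p0) (\<phi>' p0) (NJ p0 \<omega>) s T * (\<Prod>p\<in>I - {p0}. path_dens (ap p) (\<phi>' p) (NJ p \<omega>) s T)"
    unfolding path_density_def using p0 finite_I by (simp add: prod.remove)
  also have "(\<Prod>p\<in>I - {p0}. path_dens (ap p) (\<phi>' p) (NJ p \<omega>) s T) = (\<Prod>p\<in>I - {p0}. path_dens (ap p) (phi p \<omega>) (NJ p \<omega>) s T)"
    by (intro prod.cong refl) (auto simp: \<phi>'_def[abs_def])
  also have "path_dens (ap p0) (\<phi>' p0) (NJ p0 \<omega>) s T = path_dens (ap p0) (phi p0 \<omega>) (NJ p0 \<omega>) s T *
      ((1 + \<epsilon>) ^ card {v\<in>NJ p0 \<omega> \<inter> {s<..T}. q v} *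
        exp (- \<epsilon> * (ap p0 * (\<integral>u. indicator {s<..T} u * (phi p0 \<omega> u * of_bool (q u)) \<partial>lborel))))"
  proof -
    have m: "(\<lambda>u. indicator {s<..T} u * (phi p0 \<omega> u * of_bool (q u))) \<in> borel_measurable borel"
    proof (rule left_limits_measurable)
      fix u assume u: "s < u" "u \<le> T"
      have "((\<lambda>u. of_bool (s < u \<and> u \<le> min t (\<tau> n \<omega>)) * of_bool (X u \<omega> = fst p0) :: real) \<longlongrightarrow> of_bool (q u)) (at_left u)"
        using tendsto_mult[OF window_left_limit X_left[OF g, of u "fst p0"], of s "min t (\<tau> n \<omega>)"] u st
        by (simp only: q_def of_bool_conj)
      then show "((\<lambda>u. psi p0 u \<omega> * (of_bool (s < u \<and> u \<le> min t (\<tau> n \<omega>)) * of_bool (X u \<omega> = fst p0))) \<longlongrightarrow> phi p0 \<omega> u * of_bool (q u)) (at_left u)"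
        using psi_left[OF g p0, of u] u st by (intro tendsto_mult) auto
    qed
    have "path_int (phi p0 \<omega>) s T \<le> path_int (phi p0 \<omega>) 0 T"
      unfolding path_int_def using phi_nonneg[OF g p0] st by (intro nn_integral_mono ennreal_leI) (auto simp: indicator_def)
    then have fin: "path_int (phi p0 \<omega>) s T < \<infinity>" using \<theta>_pos_finite(1)[OF g pos p0] by (rule order.strict_trans1)
    have "\<phi>' p0 = (\<lambda>v. phi p0 \<omega> v * (1 + \<epsilon> * of_bool (q v)))" by (simp add: \<phi>'_def fun_eq_iff)
    then show ?thesis
      using path_dens_perturb[OF _ _ m fin \<epsilon> finite_NJ[OF g p0], of "ap p0"] psi_left[OF g p0] phi_nonneg[OF g p0] st
      by (simp add: left_limits_measurable[where f = "\<lambda>u. psi p0 u \<omega>"])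
  qed
  also have "{v\<in>NJ p0 \<omega> \<inter> {s<..T}. q v} = {w\<in>NJ p0 \<omega> \<inter> {0<..t}. (s < w \<and> w \<le> min t (\<tau> n \<omega>)) \<and> Xl \<omega> w = fst p0}"
    using st by (auto simp: q_def)
  also have "card \<dots> = jumps_in p0 s t n \<omega>" using jumps_in_eq[OF g p0] by simp
  also have "ap p0 * (\<integral>u. indicator {s<..T} u * (phi p0 \<omega> u * of_bool (q u)) \<partial>lborel) = comp_in p0 s t n \<omega>"
  proof -
    let ?h = "\<lambda>u. of_bool (s < u \<and> u \<le> min t (\<tau> n \<omega>)) * rl p0 \<omega> u"
    have "ap p0 * (\<integral>u. indicator {s<..T} u * (phi p0 \<omega> u * of_bool (q u)) \<partial>lborel) =
        (\<integral>u. ap p0 * (indicator {s<..T} u * (phi p0 \<omega> u * of_bool (q u))) \<partial>lborel)" by simp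
    also have "\<dots> = (\<integral>u. indicator {0<..t} u * ?h u \<partial>lborel)"
    proof (rule Bochner_Integration.integral_cong[OF refl])
      fix u show "ap p0 * (indicator {s<..T} u * (phi p0 \<omega> u * of_bool (q u))) = indicator {0<..t} u * ?h u"
        using st rl_phi[OF p0, of \<omega> u] by (cases "Xl \<omega> u = fst p0") (auto simp: q_def indicator_def rl_def)
    qed
    also have "\<dots> = comp_in p0 s t n \<omega>"
    proof -
      have m: "(\<lambda>u. indicator {0<..t} u * ?h u) \<in> borel_measurable borel"
        using rate_left[OF g p0] st
        by (intro left_limits_measurable[where f = "\<lambda>u. of_bool (s < u \<and> u \<le> min t (\<tau> n \<omega>)) * rate p0 u \<omega>"]
            tendsto_mult window_left_limit) auto
      have nn: "0 \<le> ?h u" if "0 < u" "u \<le> t" for u using rl_nonneg[OF g p0, of u] that st by auto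
      have fin: "path_int ?h 0 t < \<infinity>"
        using comp_in_le(1)[OF g pos p0, of t s n] st by (auto intro: order.strict_trans1)
      have "0 \<le> (\<integral>u. indicator {0<..t} u * ?h u \<partial>lborel)" by (rule path_int_real(3)[OF m nn])
      moreover have "path_int ?h 0 t = ennreal (\<integral>u. indicator {0<..t} u * ?h u \<partial>lborel)"
        by (rule path_int_real(2)[OF m nn fin])
      ultimately show ?thesis unfolding comp_in_def by (simp only: enn2real_ennreal)
    qed
    finally show ?thesis .
  qed
  finally show ?thesis unfolding Z_def path_density_def using p0 finite_I
    by (simp add: prod.remove mult_ac)
qed

text \<open>Where \<open>\<theta>\<close> is positive, \<open>\<theta>\<close> times the factor is
  the density up to \<open>s\<close> times the perturbed density after \<open>s\<close>; elsewhere
  the integrand is 0. The supermartingale inequality after \<open>s\<close> removes the perturbed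
  density, and the density up to \<open>s\<close> leads back to \<open>P\<close>.\<close>

lemma perturbation_supermartingale:
  assumes p0: "p0 \<in> I" and st: "0 \<le> s" "s \<le> t" "t \<le> T" and C: "C \<in> sets (K s)"
    and \<epsilon>: "-1 < \<epsilon>" "\<epsilon> \<le> 1"
  shows "(\<integral>\<^sup>+\<omega>. indicator C \<omega> * ennreal ((1 + \<epsilon>) ^ jumps_in p0 s t n \<omega> * exp (- \<epsilon> * comp_in p0 s t n \<omega>)) \<partial>P)
    \<le> emeasure P C"
proof -
  let ?e = "\<lambda>\<omega>. (1 + \<epsilon>) ^ jumps_in p0 s t n \<omega> * exp (- \<epsilon> * comp_in p0 s t n \<omega>)"
  let ?\<psi> = "psi_pert p0 s t n \<epsilon>"
  have CT: "C \<in> sets (K T)" using C K_mono[of s T] st by auto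
  have e: "?e \<in> borel_measurable (K T)"
  proof -
    have "jumps_in p0 s t n \<in> measurable (K T) (count_space UNIV)" "comp_in p0 s t n \<in> borel_measurable (K T)"
      using st p0 by (auto intro!: J_K_meas[of _ t] jumps_in_J comp_in_J)
    then show ?thesis by (intro borel_measurable_times borel_measurable_power_nat) auto
  qed
  have "(\<integral>\<^sup>+\<omega>. indicator C \<omega> * ennreal (?e \<omega>) \<partial>P) = (\<integral>\<^sup>+\<omega>. ennreal (\<theta> \<omega>) * (indicator C \<omega> * ennreal (?e \<omega>)) \<partial>Q)"
    using CT e by (intro P_nn_integral borel_measurable_times_ennreal borel_measurable_indicator) auto
  also have "\<dots> \<le> (\<integral>\<^sup>+\<omega>. (Zh 0 s \<omega> * indicator C \<omega>) * lim_density ?\<psi> s T \<omega> \<partial>Q)"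
  proof (rule nn_integral_mono_AE)
    show "AE \<omega> in Q. ennreal (\<theta> \<omega>) * (indicator C \<omega> * ennreal (?e \<omega>)) \<le> (Zh 0 s \<omega> * indicator C \<omega>) * lim_density ?\<psi> s T \<omega>"
      using AE_good
    proof eventually_elim
      case (elim \<omega>)
      show ?case
      proof (cases "0 < \<theta> \<omega>")
        case True
        have "lim_density ?\<psi> s T \<omega> = ennreal (Z s T \<omega>) * ennreal (?e \<omega>)"
          using perturbed_density[OF elim True p0 st, of \<epsilon> n] \<epsilon> Z_nonneg[OF elim st(1) order_refl]
          by (simp add: ennreal_mult)
        moreover have "ennreal (\<theta> \<omega>) = Zh 0 s \<omega> * ennreal (Z s T \<omega>)"
          using \<theta>_split[OF elim st(1)] Zh_eq[OF elim st(1), of T] st by simp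
        ultimately show ?thesis by (simp add: mult_ac)
      next
        case False
        then have "\<theta> \<omega> = 0" using \<theta>_nonneg[OF elim] by simp
        then show ?thesis by simp
      qed
    qed
  qed
  also have "\<dots> \<le> (\<integral>\<^sup>+\<omega>. Zh 0 s \<omega> * indicator C \<omega> \<partial>Q)"
  proof (rule lim_density_supermartingale)
    show "(\<lambda>\<omega>. Zh 0 s \<omega> * indicator C \<omega>) \<in> borel_measurable (K s)"
      using Zh_K[of 0 s] C st by (intro borel_measurable_times_ennreal borel_measurable_indicator) auto
    fix p u assume p: "p \<in> I" and u: "s \<le> u" "u \<le> T"
    show "?\<psi> p u \<in> borel_measurable (K u)"
    proof (rule J_K_meas[where s = u])
      have "(\<lambda>\<omega>. of_bool (s < u \<and> u \<le> min t (\<tau> n \<omega>)) * of_bool (X u \<omega> = fst p0) :: real) \<in> borel_measurable (J u)"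
        using u st by (intro borel_measurable_times window_J of_bool_measurable X_J) auto
      then have e: "(\<lambda>\<omega>. if p = p0 then of_bool (s < u \<and> u \<le> min t (\<tau> n \<omega>)) * of_bool (X u \<omega> = fst p0) else 0 :: real)
          \<in> borel_measurable (J u)"
        by (cases "p = p0") (simp_all only: if_True if_False refl borel_measurable_const)
      show "?\<psi> p u \<in> borel_measurable (J u)"
        unfolding psi_pert_def[abs_def]
        by (intro borel_measurable_times borel_measurable_add borel_measurable_const psi_J[OF p] e) (use u st in auto)
    qed (use u st in auto)
    show "0 \<le> ?\<psi> p u \<omega>" if "\<omega> \<in> space Q" for \<omega>
      unfolding psi_pert_def using psi_nonneg[OF p, of u \<omega>] that u st \<epsilon> by (intro mult_nonneg_nonneg) auto
  qed (use st in auto)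
  also have "\<dots> = (\<integral>\<^sup>+\<omega>. indicator C \<omega> \<partial>P)"
    using C st by (intro P_nn_integral_K[symmetric]) auto
  also have "\<dots> = emeasure P C" using CT by (simp add: sets_P)
  finally show ?thesis .
qed

text \<open>With test sets from \<open>K s\<close> the counts are compensated even when all of
  \<open>F T\<close> is known in advance.\<close>

lemma compensator:
  assumes p: "p \<in> I" and st: "0 \<le> s" "s \<le> t" "t \<le> T"
  shows "integrable P (\<lambda>\<omega>. real (jumps_in p s t n \<omega>))" "integrable P (comp_in p s t n)"
    and "C \<in> sets (K s) \<Longrightarrow> (\<integral>\<omega>. indicator C \<omega> * (real (jumps_in p s t n \<omega>) - comp_in p s t n \<omega>) \<partial>P) = 0"
proof -
  interpret P: prob_space P by (rule prob_P)
  have Psets: "f \<in> measurable P M" if "f \<in> measurable (K T) M" for f :: "'a \<Rightarrow> 'c" and M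
    using that sets_P by (simp cong: measurable_cong_sets)
  have D: "jumps_in p s t n \<in> measurable P (count_space UNIV)" and B: "comp_in p s t n \<in> borel_measurable P"
    using st p by (auto intro!: Psets J_K_meas[of _ t] jumps_in_J comp_in_J)
  have Bb: "AE \<omega> in P. 0 \<le> comp_in p s t n \<omega> \<and> comp_in p s t n \<omega> \<le> real (Suc n)"
    using AE_P_good by eventually_elim (use comp_in_le(2) p st in \<open>auto simp: comp_in_def\<close>)
  have sub: "sets (K s) \<subseteq> sets P" using K_mono[of s T] st by (auto simp: sets_P)
  have sp: "space P \<in> sets (K s)" using sets.top[of "K s"] by simp
  note * = P.compensation_from_perturbation[OF D B Bb _ sub sp, OF perturbation_supermartingale[OF p st]]
  show "integrable P (\<lambda>\<omega>. real (jumps_in p s t n \<omega>))" "integrable P (comp_in p s t n)"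
    using *[OF _ _ _ sp] by auto
  show "(\<integral>\<omega>. indicator C \<omega> * (real (jumps_in p s t n \<omega>) - comp_in p s t n \<omega>) \<partial>P) = 0" if "C \<in> sets (K s)"
    using *[OF _ _ _ that] by auto
qed

end

section \<open>The intensity\<close>

lemma continuous_on_imp_cadlag:
  fixes f :: "real \<Rightarrow> 'b::topological_space"
  assumes "continuous_on {0..T} f"
  shows "cadlag T f"
  unfolding cadlag_def
proof (intro conjI ballI)
  fix t assume t: "t \<in> {0..<T}"
  then have "continuous_on {t..T} f" by (intro continuous_on_subset[OF assms]) auto
  then show "(f \<longlongrightarrow> f t) (at_right t)" by (rule continuous_on_Icc_at_rightD) (use t in auto)
next
  fix t assume t: "t \<in> {0<..T}"
  then have "continuous_on {0..t} f" by (intro continuous_on_subset[OF assms]) auto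
  then have "(f \<longlongrightarrow> f t) (at_left t)" by (rule continuous_on_Icc_at_leftD) (use t in auto)
  then show "\<exists>l. (f \<longlongrightarrow> l) (at_left t)" ..
qed

lemma cadlag_comp:
  fixes f :: "real \<Rightarrow> nat" and h :: "nat \<Rightarrow> 'b::topological_space"
  assumes f: "cadlag T f"
  shows "cadlag T (\<lambda>t. h (f t))"
  unfolding cadlag_def
proof (intro conjI ballI)
  fix t assume t: "t \<in> {0..<T}"
  then have "(f \<longlongrightarrow> f t) (at_right t)" using f by (auto simp: cadlag_def)
  then have "eventually (\<lambda>s. f s = f t) (at_right t)" by (simp add: tendsto_discrete)
  then have "eventually (\<lambda>s. h (f s) = h (f t)) (at_right t)" by eventually_elim simp
  then show "((\<lambda>t. h (f t)) \<longlongrightarrow> h (f t)) (at_right t)" by (rule tendsto_eventually)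
next
  fix t assume t: "t \<in> {0<..T}"
  then show "\<exists>l. ((\<lambda>t. h (f t)) \<longlongrightarrow> l) (at_left t)" using tendsto_left_lim_comp[OF f, of t h] by auto
qed

lemma cadlag_diff:
  fixes f g :: "real \<Rightarrow> real"
  shows "cadlag T f \<Longrightarrow> cadlag T g \<Longrightarrow> cadlag T (\<lambda>t. f t - g t)"
  unfolding cadlag_def by (blast intro: tendsto_diff)

text \<open>At each time one of \<open>g\<close> and \<open>h\<close> vanishes, so their difference
  dominates both, and integrability of \<open>f\<close> means that both integrals are finite. The 0
  is the default of the Lebesgue integral; keeping it yields a formula on every good path.\<close>

lemma set_integral_pos_neg_parts:
  fixes f g h :: "real \<Rightarrow> real"
  assumes t: "0 \<le> t" and B: "countable B"
    and f: "\<And>u. 0 < u \<Longrightarrow> u \<le> t \<Longrightarrow> u \<notin> B \<Longrightarrow> f u = g u - h u"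
    and gm: "(\<lambda>u. indicator {0<..t} u * g u) \<in> borel_measurable borel"
    and hm: "(\<lambda>u. indicator {0<..t} u * h u) \<in> borel_measurable borel"
    and gn: "\<And>u. 0 < u \<Longrightarrow> u \<le> t \<Longrightarrow> 0 \<le> g u" and hn: "\<And>u. 0 < u \<Longrightarrow> u \<le> t \<Longrightarrow> 0 \<le> h u"
    and disj: "\<And>u. 0 < u \<Longrightarrow> u \<le> t \<Longrightarrow> g u = 0 \<or> h u = 0"
  shows "set_integrable lborel {0..t} f \<longleftrightarrow> path_int g 0 t < \<infinity> \<and> path_int h 0 t < \<infinity>"
    and "set_lebesgue_integral lborel {0..t} f =
      (if path_int g 0 t < \<infinity> \<and> path_int h 0 t < \<infinity> then enn2real (path_int g 0 t) - enn2real (path_int h 0 t) else 0)"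
proof -
  let ?g = "\<lambda>u. indicator {0<..t} u * g u" and ?h = "\<lambda>u. indicator {0<..t} u * h u"
  have eq: "indicator {0..t} u *\<^sub>R f u = ?g u - ?h u" if "u \<notin> insert 0 B" for u
    using f[of u] that by (auto simp: indicator_def)
  have C: "countable (insert 0 B)" using B by simp
  have 1: "integrable lborel (\<lambda>u. indicator {0..t} u *\<^sub>R f u) \<longleftrightarrow> integrable lborel (\<lambda>u. ?g u - ?h u)"
    by (rule integrable_discrete_difference[OF C]) (use eq in auto)
  have 2: "integral\<^sup>L lborel (\<lambda>u. indicator {0..t} u *\<^sub>R f u) = integral\<^sup>L lborel (\<lambda>u. ?g u - ?h u)"
    by (rule integral_discrete_difference[OF C]) (use eq in auto)
  have 3: "integrable lborel (\<lambda>u. ?g u - ?h u) \<longleftrightarrow> integrable lborel ?g \<and> integrable lborel ?h"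
  proof
    assume i: "integrable lborel (\<lambda>u. ?g u - ?h u)"
    have "norm (?g u) \<le> norm (?g u - ?h u)" "norm (?h u) \<le> norm (?g u - ?h u)" for u
      using disj[of u] by (auto simp: indicator_def)
    then show "integrable lborel ?g \<and> integrable lborel ?h"
      using gm hm by (intro conjI Bochner_Integration.integrable_bound[OF i] AE_I2) simp_all
  qed auto
  note G = path_int_real[of 0 t g, OF gm gn] and H = path_int_real[of 0 t h, OF hm hn]
  show iff: "set_integrable lborel {0..t} f \<longleftrightarrow> path_int g 0 t < \<infinity> \<and> path_int h 0 t < \<infinity>"
    unfolding set_integrable_def 1 3 using G(1) H(1) by blast
  show "set_lebesgue_integral lborel {0..t} f =
      (if path_int g 0 t < \<infinity> \<and> path_int h 0 t < \<infinity> then enn2real (path_int g 0 t) - enn2real (path_int h 0 t) else 0)"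
  proof (cases "path_int g 0 t < \<infinity> \<and> path_int h 0 t < \<infinity>")
    case True
    then have "integrable lborel ?g" "integrable lborel ?h" using G(1) H(1) by blast+
    then have "set_lebesgue_integral lborel {0..t} f = integral\<^sup>L lborel ?g - integral\<^sup>L lborel ?h"
      unfolding set_lebesgue_integral_def 2 by (rule Bochner_Integration.integral_diff)
    moreover have "enn2real (path_int g 0 t) = integral\<^sup>L lborel ?g"
      using G(2) True enn2real_ennreal[OF G(3)] by simp
    moreover have "enn2real (path_int h 0 t) = integral\<^sup>L lborel ?h"
      using H(2) True enn2real_ennreal[OF H(3)] by simp
    ultimately show ?thesis using True by simp
  next
    case False
    then have "\<not> integrable lborel (\<lambda>u. indicator {0..t} u *\<^sub>R f u)" using iff unfolding set_integrable_def by simp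
    then have "set_lebesgue_integral lborel {0..t} f = 0"
      unfolding set_lebesgue_integral_def by (rule not_integrable_integral_eq)
    then show ?thesis using False by (simp only: if_False)
  qed
qed

lemma path_int_window:
  assumes "0 \<le> r" "0 \<le> s"
  shows "path_int (\<lambda>u. of_bool (s < u \<and> u \<le> min t r) * \<phi> u) 0 t = path_int \<phi> (min s r) (min t r)"
  unfolding path_int_def using assms by (intro nn_integral_cong) (auto simp: indicator_def)

context cmc_setup
begin

text \<open>Component \<open>y\<close> of the transposed intensity matrix applied to the vector of
  state indicators.\<close>

definition "drift y \<omega> u = (\<Sum>x\<in>S. \<Lambda> x y u \<omega> * state_ind X x \<omega> u)"
definition "into y = {p\<in>I. snd p = y}"
definition "outof y = {p\<in>I. fst p = y}"
text \<open>The change of the indicator of \<open>y\<close> caused by a transition of kind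
  \<open>p\<close>.\<close>

definition "net y p = (of_bool (snd p = y) - of_bool (fst p = y) :: real)"

lemma into_I: "into y \<subseteq> I" and outof_I: "outof y \<subseteq> I"
  by (auto simp: into_def outof_def)

lemma sum_net: "(\<Sum>p\<in>into y. f p) - (\<Sum>p\<in>outof y. f p) = (\<Sum>p\<in>I. net y p * f p)"
proof -
  have "(\<Sum>p\<in>into y. f p) = (\<Sum>p\<in>I. of_bool (snd p = y) * f p)"
    unfolding into_def using finite_I by (simp add: Int_def)
  moreover have "(\<Sum>p\<in>outof y. f p) = (\<Sum>p\<in>I. of_bool (fst p = y) * f p)"
    unfolding outof_def using finite_I by (simp add: Int_def)
  ultimately show ?thesis by (simp add: net_def left_diff_distrib sum_subtractf)
qed

text \<open>Rows sum to zero, so the diagonal entry is minus the total rate out of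
  \<open>y\<close>.\<close>

lemma drift_eq:
  assumes y: "y \<in> S" and u: "0 \<le> u" "u \<le> T" and \<omega>: "\<omega> \<in> space Q"
  shows "drift y \<omega> u = Rt (into y) u \<omega> - Rt (outof y) u \<omega>"
proof -
  have fin: "finite S" by (simp add: S_def)
  have i: "into y = (\<lambda>x. (x, y)) ` (S - {y})" and o: "outof y = (\<lambda>z. (y, z)) ` (S - {y})"
    using y by (auto simp: into_def outof_def off_diagonal_def)
  have "Rt (into y) u \<omega> = (\<Sum>x\<in>S - {y}. \<Lambda> x y u \<omega> * state_ind X x \<omega> u)"
    unfolding Rt_def i by (subst sum.reindex) (auto simp: inj_on_def rate_def state_ind_def intro!: sum.cong)
  moreover have "Rt (outof y) u \<omega> = (\<Sum>z\<in>S - {y}. \<Lambda> y z u \<omega>) * state_ind X y \<omega> u"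
    unfolding Rt_def o by (subst sum.reindex) (auto simp: inj_on_def rate_def state_ind_def sum_distrib_right intro!: sum.cong)
  moreover have "(\<Sum>z\<in>S - {y}. \<Lambda> y z u \<omega>) = - \<Lambda> y y u \<omega>"
    using canonical y u \<omega> sum.remove[OF fin y, of "\<lambda>z. \<Lambda> y z u \<omega>"] by (simp add: canonical_conditions_def)
  ultimately show ?thesis
    unfolding drift_def using sum.remove[OF fin y, of "\<lambda>x. \<Lambda> x y u \<omega> * state_ind X x \<omega> u"] by simp
qed

lemma rate_eq_rl:
  assumes u: "0 < u" "u \<le> T" and nj: "u \<notin> XJ \<omega>" "u \<notin> jump_times (\<lambda>t. Lp p t \<omega>) T"
  shows "rate p u \<omega> = rl p \<omega> u"
proof -
  have "X u \<omega> = Xl \<omega> u" using nj(1) u by (auto simp: jump_set_def)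
  moreover have "Lp p u \<omega> = left_lim (\<lambda>t. Lp p t \<omega>) u" using nj(2) u by (auto simp: jump_times_def jump_def)
  ultimately show ?thesis by (simp add: rate_def rl_def)
qed

text \<open>Off the jumps of the chain and the countably many jumps of the intensities, values equal
  left limits. Inflow and outflow are never positive together, since the left limit of the chain
  either is \<open>y\<close> or is not.\<close>

lemma drift_integral:
  assumes g: "good \<omega>" and y: "y \<in> S" and t: "0 \<le> t" "t \<le> T"
  defines "l \<equiv> path_int (Rl (into y) \<omega>) 0 t" and "h \<equiv> path_int (Rl (outof y) \<omega>) 0 t"
  shows "set_integrable lborel {0..t} (drift y \<omega>) \<longleftrightarrow> l < \<infinity> \<and> h < \<infinity>"
    and "set_lebesgue_integral lborel {0..t} (drift y \<omega>) = (if l < \<infinity> \<and> h < \<infinity> then enn2real l - enn2real h else 0)"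
proof -
  define B where "B = XJ \<omega> \<union> (\<Union>p\<in>I. jump_times (\<lambda>t. Lp p t \<omega>) T)"
  have B: "countable B"
    unfolding B_def using finite_I good_countable[OF g] finite_jump_set[OF good_cadlag[OF g]]
    by (auto intro: countable_finite)
  have eq: "drift y \<omega> u = Rl (into y) \<omega> u - Rl (outof y) \<omega> u" if u: "0 < u" "u \<le> t" "u \<notin> B" for u
  proof -
    have "rate p u \<omega> = rl p \<omega> u" if "p \<in> I" for p
      by (rule rate_eq_rl) (use u t that in \<open>auto simp: B_def\<close>)
    then have "Rt A u \<omega> = Rl A \<omega> u" if "A \<subseteq> I" for A
      unfolding Rt_def Rl_def using that by (intro sum.cong) auto
    then show ?thesis using drift_eq[OF y, of u \<omega>] u t good_space[OF g] into_I outof_I by simp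
  qed
  have m: "(\<lambda>u. indicator {0<..t} u * Rl A \<omega> u) \<in> borel_measurable borel" if "A \<subseteq> I" for A
    using t by (intro left_limits_measurable[where f = "\<lambda>u. Rt A u \<omega>"] Rt_left[OF that g]) auto
  have nn: "0 \<le> Rl A \<omega> u" if "A \<subseteq> I" "0 < u" "u \<le> t" for A u
    using Rl_nonneg[OF that(1) g, of u] that t by auto
  have disj: "Rl (into y) \<omega> u = 0 \<or> Rl (outof y) \<omega> u = 0" for u
  proof (cases "Xl \<omega> u = y")
    case True
    then have "Rl (into y) \<omega> u = 0"
      unfolding Rl_def into_def by (intro sum.neutral) (auto simp: rl_def off_diagonal_def)
    then show ?thesis ..
  next
    case False
    then have "Rl (outof y) \<omega> u = 0"
      unfolding Rl_def outof_def by (intro sum.neutral) (auto simp: rl_def)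
    then show ?thesis ..
  qed
  note * = set_integral_pos_neg_parts[OF t(1) B eq m[OF into_I] m[OF outof_I] nn[OF into_I] nn[OF outof_I] disj]
  show "set_integrable lborel {0..t} (drift y \<omega>) \<longleftrightarrow> l < \<infinity> \<and> h < \<infinity>"
    unfolding l_def h_def by (rule *(1))
  show "set_lebesgue_integral lborel {0..t} (drift y \<omega>) = (if l < \<infinity> \<and> h < \<infinity> then enn2real l - enn2real h else 0)"
    unfolding l_def h_def by (rule *(2))
qed

text \<open>Telescoping over the jumps of the chain: each is caused by exactly one driver, and
  driver jumps that find the chain in another state contribute 0.\<close>

lemma indicator_increment:
  assumes g: "good \<omega>" and lh: "0 \<le> l" "l \<le> h" "h \<le> T"
  shows "(of_bool (X h \<omega> = y) - of_bool (X l \<omega> = y) :: real) =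
    (\<Sum>p\<in>I. net y p * real (card {w\<in>NJ p \<omega> \<inter> {l<..h}. Xl \<omega> w = fst p}))"
proof -
  let ?D = "\<lambda>w. of_bool (X w \<omega> = y) - of_bool (Xl \<omega> w = y) :: real"
  have D: "?D w = (\<Sum>p\<in>I. net y p * of_bool (w \<in> NJ p \<omega> \<and> Xl \<omega> w = fst p))" if w: "w \<in> NJs \<omega> \<inter> {l<..h}" for w
  proof (cases "\<exists>p\<in>I. w \<in> NJ p \<omega> \<and> Xl \<omega> w = fst p")
    case True
    then obtain p where p: "p \<in> I" "w \<in> NJ p \<omega>" "Xl \<omega> w = fst p" by blast
    have "(\<Sum>q\<in>I. net y q * of_bool (w \<in> NJ q \<omega> \<and> Xl \<omega> w = fst q)) = (\<Sum>q\<in>{p}. net y q)"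
      using p good_disjoint[OF g p(1)] finite_I by (intro sum.mono_neutral_cong_right) auto
    also have "\<dots> = ?D w" using X_jump[OF g _ _ p] w lh p by (simp add: net_def)
    finally show ?thesis by simp
  next
    case False
    then have "X w \<omega> = Xl \<omega> w" using w lh by (intro X_no_jump[OF g]) auto
    moreover have "(\<Sum>p\<in>I. net y p * of_bool (w \<in> NJ p \<omega> \<and> Xl \<omega> w = fst p)) = 0"
      using False by (intro sum.neutral) auto
    ultimately show ?thesis by simp
  qed
  have fin: "finite (NJs \<omega> \<inter> {l<..h})" using finite_NJs[OF g] by simp
  have "of_bool (X h \<omega> = y) - of_bool (X l \<omega> = y) = (\<Sum>w\<in>XJ \<omega> \<inter> {l<..h}. ?D w)"
    by (rule cadlag_telescope[OF good_cadlag[OF g] lh, of "\<lambda>x. of_bool (x = y)"])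
  also have "\<dots> = (\<Sum>w\<in>NJs \<omega> \<inter> {l<..h}. ?D w)"
    using XJ_NJs[OF g] fin lh by (intro sum.mono_neutral_left) (auto simp: jump_set_def)
  also have "\<dots> = (\<Sum>w\<in>NJs \<omega> \<inter> {l<..h}. \<Sum>p\<in>I. net y p * of_bool (w \<in> NJ p \<omega> \<and> Xl \<omega> w = fst p))"
    using D by (rule sum.cong[OF refl])
  also have "\<dots> = (\<Sum>p\<in>I. \<Sum>w\<in>NJs \<omega> \<inter> {l<..h}. net y p * of_bool (w \<in> NJ p \<omega> \<and> Xl \<omega> w = fst p))"
    by (rule sum.swap)
  also have "\<dots> = (\<Sum>p\<in>I. net y p * real (card {w\<in>NJ p \<omega> \<inter> {l<..h}. Xl \<omega> w = fst p}))"
  proof (rule sum.cong[OF refl])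
    fix p assume p: "p \<in> I"
    have "(\<Sum>w\<in>NJs \<omega> \<inter> {l<..h}. of_bool (w \<in> NJ p \<omega> \<and> Xl \<omega> w = fst p) :: real) =
      (\<Sum>w\<in>{w\<in>NJ p \<omega> \<inter> {l<..h}. Xl \<omega> w = fst p}. 1)"
      using p fin by (intro sum.mono_neutral_cong_right) (auto simp: NJs_def)
    then show "(\<Sum>w\<in>NJs \<omega> \<inter> {l<..h}. net y p * of_bool (w \<in> NJ p \<omega> \<and> Xl \<omega> w = fst p)) =
      net y p * real (card {w\<in>NJ p \<omega> \<inter> {l<..h}. Xl \<omega> w = fst p})"
      by (simp flip: sum_distrib_left)
  qed
  finally show ?thesis .
qed

end

context cmc_change
begin

section \<open>The compensated state indicator as a local martingale\<close>

definition "mart y t \<omega> = state_ind X y \<omega> t - set_lebesgue_integral lborel {0..t} (drift y \<omega>)"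

lemma drift_integral_J:
  assumes l: "l \<in> borel_measurable M" and h: "h \<in> borel_measurable M"
  shows "(\<lambda>\<omega>. if l \<omega> < (\<infinity>::ennreal) \<and> h \<omega> < (\<infinity>::ennreal) then enn2real (l \<omega>) - enn2real (h \<omega>) else 0) \<in> borel_measurable M"
  using l h by measurable

lemma mart_J:
  assumes y: "y \<in> S" and t: "0 \<le> t" "t \<le> T"
  shows "mart y t \<in> borel_measurable (J t)"
proof (rule null_complete[OF J_sub[OF t] null_J[OF t]])
  let ?i = "\<lambda>\<omega>. path_int (Rl (into y) \<omega>) 0 t" and ?o = "\<lambda>\<omega>. path_int (Rl (outof y) \<omega>) 0 t"
  have m: "(\<lambda>\<omega>. path_int (Rl A \<omega>) 0 t) \<in> borel_measurable (J t)" if "A \<subseteq> I" for A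
    using that t by (intro path_int_J[OF t, where f = "Rt A"] Rt_J Rt_nonneg Rt_left) auto
  show "(\<lambda>\<omega>. of_bool (X t \<omega> = y) - (if ?i \<omega> < \<infinity> \<and> ?o \<omega> < \<infinity> then enn2real (?i \<omega>) - enn2real (?o \<omega>) else 0))
      \<in> borel_measurable (J t)"
    using t by (intro borel_measurable_diff of_bool_measurable X_J drift_integral_J m into_I outof_I) auto
  show "mart y t \<omega> = of_bool (X t \<omega> = y) - (if ?i \<omega> < \<infinity> \<and> ?o \<omega> < \<infinity> then enn2real (?i \<omega>) - enn2real (?o \<omega>) else 0)"
    if "good \<omega>" for \<omega>
    unfolding mart_def drift_integral(2)[OF that y t] by (simp add: state_ind_def)
qed simp

lemma stopped_jumps:
  assumes "0 \<le> s" "s \<le> t" "t \<le> T"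
  shows "{w\<in>NJ p \<omega> \<inter> {min s (\<tau> n \<omega>)<..min t (\<tau> n \<omega>)}. Xl \<omega> w = fst p} =
    {w\<in>NJ p \<omega> \<inter> {0<..t}. (s < w \<and> w \<le> min t (\<tau> n \<omega>)) \<and> Xl \<omega> w = fst p}"
  using assms \<tau>_range[of n \<omega>] by auto

lemma stopped_indicator:
  assumes g: "good \<omega>" and st: "0 \<le> s" "s \<le> t" "t \<le> T"
  shows "(of_bool (X (min t (\<tau> n \<omega>)) \<omega> = y) - of_bool (X (min s (\<tau> n \<omega>)) \<omega> = y) :: real) =
    (\<Sum>p\<in>I. net y p * real (jumps_in p s t n \<omega>))"
proof -
  have "0 \<le> min s (\<tau> n \<omega>)" "min s (\<tau> n \<omega>) \<le> min t (\<tau> n \<omega>)" "min t (\<tau> n \<omega>) \<le> T"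
    using st \<tau>_range[of n \<omega>] by auto
  then show ?thesis
    by (subst indicator_increment[OF g]) (auto intro!: sum.cong simp only: jumps_in_eq[OF g] stopped_jumps[OF st])
qed

text \<open>Inserting a random time would call for joint measurability. Instead the stopped process
  is rewritten through jump counts and integrals over windows ending at \<open>\<tau> n\<close>,
  each already known to be measurable.\<close>

lemma mart_stopped_J:
  assumes y: "y \<in> S" and t: "0 \<le> t" "t \<le> T"
  shows "(\<lambda>\<omega>. mart y (min t (\<tau> n \<omega>)) \<omega>) \<in> borel_measurable (J t)"
proof (rule null_complete[OF J_sub[OF t] null_J[OF t]])
  let ?w = "\<lambda>A \<omega>. path_int (\<lambda>u. of_bool (0 < u \<and> u \<le> min t (\<tau> n \<omega>)) * Rl A \<omega> u) 0 t"
  let ?i = "?w (into y)" and ?o = "?w (outof y)"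
  have m: "?w A \<in> borel_measurable (J t)" if A: "A \<subseteq> I" for A
    using A t
    by (intro path_int_J[where f = "\<lambda>u \<omega>. of_bool (0 < u \<and> u \<le> min t (\<tau> n \<omega>)) * Rt A u \<omega>"]
        borel_measurable_times window_J Rt_J tendsto_mult window_left_limit Rt_left mult_nonneg_nonneg Rt_nonneg) auto
  have j: "(\<lambda>\<omega>. real (jumps_in p 0 t n \<omega>)) \<in> borel_measurable (J t)" if "p \<in> I" for p
    using jumps_in_J[OF that t] by measurable
  show "(\<lambda>\<omega>. of_bool (X 0 \<omega> = y) + (\<Sum>p\<in>I. net y p * real (jumps_in p 0 t n \<omega>)) -
      (if ?i \<omega> < \<infinity> \<and> ?o \<omega> < \<infinity> then enn2real (?i \<omega>) - enn2real (?o \<omega>) else 0)) \<in> borel_measurable (J t)"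
    using t by (intro borel_measurable_diff borel_measurable_add borel_measurable_sum borel_measurable_times
        borel_measurable_const of_bool_measurable X_J drift_integral_J m j into_I outof_I) auto
  show "mart y (min t (\<tau> n \<omega>)) \<omega> = of_bool (X 0 \<omega> = y) + (\<Sum>p\<in>I. net y p * real (jumps_in p 0 t n \<omega>)) -
      (if ?i \<omega> < \<infinity> \<and> ?o \<omega> < \<infinity> then enn2real (?i \<omega>) - enn2real (?o \<omega>) else 0)"
    if g: "good \<omega>" for \<omega>
  proof -
    have r: "0 \<le> min t (\<tau> n \<omega>)" "min t (\<tau> n \<omega>) \<le> T" and z: "min 0 (\<tau> n \<omega>) = 0" using t \<tau>_range[of n \<omega>] by auto
    have w: "?w A \<omega> = path_int (Rl A \<omega>) 0 (min t (\<tau> n \<omega>))" for A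
      using path_int_window[OF \<tau>_range(1) order_refl, of t n \<omega> "Rl A \<omega>"] z by simp
    show ?thesis
      unfolding mart_def drift_integral(2)[OF g y r] w
      using stopped_indicator[OF g order_refl t, of n y] z by (simp add: state_ind_def)
  qed
qed simp

lemma path_int_Rl_finite:
  assumes g: "good \<omega>" and pos: "0 < \<theta> \<omega>" and A: "A \<subseteq> I" and r: "0 \<le> r" "r \<le> T"
  shows "path_int (Rl A \<omega>) 0 r < \<infinity>"
proof -
  have "path_int (Rl A \<omega>) 0 r \<le> path_int (Rl I \<omega>) 0 T"
  proof -
    have "Rl A \<omega> u \<le> Rl I \<omega> u" if "0 < u" "u \<le> T" for u
      unfolding Rl_def using finite_I A rl_nonneg[OF g] that by (intro sum_mono2) auto
    then show ?thesis unfolding path_int_def using r Rl_nonneg[OF order_refl g]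
      by (intro nn_integral_mono ennreal_leI) (auto simp: indicator_def)
  qed
  then show ?thesis using Atot_finite[OF g pos] unfolding Atot_def by (rule order.strict_trans1)
qed

lemma mart_eq:
  assumes g: "good \<omega>" and pos: "0 < \<theta> \<omega>" and y: "y \<in> S" and r: "0 \<le> r" "r \<le> T"
  shows "mart y r \<omega> = of_bool (X r \<omega> = y) - (\<Sum>p\<in>I. net y p * enn2real (path_int (rl p \<omega>) 0 r))"
proof -
  have fin: "path_int (rl p \<omega>) 0 r < \<infinity>" if "p \<in> I" for p
    using path_int_Rl_finite[OF g pos _ r, of "{p}"] that by (simp add: Rl_def[abs_def])
  have e: "enn2real (path_int (Rl A \<omega>) 0 r) = (\<Sum>p\<in>A. enn2real (path_int (rl p \<omega>) 0 r))" if "A \<subseteq> I" for A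
    unfolding path_int_Rl[OF that g order_refl r(2)] using fin that by (subst enn2real_sum) (auto simp: subset_iff)
  show ?thesis
    unfolding mart_def drift_integral(2)[OF g y r]
    using path_int_Rl_finite[OF g pos _ r] into_I outof_I
    by (simp add: e state_ind_def flip: sum_net)
qed

text \<open>A stopped increment is a signed sum of compensated transition counts over the window;
  positivity of \<open>\<theta>\<close> makes all integrals finite, so they may be
  subtracted.\<close>

lemma mart_increment:
  assumes g: "good \<omega>" and pos: "0 < \<theta> \<omega>" and y: "y \<in> S" and st: "0 \<le> s" "s \<le> t" "t \<le> T"
  shows "mart y (min t (\<tau> n \<omega>)) \<omega> - mart y (min s (\<tau> n \<omega>)) \<omega> =
    (\<Sum>p\<in>I. net y p * (real (jumps_in p s t n \<omega>) - comp_in p s t n \<omega>))"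
proof -
  let ?l = "min s (\<tau> n \<omega>)" and ?h = "min t (\<tau> n \<omega>)"
  have r: "0 \<le> ?l" "?l \<le> ?h" "?h \<le> T" "0 \<le> ?h" "?l \<le> T" using st \<tau>_range[of n \<omega>] by auto
  have c: "comp_in p s t n \<omega> = enn2real (path_int (rl p \<omega>) 0 ?h) - enn2real (path_int (rl p \<omega>) 0 ?l)" if p: "p \<in> I" for p
  proof -
    have fin: "path_int (rl p \<omega>) 0 ?h < \<infinity>"
      using path_int_Rl_finite[OF g pos _ r(4,3), of "{p}"] p by (simp add: Rl_def[abs_def])
    have "path_int (rl p \<omega>) 0 ?h = path_int (rl p \<omega>) 0 ?l + path_int (rl p \<omega>) ?l ?h"
      using r by (intro path_int_split[where f = "\<lambda>u. rate p u \<omega>"] rate_left[OF g p]) auto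
    with fin have "enn2real (path_int (rl p \<omega>) 0 ?h) =
        enn2real (path_int (rl p \<omega>) 0 ?l) + enn2real (path_int (rl p \<omega>) ?l ?h)"
      by (simp add: enn2real_plus)
    then show ?thesis
      unfolding comp_in_def path_int_window[OF \<tau>_range(1) st(1)] by simp
  qed
  have "mart y ?h \<omega> - mart y ?l \<omega> = (of_bool (X ?h \<omega> = y) - of_bool (X ?l \<omega> = y)) -
      ((\<Sum>p\<in>I. net y p * enn2real (path_int (rl p \<omega>) 0 ?h)) - (\<Sum>p\<in>I. net y p * enn2real (path_int (rl p \<omega>) 0 ?l)))"
    using mart_eq[OF g pos y] r by simp
  also have "\<dots> = (\<Sum>p\<in>I. net y p * real (jumps_in p s t n \<omega>)) - (\<Sum>p\<in>I. net y p * comp_in p s t n \<omega>)"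
    unfolding stopped_indicator[OF g st]
    by (simp add: c right_diff_distrib flip: sum_subtractf)
  finally show ?thesis by (simp add: right_diff_distrib sum_subtractf)
qed

lemma J_P: "f \<in> borel_measurable (J t) \<Longrightarrow> 0 \<le> t \<Longrightarrow> t \<le> T \<Longrightarrow> f \<in> borel_measurable P"
  using measurable_from_subalg[OF J_sub_P] .

lemma mart_stopped_integrable:
  assumes y: "y \<in> S" and t: "0 \<le> t" "t \<le> T"
  shows "integrable P (\<lambda>\<omega>. mart y (min t (\<tau> n \<omega>)) \<omega>)"
proof -
  interpret P: prob_space P by (rule prob_P)
  let ?f = "\<lambda>\<omega>. of_bool (X 0 \<omega> = y) + (\<Sum>p\<in>I. net y p * (real (jumps_in p 0 t n \<omega>) - comp_in p 0 t n \<omega>))"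
  have b: "(\<lambda>\<omega>. of_bool (X 0 \<omega> = y) :: real) \<in> borel_measurable P"
    using t by (intro J_P[of _ 0] of_bool_measurable X_J) auto
  have "integrable P (\<lambda>\<omega>. of_bool (X 0 \<omega> = y) :: real)"
    using b by (intro P.integrable_const_bound[where B = 1]) auto
  then have "integrable P ?f"
    using compensator(1,2)[OF _ order_refl t]
    by (intro Bochner_Integration.integrable_add Bochner_Integration.integrable_sum integrable_mult_right
        Bochner_Integration.integrable_diff)
  moreover have "AE \<omega> in P. ?f \<omega> = mart y (min t (\<tau> n \<omega>)) \<omega>"
    using AE_P_good
  proof eventually_elim
    case (elim \<omega>)
    have z: "min 0 (\<tau> n \<omega>) = 0" using \<tau>_range[of n \<omega>] by simp
    have "mart y 0 \<omega> = of_bool (X 0 \<omega> = y)"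
      using mart_eq[of \<omega> y 0] elim y T_pos by simp
    then show ?case using mart_increment[of \<omega> y 0 t n] elim y t z by simp
  qed
  ultimately show ?thesis
    using mart_stopped_J[OF y t, of n, THEN J_P[OF _ t]]
    by (subst integrable_cong_AE[symmetric, of ?f]) auto
qed

text \<open>A linear combination of the identities in \<open>compensator\<close>, tested on
  \<open>J s\<close> as a part of \<open>K s\<close>.\<close>

lemma mart_stopped_martingale:
  assumes y: "y \<in> S"
  shows "martingale P T J (\<lambda>t \<omega>. mart y (min t (\<tau> n \<omega>)) \<omega>)"
  unfolding martingale_def adapted_def
proof (intro conjI ballI allI impI)
  fix s t assume st: "0 \<le> s \<and> s \<le> t \<and> t \<le> T"
  then have s: "0 \<le> s" "s \<le> T" and t: "0 \<le> t" "t \<le> T" by auto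
  interpret P: prob_space P by (rule prob_P)
  interpret finite_measure_subalgebra P "J s" using J_sub_P[OF s] by unfold_locales
  let ?M = "\<lambda>t \<omega>. mart y (min t (\<tau> n \<omega>)) \<omega>"
  show "AE \<omega> in P. real_cond_exp P (J s) (?M t) \<omega> = ?M s \<omega>"
  proof (rule real_cond_exp_charact[OF _ mart_stopped_integrable[OF y t] mart_stopped_integrable[OF y s] mart_stopped_J[OF y s]])
    fix C assume C: "C \<in> sets (J s)"
    then have CK: "C \<in> sets (K s)" and CP: "C \<in> sets P" using J_K[OF s] J_sub_P[OF s] by (auto simp: subalgebra_def)
    have int: "integrable P (\<lambda>\<omega>. indicator C \<omega> * f \<omega>)" if "integrable P f" for f :: "'a \<Rightarrow> real"
      using integrable_mult_indicator[OF CP that] by simp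
    let ?d = "\<lambda>p \<omega>. real (jumps_in p s t n \<omega>) - comp_in p s t n \<omega>"
    have "(\<integral>\<omega>. indicator C \<omega> * ?M t \<omega> \<partial>P) - (\<integral>\<omega>. indicator C \<omega> * ?M s \<omega> \<partial>P) =
        (\<integral>\<omega>. indicator C \<omega> * ?M t \<omega> - indicator C \<omega> * ?M s \<omega> \<partial>P)"
      by (intro Bochner_Integration.integral_diff[symmetric] int mart_stopped_integrable y s t)
    also have "\<dots> = (\<integral>\<omega>. (\<Sum>p\<in>I. net y p * (indicator C \<omega> * ?d p \<omega>)) \<partial>P)"
    proof (rule integral_cong_AE)
      show "(\<lambda>\<omega>. indicator C \<omega> * ?M t \<omega> - indicator C \<omega> * ?M s \<omega>) \<in> borel_measurable P"
        by (intro borel_measurable_integrable Bochner_Integration.integrable_diff int mart_stopped_integrable y s t)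
      show "(\<lambda>\<omega>. \<Sum>p\<in>I. net y p * (indicator C \<omega> * ?d p \<omega>)) \<in> borel_measurable P"
        using compensator[of _ s t] st
        by (intro borel_measurable_integrable Bochner_Integration.integrable_sum integrable_mult_right int
            Bochner_Integration.integrable_diff) auto
      show "AE \<omega> in P. indicator C \<omega> * ?M t \<omega> - indicator C \<omega> * ?M s \<omega> = (\<Sum>p\<in>I. net y p * (indicator C \<omega> * ?d p \<omega>))"
        using AE_P_good
      proof eventually_elim
        case (elim \<omega>)
        have "indicator C \<omega> * ?M t \<omega> - indicator C \<omega> * ?M s \<omega> = indicator C \<omega> * (?M t \<omega> - ?M s \<omega>)"
          by (simp add: right_diff_distrib)
        also have "\<dots> = (\<Sum>p\<in>I. net y p * (indicator C \<omega> * ?d p \<omega>))"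
          using mart_increment[of \<omega> y s t n] elim y st by (simp add: sum_distrib_left mult.left_commute)
        finally show ?case .
      qed
    qed
    also have "\<dots> = (\<Sum>p\<in>I. \<integral>\<omega>. net y p * (indicator C \<omega> * ?d p \<omega>) \<partial>P)"
      using compensator[of _ s t] st
      by (intro Bochner_Integration.integral_sum integrable_mult_right int Bochner_Integration.integrable_diff) auto
    also have "\<dots> = 0"
      using compensator(3)[OF _ _ _ _ CK] st by (intro sum.neutral) simp
    finally show "set_lebesgue_integral P C (?M t) = set_lebesgue_integral P C (?M s)"
      by (simp add: set_lebesgue_integral_def)
  qed
qed (use y in \<open>auto intro: mart_stopped_J mart_stopped_integrable\<close>)

text \<open>The chain contributes a step function, and the drift, once integrable, a continuous
  indefinite integral.\<close>

lemma mart_cadlag: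
  assumes g: "good \<omega>" and pos: "0 < \<theta> \<omega>" and y: "y \<in> S"
  shows "cadlag T (\<lambda>t. mart y t \<omega>)"
  unfolding mart_def state_ind_def
proof (intro cadlag_diff cadlag_comp[OF good_cadlag[OF g]] continuous_on_imp_cadlag)
  have int: "set_integrable lborel {0..t} (drift y \<omega>)" if "0 \<le> t" "t \<le> T" for t
    using drift_integral(1)[OF g y that] path_int_Rl_finite[OF g pos _ that] into_I outof_I by blast
  have "drift y \<omega> integrable_on {0..T}"
    using set_borel_integral_eq_integral(1)[OF int] T_pos by simp
  then have "continuous_on {0..T} (\<lambda>t. integral {0..t} (drift y \<omega>))"
    by (rule indefinite_integral_continuous_1)
  then show "continuous_on {0..T} (\<lambda>t. set_lebesgue_integral lborel {0..t} (drift y \<omega>))"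
    by (rule continuous_on_eq) (use set_borel_integral_eq_integral(2)[OF int] in auto)
qed

lemma \<tau>_mono: "\<tau> n \<omega> \<le> \<tau> (Suc n) \<omega>"
proof (cases "hits (Suc n) \<omega> = {}")
  case True
  then show ?thesis using \<tau>_range[of n \<omega>] by (simp add: \<tau>_def[of "Suc n"])
next
  case False
  have sub: "hits (Suc n) \<omega> \<subseteq> hits n \<omega>"
    unfolding hits_def by (auto intro: order_trans[rotated] ennreal_leI)
  have "Inf (hits n \<omega>) \<le> Inf (hits (Suc n) \<omega>)"
    using False sub by (intro cInf_superset_mono bdd_belowI[of _ 0]) (auto simp: hits_def)
  moreover have "hits n \<omega> \<noteq> {}" using False sub by blast
  ultimately show ?thesis using False by (simp add: \<tau>_def)
qed

text \<open>A finite clock at \<open>T\<close> stays below some level; that level is never hit, and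
  the default value \<open>T\<close> is taken.\<close>

lemma \<tau>_reaches_T:
  assumes g: "good \<omega>" and pos: "0 < \<theta> \<omega>"
  shows "\<exists>n. \<tau> n \<omega> = T"
proof -
  have "clock \<omega> T < \<infinity>" using clock_eq_Atot[OF g pos] Atot_finite[OF g pos] by simp
  then obtain r where r: "clock \<omega> T = ennreal r" "0 \<le> r" by (cases "clock \<omega> T") auto
  obtain n where "r < real n" using reals_Archimedean2 by blast
  then have "r < real (Suc n)" by simp
  then have "clock \<omega> T < ennreal (real (Suc n))" using r by (simp only: ennreal_less_iff)
  then have "hits n \<omega> = {}"
    unfolding hits_def using clock_mono[OF g _ order_refl] by (auto simp del: of_nat_Suc) (meson leD order.trans)
  then show ?thesis by (auto simp: \<tau>_def)
qed

lemma mart_local_martingale: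
  assumes y: "y \<in> S"
  shows "local_martingale P T J (mart y)"
  unfolding local_martingale_def
proof (intro conjI exI[of _ \<tau>] allI ballI)
  show "adapted T J borel (mart y)" unfolding adapted_def using mart_J[OF y] by auto
  show "AE \<omega> in P. cadlag T (\<lambda>t. mart y t \<omega>)"
    using AE_P_good by eventually_elim (use mart_cadlag y in blast)
  show "\<tau> n \<omega> \<in> {0..T}" for n \<omega> using \<tau>_range by simp
  show "Measurable.pred (J t) (\<lambda>\<omega>. \<tau> n \<omega> \<le> t)" if "t \<in> {0..T}" for n t
    using \<tau>_stopping[of t n] that by (simp add: pred_def)
  show "AE \<omega> in P. (\<forall>n. \<tau> n \<omega> \<le> \<tau> (Suc n) \<omega>) \<and> (\<exists>n. \<tau> n \<omega> = T)"
    using AE_P_good by eventually_elim (use \<tau>_mono \<tau>_reaches_T in blast)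
  show "martingale P T J (\<lambda>t \<omega>. mart y (min t (\<tau> n \<omega>)) \<omega>)" for n
    by (rule mart_stopped_martingale[OF y])
qed

lemma intensity: "is_intensity P T S F G X \<Lambda>"
  unfolding is_intensity_def
proof (intro conjI ballI)
  show "adapted T F borel (\<Lambda> x y)" if "x \<in> S" "y \<in> S" for x y
    unfolding adapted_def using \<Lambda>_F[OF that] by auto
  show "case p of (x, y) \<Rightarrow> \<forall>t\<in>{0..T}. \<forall>\<omega>\<in>space P. 0 \<le> \<Lambda> x y t \<omega>" if "p \<in> I" for p
    using \<Lambda>_nonneg[OF that] by (auto simp: case_prod_beta)
  show "(\<Sum>y\<in>S. \<Lambda> x y t \<omega>) = 0" if "x \<in> S" "t \<in> {0..T}" "\<omega> \<in> space P" for x t \<omega>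
    using canonical that by (simp add: canonical_conditions_def)
  show "AE \<omega> in P. set_integrable lborel {0..T} (\<lambda>u. \<Sum>x\<in>S. \<Lambda> x y u \<omega> * state_ind X x \<omega> u)" if y: "y \<in> S" for y
    using AE_P_good
  proof eventually_elim
    case (elim \<omega>)
    then show ?case
      using drift_integral(1)[of \<omega> y T] path_int_Rl_finite[of \<omega> _ T] y T_pos into_I outof_I
      by (simp add: drift_def[abs_def])
  qed
  show "local_martingale P T (\<lambda>t. join_alg (F t) (G t))
      (\<lambda>t \<omega>. state_ind X y \<omega> t - set_lebesgue_integral lborel {0..t} (\<lambda>u. \<Sum>x\<in>S. \<Lambda> x y u \<omega> * state_ind X x \<omega> u))"
    if "y \<in> S" for y
    using mart_local_martingale[OF that] by (simp add: mart_def[abs_def] drift_def[abs_def] J_def[abs_def])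
qed

end

theorem theorem3p4:
  fixes Q P :: "'a measure" and T :: real and d :: nat and S :: "nat set"
    and F G :: "real \<Rightarrow> 'a measure"
    and \<xi> :: "'a \<Rightarrow> nat" and \<mu> :: "nat \<Rightarrow> 'a \<Rightarrow> real"
    and a :: "nat \<Rightarrow> nat \<Rightarrow> real" and N :: "nat \<Rightarrow> nat \<Rightarrow> real \<Rightarrow> 'a \<Rightarrow> nat"
    and \<Lambda> :: "nat \<Rightarrow> nat \<Rightarrow> real \<Rightarrow> 'a \<Rightarrow> real"
    and X :: "real \<Rightarrow> 'a \<Rightarrow> nat" and \<theta> :: "'a \<Rightarrow> real"
  assumes T_pos: "T > 0"
    and S_def: "S = {1..d}"
    and Q: "prob_space Q" "complete_measure Q"
    and F: "usual_conditions Q T F"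
    and \<xi>: "\<xi> \<in> measurable Q (count_space UNIV)" "\<And>\<omega>. \<omega> \<in> space Q \<Longrightarrow> \<xi> \<omega> \<in> S"
    and N_poisson: "\<And>x y. x \<in> S \<Longrightarrow> y \<in> S \<Longrightarrow> x \<noteq> y \<Longrightarrow> poisson_process Q T (a x y) (N x y)"
    and N_indep: "independent_drivers Q T S N (join_alg (F T) (sigma_rv Q \<xi>))"
    and G_def: "G = driver_filtration Q T S N \<xi>"
    and canonical: "canonical_conditions Q T S F \<Lambda>"
    and \<mu>_measurable: "\<And>x. x \<in> S \<Longrightarrow> \<mu> x \<in> borel_measurable (F 0)"
    and \<mu>_range: "\<And>x \<omega>. x \<in> S \<Longrightarrow> \<omega> \<in> space Q \<Longrightarrow> \<mu> x \<omega> \<in> {0..1}"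
    and \<xi>_cond: "\<And>x. x \<in> S \<Longrightarrow> AE \<omega> in Q. cond_prob_alg Q (F T) (\<lambda>\<omega>. \<xi> \<omega> = x) \<omega> = \<mu> x \<omega>"
    and a_pos: "\<And>x y. x \<in> S \<Longrightarrow> y \<in> S \<Longrightarrow> x \<noteq> y \<Longrightarrow> a x y > 0"
    and X_SDE: "solves_SDE Q T S N \<xi> X"
    and \<theta>_def: "\<theta> = doleans_density T S \<Lambda> a X"
    and \<theta>_mean: "prob_space.expectation Q \<theta> = 1"
    and P_def: "P = density (restr_to_subalg Q (join_alg (F T) (G T))) (\<lambda>\<omega>. ennreal (\<theta> \<omega>))"
  shows "restr_to_subalg P (F T) = restr_to_subalg Q (F T)
    \<and> is_CMC P T S F G X
    \<and> is_intensity P T S F G X \<Lambda>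
    \<and> (\<forall>x\<in>S. AE \<omega> in P.
         cond_prob_alg P (F T) (\<lambda>\<omega>. X 0 \<omega> = x) \<omega> = cond_prob_alg P (F 0) (\<lambda>\<omega>. X 0 \<omega> = x) \<omega> \<and>
         cond_prob_alg P (F 0) (\<lambda>\<omega>. X 0 \<omega> = x) \<omega> = cond_prob_alg Q (F T) (\<lambda>\<omega>. X 0 \<omega> = x) \<omega>)"
proof -
  interpret cmc_setup Q T d S F G \<xi> \<mu> a N \<Lambda> X
    by (intro cmc_setup.intro cmc_setup_axioms.intro) (fact assms)+
  interpret cmc_change Q T d S F G \<xi> \<mu> a N \<Lambda> X \<theta> P
    by (intro cmc_change.intro cmc_change_axioms.intro cmc_setup_axioms) (fact assms)+
  show ?thesis using P_eq_Q_on_FT CMC intensity initial_law by blast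
qed


end
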